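(* Let $n=2m\ge4$ be an even integer and let $\xi\in\mathbb{R}$ with $[\mathbb{Q}(\xi):\mathbb{Q}]>n$. Then $\widehat{\lambda}_{2m}(\xi)\le\beta_m$, where $\beta_m$ is the positive root of the polynomial \[ Q_m(x)=\begin{cases}1-mx-mx^2-m(m-1)x^3 & \text{if } m\ge3,\\ 1-3x+x^2-2x^3-2x^4 & \text{if } m=2.\end{cases} \]
   Context: For $\xi\in\mathbb{R}$ and an integer $n\ge1$, $\widehat{\lambda}_n(\xi)$ denotes the supremum of all $\lambda\ge0$ such that, for every sufficiently large real $X$, the conditions $|x_0|\le X$ and $\max_{1\le k\le n}|x_0\xi^k-x_k|\le X^{-\lambda}$ admit a non-zero solution $(x_0,\dots,x_n)\in\mathbb{Z}^{n+1}$. *)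

theory Defs
  imports
    "HOL-Algebra.Algebraic_Closure_Type"
    "HOL-Algebra.Generated_Fields"
    "HOL-Analysis.Analysis"
begin

text \<open>Taken in \<^typ>\<open>ereal\<close>, because the supremum is infinite for rational \<open>\<xi>\<close>.\<close>

definition lambda_hat :: "nat \<Rightarrow> real \<Rightarrow> ereal" where
  "lambda_hat n \<xi> = Sup {ereal l | l :: real. 0 \<le> l \<and>
     (\<forall>\<^sub>F B in at_top. \<exists>x :: nat \<Rightarrow> int.
        (\<exists>k\<le>n. x k \<noteq> 0) \<and>
        \<bar>real_of_int (x 0)\<bar> \<le> B \<and>
        (\<forall>k\<in>{1..n}. \<bar>real_of_int (x 0) * \<xi> ^ k - real_of_int (x k)\<bar> \<le> B powr (- l)))}"

definition extension_degree :: "'a :: field set \<Rightarrow> 'a set \<Rightarrow> enat" where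
  "extension_degree K L =
     (if ring.finite_dimension ring_of_type_algebra K L
      then enat (ring.dim ring_of_type_algebra K L) else \<infinity>)"

definition rat_adjoin :: "real \<Rightarrow> real set" where
  "rat_adjoin \<xi> = generate_field ring_of_type_algebra (insert \<xi> \<rat>)"

text \<open>The second branch is the polynomial for \<open>m = 2\<close>; smaller \<open>m\<close> is never used.\<close>

definition Q_poly :: "nat \<Rightarrow> real poly" where
  "Q_poly m =
     (if m \<ge> 3 then [:1, - real m, - real m, - (real m * (real m - 1)):]
      else [:1, -3, 1, -2, -2:])"

definition beta :: "nat \<Rightarrow> real" where
  "beta m = (THE x. 0 < x \<and> poly (Q_poly m) x = 0)"

lemma poly_Q_strict_antimono:
  assumes "0 < x" "x < y"
  shows "poly (Q_poly m) y < poly (Q_poly m) x"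
proof (cases "m \<ge> 3")
  case True
  have p: "poly (Q_poly m) z = 1 - real m * z - real m * z^2 - real m * (real m - 1) * z^3" for z
    using True by (simp add: Q_poly_def algebra_simps power2_eq_square power3_eq_cube)
  have "real m * x < real m * y" using assms True by simp
  moreover have "real m * x^2 \<le> real m * y^2"
    using assms by (intro mult_left_mono power_mono) auto
  moreover have "real m * (real m - 1) * x^3 \<le> real m * (real m - 1) * y^3"
    using assms True by (intro mult_left_mono power_mono) auto
  ultimately show ?thesis unfolding p by linarith
next
  case False
  have p: "poly (Q_poly m) z = 1 - 3 * z + z^2 - 2 * z^3 - 2 * z^4" for z
    using False by (simp add: Q_poly_def algebra_simps eval_nat_numeral)
  have "poly (Q_poly m) x - poly (Q_poly m) y =
      (y - x) * ((3 - (x + y) + (x + y)^2) + (x^2 + y^2) + 2 * (x + y) * (x^2 + y^2))"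
    unfolding p by (simp add: algebra_simps eval_nat_numeral)
  moreover have "3 - (x + y) + (x + y)^2 > 0"
    using zero_le_power2[of "x + y - 1/2"] by (simp add: power2_eq_square algebra_simps)
  moreover have "2 * (x + y) * (x^2 + y^2) \<ge> 0" using assms by simp
  ultimately have "poly (Q_poly m) x - poly (Q_poly m) y > 0"
    using assms by (simp add: add_pos_nonneg)
  thus ?thesis by simp
qed

lemma ex1_positive_root_Q:
  assumes "m \<ge> 2"
  shows "\<exists>!x. 0 < x \<and> poly (Q_poly m) x = 0"
proof -
  have "poly (Q_poly m) 0 = 1" by (simp add: Q_poly_def)
  moreover have "poly (Q_poly m) 1 < 0"
  proof (cases "m \<ge> 3")
    case True
    then have "poly (Q_poly m) 1 = 1 - 2 * real m - real m * (real m - 1)"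
      by (simp add: Q_poly_def)
    moreover have "0 \<le> real m * (real m - 1)" "3 \<le> real m"
      using True by simp_all
    ultimately show ?thesis by linarith
  qed (simp add: Q_poly_def)
  ultimately obtain x where "0 < x" "poly (Q_poly m) x = 0"
    using poly_IVT_neg[of 0 1 "Q_poly m"] by auto
  then show ?thesis
    using poly_Q_strict_antimono[of _ _ m] by (metis less_irrefl linorder_neqE)
qed

end

theory Submission
  imports Defs "Jordan_Normal_Form.Determinant"
begin

text \<open>
  Suppose the exponent exceeds \<open>\<beta>\<^sub>m\<close> and let \<open>x\<^sub>0, x\<^sub>1, \<dots>\<close> be the minimal points of
  \<open>(1, \<xi>, \<dots>, \<xi>\<^sup>n)\<close>, with first coordinates \<open>X\<^sub>i\<close> and distances \<open>L\<^sub>i \<le> C X\<^bsub>i+1\<^esub>\<^bsup>-1/\<nu>\<^esup>\<close>.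
  An integer polynomial of degree at most \<open>l\<close> acts on a point by recurrence; let \<open>S\<^sup>l(K)\<close> be
  the polynomials annihilating all shifts of the points in \<open>K\<close>. A lower bound for the growth of \<open>dim S\<^sup>l(K)\<close>
  in \<open>l\<close>, in the style of Castelnuovo, controls which of these spaces vanish. If \<open>S\<^sup>l(K) = 0\<close>, shifted points of
  \<open>K\<close> form a nonzero integer determinant, and its trivial upper bound is a linear inequality between the
  \<open>ln X\<^sub>i\<close>. If \<open>S\<^sup>l(K)\<close> consists of the multiples of one primitive polynomial \<open>Q\<close>, the minors of such a matrix are
  integer multiples of those of the coefficients of \<open>Q\<close>, which yields a similar inequality involving the
  height of \<open>Q\<close>; that height is large because \<open>Q\<close> fails to annihilate an earlier minimal point.

  For \<open>m \<ge> 3\<close> these inequalities, applied at the levels \<open>m\<close>, \<open>m + 1\<close> and \<open>m + 2\<close> to blocks of consecutive minimal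
  points, contradict each other exactly when \<open>Q\<^sub>m(1/\<nu>) < 0\<close>. For \<open>m = 2\<close> the spaces \<open>S\<^sup>3(x\<^sub>i, x\<^bsub>i+1\<^esub>)\<close> are lines, and one
  attaches to them integer linear forms that are small at \<open>\<xi>\<close>; all resultants of consecutive forms vanish, so the
  forms are proportional, which forces \<open>\<xi>\<close> to be rational as soon as the exponent exceeds \<open>1/3 < \<beta>\<^sub>2\<close>.
\<close>

section \<open>Integer polynomials acting on integer sequences\<close>

text \<open>In each determinant one row, from the largest point used, is charged its size
  \<open>X\<^sub>q\<close>, every other row only the distance of its point. Late points have small
  distances but large size, so a late point should supply many rows without being on top. This is
  possible when it depends linearly on earlier points: one combination of its shifts is then
  generated by rows of the earlier points, and modulo that combination its other shifts shrink to
  the size of its distance in every column. What remains is to choose such a determinant non-zero;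
  for points spanning a plane this is a dimension count, for three-dimensional spans it leads to a
  pencil of singular \<open>2 \<times> 2\<close> matrices. For \<open>m \<ge> 3\<close> the
  polynomial arises by eliminating b and c from \<open>m * b \<le> \<mu> * a\<close>,
  \<open>(m - 1) * c + b + a \<le> \<mu> * b\<close> and
  \<open>2 * a + b \<le> (\<mu> - m + 1) * c\<close>, where a, b, c are logarithms of sizes of
  minimal points and \<mu> is a number a little above \<nu>.\<close>

definition app :: "int poly \<Rightarrow> (nat \<Rightarrow> int) \<Rightarrow> nat \<Rightarrow> int" where
  "app P x j = (\<Sum>t\<le>degree P. coeff P t * x (j + t))"

lemma app_eq_sum: "degree P \<le> N \<Longrightarrow> app P x j = (\<Sum>t\<le>N. coeff P t * x (j + t))"
  unfolding app_def by (rule sum.mono_neutral_left) (auto simp: coeff_eq_0)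

lemma app_0 [simp]: "app 0 x j = 0"
  by (simp add: app_def)

lemma app_add: "app (P + Q) x j = app P x j + app Q x j"
proof -
  let ?N = "max (degree P) (degree Q)"
  have "degree (P + Q) \<le> ?N" by (rule degree_add_le_max)
  thus ?thesis
    by (simp add: app_eq_sum[of _ ?N] algebra_simps sum.distrib)
qed

lemma app_smult: "app (smult c P) x j = c * app P x j"
  by (simp add: app_eq_sum[of "smult c P" "degree P"] app_def sum_distrib_left mult.assoc)

lemma app_minus: "app (- P) x j = - app P x j"
  by (simp add: app_def sum_negf)

lemma app_diff: "app (P - Q) x j = app P x j - app Q x j"
  using app_add[of P "-Q" x j] by (simp add: app_minus)

lemma app_pCons: "app (pCons a P) x j = a * x j + app P x (Suc j)"
proof -
  have "app (pCons a P) x j = (\<Sum>t\<le>Suc (degree P). coeff (pCons a P) t * x (j + t))"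
    by (rule app_eq_sum) (simp add: degree_pCons_le)
  also have "\<dots> = a * x j + (\<Sum>t\<le>degree P. coeff P t * x (Suc j + t))"
    by (subst sum.atMost_Suc_shift) simp
  finally show ?thesis by (simp add: app_def)
qed

text \<open>The polynomial ring acts on sequences with its variable as the shift. Hence
  \<open>app Q x\<close> can itself be treated as a point, shorter by the degree of Q.\<close>

lemma app_mult: "app (P * Q) x j = app P (app Q x) j"
proof (induction P arbitrary: j)
  case (pCons a P)
  show ?case by (simp add: app_add app_smult app_pCons pCons)
qed simp

lemma app_shift: "app P (\<lambda>t. x (j + t)) i = app P x (j + i)"
  by (simp add: app_def add.assoc)

lemma app_shift_0: "app P (\<lambda>t. x (j + t)) 0 = app P x j"
  by (simp add: app_def)

lemma app_monom_mult: "app (monom 1 k * P) x j = app P x (j + k)"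
  by (induction k arbitrary: j) (simp_all add: monom_Suc app_pCons monom_0 flip: add_Suc)

lemma app_comb: "app P (\<lambda>t. a * x t + b * y t) j = a * app P x j + b * app P y j"
  by (simp add: app_def algebra_simps sum.distrib sum_distrib_left)

subsection \<open>Degree sets as dimensions\<close>

definition submod :: "int poly set \<Rightarrow> bool" where
  "submod S \<longleftrightarrow> 0 \<in> S \<and> (\<forall>F\<in>S. \<forall>G\<in>S. F + G \<in> S) \<and> (\<forall>c. \<forall>F\<in>S. smult c F \<in> S)"

text \<open>A submodule of full rank may still have finite index greater than one. Closure under
  division by non-zero integers is what lets equal ranks imply equal modules.\<close>

definition satur :: "int poly set \<Rightarrow> bool" where
  "satur S \<longleftrightarrow> (\<forall>c F. c \<noteq> 0 \<longrightarrow> smult c F \<in> S \<longrightarrow> F \<in> S)"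

definition degb :: "nat \<Rightarrow> int poly set \<Rightarrow> bool" where
  "degb l S \<longleftrightarrow> (\<forall>F\<in>S. degree F \<le> l)"

text \<open>For a submodule of bounded degree this is the rank: one element for each occurring
  degree gives an echelon basis over the rationals. Degree sets also show directly how
  multiplication by the variable enlarges a space.\<close>

definition pdim :: "int poly set \<Rightarrow> nat" where
  "pdim S = card (degree ` (S - {0}))"

lemma submod_0: "submod S \<Longrightarrow> 0 \<in> S"
  and submod_add: "submod S \<Longrightarrow> F \<in> S \<Longrightarrow> G \<in> S \<Longrightarrow> F + G \<in> S"
  and submod_smult: "submod S \<Longrightarrow> F \<in> S \<Longrightarrow> smult c F \<in> S"
  by (simp_all add: submod_def)

lemma submod_diff: "submod S \<Longrightarrow> F \<in> S \<Longrightarrow> G \<in> S \<Longrightarrow> F - G \<in> S"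
  using submod_add[of S F "smult (-1) G"] submod_smult[of S G "-1"] by simp

lemma finite_degs: "degb l S \<Longrightarrow> finite (degree ` (S - {0}))"
  by (rule finite_subset[of _ "{..l}"]) (auto simp: degb_def)

lemma pdim_mono: "degb l S' \<Longrightarrow> S \<subseteq> S' \<Longrightarrow> pdim S \<le> pdim S'"
  unfolding pdim_def by (intro card_mono finite_degs image_mono) auto

lemma pdim_zero [simp]: "pdim {0} = 0"
  by (simp add: pdim_def)

lemma pdim_eq_0D: "degb l S \<Longrightarrow> submod S \<Longrightarrow> pdim S = 0 \<Longrightarrow> S = {0}"
  unfolding pdim_def using finite_degs[of l S] submod_0[of S] by auto

lemma pdim_pos: "degb l S \<Longrightarrow> F \<in> S \<Longrightarrow> F \<noteq> 0 \<Longrightarrow> pdim S > 0"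
  unfolding pdim_def using finite_degs[of l S] by (auto simp: card_gt_0_iff)

lemma lower_degree:
  fixes F G :: "int poly"
  assumes "degree G = degree F" and "F \<noteq> 0"
  defines "H \<equiv> smult (lead_coeff G) F - smult (lead_coeff F) G"
  shows "H = 0 \<or> degree H < degree F"
proof (cases "degree F = 0")
  case True
  then obtain a b where "F = [:a:]" "G = [:b:]"
    using assms(1) by (metis degree_eq_zeroE)
  thus ?thesis by (simp add: H_def mult.commute)
next
  case False
  have "degree H \<le> degree F"
    unfolding H_def using assms(1) by (intro degree_diff_le) auto
  moreover have "coeff H (degree F) = 0"
    unfolding H_def using assms(1) by (simp add: mult.commute)
  ultimately show ?thesis
    by (metis eq_zero_or_degree_less)
qed

text \<open>Equal ranks force equal degree sets, so S contains an element of the degree of F.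
  Cancelling leading terms against it lowers the degree, at the price of a scalar factor.\<close>

lemma full_pdim_scaled_mem:
  assumes "submod S" "submod S'" "S \<subseteq> S'" "degb l S'" "pdim S' \<le> pdim S" "F \<in> S'"
  shows "\<exists>c. c \<noteq> 0 \<and> smult c F \<in> S"
proof -
  have degs: "degree ` (S - {0}) = degree ` (S' - {0})"
    using assms finite_degs[OF assms(4)]
    by (intro card_seteq) (auto simp: pdim_def)
  show ?thesis using \<open>F \<in> S'\<close>
  proof (induction "degree F" arbitrary: F rule: less_induct)
    case less
    show ?case
    proof (cases "F = 0")
      case True
      thus ?thesis using submod_0[OF assms(1)] by (intro exI[of _ 1]) auto
    next
      case False
      then obtain G where G: "G \<in> S" "G \<noteq> 0" "degree G = degree F"
      proof -
        have "degree F \<in> degree ` (S - {0})" unfolding degs using less.prems False by blast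
        then obtain G where "G \<in> S - {0}" "degree F = degree G" by (rule imageE)
        thus ?thesis by (intro that[of G]) auto
      qed
      define H where "H = smult (lead_coeff G) F - smult (lead_coeff F) G"
      have H: "H \<in> S'" unfolding H_def
        using less.prems G(1) assms by (intro submod_diff submod_smult) auto
      have "\<exists>c. c \<noteq> 0 \<and> smult c H \<in> S"
      proof (cases "H = 0")
        case True
        thus ?thesis using submod_0[OF assms(1)] by (intro exI[of _ 1]) auto
      next
        case False
        hence "degree H < degree F"
          using lower_degree[OF G(3) \<open>F \<noteq> 0\<close>] by (auto simp: H_def)
        thus ?thesis using less.hyps[OF _ H] by blast
      qed
      then obtain c where c: "c \<noteq> 0" "smult c H \<in> S" by blast
      have "smult (c * lead_coeff G) F = smult c H + smult (c * lead_coeff F) G"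
        by (simp add: H_def smult_diff_right)
      also have "\<dots> \<in> S"
        by (rule submod_add[OF assms(1) c(2) submod_smult[OF assms(1) G(1)]])
      finally show ?thesis using c(1) leading_coeff_neq_0[OF G(2)] by (metis mult_eq_0_iff)
    qed
  qed
qed

lemma full_pdim_mem:
  assumes "submod S" "submod S'" "S \<subseteq> S'" "degb l S'" "pdim S' \<le> pdim S" "F \<in> S'" "satur S"
  shows "F \<in> S"
  using full_pdim_scaled_mem[OF assms(1-6)] assms(7) by (auto simp: satur_def)

text \<open>Exactly one degree disappears from the degree set: the least degree \<open>e0\<close> of
  an element on which the form does not vanish. An element of any larger degree can be corrected by
  a multiple of that one without changing its degree.\<close>

lemma pdim_cut:
  assumes S: "submod S" "degb l S" and F: "F \<in> S" "app F u 0 \<noteq> 0"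
  shows "pdim {F\<in>S. app F u 0 = 0} + 1 = pdim S"
proof -
  define e0 where "e0 = (LEAST e. \<exists>F\<in>S. app F u 0 \<noteq> 0 \<and> degree F = e)"
  have ex: "\<exists>F\<in>S. app F u 0 \<noteq> 0 \<and> degree F = e0"
    unfolding e0_def by (rule LeastI_ex) (use F in blast)
  then obtain F0 where F0: "F0 \<in> S" "app F0 u 0 \<noteq> 0" "degree F0 = e0" by blast
  have F00: "F0 \<noteq> 0" using F0 by auto
  have least: "e0 \<le> degree G" if "G \<in> S" "app G u 0 \<noteq> 0" for G
    unfolding e0_def by (rule Least_le) (use that in blast)
  let ?K = "{F\<in>S. app F u 0 = 0}"
  have "degree ` (?K - {0}) = degree ` (S - {0}) - {e0}"
  proof (intro equalityI subsetI)
    fix e assume "e \<in> degree ` (?K - {0})"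
    then obtain G where G: "G \<in> S" "app G u 0 = 0" "G \<noteq> 0" "degree G = e" by auto
    have "e \<noteq> e0"
    proof
      assume "e = e0"
      hence dG: "degree G = degree F0" using G F0 by simp
      define H where "H = smult (lead_coeff G) F0 - smult (lead_coeff F0) G"
      have "H \<in> S" unfolding H_def using G F0 S by (intro submod_diff submod_smult) auto
      moreover have nz: "app H u 0 \<noteq> 0"
        unfolding H_def using G F0 leading_coeff_neq_0[OF G(3)] by (simp add: app_diff app_smult)
      ultimately have "e0 \<le> degree H" using least by blast
      moreover have "H \<noteq> 0" using nz by auto
      ultimately show False using lower_degree[OF dG F00] F0(3) by (auto simp: H_def)
    qed
    thus "e \<in> degree ` (S - {0}) - {e0}" using G by auto
  next
    fix e assume "e \<in> degree ` (S - {0}) - {e0}"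
    then obtain G where G: "G \<in> S" "G \<noteq> 0" "degree G = e" "e \<noteq> e0" by auto
    show "e \<in> degree ` (?K - {0})"
    proof (cases "app G u 0 = 0")
      case True
      thus ?thesis using G by auto
    next
      case False
      hence e: "e0 < e" using least[OF G(1)] G by auto
      define H where "H = smult (app F0 u 0) G - smult (app G u 0) F0"
      have "H \<in> S" unfolding H_def using G F0 S by (intro submod_diff submod_smult) auto
      moreover have "app H u 0 = 0" by (simp add: H_def app_diff app_smult)
      moreover have dH: "degree H = e"
      proof -
        have "coeff H e = app F0 u 0 * lead_coeff G"
          using e F0 G by (simp add: H_def coeff_eq_0)
        hence "coeff H e \<noteq> 0" using F0 G by auto
        moreover have "degree H \<le> e" unfolding H_def
          using e F0 G by (intro degree_diff_le) (auto intro: order.trans[OF degree_smult_le])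
        ultimately show ?thesis by (simp add: le_degree order_antisym)
      qed
      moreover have "H \<noteq> 0" using dH e by auto
      ultimately have "H \<in> ?K - {0}" by blast
      thus ?thesis using dH by blast
    qed
  qed
  moreover have "e0 \<in> degree ` (S - {0})" using F0 F00 by auto
  ultimately show ?thesis unfolding pdim_def
    using card_Suc_Diff1[OF finite_degs[OF S(2)], of e0] by simp
qed

lemma submod_kill: "submod S \<Longrightarrow> submod {F\<in>S. \<forall>u\<in>U. app F u 0 = 0}"
  by (auto simp: submod_def app_add app_smult)

lemma degb_subset: "degb l S' \<Longrightarrow> S \<subseteq> S' \<Longrightarrow> degb l S"
  by (auto simp: degb_def)

text \<open>Each row chosen is non-zero on the space left over by the previous ones, so it lowers
  the rank by one; the procedure stops at the common kernel of U.\<close>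

lemma greedy_rows:
  assumes "submod S" "degb l S"
  shows "\<exists>vs. set vs \<subseteq> U \<and> length vs + pdim {F\<in>S. \<forall>u\<in>U. app F u 0 = 0} = pdim S
    \<and> {F\<in>S. \<forall>u\<in>set vs. app F u 0 = 0} = {F\<in>S. \<forall>u\<in>U. app F u 0 = 0}"
  using assms
proof (induction "pdim S" arbitrary: S rule: less_induct)
  case less
  show ?case
  proof (cases "\<forall>F\<in>S. \<forall>u\<in>U. app F u 0 = 0")
    case True
    hence "{F\<in>S. \<forall>u\<in>U. app F u 0 = 0} = S" by auto
    thus ?thesis by (intro exI[of _ "[]"]) auto
  next
    case False
    then obtain F u where F: "F \<in> S" "u \<in> U" "app F u 0 \<noteq> 0" by blast
    let ?S = "{F\<in>S. app F u 0 = 0}"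
    have cut: "pdim ?S + 1 = pdim S" by (rule pdim_cut[OF less.prems F(1,3)])
    have sub: "submod ?S" using submod_kill[OF less.prems(1), of "{u}"] by simp
    have dg: "degb l ?S" using less.prems(2) by (rule degb_subset) auto
    obtain vs where vs: "set vs \<subseteq> U"
      "length vs + pdim {F\<in>?S. \<forall>u\<in>U. app F u 0 = 0} = pdim ?S"
      "{F\<in>?S. \<forall>u\<in>set vs. app F u 0 = 0} = {F\<in>?S. \<forall>u\<in>U. app F u 0 = 0}"
      using less.hyps[of ?S] cut sub dg by auto
    have eq: "{F\<in>?S. \<forall>u\<in>U. app F u 0 = 0} = {F\<in>S. \<forall>u\<in>U. app F u 0 = 0}"
      using F by auto
    show ?thesis
    proof (intro exI[of _ "u # vs"] conjI)
      show "set (u # vs) \<subseteq> U" using vs F by auto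
      show "length (u # vs) + pdim {F\<in>S. \<forall>u\<in>U. app F u 0 = 0} = pdim S"
        using vs(2) cut unfolding eq by simp
      show "{F\<in>S. \<forall>u\<in>set (u # vs). app F u 0 = 0} = {F\<in>S. \<forall>u\<in>U. app F u 0 = 0}"
        using vs(3) unfolding eq by auto
    qed
  qed
qed

text \<open>The successor of the maximum is always new. If D has a gap, the first missing value
  after the minimum is a second new element.\<close>

lemma card_Un_Suc_image:
  fixes D :: "nat set"
  assumes "finite D" "D \<noteq> {}"
  shows "card (D \<union> Suc ` D) \<ge> card D + 2 \<or>
    (D = {Min D..Max D} \<and> card (D \<union> Suc ` D) \<ge> card D + 1)"
proof -
  have "Suc (Max D) \<notin> D" using Max_ge[OF assms(1), of "Suc (Max D)"] by linarith
  moreover have "Suc (Max D) \<in> Suc ` D" using Max_in[OF assms] by blast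
  ultimately have new: "Suc (Max D) \<in> D \<union> Suc ` D" "Suc (Max D) \<notin> D" by auto
  have c1: "card (D \<union> Suc ` D) \<ge> card D + 1"
    using card_mono[of "D \<union> Suc ` D" "insert (Suc (Max D)) D"] assms new by auto
  show ?thesis
  proof (cases "D = {Min D..Max D}")
    case False
    moreover have "D \<subseteq> {Min D..Max D}" using assms by auto
    ultimately have "\<not> {Min D..Max D} \<subseteq> D" by blast
    then obtain e where e: "Min D \<le> e" "e \<le> Max D" "e \<notin> D" by (meson atLeastAtMost_iff subsetI)
    define d where "d = (LEAST d. Min D \<le> d \<and> d \<notin> D)"
    have d: "Min D \<le> d" "d \<notin> D"
      using LeastI[of "\<lambda>d. Min D \<le> d \<and> d \<notin> D" e] e by (auto simp: d_def)
    have "d \<noteq> Min D" using d assms by (metis Min_in)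
    hence "d > Min D" using d by simp
    moreover have "\<not> (Min D \<le> d - 1 \<and> d - 1 \<notin> D)"
      using not_less_Least[of "d - 1" "\<lambda>d. Min D \<le> d \<and> d \<notin> D"] \<open>d > Min D\<close>
      by (auto simp: d_def)
    ultimately have "d - 1 \<in> D" "Suc (d - 1) = d" by auto
    hence "d \<in> Suc ` D" by (metis imageI)
    moreover have "d \<noteq> Suc (Max D)"
      using Least_le[of "\<lambda>d. Min D \<le> d \<and> d \<notin> D" e] e by (auto simp: d_def)
    ultimately have "card (insert d (insert (Suc (Max D)) D)) \<le> card (D \<union> Suc ` D)"
      using assms new by (intro card_mono) auto
    thus ?thesis using assms new d \<open>d \<noteq> Suc (Max D)\<close> by auto
  qed (use c1 in auto)
qed

text \<open>The degree set of the larger space contains D and D + 1, where D is that of S. Growth by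
  only one makes D an interval, and then saturation shows that an element of least degree generates
  all of S by shifts.\<close>

lemma pdim_growth:
  assumes S: "submod S" "degb l S" "satur S" "S \<noteq> {0}"
    and S': "submod S'" "degb l' S'"
    and incl: "\<And>F. F \<in> S \<Longrightarrow> F \<in> S' \<and> pCons 0 F \<in> S'"
  shows "pdim S' \<ge> pdim S + 2 \<or>
    (pdim S' = pdim S + 1 \<and> (\<exists>P\<in>S. P \<noteq> 0 \<and> (\<forall>j<pdim S. monom 1 j * P \<in> S)))"
proof -
  let ?D = "degree ` (S - {0})" and ?D' = "degree ` (S' - {0})"
  have fin: "finite ?D" "finite ?D'" using S S' finite_degs by blast+
  have ne: "?D \<noteq> {}" using S(1,4) submod_0 by blast
  have sub: "?D \<union> Suc ` ?D \<subseteq> ?D'"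
  proof -
    have "Suc (degree F) \<in> ?D'" if "F \<in> S" "F \<noteq> 0" for F
      using incl[OF that(1)] that by (intro image_eqI[of _ _ "pCons 0 F"]) auto
    moreover have "?D \<subseteq> ?D'" using incl by (intro image_mono) auto
    ultimately show ?thesis by auto
  qed
  have le: "card (?D \<union> Suc ` ?D) \<le> pdim S'"
    unfolding pdim_def by (rule card_mono[OF fin(2) sub])
  show ?thesis
  proof (cases "pdim S' \<ge> pdim S + 2")
    case False
    hence int: "?D = {Min ?D..Max ?D}" and c1: "card (?D \<union> Suc ` ?D) \<ge> card ?D + 1"
      using card_Un_Suc_image[OF fin(1) ne] le by (auto simp: pdim_def)
    define e f where "e = Min ?D" and "f = Max ?D"
    have Def: "?D = {e..f}" using int by (simp add: e_def f_def)
    have ef: "e \<le> f" using ne Def by auto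
    have pS: "pdim S = f + 1 - e" unfolding pdim_def Def by simp
    have eq: "pdim S' = pdim S + 1" using False le c1 by (auto simp: pdim_def)
    have D': "?D' = {e..Suc f}"
    proof -
      have "?D \<union> Suc ` ?D = {e..Suc f}" unfolding Def using ef by (auto simp: image_Suc_atLeastAtMost)
      moreover have "card ?D' \<le> card {e..Suc f}" using eq pS ef by (simp add: pdim_def)
      ultimately show ?thesis using sub fin by (metis card_seteq)
    qed
    \<comment> \<open>The elements of \<open>S'\<close> of degree at most f have no larger rank than
      S and contain S, hence coincide with S. So S is closed under multiplication by the variable as
      long as the degree stays at most f.\<close>
    define R where "R = {F\<in>S'. F = 0 \<or> degree F \<le> f}"
    have R: "submod R"
      unfolding submod_def R_def using S'(1)
      by (auto simp: submod_def intro: degree_add_le order.trans[OF degree_smult_le])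
    have "degree ` (R - {0}) \<subseteq> ?D' - {Suc f}" by (auto simp: R_def)
    hence "pdim R \<le> card (?D' - {Suc f})" unfolding pdim_def by (intro card_mono) (use fin in auto)
    also have "\<dots> = pdim S" unfolding D' using pS ef by simp
    finally have pR: "pdim R \<le> pdim S" .
    have SR: "S \<subseteq> R"
    proof
      fix F assume F: "F \<in> S"
      have "F = 0 \<or> degree F \<in> ?D" using F by auto
      thus "F \<in> R" using incl[OF F] Def by (auto simp: R_def)
    qed
    have degR: "degb l' R" using S'(2) by (rule degb_subset) (auto simp: R_def)
    have RS: "F \<in> S" if "F \<in> R" for F
      by (rule full_pdim_mem[OF S(1) R SR degR pR that S(3)])
    have "e \<in> ?D" using Def ef by auto
    then obtain P where P: "P \<in> S" "P \<noteq> 0" "degree P = e" by auto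
    have "monom 1 j * P \<in> S" if "j < pdim S" for j
      using that
    proof (induction j)
      case (Suc j)
      hence IH: "monom 1 j * P \<in> S" by simp
      have eqn: "monom 1 (Suc j) * P = pCons 0 (monom 1 j * P)" by (simp add: monom_Suc)
      have "degree (monom 1 (Suc j) * P) = Suc j + e"
        using P by (simp add: degree_mult_eq degree_monom_eq)
      also have "\<dots> \<le> f" using Suc.prems pS by simp
      finally have "monom 1 (Suc j) * P \<in> R"
        using incl[OF IH] unfolding R_def eqn by auto
      thus ?case by (rule RS)
    qed (use P in \<open>simp add: monom_0\<close>)
    thus ?thesis using eq P by blast
  qed auto
qed

lemma submod_all: "submod {F :: int poly. degree F \<le> l}"
  by (auto simp: submod_def intro: degree_add_le order.trans[OF degree_smult_le])

lemma pdim_all: "pdim {F. degree F \<le> l} = l + 1"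
proof -
  have "degree ` ({F :: int poly. degree F \<le> l} - {0}) = {..l}"
  proof (intro equalityI subsetI)
    fix e assume "e \<in> {..l}"
    thus "e \<in> degree ` ({F :: int poly. degree F \<le> l} - {0})"
      by (intro image_eqI[of _ _ "monom 1 e"]) (auto simp: degree_monom_eq)
  qed auto
  thus ?thesis by (simp add: pdim_def)
qed

subsection \<open>Annihilators\<close>

text \<open>This is \<open>S\<^sup>l(K)\<close>; \<open>n - l\<close> is the last shift at which a
  window of \<open>l + 1\<close> entries still fits into the coordinates 0, ..., n.\<close>

definition ann :: "nat \<Rightarrow> nat \<Rightarrow> (nat \<Rightarrow> int) set \<Rightarrow> int poly set" where
  "ann n l K = {P. degree P \<le> l \<and> (\<forall>x\<in>K. \<forall>j\<le>n - l. app P x j = 0)}"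

lemma annI: "degree P \<le> l \<Longrightarrow> (\<And>x j. x \<in> K \<Longrightarrow> j \<le> n - l \<Longrightarrow> app P x j = 0) \<Longrightarrow> P \<in> ann n l K"
  by (simp add: ann_def)

lemma annD: "P \<in> ann n l K \<Longrightarrow> x \<in> K \<Longrightarrow> j \<le> n - l \<Longrightarrow> app P x j = 0"
  by (simp add: ann_def)

lemma ann_degree: "P \<in> ann n l K \<Longrightarrow> degree P \<le> l"
  by (simp add: ann_def)

lemma submod_ann: "submod (ann n l K)"
  by (auto simp: submod_def ann_def app_add app_smult intro: degree_add_le order.trans[OF degree_smult_le])

lemma degb_ann: "degb l (ann n l K)"
  by (auto simp: degb_def ann_def)

lemma satur_ann: "satur (ann n l K)"
  by (auto simp: satur_def ann_def app_smult)

lemma zero_ann [simp]: "0 \<in> ann n l K"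
  using submod_ann submod_0 by blast

lemma ann_antimono: "K \<subseteq> K' \<Longrightarrow> ann n l K' \<subseteq> ann n l K"
  by (auto simp: ann_def)

lemma ann_Un: "ann n l (K \<union> K') = ann n l K \<inter> ann n l K'"
  by (auto simp: ann_def)

lemma ann_insert: "ann n l (insert x K) = ann n l {x} \<inter> ann n l K"
  using ann_Un[of n l "{x}" K] by simp

lemma pdim_ann_antimono: "K \<subseteq> K' \<Longrightarrow> pdim (ann n l K') \<le> pdim (ann n l K)"
  by (rule pdim_mono[OF degb_ann ann_antimono])

lemma ann_eq_0_iff: "ann n l K = {0} \<longleftrightarrow> pdim (ann n l K) = 0"
  using pdim_eq_0D[OF degb_ann submod_ann] pdim_zero by metis

lemma ann_monom:
  assumes "l + k \<le> n" "P \<in> ann n l K" "i \<le> k"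
  shows "monom 1 i * P \<in> ann n (l + k) K"
proof (rule annI)
  show "degree (monom 1 i * P) \<le> l + k"
    using degree_mult_le[of "monom (1::int) i" P] degree_monom_le[of "1::int" i] ann_degree[OF assms(2)] assms(3)
    by linarith
next
  fix x j assume "x \<in> K" "j \<le> n - (l + k)"
  thus "app (monom 1 i * P) x j = 0"
    unfolding app_monom_mult using assms by (intro annD[OF assms(2)]) auto
qed

text \<open>Shifts of P by up to k, combined with the \<open>n - l\<close> shifts tested at level l,
  account for all the shifts tested at level \<open>l - k\<close>.\<close>

lemma ann_lower:
  assumes "k \<le> l" "l \<le> n" "P \<noteq> 0" "\<And>j. j \<le> k \<Longrightarrow> monom 1 j * P \<in> ann n l K"
  shows "P \<in> ann n (l - k) K"
proof (rule annI)
  have "degree (monom 1 k * P) \<le> l" using assms(4)[of k] ann_degree by blast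
  thus "degree P \<le> l - k" using assms(3) by (simp add: degree_mult_eq degree_monom_eq)
next
  fix x j assume x: "x \<in> K" and j: "j \<le> n - (l - k)"
  define i where "i = min j k"
  have "app P x j = app (monom 1 i * P) x (j - i)"
    unfolding app_monom_mult by (simp add: i_def)
  also have "\<dots> = 0"
    using j assms(1,2) by (intro annD[OF assms(4) x]) (auto simp: i_def)
  finally show "app P x j = 0" .
qed

lemma ann_Suc:
  assumes "Suc l \<le> n" "P \<in> ann n l K"
  shows "P \<in> ann n (Suc l) K \<and> pCons 0 P \<in> ann n (Suc l) K"
  using ann_monom[of l 1 n P K 0] ann_monom[of l 1 n P K 1] assms
  by (simp add: monom_0 monom_Suc)

lemma ann_mono_level:
  assumes "l \<le> l'" "l' \<le> n" "P \<in> ann n l K"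
  shows "P \<in> ann n l' K"
  using ann_monom[of l "l' - l" n P K 0] assms by (simp add: monom_0)

text \<open>Going up from level l to level n, every step gains at least two dimensions unless the
  annihilator consists of the multiples of one polynomial. In that exceptional case
  \<open>l - k\<close> is a level at which this polynomial already occurs, and its shifts by 0, ...,
  k fill the \<open>k + 1\<close> dimensions.\<close>

lemma castelnuovo:
  assumes "l \<le> n"
  shows "ann n l K = {0} \<or> (\<exists>k\<le>l. ann n (l - k) K \<noteq> {0} \<and> pdim (ann n l K) = k + 1)
    \<or> pdim (ann n l K) + 2 * (n - l) \<le> pdim (ann n n K)"
  using assms
proof (induction rule: inc_induct)
  case base
  show ?case by simp
next
  case (step l)
  show ?case
  proof (cases "ann n l K = {0}")
    case False
    have ln: "Suc l \<le> n" using step by simp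
    have inc: "F \<in> ann n (Suc l) K \<and> pCons 0 F \<in> ann n (Suc l) K" if "F \<in> ann n l K" for F
      by (rule ann_Suc[OF ln that])
    have "ann n (Suc l) K \<noteq> {0}"
      using False inc submod_0[OF submod_ann] by blast
    note gr = pdim_growth[OF submod_ann degb_ann satur_ann False submod_ann degb_ann inc]
    have pos: "pdim (ann n l K) > 0" using False ann_eq_0_iff by blast
    show ?thesis
    proof (cases "pdim (ann n (Suc l) K) \<ge> pdim (ann n l K) + 2")
      case True
      from step.IH \<open>ann n (Suc l) K \<noteq> {0}\<close> consider
        (a) k where "k \<le> Suc l" "ann n (Suc l - k) K \<noteq> {0}" "pdim (ann n (Suc l) K) = k + 1"
        | (b) "pdim (ann n (Suc l) K) + 2 * (n - Suc l) \<le> pdim (ann n n K)"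
        by auto
      thus ?thesis
      proof cases
        \<comment> \<open>The shifts of P already give \<open>k' + 1\<close> dimensions at level l,
          while level \<open>Suc l\<close> has only \<open>k' + 2\<close>; this excludes a gain of
          two.\<close>
        case a
        then obtain k' where k': "k = Suc k'" using True pos by (cases k) auto
        have k'l: "k' \<le> l" using a(1) k' by simp
        obtain P where P: "P \<noteq> 0" "P \<in> ann n (l - k') K"
          using a(2) k' submod_0[OF submod_ann, of n "l - k'" K] by auto
        have sub: "(\<lambda>j. degree P + j) ` {..k'} \<subseteq> degree ` (ann n l K - {0})"
        proof
          fix d assume "d \<in> (\<lambda>j. degree P + j) ` {..k'}"
          then obtain j where j: "j \<le> k'" "d = degree P + j" by auto
          have "monom 1 j * P \<in> ann n l K"
            using ann_monom[of "l - k'" k' n P K j] P j k'l ln by simp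
          moreover have "degree (monom 1 j * P) = d" using P j by (simp add: degree_mult_eq degree_monom_eq)
          moreover have "monom 1 j * P \<noteq> 0" using P by simp
          ultimately show "d \<in> degree ` (ann n l K - {0})" by blast
        qed
        have "k' + 1 = card ((\<lambda>j. degree P + j) ` {..k'})"
          by (subst card_image) (auto simp: inj_on_def)
        also have "\<dots> \<le> pdim (ann n l K)"
          unfolding pdim_def by (rule card_mono[OF finite_degs[OF degb_ann] sub])
        finally have "pdim (ann n l K) \<ge> k' + 1" .
        hence False using True a(3) k' by simp
        thus ?thesis ..
      next
        case b
        moreover have "n - l = Suc (n - Suc l)" using ln by simp
        ultimately show ?thesis using True by auto
      qed
    next
      case False
      then obtain P where P: "P \<in> ann n l K" "P \<noteq> 0"
        "\<And>j. j < pdim (ann n l K) \<Longrightarrow> monom 1 j * P \<in> ann n l K"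
        using gr by auto
      define k where "k = pdim (ann n l K) - 1"
      have "monom 1 k * P \<in> ann n l K" using P(3)[of k] pos by (simp add: k_def)
      hence "degree (monom 1 k * P) \<le> l" by (rule ann_degree)
      hence kl: "k \<le> l" using P(2) by (simp add: degree_mult_eq degree_monom_eq)
      have "P \<in> ann n (l - k) K"
        using kl ln P pos by (intro ann_lower) (auto simp: k_def)
      thus ?thesis using P(2) kl pos by (intro disjI2 disjI1 exI[of _ k]) (auto simp: k_def)
    qed
  qed auto
qed

section \<open>Determinants of integer rows\<close>

definition rowmat :: "nat \<Rightarrow> (nat \<Rightarrow> 'a) list \<Rightarrow> 'a mat" where
  "rowmat N us = Matrix.mat N N (\<lambda>(r, t). (us ! r) t)"

abbreviation rdet :: "nat \<Rightarrow> (nat \<Rightarrow> 'a :: comm_ring_1) list \<Rightarrow> 'a" where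
  "rdet N us \<equiv> Determinant.det (rowmat N us)"

lemma rowmat_carrier [simp]: "rowmat N us \<in> carrier_mat N N"
  by (simp add: rowmat_def)

lemma rdet_leibniz:
  "rdet N us = (\<Sum>p | p permutes {0..<N}. signof p * (\<Prod>r = 0..<N. (us ! r) (p r)))"
proof -
  have "rdet N us = (\<Sum>p | p permutes {0..<N}. signof p * (\<Prod>r = 0..<N. rowmat N us $$ (r, p r)))"
    by (rule det_def'[OF rowmat_carrier])
  also have "\<dots> = (\<Sum>p | p permutes {0..<N}. signof p * (\<Prod>r = 0..<N. (us ! r) (p r)))"
  proof (intro sum.cong refl arg_cong2[of _ _ _ _ "times"] prod.cong)
    fix p r assume "p \<in> {p. p permutes {0..<N}}" "r \<in> {0..<N}"
    hence "p r \<in> {0..<N}" by (simp add: permutes_in_image)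
    thus "rowmat N us $$ (r, p r) = (us ! r) (p r)" using \<open>r \<in> _\<close> by (simp add: rowmat_def)
  qed
  finally show ?thesis .
qed

text \<open>A kernel vector of a singular matrix, read as a list of coefficients, is a polynomial
  annihilated by every row.\<close>

lemma rdet_nonzero:
  assumes "length us = N" and "N > 0"
    and "\<And>F. degree F < N \<Longrightarrow> (\<And>u. u \<in> set us \<Longrightarrow> app F u 0 = 0) \<Longrightarrow> F = 0"
  shows "rdet N us \<noteq> 0"
proof
  assume "rdet N us = 0"
  then obtain v where v: "v \<in> carrier_vec N" "v \<noteq> 0\<^sub>v N" "rowmat N us *\<^sub>v v = 0\<^sub>v N"
    using det_0_iff_vec_prod_zero[OF rowmat_carrier] by blast
  define F where "F = (\<Sum>t<N. monom (v $ t) t)"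
  have cF: "coeff F t = (if t < N then v $ t else 0)" for t
    by (simp add: F_def coeff_sum if_distrib cong: if_cong)
  have dF: "degree F \<le> N - 1" using assms(2) by (intro degree_le) (auto simp: cF)
  have "F = 0"
  proof (rule assms(3))
    show "degree F < N" using dF assms(2) by simp
    fix u assume "u \<in> set us"
    then obtain r where r: "r < N" "us ! r = u" using assms(1) by (metis in_set_conv_nth)
    have "app F u 0 = (\<Sum>t\<le>N - 1. coeff F t * u t)"
      using app_eq_sum[OF dF, of u 0] by simp
    also have "\<dots> = (\<Sum>t = 0..<N. u t * v $ t)"
      using assms(2) by (intro sum.cong) (auto simp: cF)
    also have "\<dots> = (rowmat N us *\<^sub>v v) $ r"
      using r v(1) by (simp add: rowmat_def scalar_prod_def)
    also have "\<dots> = 0" using v(3) r by simp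
    finally show "app F u 0 = 0" .
  qed
  have "v = 0\<^sub>v N"
  proof (rule eq_vecI)
    fix t assume "t < dim_vec (0\<^sub>v N :: int vec)"
    thus "v $ t = 0\<^sub>v N $ t" using cF[of t] \<open>F = 0\<close> by simp
  qed (use v in auto)
  thus False using v by simp
qed

lemma rdet_row_reduce:
  fixes us vs :: "(nat \<Rightarrow> real) list"
  assumes "\<And>r t. r < N \<Longrightarrow> t < N \<Longrightarrow> (vs ! r) t = (us ! r) t - (\<Sum>q<r. c r q * (us ! q) t)"
  shows "rdet N vs = rdet N us"
proof -
  define M where "M = Matrix.mat N N (\<lambda>(r, q). if q < r then - c r q else if q = r then 1 else (0::real))"
  have M: "M \<in> carrier_mat N N" by (simp add: M_def)
  have "rowmat N vs = M * rowmat N us"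
  proof (rule eq_matI)
    fix r t assume "r < dim_row (M * rowmat N us)" "t < dim_col (M * rowmat N us)"
    hence rt: "r < N" "t < N" by (simp_all add: M_def rowmat_def)
    have "(M * rowmat N us) $$ (r, t) = (\<Sum>q = 0..<N. M $$ (r, q) * (us ! q) t)"
      using rt by (simp add: M_def rowmat_def scalar_prod_def)
    also have "\<dots> = (\<Sum>q\<in>{0..<r} \<union> {r} \<union> {Suc r..<N}. M $$ (r, q) * (us ! q) t)"
      using rt by (intro sum.cong) auto
    also have "\<dots> = (\<Sum>q = 0..<r. M $$ (r, q) * (us ! q) t) + M $$ (r, r) * (us ! r) t
        + (\<Sum>q = Suc r..<N. M $$ (r, q) * (us ! q) t)"
      by (subst sum.union_disjoint, simp, simp, force) (subst sum.union_disjoint, auto)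
    also have "(\<Sum>q = Suc r..<N. M $$ (r, q) * (us ! q) t) = 0"
      using rt by (intro sum.neutral) (auto simp: M_def)
    also have "(\<Sum>q = 0..<r. M $$ (r, q) * (us ! q) t) = - (\<Sum>q<r. c r q * (us ! q) t)"
      using rt by (simp add: M_def sum_negf atLeast0LessThan)
    finally show "rowmat N vs $$ (r, t) = (M * rowmat N us) $$ (r, t)"
      using rt assms[OF rt] by (simp add: M_def rowmat_def)
  qed (simp_all add: M_def rowmat_def)
  moreover have "Determinant.det M = 1"
  proof -
    have "Determinant.det M = prod_list (diag_mat M)"
      by (rule det_lower_triangular[OF _ M]) (simp add: M_def)
    also have "diag_mat M = map (\<lambda>_. 1) [0..<N]" by (auto simp: diag_mat_def M_def)
    finally show ?thesis by (simp add: map_replicate_const prod_list_replicate)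
  qed
  ultimately show ?thesis using det_mult[OF M rowmat_carrier, of us] by simp
qed

lemma rdet_col_reduce:
  fixes us :: "(nat \<Rightarrow> real) list"
  assumes "length us = N"
  shows "rdet N (map (\<lambda>u t. if t = 0 then u 0 else u t - g t * u 0) us) = rdet N us"
proof -
  define M where "M = Matrix.mat N N (\<lambda>(q, t). if q = t then 1 else if q = 0 then - g t else (0::real))"
  have M: "M \<in> carrier_mat N N" by (simp add: M_def)
  let ?vs = "map (\<lambda>u t. if t = 0 then u 0 else u t - g t * u 0) us"
  have "rowmat N ?vs = rowmat N us * M"
  proof (rule eq_matI)
    fix r t assume "r < dim_row (rowmat N us * M)" "t < dim_col (rowmat N us * M)"
    hence rt: "r < N" "t < N" by (simp_all add: M_def rowmat_def)
    have "(rowmat N us * M) $$ (r, t) = (\<Sum>q = 0..<N. (us ! r) q * M $$ (q, t))"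
      using rt by (simp add: M_def rowmat_def scalar_prod_def)
    also have "\<dots> = (\<Sum>q\<in>{0, t}. (us ! r) q * M $$ (q, t))"
      using rt by (intro sum.mono_neutral_right) (auto simp: M_def)
    also have "\<dots> = (?vs ! r) t"
      using rt assms by (auto simp: M_def)
    finally show "rowmat N ?vs $$ (r, t) = (rowmat N us * M) $$ (r, t)"
      using rt by (simp add: rowmat_def)
  qed (simp_all add: M_def rowmat_def)
  moreover have "Determinant.det M = 1"
  proof -
    have "Determinant.det M = prod_list (diag_mat M)"
      by (rule det_upper_triangular[OF _ M]) (auto simp: M_def upper_triangular_def)
    also have "diag_mat M = map (\<lambda>_. 1) [0..<N]" by (auto simp: diag_mat_def M_def)
    finally show ?thesis by (simp add: map_replicate_const prod_list_replicate)
  qed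
  ultimately show ?thesis using det_mult[OF rowmat_carrier M, of us] by simp
qed

lemma abs_signof: "\<bar>signof p :: real\<bar> = 1"
  by (simp add: sign_def)

text \<open>In every Leibniz term exactly one row contributes its entry in column 0 and so is
  bounded by A instead of E. The hypothesis \<open>top\<close> says that giving this role to row 0
  yields the largest bound.\<close>

lemma rdet_abs_le:
  fixes us :: "(nat \<Rightarrow> real) list" and A E :: "nat \<Rightarrow> real"
  assumes N: "N > 0" and l0: "0 < l0"
    and A: "\<And>r. r < N \<Longrightarrow> \<bar>(us ! r) 0\<bar> \<le> A r"
    and E: "\<And>r t. r < N \<Longrightarrow> 0 < t \<Longrightarrow> t < N \<Longrightarrow> \<bar>(us ! r) t\<bar> \<le> E r"
    and E0: "E 0 = l0" and Epos: "\<And>r. r < N \<Longrightarrow> 0 \<le> E r"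
    and top: "\<And>r. r < N \<Longrightarrow> A r * l0 \<le> A 0 * E r"
  shows "\<bar>rdet N us\<bar> \<le> fact N * (A 0 * (\<Prod>r = 1..<N. E r))"
proof -
  have "\<bar>\<Prod>r = 0..<N. (us ! r) (p r)\<bar> \<le> A 0 * (\<Prod>r = 1..<N. E r)" if p: "p permutes {0..<N}" for p
  proof -
    obtain r0 where r0: "r0 < N" "p r0 = 0"
      using N permutes_image[OF p] by (metis atLeastLessThan_iff imageE zero_le)
    have other: "p r \<noteq> 0" if "r \<noteq> r0" for r
      using permutes_inj[OF p] r0 that by (metis injD)
    have inN: "p r < N" if "r < N" for r
      using permutes_in_image[OF p, of r] that by simp
    have "\<bar>\<Prod>r = 0..<N. (us ! r) (p r)\<bar> = (\<Prod>r = 0..<N. \<bar>(us ! r) (p r)\<bar>)" by (rule abs_prod)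
    also have "\<dots> = \<bar>(us ! r0) (p r0)\<bar> * (\<Prod>r\<in>{0..<N} - {r0}. \<bar>(us ! r) (p r)\<bar>)"
      using r0 by (intro prod.remove) auto
    also have "\<dots> \<le> A r0 * (\<Prod>r\<in>{0..<N} - {r0}. E r)"
    proof (intro mult_mono prod_mono conjI)
      show "\<bar>(us ! r0) (p r0)\<bar> \<le> A r0" using A r0 by simp
      show "0 \<le> A r0" using A[OF r0(1)] by linarith
      fix r assume "r \<in> {0..<N} - {r0}"
      thus "\<bar>(us ! r) (p r)\<bar> \<le> E r" using E[of r "p r"] other inN by auto
    qed (auto intro: prod_nonneg)
    also have "\<dots> \<le> A 0 * (\<Prod>r = 1..<N. E r)"
    proof (cases "r0 = 0")
      case True
      have "{0..<N} - {0} = {1..<N}" by auto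
      thus ?thesis using True by simp
    next
      case False
      have s1: "(\<Prod>r\<in>{0..<N} - {r0}. E r) = l0 * (\<Prod>r\<in>{1..<N} - {r0}. E r)"
      proof -
        have "{0..<N} - {r0} = insert 0 ({1..<N} - {r0})" using N False by auto
        thus ?thesis using E0 by simp
      qed
      have s2: "(\<Prod>r = 1..<N. E r) = E r0 * (\<Prod>r\<in>{1..<N} - {r0}. E r)"
        using r0 False by (intro prod.remove) auto
      have "A r0 * (l0 * (\<Prod>r\<in>{1..<N} - {r0}. E r)) = (A r0 * l0) * (\<Prod>r\<in>{1..<N} - {r0}. E r)"
        by simp
      also have "\<dots> \<le> (A 0 * E r0) * (\<Prod>r\<in>{1..<N} - {r0}. E r)"
        using top r0 Epos by (intro mult_right_mono prod_nonneg) auto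
      finally show ?thesis unfolding s1 s2 by simp
    qed
    finally show ?thesis .
  qed note bd = this
  have "\<bar>rdet N us\<bar> \<le> (\<Sum>p | p permutes {0..<N}. \<bar>signof p * (\<Prod>r = 0..<N. (us ! r) (p r))\<bar>)"
    unfolding rdet_leibniz by (rule sum_abs)
  also have "\<dots> \<le> (\<Sum>p | p permutes {0..<N}. A 0 * (\<Prod>r = 1..<N. E r))"
    by (rule sum_mono) (use bd in \<open>simp add: abs_mult abs_signof\<close>)
  also have "\<dots> = fact N * (A 0 * (\<Prod>r = 1..<N. E r))"
    by (simp add: card_permutations[OF refl])
  finally show ?thesis .
qed

lemma rdet_of_int:
  assumes "length us = N"
  shows "rdet N (map (\<lambda>u t. real_of_int (u t)) us) = real_of_int (rdet N us)"
proof -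
  have "rowmat N (map (\<lambda>u t. real_of_int (u t)) us) = map_mat real_of_int (rowmat N us)"
    using assms by (intro eq_matI) (auto simp: rowmat_def)
  thus ?thesis by (simp only: of_int_hom.hom_det)
qed

text \<open>Neither reducing rows by earlier rows nor subtracting \<open>\<xi> ^ t\<close> times
  column 0 from column t changes the determinant. Afterwards column 0 carries the sizes and all
  other columns carry distances.\<close>

lemma rdet_profile_le:
  fixes us :: "(nat \<Rightarrow> int) list" and A E :: "nat \<Rightarrow> real"
  assumes N: "length us = N" "N > 0" and l0: "0 < E 0"
    and prof: "\<And>r. r < N \<Longrightarrow> \<exists>c w. (\<forall>t<N. w t = real_of_int ((us ! r) t) - (\<Sum>q<r. c q * real_of_int ((us ! q) t)))
        \<and> \<bar>w 0\<bar> \<le> A r \<and> (\<forall>t<N. \<bar>w t - \<xi> ^ t * w 0\<bar> \<le> E r)"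
    and top: "\<And>r. r < N \<Longrightarrow> A r * E 0 \<le> A 0 * E r"
  shows "\<bar>real_of_int (rdet N us)\<bar> \<le> fact N * (A 0 * (\<Prod>r = 1..<N. E r))"
proof -
  define R where "R r c w \<longleftrightarrow> (\<forall>t<N. w t = real_of_int ((us ! r) t) - (\<Sum>q<r. c q * real_of_int ((us ! q) t)))
        \<and> \<bar>w 0\<bar> \<le> A r \<and> (\<forall>t<N. \<bar>w t - \<xi> ^ t * w 0\<bar> \<le> E r)" for r and c w :: "nat \<Rightarrow> real"
  have "\<forall>r. \<exists>c w. r < N \<longrightarrow> R r c w" using prof by (auto simp: R_def)
  from choice[OF this] obtain c where "\<forall>r. \<exists>w. r < N \<longrightarrow> R r (c r) w" by blast
  from choice[OF this] obtain w where cw: "\<And>r. r < N \<Longrightarrow> R r (c r) (w r)" by blast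
  have w: "w r t = real_of_int ((us ! r) t) - (\<Sum>q<r. c r q * real_of_int ((us ! q) t))"
    and wt: "\<bar>w r t - \<xi> ^ t * w r 0\<bar> \<le> E r" if "r < N" "t < N" for r t
    using cw[OF that(1)] that(2) by (auto simp: R_def)
  have w0: "\<bar>w r 0\<bar> \<le> A r" if "r < N" for r
    using cw[OF that] by (auto simp: R_def)
  let ?vs = "map w [0..<N]" and ?us = "map (\<lambda>u t. real_of_int (u t)) us"
  let ?zs = "map (\<lambda>u t. if t = 0 then u 0 else u t - \<xi> ^ t * u 0) ?vs"
  have "rdet N ?vs = rdet N ?us"
  proof (rule rdet_row_reduce[of N _ _ c])
    fix r t assume "r < N" "t < N"
    moreover have "(\<Sum>q<r. c r q * (?us ! q) t) = (\<Sum>q<r. c r q * real_of_int ((us ! q) t))"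
      using \<open>r < N\<close> N by (intro sum.cong) auto
    ultimately show "(?vs ! r) t = (?us ! r) t - (\<Sum>q<r. c r q * (?us ! q) t)"
      using w N by simp
  qed
  moreover have "rdet N ?zs = rdet N ?vs" by (rule rdet_col_reduce) simp
  moreover have "\<bar>rdet N ?zs\<bar> \<le> fact N * (A 0 * (\<Prod>r = 1..<N. E r))"
  proof (rule rdet_abs_le[of N "E 0"])
    fix r assume r: "r < N"
    show "\<bar>(?zs ! r) 0\<bar> \<le> A r" using r w0 by simp
    show "0 \<le> E r" using wt[OF r N(2)] by simp
    show "A r * E 0 \<le> A 0 * E r" using top r .
  next
    fix r t assume "r < N" "0 < t" "t < N"
    thus "\<bar>(?zs ! r) t\<bar> \<le> E r" using wt by simp
  qed (use N l0 in auto)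
  ultimately show ?thesis using rdet_of_int[OF N(1)] by simp
qed

section \<open>Minors annihilated by a primitive polynomial\<close>

definition unitrow :: "nat \<Rightarrow> nat \<Rightarrow> int" where
  "unitrow i t = (if t = i then 1 else 0)"

lemma app_unitrow: "app Q (unitrow i) a = (if a \<le> i then coeff Q (i - a) else 0)"
proof (cases "a \<le> i")
  case True
  let ?N = "max (degree Q) (i - a)"
  have "app Q (unitrow i) a = (\<Sum>t\<le>?N. coeff Q t * unitrow i (a + t))"
    by (rule app_eq_sum) simp
  also have "\<dots> = (\<Sum>t\<le>?N. if t = i - a then coeff Q t else 0)"
    using True by (intro sum.cong) (auto simp: unitrow_def)
  also have "\<dots> = coeff Q (i - a)" by simp
  finally show ?thesis using True by simp
qed (simp add: app_def unitrow_def)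

text \<open>Applying Q to these rows produces a Toeplitz matrix of coefficients of Q with
  \<open>coeff Q j\<close> on its diagonal, a minor of the matrix of shifts of Q.\<close>

definition window :: "nat \<Rightarrow> nat \<Rightarrow> (nat \<Rightarrow> int) list" where
  "window k j = map (\<lambda>b. unitrow (j + b)) [0..<k]"

lemma window_det_expand:
  assumes "finite P" "P = {p. p permutes {0..<k}} - {id}"
  shows "rdet k (map (app Q) (window k j)) = coeff Q j ^ k +
    (\<Sum>p\<in>P. signof p * (\<Prod>b = 0..<k. app Q (unitrow (j + b)) (p b)))"
proof -
  have fin: "finite {p. p permutes {0..<k}}" by (simp add: finite_permutations)
  have ent: "(map (app Q) (window k j) ! b) a = app Q (unitrow (j + b)) a" if "b < k" for b a
    using that by (simp add: window_def)
  have "rdet k (map (app Q) (window k j)) =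
      (\<Sum>p | p permutes {0..<k}. signof p * (\<Prod>b = 0..<k. app Q (unitrow (j + b)) (p b)))"
    unfolding rdet_leibniz by (intro sum.cong refl arg_cong2[of _ _ _ _ "times"] prod.cong) (use ent in auto)
  also have "\<dots> = signof id * (\<Prod>b = 0..<k. app Q (unitrow (j + b)) (id b)) +
      (\<Sum>p\<in>P. signof p * (\<Prod>b = 0..<k. app Q (unitrow (j + b)) (p b)))"
    unfolding assms(2) by (rule sum.remove[OF fin]) (simp add: permutes_id)
  also have "signof id * (\<Prod>b = 0..<k. app Q (unitrow (j + b)) (id b)) = coeff Q j ^ k"
    by (simp add: app_unitrow)
  finally show ?thesis .
qed

lemma permutes_not_id_exceed:
  fixes k :: nat
  assumes "p permutes {0..<k}" "p \<noteq> id"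
  shows "\<exists>b<k. b < p b"
proof (rule ccontr)
  assume "\<not> ?thesis"
  hence "\<forall>i\<in>{0..<k}. p i \<le> i" by (metis atLeastLessThan_iff not_less)
  hence "p = id" using permutes_natset_le[OF assms(1)] by blast
  thus False using assms by simp
qed

definition ht :: "int poly \<Rightarrow> real" where
  "ht Q = real_of_int (Max ((\<lambda>i. \<bar>coeff Q i\<bar>) ` {..degree Q}))"

lemma coeff_le_ht: "\<bar>real_of_int (coeff Q i)\<bar> \<le> ht Q"
proof (cases "i \<le> degree Q")
  case True
  hence "\<bar>coeff Q i\<bar> \<le> Max ((\<lambda>i. \<bar>coeff Q i\<bar>) ` {..degree Q})" by (intro Max_ge) auto
  thus ?thesis by (simp add: ht_def flip: of_int_abs)
next
  case False
  have "\<bar>coeff Q 0\<bar> \<le> Max ((\<lambda>i. \<bar>coeff Q i\<bar>) ` {..degree Q})" by (intro Max_ge) auto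
  hence "0 \<le> Max ((\<lambda>i. \<bar>coeff Q i\<bar>) ` {..degree Q})" by linarith
  thus ?thesis using False by (simp add: ht_def coeff_eq_0)
qed

lemma ht_attained: "\<exists>i\<le>degree Q. ht Q = \<bar>real_of_int (coeff Q i)\<bar>"
proof -
  have "Max ((\<lambda>i. \<bar>coeff Q i\<bar>) ` {..degree Q}) \<in> (\<lambda>i. \<bar>coeff Q i\<bar>) ` {..degree Q}"
    by (intro Max_in) auto
  then obtain i where "i \<le> degree Q" "Max ((\<lambda>i. \<bar>coeff Q i\<bar>) ` {..degree Q}) = \<bar>coeff Q i\<bar>"
    by (auto simp del: Max_in)
  thus ?thesis by (intro exI[of _ i]) (simp add: ht_def)
qed

lemma ht_ge_1:
  assumes "Q \<noteq> 0"
  shows "1 \<le> ht Q"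
proof -
  have "1 \<le> \<bar>lead_coeff Q\<bar>" using leading_coeff_neq_0[OF assms] by linarith
  hence "1 \<le> real_of_int \<bar>lead_coeff Q\<bar>" by (simp only: of_int_1_le_iff)
  thus ?thesis using coeff_le_ht[of Q "degree Q"] by simp
qed

lemma abs_app_unitrow_le: "\<bar>real_of_int (app Q (unitrow i) a)\<bar> \<le> ht Q"
  using coeff_le_ht[of Q] ht_attained[of Q] by (auto simp: app_unitrow)

text \<open>The thresholds \<open>f\<close> make the first coefficient that exceeds its threshold dominate the
  off-diagonal terms of the window determinant.\<close>

lemma window_det_lower:
  fixes e k :: nat
  assumes k: "k > 0"
  defines "c \<equiv> ((1 / (2 * fact k)) ^ ((k + 1) ^ e)) ^ k / (2::real)"
  assumes Q: "degree Q \<le> e"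
  shows "\<exists>j\<le>e. c * ht Q ^ k \<le> \<bar>real_of_int (rdet k (map (app Q) (window k j)))\<bar>"
proof -
  define \<rho> where "\<rho> = 1 / (2 * fact k :: real)"
  have fk: "(1::real) \<le> fact k" by (rule fact_ge_1)
  have "(1::real) \<le> 2 * fact k" using fk by linarith
  hence rho: "0 < \<rho>" "\<rho> \<le> 1" by (auto simp: \<rho>_def)
  \<comment> \<open>With these exponents \<open>f j = f (Suc j) ^ (k + 1)\<close>, and the surplus
    factor \<open>f (Suc j)\<close> pays for the number of permutations and for a factor 2.\<close>
  define f where "f j = \<rho> ^ ((k + 1) ^ (e - j))" for j
  have f0: "0 < f j" for j using rho by (simp add: f_def)
  have frho: "f j \<le> \<rho>" for j
    using power_decreasing[of 1 "(k + 1) ^ (e - j)" \<rho>] rho by (simp add: f_def)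
  have fstep: "f j * fact k * 2 \<le> f (Suc j) ^ k" if "Suc j \<le> e" for j
  proof -
    have "e - j = Suc (e - Suc j)" using that by simp
    hence "f j = f (Suc j) ^ (k + 1)" by (simp add: f_def power_mult[symmetric] mult.commute power_add)
    hence "f j * fact k * 2 = f (Suc j) ^ k * (f (Suc j) * (fact k * 2))" by simp
    also have "\<dots> \<le> f (Suc j) ^ k * (\<rho> * (fact k * 2))"
      using frho f0 by (intro mult_left_mono mult_right_mono) (auto simp: less_imp_le)
    also have "\<rho> * (fact k * 2) = 1" by (simp add: \<rho>_def)
    finally show ?thesis by simp
  qed
  have fmono: "f i \<le> f j" if "i \<le> j" for i j
    unfolding f_def using that rho by (intro power_decreasing power_increasing) auto
  obtain i where i: "i \<le> degree Q" "ht Q = \<bar>real_of_int (coeff Q i)\<bar>" using ht_attained by blast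
  define j where "j = (LEAST j. f j * ht Q \<le> \<bar>real_of_int (coeff Q j)\<bar>)"
  have "f i * ht Q \<le> 1 * ht Q" using frho[of i] rho i by (intro mult_right_mono) auto
  hence Pi: "f i * ht Q \<le> \<bar>real_of_int (coeff Q i)\<bar>" using i by simp
  have j: "f j * ht Q \<le> \<bar>real_of_int (coeff Q j)\<bar>" unfolding j_def by (rule LeastI[where P = "\<lambda>j. f j * ht Q \<le> \<bar>real_of_int (coeff Q j)\<bar>", OF Pi])
  have "j \<le> i" unfolding j_def by (rule Least_le[where P = "\<lambda>j. f j * ht Q \<le> \<bar>real_of_int (coeff Q j)\<bar>", OF Pi])
  hence je: "j \<le> e" using i Q by simp
  have small: "\<bar>real_of_int (coeff Q l)\<bar> \<le> f l * ht Q" if "l < j" for l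
    using not_less_Least[of l "\<lambda>j. f j * ht Q \<le> \<bar>real_of_int (coeff Q j)\<bar>"] that by (simp add: j_def)
  have h0: "0 \<le> ht Q" using i by simp
  define P where "P = {p. p permutes {0..<k}} - {id}"
  have finP: "finite P" by (simp add: P_def finite_permutations)
  let ?tm = "\<lambda>p. real_of_int (\<Prod>b = 0..<k. app Q (unitrow (j + b)) (p b))"
  have tm: "\<bar>?tm p\<bar> * (fact k * 2) \<le> f j ^ k * ht Q ^ k" if "p \<in> P" for p
  proof -
    have p: "p permutes {0..<k}" "p \<noteq> id" using that by (auto simp: P_def)
    \<comment> \<open>In this row the permutation picks an entry that is zero or a coefficient of
      index below j, hence below its threshold.\<close>
    obtain b0 where b0: "b0 < k" "b0 < p b0" using permutes_not_id_exceed[OF p] by blast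
    have eq: "\<bar>?tm p\<bar> = \<bar>real_of_int (app Q (unitrow (j + b0)) (p b0))\<bar> *
        (\<Prod>b\<in>{0..<k} - {b0}. \<bar>real_of_int (app Q (unitrow (j + b)) (p b))\<bar>)"
      using b0 by (simp add: abs_prod prod.remove[of "{0..<k}" b0] abs_mult)
    have rest: "(\<Prod>b\<in>{0..<k} - {b0}. \<bar>real_of_int (app Q (unitrow (j + b)) (p b))\<bar>) \<le> ht Q ^ (k - 1)"
    proof -
      have "(\<Prod>b\<in>{0..<k} - {b0}. \<bar>real_of_int (app Q (unitrow (j + b)) (p b))\<bar>) \<le> (\<Prod>b\<in>{0..<k} - {b0}. ht Q)"
        by (intro prod_mono) (auto simp: abs_app_unitrow_le)
      thus ?thesis using b0 by simp
    qed
    have first: "\<bar>real_of_int (app Q (unitrow (j + b0)) (p b0))\<bar> * (fact k * 2) \<le> f j ^ k * ht Q"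
    proof (cases "p b0 \<le> j + b0")
      case True
      define l where "l = j + b0 - p b0"
      have l: "l < j" using True b0 by (simp add: l_def)
      have "\<bar>real_of_int (app Q (unitrow (j + b0)) (p b0))\<bar> = \<bar>real_of_int (coeff Q l)\<bar>"
        using True by (simp add: app_unitrow l_def)
      also have "\<dots> \<le> f (j - 1) * ht Q"
        using small[OF l] fmono[of l "j - 1"] l h0
        by (intro order.trans[OF small[OF l]] mult_right_mono) auto
      finally have "\<bar>real_of_int (app Q (unitrow (j + b0)) (p b0))\<bar> * (fact k * 2) \<le> (f (j - 1) * fact k * 2) * ht Q"
        using mult_right_mono[of "\<bar>real_of_int (app Q (unitrow (j + b0)) (p b0))\<bar>" "f (j - 1) * ht Q" "fact k * 2"]
        by (simp add: mult_ac)
      also have "\<dots> \<le> f j ^ k * ht Q"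
        using fstep[of "j - 1"] l je h0 by (intro mult_right_mono) auto
      finally show ?thesis .
    next
      case False
      thus ?thesis using f0[of j] h0 by (simp add: app_unitrow)
    qed
    have "\<bar>?tm p\<bar> * (fact k * 2) = (\<bar>real_of_int (app Q (unitrow (j + b0)) (p b0))\<bar> * (fact k * 2)) *
        (\<Prod>b\<in>{0..<k} - {b0}. \<bar>real_of_int (app Q (unitrow (j + b)) (p b))\<bar>)"
      unfolding eq by simp
    also have "\<dots> \<le> (f j ^ k * ht Q) * ht Q ^ (k - 1)"
      using f0[of j] h0 by (intro mult_mono[OF first rest]) (auto intro!: prod_nonneg)
    also have "\<dots> = f j ^ k * ht Q ^ k" using k by (cases k) auto
    finally show ?thesis .
  qed
  have cardP: "real (card P) \<le> fact k"
  proof -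
    have "card P \<le> card {p. p permutes {0..<k}}" by (intro card_mono) (auto simp: P_def finite_permutations)
    also have "\<dots> = fact k" by (simp add: card_permutations[OF refl])
    finally show ?thesis by (metis of_nat_fact of_nat_le_iff)
  qed
  let ?R = "\<Sum>p\<in>P. signof p * (\<Prod>b = 0..<k. app Q (unitrow (j + b)) (p b))"
  have "\<bar>real_of_int ?R\<bar> \<le> (\<Sum>p\<in>P. \<bar>?tm p\<bar>)"
  proof -
    have "\<bar>real_of_int ?R\<bar> \<le> (\<Sum>p\<in>P. \<bar>real_of_int (signof p * (\<Prod>b = 0..<k. app Q (unitrow (j + b)) (p b)))\<bar>)"
      by (simp only: of_int_sum sum_abs)
    also have "\<dots> = (\<Sum>p\<in>P. \<bar>?tm p\<bar>)"
      by (intro sum.cong refl) (auto simp: sign_def abs_mult)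
    finally show ?thesis .
  qed
  also have "\<dots> \<le> (\<Sum>p\<in>P. f j ^ k * ht Q ^ k / (fact k * 2))"
    using tm by (intro sum_mono) (simp add: pos_le_divide_eq)
  also have "\<dots> = real (card P) * (f j ^ k * ht Q ^ k / (fact k * 2))" by simp
  also have "\<dots> \<le> fact k * (f j ^ k * ht Q ^ k / (fact k * 2))"
    using cardP f0[of j] h0 by (intro mult_right_mono) auto
  also have "\<dots> = f j ^ k * ht Q ^ k / 2" by simp
  finally have R: "\<bar>real_of_int ?R\<bar> \<le> f j ^ k * ht Q ^ k / 2" .
  have "f j ^ k * ht Q ^ k = (f j * ht Q) ^ k" by (simp add: power_mult_distrib)
  also have "\<dots> \<le> \<bar>real_of_int (coeff Q j)\<bar> ^ k" using j f0[of j] h0 by (intro power_mono) auto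
  finally have main: "f j ^ k * ht Q ^ k \<le> \<bar>real_of_int (coeff Q j ^ k)\<bar>" by (simp add: power_abs)
  have "real_of_int (rdet k (map (app Q) (window k j))) = real_of_int (coeff Q j ^ k) + real_of_int ?R"
    using window_det_expand[OF finP P_def, of Q j] by simp
  hence "f j ^ k * ht Q ^ k / 2 \<le> \<bar>real_of_int (rdet k (map (app Q) (window k j)))\<bar>"
    using R main by linarith
  moreover have "c * ht Q ^ k \<le> f j ^ k * ht Q ^ k / 2"
  proof -
    have "f 0 ^ k \<le> f j ^ k" using fmono[of 0 j] f0[of 0] by (intro power_mono) (auto simp: less_imp_le)
    hence "f 0 ^ k * ht Q ^ k \<le> f j ^ k * ht Q ^ k" using h0 by (intro mult_right_mono) auto
    moreover have "c = f 0 ^ k / 2" by (simp add: c_def f_def \<rho>_def)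
    hence "c * ht Q ^ k = f 0 ^ k * ht Q ^ k / 2" by (simp only:)
    ultimately show ?thesis by linarith
  qed
  ultimately show ?thesis using je by (intro exI[of _ j]) auto
qed

text \<open>Starting at the first coefficient not divisible by p, the window matrix is triangular
  modulo p with that coefficient along the diagonal.\<close>

lemma window_det_not_dvd:
  assumes Q: "Polynomial.content Q = 1" and p: "prime (p::int)"
  shows "\<exists>j\<le>degree Q. \<not> p dvd rdet k (map (app Q) (window k j))"
proof -
  have "\<exists>j. \<not> p dvd coeff Q j"
  proof (rule ccontr)
    assume "\<not> ?thesis"
    hence "[:p:] dvd Q" by (simp add: const_poly_dvd_iff)
    hence "p dvd Polynomial.content Q" by (simp add: const_poly_dvd_iff_dvd_content)
    thus False using p Q by (simp add: not_prime_unit)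
  qed
  define j where "j = (LEAST j. \<not> p dvd coeff Q j)"
  have j: "\<not> p dvd coeff Q j" unfolding j_def using \<open>\<exists>j. _\<close> by (rule LeastI_ex)
  have small: "p dvd coeff Q l" if "l < j" for l using not_less_Least that by (auto simp: j_def)
  have jd: "j \<le> degree Q" using j by (metis coeff_eq_0 dvd_0_right not_le_imp_less)
  define P where "P = {p. p permutes {0..<k}} - {id}"
  have finP: "finite P" by (simp add: P_def finite_permutations)
  have "p dvd (\<Sum>s\<in>P. signof s * (\<Prod>b = 0..<k. app Q (unitrow (j + b)) (s b)))"
  proof (intro dvd_sum dvd_mult)
    fix s assume "s \<in> P"
    then obtain b0 where b0: "b0 < k" "b0 < s b0" using permutes_not_id_exceed by (auto simp: P_def)
    have "p dvd app Q (unitrow (j + b0)) (s b0)"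
      using b0 small[of "j + b0 - s b0"] by (auto simp: app_unitrow)
    thus "p dvd (\<Prod>b = 0..<k. app Q (unitrow (j + b)) (s b))"
      using b0 by (intro dvd_prodI[THEN dvd_trans[rotated]]) auto
  qed
  moreover have "\<not> p dvd coeff Q j ^ k" using j prime_dvd_power[OF p] by blast
  ultimately have "\<not> p dvd rdet k (map (app Q) (window k j))"
    unfolding window_det_expand[OF finP P_def] using dvd_add_left_iff by blast
  thus ?thesis using jd by blast
qed

text \<open>Duality of complementary minors: the given rows are orthogonal to the k shifts of Q, so
  completing them to a square determinant is, up to a rational factor, the same as evaluating a
  minor of the shifts. Primitivity of Q makes the factor an integer.\<close>

lemma dual_minors:
  fixes us :: "(nat \<Rightarrow> int) list"
  assumes N: "N = e + k" "length us = e" "k > 0" and Q: "Polynomial.content Q = 1" "degree Q \<le> e"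
    and kill: "\<And>u a. u \<in> set us \<Longrightarrow> a < k \<Longrightarrow> app Q u a = 0"
  shows "\<exists>z. \<forall>ws. length ws = k \<longrightarrow> rdet N (us @ ws) = z * rdet k (map (app Q) ws)"
proof -
  have Q0: "Q \<noteq> 0" using Q(1) by auto
  define d where "d = degree Q"
  \<comment> \<open>The unit columns of Z skip the positions d, ..., d + k - 1, where the k shifts
    of Q have their leading coefficients; this makes Z non-singular.\<close>
  define idx where "idx c = (if c < d then c else c + k)" for c
  have de: "d \<le> e" using Q by (simp add: d_def)
  define Z where "Z = Matrix.mat N N (\<lambda>(i, c). if c < e then (if i = idx c then 1 else 0)
      else if c - e \<le> i then coeff Q (i - (c - e)) else (0::int))"
  have Zc: "Z \<in> carrier_mat N N" by (simp add: Z_def)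
  define A1 where "A1 = Matrix.mat e e (\<lambda>(r, c). (us ! r) (idx c))"
  have prod: "rdet N (us @ ws) * Determinant.det Z = Determinant.det A1 * rdet k (map (app Q) ws)"
    if ws: "length ws = k" for ws
  proof -
    define A3 where "A3 = Matrix.mat k e (\<lambda>(r, c). (ws ! r) (idx c))"
    have "rowmat N (us @ ws) * Z = four_block_mat A1 (0\<^sub>m e k) A3 (rowmat k (map (app Q) ws))"
    proof (rule eq_matI)
      fix r c assume "r < dim_row (four_block_mat A1 (0\<^sub>m e k) A3 (rowmat k (map (app Q) ws)))"
        "c < dim_col (four_block_mat A1 (0\<^sub>m e k) A3 (rowmat k (map (app Q) ws)))"
      hence rc: "r < e + k" "c < e + k" by (simp_all add: A1_def rowmat_def)
      let ?u = "(us @ ws) ! r"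
      have val: "(rowmat N (us @ ws) * Z) $$ (r, c) = (\<Sum>i = 0..<N. ?u i * Z $$ (i, c))"
        using rc N by (simp add: rowmat_def Z_def scalar_prod_def)
      also have "\<dots> = (if c < e then ?u (idx c) else app Q ?u (c - e))"
      proof (cases "c < e")
        case True
        have "idx c < N" using True N by (simp add: idx_def)
        have "(\<Sum>i = 0..<N. ?u i * Z $$ (i, c)) = (\<Sum>i = 0..<N. if i = idx c then ?u i else 0)"
          using rc True N by (intro sum.cong) (auto simp: Z_def)
        also have "\<dots> = ?u (idx c)" using \<open>idx c < N\<close> by simp
        finally show ?thesis using True by simp
      next
        case False
        define a where "a = c - e"
        have a: "a < k" using False rc by (simp add: a_def)
        have "app Q ?u a = (\<Sum>t\<le>e. coeff Q t * ?u (a + t))" by (rule app_eq_sum[OF Q(2)])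
        also have "\<dots> = (\<Sum>i\<in>{a..a + e}. ?u i * coeff Q (i - a))"
          by (rule sum.reindex_bij_witness[of _ "\<lambda>i. i - a" "\<lambda>t. a + t"]) auto
        also have "\<dots> = (\<Sum>i = 0..<N. ?u i * (if a \<le> i then coeff Q (i - a) else 0))"
        proof (rule sum.mono_neutral_cong_left)
          show "{a..a + e} \<subseteq> {0..<N}" using a N by auto
          show "\<forall>i\<in>{0..<N} - {a..a + e}. ?u i * (if a \<le> i then coeff Q (i - a) else 0) = 0"
            using Q(2) by (auto intro!: coeff_eq_0)
        qed auto
        also have "\<dots> = (\<Sum>i = 0..<N. ?u i * Z $$ (i, c))"
          using rc False N by (intro sum.cong) (auto simp: Z_def a_def)
        finally show ?thesis using False by (simp add: a_def)
      qed
      also have "\<dots> = four_block_mat A1 (0\<^sub>m e k) A3 (rowmat k (map (app Q) ws)) $$ (r, c)"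
        using rc N ws kill[of "us ! r" "c - e"]
        by (auto simp: A1_def A3_def rowmat_def nth_append)
      finally show "(rowmat N (us @ ws) * Z) $$ (r, c) = four_block_mat A1 (0\<^sub>m e k) A3 (rowmat k (map (app Q) ws)) $$ (r, c)" .
    qed (simp_all add: A1_def rowmat_def Z_def N)
    moreover have "Determinant.det (four_block_mat A1 (0\<^sub>m e k) A3 (rowmat k (map (app Q) ws))) =
        Determinant.det A1 * rdet k (map (app Q) ws)"
      by (rule det_four_block_mat_upper_right_zero) (auto simp: A1_def A3_def)
    ultimately show ?thesis using det_mult[OF rowmat_carrier Zc, of "us @ ws"] by simp
  qed
  have Z0: "Determinant.det Z \<noteq> 0"
  proof
    assume "Determinant.det Z = 0"
    then obtain v where v: "v \<in> carrier_vec N" "v \<noteq> 0\<^sub>v N" "Z *\<^sub>v v = 0\<^sub>v N"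
      using det_0_iff_vec_prod_zero[OF Zc] by blast
    have row: "(\<Sum>c = 0..<N. Z $$ (i, c) * v $ c) = 0" if "i < N" for i
    proof -
      have "(Z *\<^sub>v v) $ i = (\<Sum>c = 0..<N. Z $$ (i, c) * v $ c)"
        using that v(1) by (simp add: Z_def scalar_prod_def)
      thus ?thesis using v(3) that by simp
    qed
    have last: "v $ (e + (k - 1 - b)) = 0" if "b < k" for b
      using that
    proof (induction b rule: less_induct)
      case (less b)
      define a0 where "a0 = k - 1 - b"
      have a0: "a0 < k" using less.prems by (simp add: a0_def)
      let ?i = "d + a0"
      have iN: "?i < N" using a0 de N by simp
      have "(\<Sum>c = 0..<N. Z $$ (?i, c) * v $ c) = (\<Sum>c\<in>{e + a0}. Z $$ (?i, c) * v $ c)"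
      proof (rule sum.mono_neutral_right)
        show "\<forall>c\<in>{0..<N} - {e + a0}. Z $$ (?i, c) * v $ c = 0"
        proof
          fix c assume c: "c \<in> {0..<N} - {e + a0}"
          show "Z $$ (?i, c) * v $ c = 0"
          proof (cases "c < e")
            case True
            have "?i \<noteq> idx c" using a0 by (auto simp: idx_def)
            thus ?thesis using True c iN by (simp add: Z_def)
          next
            case False
            define a where "a = c - e"
            have ca: "c = e + a" "a < k" "a \<noteq> a0" using False c N by (auto simp: a_def)
            show ?thesis
            proof (cases "a < a0")
              case True
              have "coeff Q (d + a0 - a) = 0" using True by (intro coeff_eq_0) (simp add: d_def)
              thus ?thesis using ca c iN by (simp add: Z_def)
            next
              case False
              hence "k - 1 - a < b" "k - 1 - (k - 1 - a) = a" using ca less.prems by (auto simp: a0_def)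
              hence "v $ (e + a) = 0" using less.IH[of "k - 1 - a"] ca by simp
              thus ?thesis using ca by simp
            qed
          qed
        qed
      qed (use a0 N in auto)
      also have "\<dots> = coeff Q d * v $ (e + a0)" using a0 N iN by (simp add: Z_def)
      finally have "coeff Q d * v $ (e + a0) = 0" using row[OF iN] by simp
      thus ?case using Q0 by (simp add: d_def a0_def)
    qed
    have lastv: "v $ c = 0" if "e \<le> c" "c < N" for c
      using last[of "k - 1 - (c - e)"] that N by simp
    have firstv: "v $ c = 0" if "c < e" for c
    proof -
      have iN: "idx c < N" using that N by (simp add: idx_def)
      have "(\<Sum>c' = 0..<N. Z $$ (idx c, c') * v $ c') = (\<Sum>c'\<in>{c}. Z $$ (idx c, c') * v $ c')"
      proof (rule sum.mono_neutral_right)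
        show "\<forall>c'\<in>{0..<N} - {c}. Z $$ (idx c, c') * v $ c' = 0"
        proof
          fix c' assume c': "c' \<in> {0..<N} - {c}"
          have "idx c \<noteq> idx c'" using c' by (auto simp: idx_def split: if_splits)
          thus "Z $$ (idx c, c') * v $ c' = 0"
            using c' iN lastv[of c'] by (cases "c' < e") (auto simp: Z_def)
        qed
      qed (use that N in auto)
      also have "\<dots> = v $ c" using that N iN by (simp add: Z_def)
      finally show ?thesis using row[OF iN] by simp
    qed
    have "v = 0\<^sub>v N"
      using v(1) firstv lastv by (intro eq_vecI) (auto simp: not_less[symmetric])
    thus False using v(2) by simp
  qed
  define D1 Dz where "D1 = Determinant.det A1" and "Dz = Determinant.det Z"
  define g where "g = gcd D1 Dz"
  have g0: "g \<noteq> 0" using Z0 by (simp add: g_def Dz_def)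
  obtain z1 z' where z: "D1 = g * z1" "Dz = g * z'" "coprime z1 z'"
    using gcd_coprime_exists[of D1 Dz] g0 unfolding g_def by (metis mult.commute)
  \<comment> \<open>A prime dividing the denominator would have to divide every window determinant
    of Q.\<close>
  have "is_unit z'"
  proof (rule ccontr)
    assume "\<not> is_unit z'"
    moreover have "z' \<noteq> 0" using z Z0 by (auto simp: Dz_def)
    ultimately obtain p where p: "prime p" "p dvd z'" using prime_divisorE by blast
    obtain j where j: "j \<le> degree Q" "\<not> p dvd rdet k (map (app Q) (window k j))"
      using window_det_not_dvd[OF Q(1) p(1)] by blast
    have "rdet N (us @ window k j) * z' = z1 * rdet k (map (app Q) (window k j))"
      using prod[of "window k j"] z g0 by (simp add: D1_def[symmetric] Dz_def[symmetric] window_def mult_ac)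
    hence "p dvd z1 * rdet k (map (app Q) (window k j))" using p(2) by (metis dvd_mult)
    hence "p dvd z1" using j p(1) by (simp add: prime_dvd_mult_iff)
    thus False using p z(3) by (meson coprime_def not_prime_unit)
  qed
  hence "Dz dvd D1" using z by (metis dvd_mult_cancel_left dvd_trans unit_imp_dvd)
  then obtain zz where zz: "D1 = Dz * zz" by (elim dvdE)
  have "rdet N (us @ ws) = zz * rdet k (map (app Q) ws)" if "length ws = k" for ws
    using prod[OF that] Z0 zz by (simp add: D1_def[symmetric] Dz_def[symmetric] mult_ac)
  thus ?thesis by blast
qed

section \<open>Minimal points\<close>

definition ev :: "real \<Rightarrow> int poly \<Rightarrow> real" where
  "ev \<xi> P = (\<Sum>t\<le>degree P. real_of_int (coeff P t) * \<xi> ^ t)"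

definition err :: "nat \<Rightarrow> real \<Rightarrow> (nat \<Rightarrow> int) \<Rightarrow> real" where
  "err n \<xi> y = Max ((\<lambda>t. \<bar>real_of_int (y t) - \<xi> ^ t * real_of_int (y 0)\<bar>) ` {..n})"

lemma err_ge: "t \<le> n \<Longrightarrow> \<bar>real_of_int (y t) - \<xi> ^ t * real_of_int (y 0)\<bar> \<le> err n \<xi> y"
  unfolding err_def by (intro Max_ge) auto

lemma err_le: "(\<And>t. t \<le> n \<Longrightarrow> \<bar>real_of_int (y t) - \<xi> ^ t * real_of_int (y 0)\<bar> \<le> B) \<Longrightarrow> err n \<xi> y \<le> B"
  unfolding err_def by (intro Max.boundedI) auto

lemma ev_eq_sum: "degree P \<le> N \<Longrightarrow> ev \<xi> P = (\<Sum>t\<le>N. real_of_int (coeff P t) * \<xi> ^ t)"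
  unfolding ev_def by (rule sum.mono_neutral_left) (auto simp: coeff_eq_0)

lemma ht_nonneg: "0 \<le> ht P"
  using coeff_le_ht[of P 0] by linarith

lemma app_approx:
  assumes "degree P \<le> l" "j + l \<le> n"
  shows "\<bar>real_of_int (app P y j) - real_of_int (y 0) * \<xi> ^ j * ev \<xi> P\<bar> \<le> (real l + 1) * ht P * err n \<xi> y"
proof -
  have "real_of_int (app P y j) - real_of_int (y 0) * \<xi> ^ j * ev \<xi> P =
      (\<Sum>t\<le>l. real_of_int (coeff P t) * (real_of_int (y (j + t)) - \<xi> ^ (j + t) * real_of_int (y 0)))"
    by (simp add: app_eq_sum[OF assms(1)] ev_eq_sum[OF assms(1)] sum_distrib_left sum_subtractf
        algebra_simps power_add)
  also have "\<bar>\<dots>\<bar> \<le> (\<Sum>t\<le>l. \<bar>real_of_int (coeff P t) * (real_of_int (y (j + t)) - \<xi> ^ (j + t) * real_of_int (y 0))\<bar>)"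
    by (rule sum_abs)
  also have "\<dots> \<le> (\<Sum>t\<le>l. ht P * err n \<xi> y)"
    unfolding abs_mult using assms
    by (intro sum_mono mult_mono coeff_le_ht err_ge) (auto simp: ht_nonneg)
  also have "\<dots> = (real l + 1) * ht P * err n \<xi> y" by simp
  finally show ?thesis .
qed

lemma list_subset_image: "set vs \<subseteq> f ` A \<Longrightarrow> \<exists>js. vs = map f js \<and> set js \<subseteq> A"
proof (induction vs)
  case (Cons v vs)
  then obtain js a where "vs = map f js" "set js \<subseteq> A" "v = f a" "a \<in> A" by auto
  thus ?case by (intro exI[of _ "a # js"]) auto
qed simp

text \<open>Read multiplicatively, \<open>L_upper\<close> bounds the error of a point by
  \<open>exp K0\<close> times the next first coordinate to the power \<open>-1/\<nu>\<close>, so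
  \<nu> is the reciprocal of the exponent. The hypothesis on the degree of \<xi> enters as
  \<open>nonalg\<close>.\<close>

locale minpts =
  fixes n :: nat and \<xi> \<nu> K0 :: real and x :: "nat \<Rightarrow> nat \<Rightarrow> int"
  assumes n_pos: "n \<ge> 1" and nu_pos: "\<nu> > 0" and K0_nonneg: "K0 \<ge> 0"
    and nonalg: "\<And>P. P \<noteq> 0 \<Longrightarrow> degree P \<le> n \<Longrightarrow> ev \<xi> P \<noteq> 0"
    and x_pos: "\<And>i. 0 < x i 0"
    and x_Suc: "\<And>i. x i 0 < x (Suc i) 0"
    and L_Suc: "\<And>i. err n \<xi> (x (Suc i)) < err n \<xi> (x i)"
    and L_pos: "\<And>i. 0 < err n \<xi> (x i)"
    and L_le_1: "\<And>i. err n \<xi> (x i) \<le> 1"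
    and minimal: "\<And>i y. (\<exists>t\<le>n. y t \<noteq> 0) \<Longrightarrow> \<bar>y 0\<bar> < x (Suc i) 0 \<Longrightarrow> err n \<xi> (x i) \<le> err n \<xi> y"
    and L_upper: "\<And>i. ln (err n \<xi> (x i)) \<le> K0 - ln (real_of_int (x (Suc i) 0)) / \<nu>"
begin

abbreviation Xv :: "nat \<Rightarrow> real" where "Xv i \<equiv> real_of_int (x i 0)"
abbreviation L :: "nat \<Rightarrow> real" where "L i \<equiv> err n \<xi> (x i)"
abbreviation y :: "nat \<Rightarrow> real" where "y i \<equiv> ln (Xv i)"

lemma X_ge_1: "1 \<le> Xv i"
  using x_pos[of i] by linarith

lemma X_mono: "i \<le> j \<Longrightarrow> Xv i \<le> Xv j"
  by (induction rule: dec_induct) (use x_Suc in \<open>auto intro: order.trans less_imp_le\<close>)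

lemma X_strict: "i < j \<Longrightarrow> Xv i < Xv j"
  using X_mono[of "Suc i" j] x_Suc[of i] by (simp add: Suc_leI order_less_le_trans)

lemma L_mono: "i \<le> j \<Longrightarrow> L j \<le> L i"
  by (induction rule: dec_induct) (use L_Suc in \<open>auto intro: order.trans less_imp_le\<close>)

lemma X_ge: "real i \<le> Xv i"
proof (induction i)
  case (Suc i)
  have "Xv i + 1 \<le> Xv (Suc i)" using x_Suc[of i] by linarith
  thus ?case using Suc by simp
qed (use X_ge_1[of 0] in simp)

lemma y_nonneg: "0 \<le> y i" using X_ge_1[of i] by simp

lemma y_mono: "i \<le> j \<Longrightarrow> y i \<le> y j"
  using X_mono[of i j] X_ge_1[of i] by (simp add: order_less_le_trans)

lemma y_large: "\<exists>i0. \<forall>i\<ge>i0. B \<le> y i"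
proof -
  have "B \<le> y i" if "i \<ge> nat \<lceil>exp B\<rceil>" for i
  proof -
    have "exp B \<le> Xv i" using that X_ge[of i] by linarith
    thus ?thesis using X_ge_1[of i] by (simp add: ln_ge_iff)
  qed
  thus ?thesis by blast
qed

text \<open>Chosen to bound \<open>1 + \<bar>\<xi>\<bar> ^ t\<close> for \<open>t \<le> n\<close>;
  this is the loss in passing from a point to one of its shifts.\<close>

definition M :: real where "M = 1 + (1 + \<bar>\<xi>\<bar>) ^ n"

lemma M_ge: "t \<le> n \<Longrightarrow> \<bar>\<xi>\<bar> ^ t \<le> M - 1" and M_ge_2: "2 \<le> M"
proof -
  have one: "(1::real) \<le> (1 + \<bar>\<xi>\<bar>) ^ n" by simp
  show "2 \<le> M" using one by (simp add: M_def)
  assume "t \<le> n"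
  have "\<bar>\<xi>\<bar> ^ t \<le> (1 + \<bar>\<xi>\<bar>) ^ t" by (intro power_mono) auto
  also have "\<dots> \<le> (1 + \<bar>\<xi>\<bar>) ^ n" using \<open>t \<le> n\<close> by (intro power_increasing) auto
  finally show "\<bar>\<xi>\<bar> ^ t \<le> M - 1" by (simp add: M_def)
qed

definition shrow :: "nat \<Rightarrow> nat \<Rightarrow> nat \<Rightarrow> int" where
  "shrow c j = (\<lambda>t. x c (j + t))"

lemma app_shrow: "app F (shrow c j) 0 = app F (x c) j"
  by (simp add: shrow_def app_shift_0)

lemma shrow_first:
  assumes "j \<le> n"
  shows "\<bar>real_of_int (shrow c j 0)\<bar> \<le> M * Xv c"
proof -
  have "\<bar>real_of_int (x c j)\<bar> \<le> \<bar>\<xi> ^ j * Xv c\<bar> + L c"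
    using err_ge[of j n "x c" \<xi>] assms by linarith
  also have "\<dots> \<le> (M - 1) * Xv c + Xv c"
    using M_ge[OF assms] X_ge_1[of c] L_le_1[of c]
    by (intro add_mono) (auto simp: abs_mult power_abs intro!: mult_right_mono)
  finally show ?thesis by (simp add: shrow_def algebra_simps)
qed

lemma shrow_err:
  assumes "j + t \<le> n"
  shows "\<bar>real_of_int (shrow c j t) - \<xi> ^ t * real_of_int (shrow c j 0)\<bar> \<le> M * L c"
proof -
  let ?e = "\<lambda>t. real_of_int (x c t) - \<xi> ^ t * Xv c"
  have "real_of_int (shrow c j t) - \<xi> ^ t * real_of_int (shrow c j 0) = ?e (j + t) - \<xi> ^ t * ?e j"
    by (simp add: shrow_def power_add algebra_simps)
  also have "\<bar>\<dots>\<bar> \<le> \<bar>?e (j + t)\<bar> + \<bar>\<xi>\<bar> ^ t * \<bar>?e j\<bar>"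
    using abs_triangle_ineq4[of "?e (j + t)" "\<xi> ^ t * ?e j"] by (simp add: abs_mult power_abs)
  also have "\<dots> \<le> L c + (M - 1) * L c"
    using assms M_ge[of t] err_ge[of "j + t" n "x c" \<xi>] err_ge[of j n "x c" \<xi>] M_ge_2
    by (intro add_mono mult_mono) auto
  finally show ?thesis by (simp add: algebra_simps)
qed

text \<open>This is the exchange condition of the determinant bound: the row charged its full size
  should belong to the largest point.\<close>

lemma cost_mono: "c \<le> q \<Longrightarrow> Xv c * L q \<le> Xv q * L c"
  using X_mono[of c q] L_mono[of c q] X_ge_1[of q] L_pos[of q] by (intro mult_mono) auto

text \<open>Row \<open>r\<close> may be reduced by earlier rows; afterwards it has leading entry at most \<open>K * a\<close>
  and distance at most \<open>K * l r\<close> from the line of \<open>(1, \<xi>, \<xi>\<^sup>2, \<dots>)\<close>.\<close>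

lemma rdet_cost:
  fixes us :: "(nat \<Rightarrow> int) list"
  assumes N: "length us = N" "N > 0" and K: "K > 0"
    and l0: "l 0 = L q"
    and prof: "\<And>r. r < N \<Longrightarrow> \<exists>c w a. (\<forall>t<N. w t = real_of_int ((us ! r) t) - (\<Sum>p<r. c p * real_of_int ((us ! p) t)))
        \<and> \<bar>w 0\<bar> \<le> K * a \<and> (r = 0 \<longrightarrow> a = Xv q) \<and> a * L q \<le> Xv q * l r \<and> (\<forall>t<N. \<bar>w t - \<xi> ^ t * w 0\<bar> \<le> K * l r)"
  shows "\<bar>real_of_int (rdet N us)\<bar> \<le> fact N * K ^ N * Xv q * (\<Prod>r = 1..<N. l r)"
proof -
  define A where "A r = (if r = 0 then K * Xv q else K * (Xv q * l r / L q))" for r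
  have "\<bar>real_of_int (rdet N us)\<bar> \<le> fact N * (A 0 * (\<Prod>r = 1..<N. K * l r))"
  proof (rule rdet_profile_le[OF N])
    show "0 < K * l 0" using K l0 L_pos by simp
  next
    fix r assume r: "r < N"
    obtain c w a where cw: "\<forall>t<N. w t = real_of_int ((us ! r) t) - (\<Sum>p<r. c p * real_of_int ((us ! p) t))"
      "\<bar>w 0\<bar> \<le> K * a" "r = 0 \<longrightarrow> a = Xv q" "a * L q \<le> Xv q * l r" "\<forall>t<N. \<bar>w t - \<xi> ^ t * w 0\<bar> \<le> K * l r"
      using prof[OF r] by blast
    have "a \<le> Xv q * l r / L q" using cw(4) L_pos by (simp add: pos_le_divide_eq)
    hence "K * a \<le> K * (Xv q * l r / L q)" using K by (intro mult_left_mono) auto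
    hence "K * a \<le> A r" using cw(3) by (auto simp: A_def)
    thus "\<exists>c w. (\<forall>t<N. w t = real_of_int ((us ! r) t) - (\<Sum>q<r. c q * real_of_int ((us ! q) t)))
        \<and> \<bar>w 0\<bar> \<le> A r \<and> (\<forall>t<N. \<bar>w t - \<xi> ^ t * w 0\<bar> \<le> K * l r)"
      using cw by (intro exI[of _ c] exI[of _ w]) auto
  next
    fix r assume "r < N"
    show "A r * (K * l 0) \<le> A 0 * (K * l r)" using L_pos[of q] by (simp add: A_def l0)
  qed
  also have "\<dots> = fact N * (K * Xv q * (K ^ (N - 1) * (\<Prod>r = 1..<N. l r)))"
    by (simp add: A_def prod.distrib)
  also have "\<dots> = fact N * K ^ N * Xv q * (\<Prod>r = 1..<N. l r)"
    using N(2) by (cases N) auto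
  finally show ?thesis .
qed

text \<open>Divided by \<nu> and negated, this bounds the logarithm of the product of the errors of
  the listed rows, up to constants.\<close>

definition rcost :: "(nat \<times> nat) list \<Rightarrow> real" where
  "rcost ts = sum_list (map (\<lambda>(c, j). y (Suc c)) ts)"

lemma ln_L_list: "ln (\<Prod>r<length ts. L (fst (ts ! r))) \<le> real (length ts) * K0 - rcost ts / \<nu>"
proof (induction ts)
  case (Cons p ts)
  have pos: "0 < (\<Prod>r<length ts. L (fst (ts ! r)))" using L_pos by (intro prod_pos) auto
  have "(\<Prod>r<length (p # ts). L (fst ((p # ts) ! r))) = L (fst p) * (\<Prod>r<length ts. L (fst (ts ! r)))"
    by (simp only: length_Cons prod.lessThan_Suc_shift) simp
  hence "ln (\<Prod>r<length (p # ts). L (fst ((p # ts) ! r))) = ln (L (fst p)) + ln (\<Prod>r<length ts. L (fst (ts ! r)))"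
    using pos L_pos by (simp only: ln_mult_pos)
  also have "\<dots> \<le> (K0 - y (Suc (fst p)) / \<nu>) + (real (length ts) * K0 - rcost ts / \<nu>)"
    using L_upper Cons by (intro add_mono) auto
  also have "\<dots> = real (length (p # ts)) * K0 - rcost (p # ts) / \<nu>"
    by (simp add: rcost_def case_prod_unfold add_divide_distrib algebra_simps)
  finally show ?case .
qed (simp add: rcost_def)

text \<open>\<open>ts\<close> lists pairs (point, shift); the first pair carries the largest point.\<close>

lemma rows_with_units:
  fixes ts :: "(nat \<times> nat) list" and ks :: "nat list"
  assumes N: "length ts + length ks = N" and top: "\<And>c j. (c, j) \<in> set ts \<Longrightarrow> c \<le> q \<and> j + N \<le> Suc n"
    and ne: "ts = (q, j0) # ts'" and ks: "\<And>i. i \<in> set ks \<Longrightarrow> i < N" and Nn: "N \<le> Suc n"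
  shows "\<bar>real_of_int (rdet N (map (\<lambda>(c, j). shrow c j) ts @ map unitrow ks))\<bar> \<le>
    fact N * M ^ N * Xv q * (\<Prod>r<length ts'. L (fst (ts' ! r)))"
proof -
  let ?us = "map (\<lambda>(c, j). shrow c j) ts @ map unitrow ks"
  define l where "l r = (if r < length ts then L (fst (ts ! r)) else 1)" for r
  have "\<bar>real_of_int (rdet N ?us)\<bar> \<le> fact N * M ^ N * Xv q * (\<Prod>r = 1..<N. l r)"
  proof (rule rdet_cost)
    show "length ?us = N" using N by simp
    show "N > 0" using N ne by simp
    show "0 < M" using M_ge_2 by simp
    show "l 0 = L q" using ne by (simp add: l_def)
  next
    fix r assume r: "r < N"
    show "\<exists>c w a. (\<forall>t<N. w t = real_of_int ((?us ! r) t) - (\<Sum>p<r. c p * real_of_int ((?us ! p) t)))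
        \<and> \<bar>w 0\<bar> \<le> M * a \<and> (r = 0 \<longrightarrow> a = Xv q) \<and> a * L q \<le> Xv q * l r \<and> (\<forall>t<N. \<bar>w t - \<xi> ^ t * w 0\<bar> \<le> M * l r)"
    proof (cases "r < length ts")
      case True
      obtain c j where cj: "ts ! r = (c, j)" by (cases "ts ! r")
      hence "(c, j) \<in> set ts" using True by (metis nth_mem)
      hence c: "c \<le> q" "j + N \<le> Suc n" using top by auto
      have us: "?us ! r = shrow c j" using True cj by (simp add: nth_append)
      have 1: "\<bar>real_of_int (shrow c j 0)\<bar> \<le> M * Xv c" using c r by (intro shrow_first) auto
      have 2: "Xv c * L q \<le> Xv q * l r" using cost_mono[OF c(1)] True cj by (simp add: l_def)
      have 3: "\<bar>real_of_int (shrow c j t) - \<xi> ^ t * real_of_int (shrow c j 0)\<bar> \<le> M * l r" if "t < N" for t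
        using shrow_err[of j t c] c True cj that by (simp add: l_def)
      have 4: "r = 0 \<longrightarrow> Xv c = Xv q" using cj ne by auto
      show ?thesis
        unfolding us
        by (intro exI[of _ "\<lambda>_. 0"] exI[of _ "\<lambda>t. real_of_int (shrow c j t)"] exI[of _ "Xv c"])
          (use 1 2 3 4 in auto)
    next
      case False
      define i where "i = ks ! (r - length ts)"
      have us: "?us ! r = unitrow i" using False r N by (simp add: nth_append i_def)
      have 1: "\<bar>real_of_int (unitrow i 0)\<bar> \<le> M * 1" using M_ge_2 by (simp add: unitrow_def)
      have 2: "1 * L q \<le> Xv q * l r" using L_le_1[of q] X_ge_1[of q] False by (simp add: l_def)
      have 3: "\<bar>real_of_int (unitrow i t) - \<xi> ^ t * real_of_int (unitrow i 0)\<bar> \<le> M * l r" if t: "t < N" for t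
      proof -
        have "\<bar>real_of_int (unitrow i t) - \<xi> ^ t * real_of_int (unitrow i 0)\<bar> \<le> 1 + \<bar>\<xi>\<bar> ^ t"
          by (auto simp: unitrow_def power_abs[symmetric])
        also have "\<dots> \<le> M" using M_ge[of t] t Nn by simp
        finally show ?thesis using False by (simp add: l_def)
      qed
      have 4: "r \<noteq> 0" using False ne by auto
      show ?thesis
        unfolding us
        by (intro exI[of _ "\<lambda>_. 0"] exI[of _ "\<lambda>t. real_of_int (unitrow i t)"] exI[of _ 1])
          (use 1 2 3 4 in auto)
    qed
  qed
  also have "(\<Prod>r = 1..<N. l r) = (\<Prod>r<length ts'. L (fst (ts' ! r)))"
  proof -
    have "(\<Prod>r = 1..<N. l r) = (\<Prod>r = 1..<length ts. l r)"
      using N by (intro prod.mono_neutral_right) (auto simp: l_def)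
    also have "\<dots> = (\<Prod>r<length ts'. L (fst (ts' ! r)))"
      using ne by (intro prod.reindex_bij_witness[of _ Suc "\<lambda>r. r - 1"]) (auto simp: l_def)
    finally show ?thesis .
  qed
  finally show ?thesis .
qed

definition C1 :: "nat \<Rightarrow> real" where "C1 N = ln (fact N * M ^ N) + real N * K0"

lemma rows_with_units_log:
  fixes ts :: "(nat \<times> nat) list" and ks :: "nat list"
  assumes N: "length ts + length ks = N" and top: "\<And>c j. (c, j) \<in> set ts \<Longrightarrow> c \<le> q \<and> j + N \<le> Suc n"
    and ne: "ts = (q, j0) # ts'" and ks: "\<And>i. i \<in> set ks \<Longrightarrow> i < N" and Nn: "N \<le> Suc n"
    and low: "D > 0" "D \<le> \<bar>real_of_int (rdet N (map (\<lambda>(c, j). shrow c j) ts @ map unitrow ks))\<bar>"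
  shows "ln D + rcost ts' / \<nu> \<le> y q + C1 N"
proof -
  let ?P = "\<Prod>r<length ts'. L (fst (ts' ! r))"
  have P: "0 < ?P" using L_pos by (intro prod_pos) auto
  have K: "0 < fact N * M ^ N" using M_ge_2 by simp
  have "D \<le> fact N * M ^ N * Xv q * ?P"
    using rows_with_units[OF N top ne ks Nn] low(2) by linarith
  hence "ln D \<le> ln (fact N * M ^ N * Xv q * ?P)" using low(1) by simp
  also have "\<dots> = ln (fact N * M ^ N) + y q + ln ?P"
  proof -
    have "0 < Xv q" using X_ge_1[of q] by linarith
    thus ?thesis using K P by (simp only: ln_mult_pos mult_pos_pos)
  qed
  also have "ln ?P \<le> real (length ts') * K0 - rcost ts' / \<nu>" by (rule ln_L_list)
  also have "real (length ts') * K0 \<le> real N * K0"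
    using N ne K0_nonneg by (intro mult_right_mono) auto
  finally show ?thesis by (simp add: C1_def)
qed

subsection \<open>Choosing rows point by point\<close>

text \<open>If rows are chosen greedily point after point, a point supplies as many rows as it
  lowers the dimension, each of weight \<open>y (Suc c)\<close>. This expresses the total weight of
  the chosen rows through dimensions alone.\<close>

fun drops :: "nat \<Rightarrow> int poly set \<Rightarrow> nat list \<Rightarrow> real" where
  "drops l S [] = 0"
| "drops l S (c # cs) = (real (pdim S) - real (pdim (S \<inter> ann n l {x c}))) * y (Suc c) + drops l (S \<inter> ann n l {x c}) cs"

lemma submod_Int: "submod S \<Longrightarrow> submod T \<Longrightarrow> submod (S \<inter> T)"
  by (auto simp: submod_def)

lemma ann_single_rows: "l \<le> n \<Longrightarrow> F \<in> ann n l {x c} \<longleftrightarrow> degree F \<le> l \<and> (\<forall>u\<in>shrow c ` {..n - l}. app F u 0 = 0)"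
  by (auto simp: ann_def app_shrow)

text \<open>The last clause guarantees that the list begins with a row of the first point, as the
  determinant bounds require for the row on top.\<close>

lemma choose_rows:
  assumes "submod S" "degb l S" "l \<le> n"
  shows "\<exists>ts. (\<forall>(c, j)\<in>set ts. c \<in> set cs \<and> j \<le> n - l) \<and>
    {F\<in>S. \<forall>(c, j)\<in>set ts. app F (x c) j = 0} = S \<inter> ann n l (x ` set cs) \<and>
    length ts + pdim (S \<inter> ann n l (x ` set cs)) = pdim S \<and> rcost ts = drops l S cs \<and>
    (\<forall>c cs'. cs = c # cs' \<longrightarrow> pdim (S \<inter> ann n l {x c}) < pdim S \<longrightarrow> (\<exists>j ts'. ts = (c, j) # ts'))"
  using assms(1,2)
proof (induction cs arbitrary: S)
  case Nil
  have "S \<inter> ann n l {} = S" using Nil(2) by (auto simp: ann_def degb_def)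
  thus ?case by (intro exI[of _ "[]"]) (auto simp: rcost_def)
next
  case (Cons c cs)
  let ?S = "S \<inter> ann n l {x c}" and ?U = "shrow c ` {..n - l}"
  have eqS: "{F\<in>S. \<forall>u\<in>?U. app F u 0 = 0} = ?S"
    using Cons.prems(2) ann_single_rows[OF assms(3)] by (auto simp: degb_def)
  obtain vs where vs: "set vs \<subseteq> ?U" "length vs + pdim ?S = pdim S"
    "{F\<in>S. \<forall>u\<in>set vs. app F u 0 = 0} = ?S"
    using greedy_rows[OF Cons.prems, of ?U] unfolding eqS by blast
  obtain js where js: "vs = map (shrow c) js" "set js \<subseteq> {..n - l}"
    using list_subset_image[OF vs(1)] by blast
  have sub: "submod ?S" by (rule submod_Int[OF Cons.prems(1) submod_ann])
  have dg: "degb l ?S" by (rule degb_subset[OF Cons.prems(2)]) auto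
  obtain ts where ts: "\<forall>(d, j)\<in>set ts. d \<in> set cs \<and> j \<le> n - l"
    "{F\<in>?S. \<forall>(c, j)\<in>set ts. app F (x c) j = 0} = ?S \<inter> ann n l (x ` set cs)"
    "length ts + pdim (?S \<inter> ann n l (x ` set cs)) = pdim ?S" "rcost ts = drops l ?S cs"
    using Cons.IH[OF sub dg] by blast
  have un: "?S \<inter> ann n l (x ` set cs) = S \<inter> ann n l (x ` set (c # cs))"
    using ann_Un[of n l "{x c}" "x ` set cs"] by auto
  show ?case
  proof (intro exI[of _ "map (\<lambda>j. (c, j)) js @ ts"] conjI)
    show "\<forall>(d, j)\<in>set (map (\<lambda>j. (c, j)) js @ ts). d \<in> set (c # cs) \<and> j \<le> n - l"
      using ts(1) js(2) by auto
    have "{F\<in>S. \<forall>(d, j)\<in>set (map (\<lambda>j. (c, j)) js @ ts). app F (x d) j = 0} =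
        {F\<in>{F\<in>S. \<forall>u\<in>set vs. app F u 0 = 0}. \<forall>(c, j)\<in>set ts. app F (x c) j = 0}"
      using js(1) by (auto simp: app_shrow)
    also have "\<dots> = S \<inter> ann n l (x ` set (c # cs))" unfolding vs(3) ts(2) un ..
    finally show "{F\<in>S. \<forall>(d, j)\<in>set (map (\<lambda>j. (c, j)) js @ ts). app F (x d) j = 0} = S \<inter> ann n l (x ` set (c # cs))" .
    show "length (map (\<lambda>j. (c, j)) js @ ts) + pdim (S \<inter> ann n l (x ` set (c # cs))) = pdim S"
      using ts(3) vs(2) js(1) unfolding un by simp
    have "rcost (map (\<lambda>j. (c, j)) js @ ts) = real (length js) * y (Suc c) + rcost ts"
      by (simp add: rcost_def sum_list_triv o_def)
    also have "real (length js) = real (pdim S) - real (pdim ?S)"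
      using vs(2) js(1) by simp
    finally show "rcost (map (\<lambda>j. (c, j)) js @ ts) = drops l S (c # cs)" using ts(4) by simp
    show "\<forall>c' cs'. c # cs = c' # cs' \<longrightarrow> pdim (S \<inter> ann n l {x c'}) < pdim S \<longrightarrow>
        (\<exists>j ts'. map (\<lambda>j. (c, j)) js @ ts = (c', j) # ts')"
      using vs(2) js(1) by (cases js) auto
  qed
qed

abbreviation allp :: "nat \<Rightarrow> int poly set" where "allp l \<equiv> {F. degree F \<le> l}"

lemma pdim_point:
  assumes "l \<le> n"
  shows "pdim (ann n l {x c}) < l + 1"
proof -
  let ?S = "{F \<in> allp l. app F (x c) 0 = 0}"
  have "pdim ?S + 1 = pdim (allp l)"
    by (rule pdim_cut[OF submod_all, of l _ 1]) (use x_pos[of c] in \<open>auto simp: degb_def app_def\<close>)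
  moreover have "pdim (ann n l {x c}) \<le> pdim ?S"
    by (rule pdim_mono[of l]) (auto simp: degb_def ann_def)
  ultimately show ?thesis using pdim_all[of l] by simp
qed

lemma all_Int_ann: "allp l \<inter> ann n l K = ann n l K"
  by (auto simp: ann_def)

end

section \<open>Determinant estimates for minimal points\<close>

lemma ann_primitive:
  assumes "ann n l K \<noteq> {0}"
  shows "\<exists>Q\<in>ann n l K. Q \<noteq> 0 \<and> Polynomial.content Q = 1"
proof -
  obtain Q where Q: "Q \<in> ann n l K" "Q \<noteq> 0" using assms zero_ann by blast
  have "smult (Polynomial.content Q) (primitive_part Q) = Q" by (rule content_times_primitive_part)
  moreover have "Polynomial.content Q \<noteq> 0" using Q by simp
  ultimately have "primitive_part Q \<in> ann n l K"
    using satur_ann[of n l K] Q unfolding satur_def by metis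
  thus ?thesis using Q by (intro bexI[of _ "primitive_part Q"]) auto
qed

context minpts
begin

lemma exists_rows:
  assumes "l \<le> n"
  shows "\<exists>ts ts' j. ts = (q, j) # ts' \<and> (\<forall>(c, j)\<in>set ts. c \<in> set (q # cs) \<and> j \<le> n - l) \<and>
    {F. degree F \<le> l \<and> (\<forall>(c, j)\<in>set ts. app F (x c) j = 0)} = ann n l (x ` set (q # cs)) \<and>
    length ts + pdim (ann n l (x ` set (q # cs))) = l + 1 \<and>
    rcost ts' = drops l (allp l) (q # cs) - y (Suc q)"
proof -
  have db: "degb l (allp l)" by (simp add: degb_def)
  obtain ts where ts: "\<forall>(c, j)\<in>set ts. c \<in> set (q # cs) \<and> j \<le> n - l"
    "{F\<in>allp l. \<forall>(c, j)\<in>set ts. app F (x c) j = 0} = allp l \<inter> ann n l (x ` set (q # cs))"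
    "length ts + pdim (allp l \<inter> ann n l (x ` set (q # cs))) = pdim (allp l)"
    "rcost ts = drops l (allp l) (q # cs)"
    "\<forall>c cs'. q # cs = c # cs' \<longrightarrow> pdim (allp l \<inter> ann n l {x c}) < pdim (allp l) \<longrightarrow> (\<exists>j ts'. ts = (c, j) # ts')"
    using choose_rows[OF submod_all db assms, of "q # cs"] by (elim exE conjE) (rule that)
  have "pdim (allp l \<inter> ann n l {x q}) < pdim (allp l)"
    unfolding all_Int_ann pdim_all by (rule pdim_point[OF assms])
  then obtain j ts' where tse: "ts = (q, j) # ts'" using ts(5) by blast
  show ?thesis
    using ts(1-4) tse unfolding all_Int_ann pdim_all
    by (intro exI[of _ ts] exI[of _ ts'] exI[of _ j]) (auto simp: rcost_def)
qed

lemma full_rows_det: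
  assumes "length us = Suc l" "\<And>F. degree F \<le> l \<Longrightarrow> (\<And>u. u \<in> set us \<Longrightarrow> app F u 0 = 0) \<Longrightarrow> F = 0"
  shows "1 \<le> \<bar>real_of_int (rdet (Suc l) us)\<bar>"
proof -
  have "rdet (Suc l) us \<noteq> 0"
    by (rule rdet_nonzero[OF assms(1)]) (use assms(2) in auto)
  hence "1 \<le> \<bar>rdet (Suc l) us\<bar>" by linarith
  thus ?thesis by (metis of_int_1_le_iff of_int_abs)
qed

text \<open>The chosen rows have no common annihilator, so their determinant is a non-zero integer
  and its upper bound is at least 1. The term \<open>y (Suc q)\<close> on the right compensates for
  \<open>drops\<close> counting the top row, which enters with its size and not with its
  error.\<close>

lemma chain_full:
  assumes l: "l \<le> n" and cs: "\<And>c. c \<in> set cs \<Longrightarrow> c \<le> q"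
    and zero: "ann n l (x ` set (q # cs)) = {0}"
  shows "drops l (allp l) (q # cs) \<le> y (Suc q) + \<nu> * y q + \<nu> * C1 (Suc l)"
proof -
  obtain ts ts' j where ts: "ts = (q, j) # ts'" "\<forall>(c, j)\<in>set ts. c \<in> set (q # cs) \<and> j \<le> n - l"
    "{F. degree F \<le> l \<and> (\<forall>(c, j)\<in>set ts. app F (x c) j = 0)} = ann n l (x ` set (q # cs))"
    "length ts + pdim (ann n l (x ` set (q # cs))) = l + 1"
    "rcost ts' = drops l (allp l) (q # cs) - y (Suc q)"
    using exists_rows[OF l, of q cs] by (elim exE conjE) (rule that)
  let ?us = "map (\<lambda>(c, j). shrow c j) ts @ map unitrow []"
  have len: "length ts + length ([] :: nat list) = Suc l" using ts(4) zero by simp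
  have "1 \<le> \<bar>real_of_int (rdet (Suc l) ?us)\<bar>"
  proof (rule full_rows_det)
    show "length ?us = Suc l" using len by simp
    fix F assume F: "degree F \<le> l" "\<And>u. u \<in> set ?us \<Longrightarrow> app F u 0 = 0"
    have "app F (x c) j = 0" if "(c, j) \<in> set ts" for c j
      using F(2)[of "shrow c j"] that by (force simp: app_shrow)
    hence "F \<in> ann n l (x ` set (q # cs))" using F(1) ts(3) by blast
    thus "F = 0" using zero by simp
  qed
  hence "ln 1 + rcost ts' / \<nu> \<le> y q + C1 (Suc l)"
    by (intro rows_with_units_log[OF len _ ts(1)]) (use ts(2) cs l in auto)
  hence "rcost ts' \<le> \<nu> * (y q + C1 (Suc l))"
    using nu_pos by (simp add: pos_divide_le_eq mult.commute)
  thus ?thesis using ts(5) by (simp add: algebra_simps)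
qed

text \<open>The subtracted logarithm is that of the constant in \<open>window_det_lower\<close>, for
  the number of rows that remain when k dimensions are left over.\<close>

definition C2 :: "nat \<Rightarrow> nat \<Rightarrow> real" where
  "C2 l k = C1 (Suc l) - ln (((1 / (2 * fact k)) ^ ((k + 1) ^ (Suc l - k))) ^ k / 2)"

text \<open>The rows from the points leave k dimensions and are completed by a window of k unit
  rows. By \<open>dual_minors\<close> the determinant is a non-zero integer multiple of a window
  determinant of Q, and a suitable window makes that at least a constant times
  \<open>ht Q ^ k\<close>.\<close>

lemma chain_dual:
  assumes l: "l \<le> n" and cs: "\<And>c. c \<in> set cs \<Longrightarrow> c \<le> q"
    and k: "k > 0" "pdim (ann n l (x ` set (q # cs))) = k"
    and Q: "Polynomial.content Q = 1" "degree Q + k \<le> Suc l"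
    and kill: "\<And>a. a < k \<Longrightarrow> monom 1 a * Q \<in> ann n l (x ` set (q # cs))"
  shows "real k * ln (ht Q) + (drops l (allp l) (q # cs) - y (Suc q)) / \<nu> \<le> y q + C2 l k"
proof -
  let ?A = "ann n l (x ` set (q # cs))"
  have Q0: "Q \<noteq> 0" using Q by auto
  obtain ts ts' j where ts: "ts = (q, j) # ts'" "\<forall>(c, j)\<in>set ts. c \<in> set (q # cs) \<and> j \<le> n - l"
    "{F. degree F \<le> l \<and> (\<forall>(c, j)\<in>set ts. app F (x c) j = 0)} = ?A"
    "length ts + pdim ?A = l + 1"
    "rcost ts' = drops l (allp l) (q # cs) - y (Suc q)"
    using exists_rows[OF l, of q cs] by (elim exE conjE) (rule that)
  define e where "e = Suc l - k"
  have e: "length ts = e" "Suc l = e + k" using ts(4) k by (auto simp: e_def)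
  let ?us = "map (\<lambda>(c, j). shrow c j) ts"
  have killus: "app Q u a = 0" if "u \<in> set ?us" "a < k" for u a
  proof -
    have "u \<in> (\<lambda>(c, j). shrow c j) ` set ts" using that(1) by (simp only: set_map)
    then obtain p where p: "p \<in> set ts" "u = (case p of (c, j) \<Rightarrow> shrow c j)" by (rule imageE)
    obtain c j where pe: "p = (c, j)" by (cases p)
    have cj: "(c, j) \<in> set ts" "u = shrow c j" using p pe by auto
    have "monom 1 a * Q \<in> {F. degree F \<le> l \<and> (\<forall>(c, j)\<in>set ts. app F (x c) j = 0)}"
      using kill[OF that(2)] ts(3) by simp
    hence "app (monom 1 a * Q) (x c) j = 0" using cj by auto
    thus ?thesis using cj by (simp add: app_monom_mult shrow_def app_shift)
  qed
  obtain z where z: "\<And>ws. length ws = k \<Longrightarrow> rdet (Suc l) (?us @ ws) = z * rdet k (map (app Q) ws)"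
  proof -
    have "\<exists>z. \<forall>ws. length ws = k \<longrightarrow> rdet (Suc l) (?us @ ws) = z * rdet k (map (app Q) ws)"
      by (rule dual_minors[of "Suc l" e k ?us Q]) (use e k(1) Q killus in auto)
    then obtain z where zz: "\<forall>ws. length ws = k \<longrightarrow> rdet (Suc l) (?us @ ws) = z * rdet k (map (app Q) ws)"
      by (rule exE)
    show ?thesis by (rule that[of z]) (rule zz[rule_format])
  qed
  \<comment> \<open>With z = 0 every completion would be singular, but k unit rows that separate the
    k remaining dimensions give a non-singular one.\<close>
  have "z \<noteq> 0"
  proof
    assume z0: "z = 0"
    let ?U = "unitrow ` {..l}"
    have zero: "{F\<in>?A. \<forall>u\<in>?U. app F u 0 = 0} = {0}"
    proof (intro equalityI subsetI)
      fix F assume F: "F \<in> {F\<in>?A. \<forall>u\<in>?U. app F u 0 = 0}"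
      have "coeff F i = 0" for i
      proof (cases "i \<le> l")
        case True
        hence "app F (unitrow i) 0 = 0" using F by auto
        thus ?thesis by (simp add: app_unitrow)
      next
        case False
        have "degree F \<le> l" using F by (intro ann_degree[of F n l "x ` set (q # cs)"]) simp
        thus ?thesis using False by (intro coeff_eq_0) linarith
      qed
      thus "F \<in> {0}" by (simp add: poly_eq_iff)
    qed auto
    obtain vs where vs: "set vs \<subseteq> ?U" "length vs + pdim {F\<in>?A. \<forall>u\<in>?U. app F u 0 = 0} = pdim ?A"
      "{F\<in>?A. \<forall>u\<in>set vs. app F u 0 = 0} = {F\<in>?A. \<forall>u\<in>?U. app F u 0 = 0}"
      using greedy_rows[OF submod_ann[of n l "x ` set (q # cs)"] degb_ann, of ?U] by (elim exE conjE) (rule that)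
    have lv: "length vs = k" using vs(2) k(2) unfolding zero by simp
    have "1 \<le> \<bar>real_of_int (rdet (Suc l) (?us @ vs))\<bar>"
    proof (rule full_rows_det)
      show "length (?us @ vs) = Suc l" using e lv by simp
      fix F assume F: "degree F \<le> l" "\<And>u. u \<in> set (?us @ vs) \<Longrightarrow> app F u 0 = 0"
      have "app F (x c) j = 0" if "(c, j) \<in> set ts" for c j
        using F(2)[of "shrow c j"] that by (force simp: app_shrow)
      hence "F \<in> ?A" using F(1) ts(3) by blast
      thus "F = 0" using vs(3) F(2) unfolding zero by auto
    qed
    thus False using z[OF lv] z0 by simp
  qed
  define c where "c = ((1 / (2 * fact k)) ^ ((k + 1) ^ e)) ^ k / (2::real)"
  have c0: "0 < c" by (simp add: c_def)
  obtain j1 where j1: "j1 \<le> e" "c * ht Q ^ k \<le> \<bar>real_of_int (rdet k (map (app Q) (window k j1)))\<bar>"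
    using window_det_lower[OF k(1), of Q e] Q(2) e by (auto simp: c_def)
  have win: "window k j1 = map unitrow [j1..<j1 + k]"
    by (rule nth_equalityI) (auto simp: window_def add.commute)
  have "\<bar>real_of_int (rdet k (map (app Q) (window k j1)))\<bar> \<le> \<bar>real_of_int (rdet (Suc l) (?us @ window k j1))\<bar>"
  proof -
    have "1 \<le> \<bar>z\<bar>" using \<open>z \<noteq> 0\<close> by linarith
    hence "\<bar>rdet k (map (app Q) (window k j1))\<bar> \<le> \<bar>z\<bar> * \<bar>rdet k (map (app Q) (window k j1))\<bar>"
      by (simp add: mult_le_cancel_right1)
    also have "\<dots> = \<bar>rdet (Suc l) (?us @ window k j1)\<bar>"
      using z[of "window k j1"] by (simp add: window_def abs_mult)
    finally show ?thesis by (metis of_int_abs of_int_le_iff)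
  qed
  hence low: "c * ht Q ^ k \<le> \<bar>real_of_int (rdet (Suc l) (?us @ map unitrow [j1..<j1 + k]))\<bar>"
    using j1(2) win by simp
  have h1: "1 \<le> ht Q" by (rule ht_ge_1[OF Q0])
  have Dpos: "0 < c * ht Q ^ k" using c0 h1 by simp
  have "ln (c * ht Q ^ k) + rcost ts' / \<nu> \<le> y q + C1 (Suc l)"
  proof (rule rows_with_units_log[OF _ _ ts(1) _ _ Dpos low])
    show "length ts + length [j1..<j1 + k] = Suc l" using e by simp
    show "Suc l \<le> Suc n" using l by simp
  qed (use ts(2) cs l j1 e in auto)
  moreover have "ln (c * ht Q ^ k) = ln c + real k * ln (ht Q)"
    using c0 h1 by (simp only: ln_mult_pos zero_less_power ln_realpow order_less_le_trans[OF zero_less_one])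
  ultimately show ?thesis using ts(5) by (simp add: C2_def c_def e_def)
qed

definition C3 :: real where "C3 = ln ((1 + M) * (real n + 1)) + K0"

text \<open>Since Q kills \<open>x (Suc h)\<close>, its value at \<xi> is at most a constant times
  \<open>ht Q * L (Suc h) / Xv (Suc h)\<close>. Hence a non-zero integer
  \<open>app Q (x h) j\<close> is at most a constant times \<open>ht Q * L h\<close>, and
  \<open>L h\<close> is small in terms of \<open>Xv (Suc h)\<close>.\<close>

lemma height_lower:
  assumes r: "r \<le> n" and Q: "Q \<in> ann n r {x (Suc h)}" "Q \<notin> ann n r {x h}"
  shows "y (Suc h) / \<nu> \<le> ln (ht Q) + C3"
proof -
  have Q0: "Q \<noteq> 0" using Q(2) zero_ann by auto
  have dQ: "degree Q \<le> r" using Q ann_degree by blast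
  obtain j where j: "j \<le> n - r" "app Q (x h) j \<noteq> 0" using Q(2) dQ by (auto simp: ann_def)
  define B where "B = (real n + 1) * ht Q"
  have h1: "1 \<le> ht Q" by (rule ht_ge_1[OF Q0])
  have B0: "0 < B" using h1 by (simp add: B_def)
  have ap: "\<bar>real_of_int (app Q (x c) i) - Xv c * \<xi> ^ i * ev \<xi> Q\<bar> \<le> B * L c" if "i + r \<le> n" for c i
  proof -
    have "\<bar>real_of_int (app Q (x c) i) - Xv c * \<xi> ^ i * ev \<xi> Q\<bar> \<le> (real r + 1) * ht Q * L c"
      by (rule app_approx[OF dQ that])
    also have "\<dots> \<le> B * L c" unfolding B_def using r h1 L_pos[of c] by (intro mult_right_mono) auto
    finally show ?thesis .
  qed
  have "app Q (x (Suc h)) 0 = 0" using Q(1) annD by blast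
  hence evb: "Xv (Suc h) * \<bar>ev \<xi> Q\<bar> \<le> B * L (Suc h)"
    using ap[of 0 "Suc h"] r X_ge_1[of "Suc h"] by (simp add: abs_mult)
  have "Xv h * \<bar>ev \<xi> Q\<bar> \<le> Xv (Suc h) * \<bar>ev \<xi> Q\<bar>" using X_mono[of h "Suc h"] by (intro mult_right_mono) auto
  also have "\<dots> \<le> B * L h" using evb L_mono[of h "Suc h"] B0 by (meson le_SucI mult_left_mono order.refl order.trans less_imp_le)
  finally have e1: "Xv h * \<bar>ev \<xi> Q\<bar> \<le> B * L h" .
  have "1 \<le> \<bar>real_of_int (app Q (x h) j)\<bar>" using j(2) by linarith
  also have "\<dots> \<le> \<bar>Xv h * \<xi> ^ j * ev \<xi> Q\<bar> + B * L h" using ap[of j h] j r by linarith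
  also have "\<bar>Xv h * \<xi> ^ j * ev \<xi> Q\<bar> = \<bar>\<xi>\<bar> ^ j * (Xv h * \<bar>ev \<xi> Q\<bar>)"
    using X_ge_1[of h] by (simp add: abs_mult power_abs)
  also have "\<dots> \<le> M * (B * L h)"
  proof (rule mult_mono[OF _ e1])
    have "j \<le> n" using j by simp
    thus "\<bar>\<xi>\<bar> ^ j \<le> M" using M_ge[of j] by linarith
    show "0 \<le> Xv h * \<bar>ev \<xi> Q\<bar>" using X_ge_1[of h] by simp
  qed (use M_ge_2 in simp)
  finally have "1 \<le> (1 + M) * (real n + 1) * ht Q * L h"
    by (simp add: B_def algebra_simps)
  hence "0 \<le> ln ((1 + M) * (real n + 1) * ht Q * L h)" by simp
  also have "\<dots> = ln ((1 + M) * (real n + 1)) + ln (ht Q) + ln (L h)"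
  proof -
    have "0 < (1 + M) * (real n + 1)" using M_ge_2 by simp
    thus ?thesis using h1 L_pos[of h] by (simp only: ln_mult_pos mult_pos_pos order_less_le_trans[OF zero_less_one])
  qed
  finally show ?thesis using L_upper[of h] by (simp add: C3_def)
qed

definition CD :: "nat \<Rightarrow> nat \<Rightarrow> real" where "CD l k = \<nu> * (C2 l k + real k * C3)"

lemma chain_dual_lower:
  assumes l: "l \<le> n" and cs: "\<And>c. c \<in> set cs \<Longrightarrow> c \<le> q"
    and k: "k > 0" "pdim (ann n l (x ` set (q # cs))) = k"
    and Q: "Polynomial.content Q = 1" "degree Q + k \<le> Suc l"
    and kill: "\<And>a. a < k \<Longrightarrow> monom 1 a * Q \<in> ann n l (x ` set (q # cs))"
    and r: "r \<le> n" "Q \<in> ann n r {x (Suc h)}" "Q \<notin> ann n r {x h}"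
  shows "real k * y (Suc h) + drops l (allp l) (q # cs) \<le> y (Suc q) + \<nu> * y q + CD l k"
proof -
  have "real k * (y (Suc h) / \<nu> - C3) \<le> real k * ln (ht Q)"
    using height_lower[OF r] by (intro mult_left_mono) auto
  hence "real k * (y (Suc h) / \<nu> - C3) + (drops l (allp l) (q # cs) - y (Suc q)) / \<nu> \<le> y q + C2 l k"
    using chain_dual[OF l cs k Q kill] by linarith
  hence "\<nu> * (real k * (y (Suc h) / \<nu> - C3) + (drops l (allp l) (q # cs) - y (Suc q)) / \<nu>) \<le> \<nu> * (y q + C2 l k)"
    using nu_pos by (intro mult_left_mono) auto
  thus ?thesis using nu_pos by (simp add: CD_def algebra_simps)
qed

text \<open>The dimensions along growing blocks become stationary. By saturation a non-zero
  polynomial in the stationary space kills all later points, so its value at \<xi> would be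
  zero.\<close>

lemma eventually_killed:
  assumes "l \<le> n"
  shows "\<exists>k\<ge>i. ann n l (x ` {i..k}) = {0}"
proof (rule ccontr)
  assume neg: "\<not> ?thesis"
  let ?A = "\<lambda>k. ann n l (x ` {i..i + k})"
  define d where "d = (LEAST d. \<exists>k. pdim (?A k) = d)"
  have "\<exists>k. pdim (?A k) = d"
    unfolding d_def by (rule LeastI[where P = "\<lambda>d. \<exists>k. pdim (?A k) = d" and k = "pdim (?A 0)"]) (rule exI, rule refl)
  then obtain k where k: "pdim (?A k) = d" by blast
  have dmin: "d \<le> pdim (?A k')" for k'
    unfolding d_def by (rule Least_le) (rule exI, rule refl)
  have "?A k \<noteq> {0}" using neg le_add1[of i k] by blast
  then obtain P where P: "P \<in> ?A k" "P \<noteq> 0" using zero_ann by blast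
  have dP: "degree P \<le> l" using P ann_degree by blast
  have kills: "app P (x (i + k')) 0 = 0" if "k' \<ge> k" for k'
  proof -
    have sub: "?A k' \<subseteq> ?A k" using that by (intro ann_antimono) auto
    have le: "pdim (?A k) \<le> pdim (?A k')" using k dmin[of k'] by simp
    have "P \<in> ?A k'"
      by (rule full_pdim_mem[OF submod_ann submod_ann sub degb_ann le P(1) satur_ann])
    thus ?thesis by (rule annD) auto
  qed
  have "ev \<xi> P = 0"
  proof (rule ccontr)
    assume "ev \<xi> P \<noteq> 0"
    define B where "B = (real l + 1) * ht P / \<bar>ev \<xi> P\<bar>"
    have "Xv (i + k') \<le> B" if "k' \<ge> k" for k'
    proof -
      have "Xv (i + k') * \<bar>ev \<xi> P\<bar> \<le> (real l + 1) * ht P * L (i + k')"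
        using app_approx[OF dP, of 0 n "x (i + k')" \<xi>] kills[OF that] assms X_ge_1[of "i + k'"]
        by (simp add: abs_mult)
      also have "\<dots> \<le> (real l + 1) * ht P * 1"
        using L_le_1 ht_nonneg[of P] by (intro mult_left_mono) auto
      finally show ?thesis using \<open>ev \<xi> P \<noteq> 0\<close> by (simp add: B_def pos_le_divide_eq)
    qed
    from this[of "k + nat \<lceil>B\<rceil> + 1"] X_ge[of "i + (k + nat \<lceil>B\<rceil> + 1)"] show False by linarith
  qed
  thus False using nonalg P dP assms by (meson order.trans)
qed

lemma pdim_ann_n_point: "pdim (ann n n {x c}) = n"
proof -
  have "pdim {F \<in> allp n. app F (x c) 0 = 0} + 1 = pdim (allp n)"
    by (rule pdim_cut[OF submod_all, of n _ 1]) (use x_pos[of c] in \<open>auto simp: degb_def app_def\<close>)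
  moreover have "{F \<in> allp n. app F (x c) 0 = 0} = ann n n {x c}" by (auto simp: ann_def)
  ultimately show ?thesis by (simp add: pdim_all)
qed

lemma monom_mults_pdim:
  assumes "Q \<noteq> 0" "\<And>a. a < k \<Longrightarrow> monom 1 a * Q \<in> S" "degb l S"
  shows "k \<le> pdim S"
proof -
  have "(\<lambda>a. degree Q + a) ` {..<k} \<subseteq> degree ` (S - {0})"
  proof
    fix d assume "d \<in> (\<lambda>a. degree Q + a) ` {..<k}"
    then obtain a where "a < k" "d = degree (monom 1 a * Q)" "monom 1 a * Q \<noteq> 0"
      using assms(1) by (auto simp: degree_mult_eq degree_monom_eq)
    thus "d \<in> degree ` (S - {0})" using assms(2) by blast
  qed
  from card_mono[OF finite_degs[OF assms(3)] this] show ?thesis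
    by (simp add: pdim_def card_image inj_on_def)
qed

text \<open>An unwanted annihilator F is always exploited in this way: it misses some earlier point,
  and directly after the last missed point \<open>height_lower\<close> becomes available.\<close>

lemma last_not_killed:
  assumes "i0 \<le> k" "F \<notin> ann n r (x ` {i0..k})" "F \<in> ann n r {x i}" "degree F \<le> r" "k \<le> i"
  shows "\<exists>h. i0 \<le> h \<and> h < i \<and> F \<notin> ann n r {x h} \<and> (\<forall>j. h < j \<and> j \<le> i \<longrightarrow> F \<in> ann n r {x j})"
proof -
  have "\<exists>h\<in>{i0..k}. F \<notin> ann n r {x h}" using assms(2,4) by (force simp: ann_def)
  then obtain h0 where h0: "i0 \<le> h0" "h0 \<le> k" "F \<notin> ann n r {x h0}" by auto
  let ?H = "{h. i0 \<le> h \<and> h \<le> i \<and> F \<notin> ann n r {x h}}"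
  have fin: "finite ?H" by (rule finite_subset[of _ "{..i}"]) auto
  have "h0 \<in> ?H" using h0 assms(5) by simp
  hence ne: "?H \<noteq> {}" by blast
  define h where "h = Max ?H"
  have hH: "h \<in> ?H" unfolding h_def by (rule Max_in[OF fin ne])
  hence "h \<noteq> i" using assms(3) by auto
  moreover have "F \<in> ann n r {x j}" if "h < j" "j \<le> i" for j
  proof (rule ccontr)
    assume "F \<notin> ann n r {x j}"
    hence "j \<in> ?H" using hH that by auto
    hence "j \<le> h" unfolding h_def by (rule Max_ge[OF fin])
    thus False using that by simp
  qed
  ultimately show ?thesis using hH by (intro exI[of _ h]) auto
qed

text \<open>Suppose F kills a late point, and let Q be a primitive polynomial of least level killing
  the point after the last one missed by F. At level l that point is annihilated exactly by the
  multiples of Q, and the dual inequality bounds \<open>l * y (Suc h)\<close> by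
  \<open>\<nu> * y (Suc h)\<close> plus a constant, which fails for large h.\<close>

lemma rank_lower:
  assumes l: "1 \<le> l" "l \<le> n" "n + 1 \<le> 2 * l" and nu: "\<nu> < real l"
  shows "\<exists>i1. \<forall>i\<ge>i1. ann n (n + 1 - l) {x i} = {0}"
proof -
  define R where "R = n + 1 - l"
  have Rl: "R \<le> l" "R \<le> n" "R + l = n + 1" using l by (auto simp: R_def)
  define C where "C = Max ((\<lambda>k. CD l k) ` {..l + 1})"
  have C: "CD l k \<le> C" if "k \<le> l + 1" for k unfolding C_def using that by (intro Max_ge) auto
  obtain i0 where i0: "\<And>i. i \<ge> i0 \<Longrightarrow> C / (real l - \<nu>) + 1 \<le> y i" using y_large by blast
  obtain k0 where k0: "k0 \<ge> i0" "ann n R (x ` {i0..k0}) = {0}" using eventually_killed[OF Rl(2), of i0] by blast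
  have "ann n R {x i} = {0}" if i: "i \<ge> k0" for i
  proof (rule ccontr)
    assume "ann n R {x i} \<noteq> {0}"
    then obtain F where F: "F \<in> ann n R {x i}" "F \<noteq> 0" using zero_ann by blast
    have dF: "degree F \<le> R" using F ann_degree by blast
    have "F \<notin> ann n R (x ` {i0..k0})" using k0(2) F(2) by auto
    then obtain h where h: "i0 \<le> h" "h < i" "F \<notin> ann n R {x h}" "F \<in> ann n R {x (Suc h)}"
    proof -
      assume "F \<notin> ann n R (x ` {i0..k0})"
      from last_not_killed[OF k0(1) this F(1) dF i] obtain h where
        "i0 \<le> h" "h < i" "F \<notin> ann n R {x h}" "\<forall>j. h < j \<and> j \<le> i \<longrightarrow> F \<in> ann n R {x j}" by blast
      thus ?thesis by (intro that[of h]) auto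
    qed
    let ?K = "{x (Suc h)}"
    define r where "r = (LEAST r. ann n r ?K \<noteq> {0})"
    have r: "ann n r ?K \<noteq> {0}" unfolding r_def by (rule LeastI[of _ R]) (use h(4) F(2) in auto)
    have rR: "r \<le> R" unfolding r_def by (rule Least_le) (use h(4) F(2) in auto)
    have rmin: "ann n r' ?K = {0}" if "r' < r" for r' using not_less_Least that by (auto simp: r_def)
    obtain Q where Q: "Q \<in> ann n r ?K" "Q \<noteq> 0" "Polynomial.content Q = 1"
      using ann_primitive[OF r] by blast
    have rl: "r \<le> l" using rR Rl by simp
    define k where "k = l - r + 1"
    have mono: "monom 1 a * Q \<in> ann n l ?K" if "a < k" for a
      using ann_monom[of r "l - r" n Q ?K a] Q rl l that by (simp add: k_def)
    have kle: "k \<le> pdim (ann n l ?K)" by (rule monom_mults_pdim[OF Q(2) mono degb_ann])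
    have "pdim (ann n l ?K) \<le> k"
    proof -
      from castelnuovo[OF l(2), of ?K] consider "ann n l ?K = {0}"
        | k' where "k' \<le> l" "ann n (l - k') ?K \<noteq> {0}" "pdim (ann n l ?K) = k' + 1"
        | "pdim (ann n l ?K) + 2 * (n - l) \<le> pdim (ann n n ?K)" by blast
      thus ?thesis
      proof cases
        case 2
        have "\<not> l - k' < r" using rmin 2(2) by blast
        thus ?thesis using 2 by (simp add: k_def)
      next
        \<comment> \<open>Here the dimension is at most \<open>2 * l - n\<close>, and
          \<open>r \<le> n + 1 - l\<close> makes this at most k.\<close>
        case 3
        thus ?thesis using rR Rl l unfolding pdim_ann_n_point by (simp add: k_def)
      qed simp
    qed
    hence pk: "pdim (ann n l ?K) = k" using kle by simp
    \<comment> \<open>Otherwise the whole level l annihilator of \<open>x (Suc h)\<close>, and with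
      it every shift of F, would kill \<open>x h\<close>; then \<open>ann_lower\<close> would bring
      F itself back to level R.\<close>
    have "Q \<notin> ann n r {x h}"
    proof
      assume Qh: "Q \<in> ann n r {x h}"
      let ?S = "ann n l {x (Suc h), x h}"
      have "monom 1 a * Q \<in> ann n l {x h}" if "a < k" for a
        using ann_monom[of r "l - r" n Q "{x h}" a] Qh rl l that by (simp add: k_def)
      hence "monom 1 a * Q \<in> ?S" if "a < k" for a
        using mono that unfolding ann_insert[of n l "x (Suc h)" "{x h}"] by blast
      hence "k \<le> pdim ?S" by (rule monom_mults_pdim[OF Q(2) _ degb_ann])
      hence le: "pdim (ann n l ?K) \<le> pdim ?S" using pk by simp
      have sub: "?S \<subseteq> ann n l ?K" by (rule ann_antimono) auto
      have all: "G \<in> ?S" if "G \<in> ann n l ?K" for G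
        by (rule full_pdim_mem[OF submod_ann submod_ann sub degb_ann le that satur_ann])
      have "monom 1 j * F \<in> ann n l {x h}" if "j \<le> l - R" for j
      proof -
        have eq: "R + (l - R) = l" using Rl(1) by simp
        have "monom 1 j * F \<in> ann n (R + (l - R)) ?K"
          by (rule ann_monom) (use h(4) that in \<open>simp_all add: eq l(2)\<close>)
        hence "monom 1 j * F \<in> ann n l ?K" by (simp only: eq)
        thus ?thesis using all ann_antimono[of "{x h}" "{x (Suc h), x h}" n l] by blast
      qed
      hence "F \<in> ann n (l - (l - R)) {x h}" using F(2) l by (intro ann_lower) auto
      thus False using h(3) Rl by simp
    qed
    note nk = this
    have main0: "real k * y (Suc h) + drops l (allp l) [Suc h] \<le> y (Suc (Suc h)) + \<nu> * y (Suc h) + CD l k"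
    proof (rule chain_dual_lower[OF l(2) _ _ _ Q(3) _ _ _ Q(1) nk])
      show "degree Q + k \<le> Suc l" using ann_degree[OF Q(1)] rl by (simp add: k_def)
      show "r \<le> n" using rR Rl by simp
      show "k > 0" by (simp add: k_def)
      show "pdim (ann n l (x ` set [Suc h])) = k" using pk by simp
      show "monom 1 a * Q \<in> ann n l (x ` set [Suc h])" if "a < k" for a using mono[OF that] by simp
    qed simp
    have "drops l (allp l) [Suc h] = (real l + 1 - real k) * y (Suc (Suc h))"
      by (simp add: all_Int_ann pdim_all pk)
    moreover have rk: "real l + 1 - real k = real r" using rl by (simp add: k_def)
    ultimately have dr: "drops l (allp l) [Suc h] = real r * y (Suc (Suc h))" by (simp only:)
    have "CD l k \<le> C" by (rule C) (simp add: k_def)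
    hence main: "real k * y (Suc h) + (real r - 1) * y (Suc (Suc h)) \<le> \<nu> * y (Suc h) + C"
      using main0 unfolding dr left_diff_distrib by linarith
    have "1 \<le> r"
    proof (rule ccontr)
      assume "\<not> 1 \<le> r"
      hence "r = 0" by simp
      hence "degree Q = 0" using ann_degree[OF Q(1)] by simp
      hence "app Q (x (Suc h)) 0 = coeff Q 0 * x (Suc h) 0" by (simp add: app_def)
      moreover have "app Q (x (Suc h)) 0 = 0" using annD[OF Q(1)] by simp
      moreover have "coeff Q 0 \<noteq> 0" using Q(2) \<open>degree Q = 0\<close> by (metis leading_coeff_0_iff)
      ultimately show False using x_pos[of "Suc h"] by simp
    qed
    hence "(real r - 1) * y (Suc h) \<le> (real r - 1) * y (Suc (Suc h))"
      using y_mono[of "Suc h" "Suc (Suc h)"] by (intro mult_left_mono) auto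
    hence "(real k + real r - 1) * y (Suc h) \<le> \<nu> * y (Suc h) + C"
      using main by (simp add: algebra_simps)
    moreover have "real k + real r - 1 = real l" using rl by (simp add: k_def)
    ultimately have "(real l - \<nu>) * y (Suc h) \<le> C" by (simp add: algebra_simps)
    moreover have "C / (real l - \<nu>) + 1 \<le> y (Suc h)" using i0 h(1) by simp
    hence "C < y (Suc h) * (real l - \<nu>)" using nu by (simp add: pos_divide_less_eq[symmetric])
    ultimately show False by (simp add: mult.commute)
  qed
  thus ?thesis unfolding R_def by blast
qed

end

section \<open>Spans of minimal points\<close>

lemma ann_top: "F \<in> ann n n K \<longleftrightarrow> degree F \<le> n \<and> (\<forall>v\<in>K. app F v 0 = 0)"
  by (auto simp: ann_def)

text \<open>Every level is determined by level n, that is, by the linear span of K. Hence points may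
  be replaced by others with the same span at all levels simultaneously.\<close>

lemma ann_level:
  assumes "l \<le> n"
  shows "F \<in> ann n l K \<longleftrightarrow> degree F \<le> l \<and> (\<forall>j\<le>n - l. monom 1 j * F \<in> ann n n K)"
proof
  assume F: "F \<in> ann n l K"
  have "monom 1 j * F \<in> ann n n K" if "j \<le> n - l" for j
    using ann_monom[of l "n - l" n F K j] F that assms by simp
  thus "degree F \<le> l \<and> (\<forall>j\<le>n - l. monom 1 j * F \<in> ann n n K)" using ann_degree[OF F] by blast
next
  assume F: "degree F \<le> l \<and> (\<forall>j\<le>n - l. monom 1 j * F \<in> ann n n K)"
  show "F \<in> ann n l K"
  proof (rule annI)
    show "degree F \<le> l" using F by blast
    fix v j assume "v \<in> K" "j \<le> n - l"
    hence "app (monom 1 j * F) v 0 = 0" using F annD[of "monom 1 j * F" n n K v 0] by simp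
    thus "app F v j = 0" by (simp add: app_monom_mult)
  qed
qed

lemma ann_level_mono: "l \<le> n \<Longrightarrow> ann n n K \<subseteq> ann n n K' \<Longrightarrow> ann n l K \<subseteq> ann n l K'"
  using ann_level[of l n _ K] ann_level[of l n _ K'] by blast

lemma ann_level_cong: "l \<le> n \<Longrightarrow> ann n n K = ann n n K' \<Longrightarrow> ann n l K = ann n l K'"
  using ann_level_mono[of l n K K'] ann_level_mono[of l n K' K] by blast

lemma pdim_ann_insert: "pdim (ann n n K) \<le> pdim (ann n n (insert v K)) + 1"
proof -
  have eq: "ann n n (insert v K) = {F \<in> ann n n K. app F v 0 = 0}" by (auto simp: ann_top)
  show ?thesis
  proof (cases "\<exists>F\<in>ann n n K. app F v 0 \<noteq> 0")
    case True
    thus ?thesis using pdim_cut[OF submod_ann degb_ann] unfolding eq by fastforce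
  next
    case False
    hence "{F \<in> ann n n K. app F v 0 = 0} = ann n n K" by blast
    thus ?thesis unfolding eq by simp
  qed
qed

text \<open>Induction eliminates one generator u: if \<open>F0\<close> kills the remaining ones but
  not u, then v can be corrected by a multiple of u so that \<open>F0\<close> kills it, and the
  corrected vector is killed by everything that kills the remaining generators.\<close>

lemma double_ann:
  fixes us :: "(nat \<Rightarrow> int) list"
  assumes "ann n n (set us) \<subseteq> ann n n {v}"
  shows "\<exists>\<gamma> c. \<gamma> \<noteq> 0 \<and> (\<forall>t\<le>n. \<gamma> * v t = (\<Sum>r<length us. c r * (us ! r) t))"
  using assms
proof (induction us arbitrary: v)
  case Nil
  have "v t = 0" if "t \<le> n" for t
  proof -
    have "monom 1 t \<in> ann n n (set [])" using that by (auto simp: ann_top intro: order.trans[OF degree_monom_le])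
    hence "app (monom 1 t * 1) v 0 = 0" using Nil by (auto simp: ann_top)
    thus ?thesis unfolding app_monom_mult by (simp add: app_def)
  qed
  thus ?case by (intro exI[of _ 1]) auto
next
  case (Cons u us)
  show ?case
  proof (cases "\<forall>F\<in>ann n n (set us). app F u 0 = 0")
    case True
    hence "ann n n (set us) \<subseteq> ann n n (set (u # us))" by (auto simp: ann_top)
    hence "ann n n (set us) \<subseteq> ann n n {v}" using Cons.prems by blast
    from Cons.IH[OF this] obtain g c where
      "g \<noteq> 0" "\<forall>t\<le>n. g * v t = (\<Sum>r<length us. c r * (us ! r) t)" by blast
    thus ?thesis
      by (intro exI[of _ g] exI[of _ "case_nat 0 c"])
        (simp add: sum.lessThan_Suc_shift del: sum.lessThan_Suc)
  next
    case False
    then obtain F0 where F0: "F0 \<in> ann n n (set us)" "app F0 u 0 \<noteq> 0" by blast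
    let ?a = "app F0 u 0" and ?b = "app F0 v 0"
    define v' where "v' = (\<lambda>t. ?a * v t + (- ?b) * u t)"
    have "ann n n (set us) \<subseteq> ann n n {v'}"
    proof
      fix F assume F: "F \<in> ann n n (set us)"
      let ?F = "smult ?a F - smult (app F u 0) F0"
      have "?F \<in> ann n n (set us)"
        by (intro submod_diff submod_smult submod_ann F F0(1))
      moreover have "app ?F u 0 = 0" by (simp add: app_diff app_smult)
      ultimately have "?F \<in> ann n n (set (u # us))" by (auto simp: ann_top)
      hence "?F \<in> ann n n {v}" using Cons.prems by blast
      hence "app ?F v 0 = 0" by (simp add: ann_top)
      hence "app F v' 0 = 0" unfolding v'_def app_comb by (simp add: app_diff app_smult)
      thus "F \<in> ann n n {v'}" using F by (auto simp: ann_top)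
    qed
    from Cons.IH[OF this] obtain g c where
      g: "g \<noteq> 0" "\<forall>t\<le>n. g * v' t = (\<Sum>r<length us. c r * (us ! r) t)" by blast
    have "g * ?a * v t = (\<Sum>r<length (u # us). case_nat (g * ?b) c r * ((u # us) ! r) t)" if "t \<le> n" for t
    proof -
      have "g * ?a * v t = g * v' t + g * ?b * u t" by (simp add: v'_def algebra_simps)
      thus ?thesis using g(2) that by (simp add: sum.lessThan_Suc_shift del: sum.lessThan_Suc)
    qed
    thus ?thesis using g(1) F0(2) by (intro exI[of _ "g * ?a"] exI[of _ "case_nat (g * ?b) c"]) auto
  qed
qed

context minpts
begin

subsection \<open>Ranks of blocks of consecutive minimal points\<close>

text \<open>Errors of proportional points are in the ratio of their first coordinates, so the later
  point would have the larger error.\<close>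

lemma points_not_proportional:
  assumes "i < j"
  shows "\<exists>t\<le>n. x i 0 * x j t \<noteq> x i t * x j 0"
proof (rule ccontr)
  assume neg: "\<not> ?thesis"
  have "L i \<le> L j"
  proof (rule err_le)
    fix t assume t: "t \<le> n"
    have "Xv i * real_of_int (x j t) = real_of_int (x i t) * Xv j"
      using neg t by (simp flip: of_int_mult)
    hence "Xv i * (real_of_int (x j t) - \<xi> ^ t * Xv j) = Xv j * (real_of_int (x i t) - \<xi> ^ t * Xv i)"
      by (simp add: algebra_simps)
    hence eq: "Xv i * \<bar>real_of_int (x j t) - \<xi> ^ t * Xv j\<bar> = Xv j * \<bar>real_of_int (x i t) - \<xi> ^ t * Xv i\<bar>"
    proof -
      assume "Xv i * (real_of_int (x j t) - \<xi> ^ t * Xv j) = Xv j * (real_of_int (x i t) - \<xi> ^ t * Xv i)"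
      hence "\<bar>Xv i\<bar> * \<bar>real_of_int (x j t) - \<xi> ^ t * Xv j\<bar> = \<bar>Xv j\<bar> * \<bar>real_of_int (x i t) - \<xi> ^ t * Xv i\<bar>"
        by (simp only: abs_mult[symmetric])
      moreover have "\<bar>Xv i\<bar> = Xv i" "\<bar>Xv j\<bar> = Xv j" using X_ge_1[of i] X_ge_1[of j] by linarith+
      ultimately show ?thesis by (simp only:)
    qed
    have "Xv i * \<bar>real_of_int (x i t) - \<xi> ^ t * Xv i\<bar> \<le> Xv j * \<bar>real_of_int (x i t) - \<xi> ^ t * Xv i\<bar>"
      using X_mono[of i j] assms by (intro mult_right_mono) auto
    also have "\<dots> \<le> Xv i * L j"
      unfolding eq[symmetric] using err_ge[OF t, of "x j" \<xi>] X_ge_1[of i] by (intro mult_left_mono) auto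
    finally show "\<bar>real_of_int (x i t) - \<xi> ^ t * Xv i\<bar> \<le> L j" using X_ge_1[of i] by simp
  qed
  moreover have "L j \<le> L (Suc i)" using assms by (intro L_mono) simp
  ultimately show False using L_Suc[of i] by linarith
qed

lemma pdim_ann_pair:
  assumes "i \<noteq> j"
  shows "pdim (ann n n {x i, x j}) = n - 1"
proof -
  have *: "pdim (ann n n {x i, x j}) = n - 1" if ij: "i < j" for i j
  proof -
    obtain t where t: "t \<le> n" "x i 0 * x j t \<noteq> x i t * x j 0" using points_not_proportional[OF ij] by blast
    let ?F = "smult (x i 0) (monom 1 t * 1) - smult (x i t) (monom 1 0 * 1)"
    have ap: "app ?F v 0 = x i 0 * v t - x i t * v 0" for v
      unfolding app_diff app_smult app_monom_mult by (simp add: app_def)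
    have "degree ?F \<le> n"
      using t(1) by (intro degree_diff_le order.trans[OF degree_smult_le]) (auto intro: order.trans[OF degree_monom_le])
    hence F: "?F \<in> ann n n {x i}" using ap by (auto simp: ann_top)
    have "pdim {F \<in> ann n n {x i}. app F (x j) 0 = 0} + 1 = pdim (ann n n {x i})"
      by (rule pdim_cut[OF submod_ann degb_ann F]) (use ap t in auto)
    moreover have "{F \<in> ann n n {x i}. app F (x j) 0 = 0} = ann n n {x i, x j}" by (auto simp: ann_top)
    ultimately show ?thesis using pdim_ann_n_point[of i] by simp
  qed
  show ?thesis using *[of i j] *[of j i] assms by (cases i j rule: linorder_cases) (auto simp: insert_commute)
qed

abbreviation blk :: "nat \<Rightarrow> nat \<Rightarrow> (nat \<Rightarrow> int) set" where "blk i k \<equiv> x ` {i..k}"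

text \<open>The first \<open>k\<close> for which \<open>x i, \<dots>, x k\<close> span a space of dimension greater than \<open>d\<close>.\<close>

definition rix :: "nat \<Rightarrow> nat \<Rightarrow> nat" where
  "rix d i = (LEAST k. pdim (ann n n (blk i k)) \<le> n - d)"

lemma rix_le: "pdim (ann n n (blk i (rix d i))) \<le> n - d"
proof -
  obtain k where "ann n n (blk i k) = {0}" using eventually_killed[of n i] by blast
  hence "pdim (ann n n (blk i k)) \<le> n - d" by simp
  thus ?thesis unfolding rix_def by (rule LeastI)
qed

lemma rix_least: "pdim (ann n n (blk i k)) \<le> n - d \<Longrightarrow> rix d i \<le> k"
  unfolding rix_def by (rule Least_le)

lemma rix_before: "k < rix d i \<Longrightarrow> n - d < pdim (ann n n (blk i k))"
  using rix_least[of i k d] by linarith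

lemma blk_Suc: "i \<le> Suc k \<Longrightarrow> blk i (Suc k) = insert (x (Suc k)) (blk i k)"
  by (simp add: atLeastAtMostSuc_conv)

lemma rix_gt:
  assumes "1 \<le> d" "d \<le> n"
  shows "i < rix d i"
proof (rule ccontr)
  assume "\<not> i < rix d i"
  hence "{i..rix d i} \<subseteq> {i}" by auto
  hence "blk i (rix d i) \<subseteq> {x i}" by auto
  hence "pdim (ann n n {x i}) \<le> pdim (ann n n (blk i (rix d i)))" by (rule pdim_ann_antimono)
  thus False using rix_le[of i d] pdim_ann_n_point[of i] assms by simp
qed

lemma rix_eq:
  assumes "1 \<le> d" "d \<le> n"
  shows "pdim (ann n n (blk i (rix d i))) = n - d"
proof -
  obtain k where k: "rix d i = Suc k" "i \<le> k" using rix_gt[OF assms, of i] by (cases "rix d i") auto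
  have "n - d < pdim (ann n n (blk i k))" using rix_before[of k d i] k by simp
  also have "\<dots> \<le> pdim (ann n n (blk i (Suc k))) + 1"
    using pdim_ann_insert[of n "blk i k" "x (Suc k)"] blk_Suc[of i k] k(2) by simp
  finally show ?thesis using rix_le[of i d] k by simp
qed

lemma ann_blk_eqI:
  assumes "K \<subseteq> blk i k" "pdim (ann n n K) \<le> pdim (ann n n (blk i k))"
  shows "ann n n (blk i k) = ann n n K"
proof -
  have sub: "ann n n (blk i k) \<subseteq> ann n n K" by (rule ann_antimono[OF assms(1)])
  moreover have "ann n n K \<subseteq> ann n n (blk i k)"
    using full_pdim_mem[OF submod_ann submod_ann sub degb_ann assms(2) _ satur_ann] by blast
  ultimately show ?thesis by blast
qed

text \<open>Before \<open>rix 2 i\<close> the block spans a plane, and any two distinct minimal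
  points already span it.\<close>

lemma blk_pair:
  assumes "2 \<le> n" "i \<le> a" "a < b" "b \<le> k" "k < rix 2 i"
  shows "ann n n (blk i k) = ann n n {x a, x b}"
  by (rule ann_blk_eqI) (use assms pdim_ann_pair[of a b] rix_before[of k 2 i] in auto)

lemma rix2_gt: "2 \<le> n \<Longrightarrow> Suc i < rix 2 i"
proof (rule ccontr)
  assume "2 \<le> n" "\<not> Suc i < rix 2 i"
  hence "{i..rix 2 i} \<subseteq> {i, Suc i}" by auto
  hence "blk i (rix 2 i) \<subseteq> {x i, x (Suc i)}" by auto
  hence "pdim (ann n n {x i, x (Suc i)}) \<le> pdim (ann n n (blk i (rix 2 i)))" by (rule pdim_ann_antimono)
  thus False using rix_le[of i 2] pdim_ann_pair[of i "Suc i"] \<open>2 \<le> n\<close> by simp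
qed

lemma rix_pred:
  assumes "2 \<le> n"
  obtains q where "rix 2 i = Suc q" "Suc i \<le> q" "q < rix 2 i"
  using rix2_gt[OF assms, of i] that by (cases "rix 2 i") auto

lemma blk_triple_rix2:
  assumes "2 \<le> n" "rix 2 i = Suc q"
  shows "ann n n (blk i (Suc q)) = ann n n {x (Suc q), x q, x i}"
proof -
  have iq: "Suc i \<le> q" "q < rix 2 i" using assms rix2_gt[OF assms(1), of i] by auto
  have "ann n n (blk i (Suc q)) = ann n n (insert (x (Suc q)) (blk i q))"
    using blk_Suc[of i q] iq by simp
  also have "\<dots> = ann n n {x (Suc q)} \<inter> ann n n (blk i q)" by (rule ann_insert)
  also have "ann n n (blk i q) = ann n n {x i, x q}"
    using blk_pair[OF assms(1), of i i q q] iq by simp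
  also have "ann n n {x (Suc q)} \<inter> ann n n {x i, x q} = ann n n {x (Suc q), x q, x i}"
    by (auto simp: ann_top)
  finally show ?thesis .
qed

lemma blk_triple:
  assumes "3 \<le> n" "rix 2 i = Suc q" "Suc q \<le> k" "k < rix 3 i"
  shows "ann n n (blk i k) = ann n n {x (Suc q), x q, x i}"
proof (rule ann_blk_eqI)
  have iq: "Suc i \<le> q" using assms rix2_gt[of i] by auto
  thus "{x (Suc q), x q, x i} \<subseteq> blk i k" using assms by auto
  have "pdim (ann n n {x (Suc q), x q, x i}) \<le> n - 2"
    using rix_le[of i 2] blk_triple_rix2[of i q] assms by simp
  thus "pdim (ann n n {x (Suc q), x q, x i}) \<le> pdim (ann n n (blk i k))"
    using rix_before[OF assms(4)] assms(1) by linarith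
qed

lemma rix3_gt: "3 \<le> n \<Longrightarrow> rix 2 i < rix 3 i"
proof (rule ccontr)
  assume "3 \<le> n" "\<not> rix 2 i < rix 3 i"
  hence "blk i (rix 3 i) \<subseteq> blk i (rix 2 i)" by auto
  hence "pdim (ann n n (blk i (rix 2 i))) \<le> pdim (ann n n (blk i (rix 3 i)))" by (rule pdim_ann_antimono)
  thus False using rix_le[of i 3] rix_eq[of 2 i] \<open>3 \<le> n\<close> by simp
qed

lemma rix_mono: "i \<le> j \<Longrightarrow> rix d i \<le> rix d j"
proof (rule rix_least)
  assume "i \<le> j"
  hence "blk j (rix d j) \<subseteq> blk i (rix d j)" by auto
  from pdim_ann_antimono[OF this, of n n] rix_le[of j d]
  show "pdim (ann n n (blk i (rix d j))) \<le> n - d" by linarith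
qed

lemma real_relation:
  assumes "ann n n (x ` set ps) \<subseteq> ann n n {x k}"
  shows "\<exists>a. \<forall>t\<le>n. real_of_int (x k t) = (\<Sum>r<length ps. a r * real_of_int (x (ps ! r) t))"
proof -
  obtain g c where g: "g \<noteq> 0" "\<And>t. t \<le> n \<Longrightarrow> g * x k t = (\<Sum>r<length ps. c r * x (ps ! r) t)"
    using double_ann[of n "map x ps" "x k"] assms by auto
  have "real_of_int (x k t) = (\<Sum>r<length ps. real_of_int (c r) / real_of_int g * real_of_int (x (ps ! r) t))" if "t \<le> n" for t
  proof -
    have "real_of_int g * real_of_int (x k t) = (\<Sum>r<length ps. real_of_int (c r) * real_of_int (x (ps ! r) t))"
      using arg_cong[OF g(2)[OF that], of real_of_int] by simp
    hence "real_of_int (x k t) = (\<Sum>r<length ps. real_of_int (c r) * real_of_int (x (ps ! r) t)) / real_of_int g"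
      using g(1) by (simp add: field_simps)
    thus ?thesis by (simp add: sum_divide_distrib)
  qed
  thus ?thesis by (intro exI allI impI)
qed

subsection \<open>Determinants with rows reduced modulo a dependent minimal point\<close>

text \<open>The same combination of shifts is applied to every point, so a linear relation between
  points remains one between these rows; rows of a spanning set thus generate the row of a dependent
  point. Two shifts are allowed, instead of one, because the argument with singular pencils needs
  sums of two matrices.\<close>

definition grow :: "nat \<Rightarrow> nat \<Rightarrow> nat \<Rightarrow> nat \<Rightarrow> int" where
  "grow j j' p = (\<lambda>t. x p (j + t) + x p (j' + t))"

lemma app_grow: "app F (grow j j' p) 0 = app F (x p) j + app F (x p) j'"
  unfolding grow_def using app_comb[of F 1 "\<lambda>t. x p (j + t)" 1 "\<lambda>t. x p (j' + t)" 0]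
  by (simp add: app_shift_0)

lemma pair_power_nonzero:
  assumes "j \<le> n" "j' \<le> n"
  shows "\<xi> ^ j + \<xi> ^ j' \<noteq> 0"
proof
  assume z: "\<xi> ^ j + \<xi> ^ j' = 0"
  let ?P = "monom 1 j + monom 1 j' :: int poly"
  have d: "degree ?P \<le> n" using assms by (intro degree_add_le) (auto intro: order.trans[OF degree_monom_le])
  have cj: "coeff ?P j \<noteq> 0" by simp
  hence "?P \<noteq> 0" by force
  moreover have "ev \<xi> ?P = \<xi> ^ j + \<xi> ^ j'"
  proof -
    have "ev \<xi> ?P = (\<Sum>t\<le>n. (if t = j then \<xi> ^ t else 0) + (if t = j' then \<xi> ^ t else 0))"
      unfolding ev_eq_sum[OF d] by (intro sum.cong) auto
    also have "\<dots> = \<xi> ^ j + \<xi> ^ j'" using assms by (simp add: sum.distrib)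
    finally show ?thesis .
  qed
  ultimately show False using nonalg[OF _ d] z by simp
qed

definition gmin :: real where
  "gmin = Min ((\<lambda>(j, j'). \<bar>\<xi> ^ j + \<xi> ^ j'\<bar>) ` ({..n} \<times> {..n}))"

lemma gmin_le: "j \<le> n \<Longrightarrow> j' \<le> n \<Longrightarrow> gmin \<le> \<bar>\<xi> ^ j + \<xi> ^ j'\<bar>"
  unfolding gmin_def by (intro Min_le) auto

lemma gmin_pos: "0 < gmin"
  unfolding gmin_def by (subst Min_gr_iff) (auto simp: pair_power_nonzero)

definition KR :: real where "KR = (1 + M) * (2 + 2 * M / gmin)"

lemma KR_ge: "2 * M \<le> KR" and KR_pos: "0 < KR"
proof -
  have "(1 + M) * 2 \<le> KR" unfolding KR_def using M_ge_2 gmin_pos by (intro mult_left_mono) auto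
  thus "2 * M \<le> KR" "0 < KR" using M_ge_2 by auto
qed

lemma grow_first:
  assumes "j \<le> n" "j' \<le> n"
  shows "\<bar>real_of_int (grow j j' p 0)\<bar> \<le> KR * Xv p"
proof -
  have "\<bar>real_of_int (grow j j' p 0)\<bar> \<le> M * Xv p + M * Xv p"
    using shrow_first[OF assms(1), of p] shrow_first[OF assms(2), of p] by (simp add: grow_def shrow_def)
  also have "\<dots> = 2 * M * Xv p" by simp
  also have "\<dots> \<le> KR * Xv p" using KR_ge X_ge_1[of p] by (intro mult_right_mono) auto
  finally show ?thesis .
qed

lemma grow_err:
  assumes "j + t \<le> n" "j' + t \<le> n"
  shows "\<bar>real_of_int (grow j j' p t) - \<xi> ^ t * real_of_int (grow j j' p 0)\<bar> \<le> KR * L p"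
proof -
  have "real_of_int (grow j j' p t) - \<xi> ^ t * real_of_int (grow j j' p 0) =
    (real_of_int (shrow p j t) - \<xi> ^ t * real_of_int (shrow p j 0)) +
    (real_of_int (shrow p j' t) - \<xi> ^ t * real_of_int (shrow p j' 0))"
    by (simp add: grow_def shrow_def algebra_simps)
  also have "\<bar>\<dots>\<bar> \<le> M * L p + M * L p"
    using shrow_err[OF assms(1), of p] shrow_err[OF assms(2), of p] by linarith
  also have "\<dots> = 2 * M * L p" by simp
  also have "\<dots> \<le> KR * L p" using KR_ge L_pos[of p] by (intro mult_right_mono) auto
  finally show ?thesis .
qed

text \<open>The multiple subtracted cancels the main term \<open>\<xi> ^ (l + t) * Xv k\<close>.
  What is left has the size of the error in every column, column 0 included.\<close>

lemma reduced_entry: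
  assumes "l + t \<le> n" "j + t \<le> n" "j' + t \<le> n"
  shows "\<bar>real_of_int (x k (l + t)) - \<xi> ^ l / (\<xi> ^ j + \<xi> ^ j') * real_of_int (grow j j' k t)\<bar>
    \<le> (1 + 2 * M / gmin) * L k"
proof -
  let ?e = "\<lambda>s. real_of_int (x k s) - \<xi> ^ s * Xv k"
  let ?g = "\<xi> ^ j + \<xi> ^ j'"
  have g: "?g \<noteq> 0" "gmin \<le> \<bar>?g\<bar>" using pair_power_nonzero gmin_le assms by auto
  have "real_of_int (grow j j' k t) = ?g * (\<xi> ^ t * Xv k) + (?e (j + t) + ?e (j' + t))"
    by (simp add: grow_def power_add algebra_simps)
  hence "real_of_int (x k (l + t)) - \<xi> ^ l / ?g * real_of_int (grow j j' k t)
      = ?e (l + t) - \<xi> ^ l / ?g * (?e (j + t) + ?e (j' + t))"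
    using g(1) by (simp add: distrib_left power_add)
  also have "\<bar>\<dots>\<bar> \<le> \<bar>?e (l + t)\<bar> + \<bar>\<xi> ^ l / ?g\<bar> * \<bar>?e (j + t) + ?e (j' + t)\<bar>"
    unfolding abs_mult[symmetric] by (rule abs_triangle_ineq4)
  also have "\<dots> \<le> L k + (M / gmin) * (2 * L k)"
  proof (intro add_mono mult_mono)
    show "\<bar>?e (l + t)\<bar> \<le> L k" by (rule err_ge[OF assms(1)])
    have "\<bar>\<xi>\<bar> ^ l \<le> M" using M_ge[of l] assms by simp
    hence "\<bar>\<xi>\<bar> ^ l / \<bar>?g\<bar> \<le> M / gmin"
      by (rule frac_le[rotated]) (use g(2) gmin_pos M_ge_2 in linarith)+
    thus "\<bar>\<xi> ^ l / ?g\<bar> \<le> M / gmin" by (simp add: abs_divide power_abs)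
    show "\<bar>?e (j + t) + ?e (j' + t)\<bar> \<le> 2 * L k"
      using err_ge[OF assms(2), of "x k" \<xi>] err_ge[OF assms(3), of "x k" \<xi>] by linarith
  qed (use M_ge_2 gmin_pos in auto)
  finally show ?thesis by (simp add: algebra_simps)
qed

text \<open>The rows of \<open>x k\<close> are reduced modulo its own \<open>grow\<close> row, which
  the rows of \<open>ps\<close> generate. They then cost only \<open>L k\<close>, and the possibly
  much larger size \<open>Xv k\<close> does not enter.\<close>

lemma reduced_rows_det:
  fixes ps js :: "nat list" and ws :: "(nat \<Rightarrow> int) list" and a :: "nat \<Rightarrow> real"
  assumes N: "length ps + length js + length ws = N" and ps: "ps = p0 # ps'" "\<And>p. p \<in> set ps \<Longrightarrow> p \<le> p0"
    and jN: "j + N \<le> Suc n" "j' + N \<le> Suc n" and js: "\<And>l. l \<in> set js \<Longrightarrow> l + N \<le> Suc n"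
    and rel: "\<And>t. t \<le> n \<Longrightarrow> real_of_int (x k t) = (\<Sum>r<length ps. a r * real_of_int (x (ps ! r) t))"
    and ws: "\<And>w. w \<in> set ws \<Longrightarrow> \<bar>real_of_int (w 0)\<bar> \<le> M * aw \<and> (\<forall>t<N. \<bar>real_of_int (w t) - \<xi> ^ t * real_of_int (w 0)\<bar> \<le> M * lw)"
    and aw: "aw * L p0 \<le> Xv p0 * lw" "0 \<le> aw" "0 < lw"
  shows "\<bar>real_of_int (rdet N (map (grow j j') ps @ map (shrow k) js @ ws))\<bar> \<le>
    fact N * KR ^ N * Xv p0 * ((\<Prod>r<length ps'. L (ps' ! r)) * L k ^ length js * lw ^ length ws)"
proof -
  let ?us = "map (grow j j') ps @ map (shrow k) js @ ws"
  let ?P = "length ps" and ?J = "length js"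
  let ?g = "\<xi> ^ j + \<xi> ^ j'"
  define l where "l r = (if r < ?P then L (ps ! r) else if r < ?P + ?J then L k else lw)" for r
  have P0: "0 < ?P" using ps by simp
  have "\<bar>real_of_int (rdet N ?us)\<bar> \<le> fact N * KR ^ N * Xv p0 * (\<Prod>r = 1..<N. l r)"
  proof (rule rdet_cost)
    show "length ?us = N" using N by simp
    show "N > 0" using N P0 by linarith
    show "0 < KR" by (rule KR_pos)
    show "l 0 = L p0" using ps by (simp add: l_def)
  next
    fix r assume r: "r < N"
    show "\<exists>c w a. (\<forall>t<N. w t = real_of_int ((?us ! r) t) - (\<Sum>p<r. c p * real_of_int ((?us ! p) t)))
        \<and> \<bar>w 0\<bar> \<le> KR * a \<and> (r = 0 \<longrightarrow> a = Xv p0) \<and> a * L p0 \<le> Xv p0 * l r \<and> (\<forall>t<N. \<bar>w t - \<xi> ^ t * w 0\<bar> \<le> KR * l r)"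
    proof -
      consider "r < ?P" | "?P \<le> r" "r < ?P + ?J" | "?P + ?J \<le> r" by linarith
      thus ?thesis
      proof cases
        case 1
        define p where "p = ps ! r"
        have p: "p \<le> p0" using 1 ps(2) by (simp add: p_def)
        have us: "?us ! r = grow j j' p" using 1 by (simp add: nth_append p_def)
        have 11: "\<bar>real_of_int (grow j j' p 0)\<bar> \<le> KR * Xv p" using jN r by (intro grow_first) auto
        have 12: "Xv p * L p0 \<le> Xv p0 * l r" using cost_mono[OF p] 1 by (simp add: l_def p_def)
        have 13: "\<bar>real_of_int (grow j j' p t) - \<xi> ^ t * real_of_int (grow j j' p 0)\<bar> \<le> KR * l r" if "t < N" for t
          using grow_err[of j t j' p] 1 jN that by (simp add: l_def p_def)
        have 14: "r = 0 \<longrightarrow> Xv p = Xv p0" using ps(1) by (auto simp: p_def)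
        show ?thesis unfolding us
          by (intro exI[of _ "\<lambda>_. 0"] exI[of _ "\<lambda>t. real_of_int (grow j j' p t)"] exI[of _ "Xv p"])
            (use 11 12 13 14 in auto)
      next
        case 2
        define s where "s = js ! (r - ?P)"
        have s: "s + N \<le> Suc n" using 2 js by (simp add: s_def)
        have "r - ?P < ?J" using 2 by linarith
        hence us: "?us ! r = shrow k s" using 2 by (simp add: nth_append s_def)
        \<comment> \<open>The coefficients a express \<open>x k\<close> through the points of
          \<open>ps\<close>; the factor is the one subtracted in
          \<open>reduced_entry\<close>.\<close>
        define c where "c p = (if p < ?P then \<xi> ^ s / ?g * a p else 0)" for p
        define w where "w t = real_of_int (x k (s + t)) - \<xi> ^ s / ?g * real_of_int (grow j j' k t)" for t
        have wt: "w t = real_of_int ((?us ! r) t) - (\<Sum>p<r. c p * real_of_int ((?us ! p) t))" if t: "t < N" for t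
        proof -
          have "(\<Sum>p<r. c p * real_of_int ((?us ! p) t)) = (\<Sum>p<?P. c p * real_of_int ((?us ! p) t))"
            using 2 by (intro sum.mono_neutral_right) (auto simp: c_def)
          also have "\<dots> = (\<Sum>p<?P. \<xi> ^ s / ?g * (a p * real_of_int (x (ps ! p) (j + t)) + a p * real_of_int (x (ps ! p) (j' + t))))"
            by (intro sum.cong) (auto simp: c_def nth_append grow_def algebra_simps)
          also have "\<dots> = \<xi> ^ s / ?g * real_of_int (grow j j' k t)"
            unfolding sum_distrib_left[symmetric] sum.distrib using jN t by (simp add: grow_def rel)
          finally show ?thesis unfolding us by (simp add: w_def shrow_def)
        qed
        have wb: "\<bar>w t\<bar> \<le> (1 + 2 * M / gmin) * L k" if "t < N" for t
          unfolding w_def using that s jN by (intro reduced_entry) auto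
        have B: "(1 + M) * ((1 + 2 * M / gmin) * L k) \<le> KR * L k"
          unfolding KR_def mult.assoc[symmetric] using M_ge_2 L_pos[of k] by (intro mult_right_mono mult_left_mono) auto
        have pos: "0 \<le> (1 + 2 * M / gmin) * L k" using M_ge_2 gmin_pos L_pos[of k] by simp
        have N0: "0 < N" using r by simp
        have 21: "\<bar>w 0\<bar> \<le> KR * L k"
        proof -
          have "(1 + 2 * M / gmin) * L k \<le> (1 + M) * ((1 + 2 * M / gmin) * L k)"
            using pos M_ge_2 by (intro mult_le_cancel_right1[THEN iffD2]) auto
          thus ?thesis using wb[OF N0] B by linarith
        qed
        have 22: "L k * L p0 \<le> Xv p0 * l r"
        proof -
          have "L k * L p0 \<le> L k * Xv p0"
            using L_le_1[of p0] X_ge_1[of p0] L_pos[of k] by (intro mult_left_mono) linarith+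
          thus ?thesis using 2 by (simp add: l_def mult.commute)
        qed
        have 23: "\<bar>w t - \<xi> ^ t * w 0\<bar> \<le> KR * l r" if t: "t < N" for t
        proof -
          have "\<bar>w t - \<xi> ^ t * w 0\<bar> \<le> \<bar>w t\<bar> + \<bar>\<xi>\<bar> ^ t * \<bar>w 0\<bar>"
            using abs_triangle_ineq4[of "w t" "\<xi> ^ t * w 0"] by (simp add: abs_mult power_abs)
          also have "\<dots> \<le> (1 + 2 * M / gmin) * L k + M * ((1 + 2 * M / gmin) * L k)"
          proof (intro add_mono mult_mono wb t N0)
            show "\<bar>\<xi>\<bar> ^ t \<le> M" using M_ge[of t] t s by simp
          qed (use M_ge_2 in auto)
          also have "\<dots> = (1 + M) * ((1 + 2 * M / gmin) * L k)" by (simp only: distrib_right mult_1)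
          finally show ?thesis using B 2 by (simp add: l_def)
        qed
        have 24: "r \<noteq> 0" using 2 P0 by linarith
        show ?thesis
          by (rule exI[of _ c], rule exI[of _ w], rule exI[of _ "L k"])
            (intro conjI allI impI wt 21 22 23; use 24 in simp)
      next
        case 3
        define w where "w = ws ! (r - ?P - ?J)"
        have "\<not> r < ?P" "\<not> r - ?P < ?J" using 3 by linarith+
        hence us: "?us ! r = w" by (simp add: nth_append w_def)
        have "w \<in> set ws" using 3 r N by (simp add: w_def)
        hence w: "\<bar>real_of_int (w 0)\<bar> \<le> M * aw" "\<And>t. t < N \<Longrightarrow> \<bar>real_of_int (w t) - \<xi> ^ t * real_of_int (w 0)\<bar> \<le> M * lw"
          using ws by blast+
        have lr: "l r = lw" using 3 by (simp add: l_def)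
        have M_KR: "M \<le> KR" using KR_ge M_ge_2 by linarith
        have 31: "\<bar>real_of_int (w 0)\<bar> \<le> KR * aw" using w(1) mult_right_mono[OF M_KR aw(2)] by linarith
        have 33: "\<bar>real_of_int (w t) - \<xi> ^ t * real_of_int (w 0)\<bar> \<le> KR * l r" if "t < N" for t
          using w(2)[OF that] mult_right_mono[OF M_KR, of lw] aw(3) unfolding lr by linarith
        have 34: "r \<noteq> 0" using 3 P0 by linarith
        show ?thesis unfolding us
          by (intro exI[of _ "\<lambda>_. 0"] exI[of _ "\<lambda>t. real_of_int (w t)"] exI[of _ aw])
            (use 31 33 34 aw lr in auto)
      qed
    qed
  qed
  also have "(\<Prod>r = 1..<N. l r) = (\<Prod>r<length ps'. L (ps' ! r)) * L k ^ ?J * lw ^ length ws"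
  proof -
    have "(\<Prod>r = 1..<N. l r) = (\<Prod>r\<in>{1..<?P} \<union> {?P..<?P + ?J} \<union> {?P + ?J..<N}. l r)"
      using N ps(1) by (intro prod.cong) auto
    also have "\<dots> = (\<Prod>r = 1..<?P. l r) * (\<Prod>r = ?P..<?P + ?J. l r) * (\<Prod>r = ?P + ?J..<N. l r)"
      by (subst prod.union_disjoint; (subst prod.union_disjoint)?) auto
    also have "(\<Prod>r = 1..<?P. l r) = (\<Prod>r<length ps'. L (ps' ! r))"
      using ps(1) by (intro prod.reindex_bij_witness[of _ Suc "\<lambda>r. r - 1"]) (auto simp: l_def)
    also have "(\<Prod>r = ?P..<?P + ?J. l r) = L k ^ ?J" by (simp add: l_def)
    also have "(\<Prod>r = ?P + ?J..<N. l r) = lw ^ length ws"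
    proof -
      have "(\<Prod>r = ?P + ?J..<N. l r) = (\<Prod>r = ?P + ?J..<N. lw)" by (intro prod.cong) (auto simp: l_def)
      also have "\<dots> = lw ^ (N - (?P + ?J))" by simp
      also have "N - (?P + ?J) = length ws" using N by simp
      finally show ?thesis .
    qed
    finally show ?thesis .
  qed
  finally show ?thesis .
qed

definition C4 :: "nat \<Rightarrow> real" where "C4 N = ln (fact N * KR ^ N) + real N * K0"

lemma ln_L_prod: "ln (\<Prod>r<length ps. L (ps ! r)) \<le> real (length ps) * K0 - (\<Sum>p\<leftarrow>ps. y (Suc p)) / \<nu>"
  using ln_L_list[of "map (\<lambda>p. (p, 0)) ps"] by (simp add: rcost_def o_def)

lemma reduced_rows_log:
  fixes ps js :: "nat list" and ws :: "(nat \<Rightarrow> int) list"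
  assumes N: "length ps + length js + length ws = N" and ps: "ps = p0 # ps'" "\<And>p. p \<in> set ps \<Longrightarrow> p \<le> p0"
    and jN: "j + N \<le> Suc n" "j' + N \<le> Suc n" and js: "\<And>l. l \<in> set js \<Longrightarrow> l + N \<le> Suc n"
    and rel: "ann n n (x ` set ps) \<subseteq> ann n n {x k}"
    and ws: "\<And>w. w \<in> set ws \<Longrightarrow> \<bar>real_of_int (w 0)\<bar> \<le> M * aw \<and> (\<forall>t<N. \<bar>real_of_int (w t) - \<xi> ^ t * real_of_int (w 0)\<bar> \<le> M * lw)"
    and aw: "aw * L p0 \<le> Xv p0 * lw" "0 \<le> aw" "0 < lw"
    and low: "D > 0" "D \<le> \<bar>real_of_int (rdet N (map (grow j j') ps @ map (shrow k) js @ ws))\<bar>"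
  shows "ln D + ((\<Sum>p\<leftarrow>ps'. y (Suc p)) + real (length js) * y (Suc k)) / \<nu> \<le> y p0 + real (length ws) * ln lw + C4 N"
proof -
  obtain a where a: "\<And>t. t \<le> n \<Longrightarrow> real_of_int (x k t) = (\<Sum>r<length ps. a r * real_of_int (x (ps ! r) t))"
    using real_relation[OF rel] by blast
  let ?A = "\<Prod>r<length ps'. L (ps' ! r)"
  have A: "0 < ?A" using L_pos by (intro prod_pos) auto
  have K: "0 < fact N * KR ^ N" using KR_pos by simp
  have "D \<le> fact N * KR ^ N * Xv p0 * (?A * L k ^ length js * lw ^ length ws)"
    using reduced_rows_det[OF N ps jN js a ws aw] low(2) by linarith
  hence "ln D \<le> ln (fact N * KR ^ N * Xv p0 * (?A * L k ^ length js * lw ^ length ws))" using low(1) by simp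
  also have "\<dots> = ln (fact N * KR ^ N) + y p0 + (ln ?A + ln (L k ^ length js) + ln (lw ^ length ws))"
  proof -
    have "0 < Xv p0" using X_ge_1[of p0] by linarith
    moreover have "0 < L k ^ length js" "0 < lw ^ length ws" using L_pos[of k] aw(3) by simp_all
    ultimately show ?thesis using K A by (simp only: ln_mult_pos mult_pos_pos)
  qed
  also have "ln (L k ^ length js) = real (length js) * ln (L k)" using L_pos[of k] by (simp add: ln_realpow)
  also have "ln (lw ^ length ws) = real (length ws) * ln lw" using aw(3) by (simp add: ln_realpow)
  finally have 1: "ln D \<le> ln (fact N * KR ^ N) + y p0 + (ln ?A + real (length js) * ln (L k) + real (length ws) * ln lw)" .
  have 2: "ln ?A \<le> real (length ps') * K0 - (\<Sum>p\<leftarrow>ps'. y (Suc p)) / \<nu>" by (rule ln_L_prod)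
  have 3: "real (length js) * ln (L k) \<le> real (length js) * (K0 - y (Suc k) / \<nu>)"
    using L_upper[of k] by (intro mult_left_mono) auto
  have 4: "real (length ps') * K0 + real (length js) * K0 \<le> real N * K0"
    unfolding distrib_right[symmetric] using N ps(1) K0_nonneg by (intro mult_right_mono) auto
  show ?thesis using 1 2 3 4 unfolding C4_def add_divide_distrib right_diff_distrib by simp
qed

end

section \<open>Absorbing constants\<close>

text \<open>Vanishing at level r leaves room for at most \<open>l - r\<close> shifts of a single
  polynomial; in the other case of \<open>castelnuovo\<close> the dimension is lower than at level n
  by \<open>2 * (n - l)\<close>.\<close>

lemma castel_dim:
  assumes "l \<le> n" "r \<le> l" "ann n r K = {0}" "pdim (ann n n K) \<le> D" "l - r \<le> d" "D \<le> d + 2 * (n - l)"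
  shows "pdim (ann n l K) \<le> d"
proof -
  from castelnuovo[OF assms(1), of K] consider "ann n l K = {0}"
    | k where "k \<le> l" "ann n (l - k) K \<noteq> {0}" "pdim (ann n l K) = k + 1"
    | "pdim (ann n l K) + 2 * (n - l) \<le> pdim (ann n n K)" by blast
  thus ?thesis
  proof cases
    case 2
    have "r < l - k"
    proof (rule ccontr)
      assume "\<not> r < l - k"
      hence "ann n (l - k) K \<subseteq> ann n r K" using ann_mono_level[of "l - k" r n _ K] assms(1,2) by auto
      hence "ann n (l - k) K \<subseteq> {0}" unfolding assms(3) .
      hence "ann n (l - k) K = {0}" using zero_ann[of n "l - k" K] by (intro equalityI) simp_all
      thus False using 2(2) by simp
    qed
    thus ?thesis using 2 assms(5) by simp
  qed (use assms in auto)
qed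

text \<open>One point imposes \<open>n - l + 1\<close> linear conditions on a space of dimension
  \<open>l + 1\<close>.\<close>

lemma pdim_ann_single_ge:
  assumes "l \<le> n"
  shows "2 * l \<le> pdim (ann n l {v}) + n"
proof -
  let ?S = "\<lambda>j. {F. degree F \<le> l \<and> (\<forall>i<j. app F v i = 0)}"
  have sm: "submod (?S j)" "degb l (?S j)" for j
    using submod_all[of l] by (auto simp: submod_def degb_def app_add app_smult)
  have "l + 1 \<le> pdim (?S j) + j" for j
  proof (induction j)
    case 0
    thus ?case by (simp add: pdim_all)
  next
    case (Suc j)
    have eq: "?S (Suc j) = {F \<in> ?S j. app F (\<lambda>t. v (j + t)) 0 = 0}"
      by (auto simp: app_shift_0 less_Suc_eq)
    show ?case
    proof (cases "\<exists>F\<in>?S j. app F (\<lambda>t. v (j + t)) 0 \<noteq> 0")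
      case True
      then obtain F where F: "F \<in> ?S j" "app F (\<lambda>t. v (j + t)) 0 \<noteq> 0" by blast
      from pdim_cut[OF sm F] show ?thesis using Suc unfolding eq by linarith
    next
      case False
      hence "?S (Suc j) = ?S j" unfolding eq by blast
      thus ?thesis using Suc by simp
    qed
  qed
  from this[of "Suc (n - l)"] have "l + 1 \<le> pdim (?S (Suc (n - l))) + Suc (n - l)" .
  moreover have "?S (Suc (n - l)) = ann n l {v}" by (auto simp: ann_def less_Suc_eq_le)
  ultimately show ?thesis using assms by simp
qed

section \<open>Row weights from upper bounds for dimensions\<close>

context minpts
begin

text \<open>This is the value \<open>drops\<close> would have if the successive dimensions were the
  prescribed ones; D is the dimension before the first point.\<close>

fun dsum :: "real \<Rightarrow> nat list \<Rightarrow> nat list \<Rightarrow> real" where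
  "dsum D (c # cs) (d # ds) = (D - real d) * y (Suc c) + dsum (real d) cs ds"
| "dsum D _ _ = 0"

fun dims_le :: "nat \<Rightarrow> (nat \<Rightarrow> int) set \<Rightarrow> nat list \<Rightarrow> nat list \<Rightarrow> bool" where
  "dims_le l K (c # cs) (d # ds) \<longleftrightarrow> pdim (ann n l (insert (x c) K)) \<le> d \<and> (\<forall>c'\<in>set cs. c' \<le> c) \<and> dims_le l (insert (x c) K) cs ds"
| "dims_le l K [] [] \<longleftrightarrow> True"
| "dims_le l K _ _ \<longleftrightarrow> False"

lemma dsum_mono_start:
  assumes "p \<le> D" "\<And>c. c \<in> set cs \<Longrightarrow> c \<le> b"
  shows "dsum D cs ds \<le> dsum p cs ds + (D - p) * y (Suc b)"
proof (cases cs)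
  case Nil
  thus ?thesis using assms y_nonneg[of "Suc b"] by simp
next
  case (Cons c cs')
  show ?thesis
  proof (cases ds)
    case Nil
    thus ?thesis using Cons assms y_nonneg[of "Suc b"] by simp
  next
    case (Cons d ds')
    have "(D - p) * y (Suc c) \<le> (D - p) * y (Suc b)"
      using assms y_mono[of "Suc c" "Suc b"] \<open>cs = c # cs'\<close> by (intro mult_left_mono) auto
    thus ?thesis using Cons \<open>cs = c # cs'\<close> by (simp add: algebra_simps)
  qed
qed

text \<open>The weights do not increase along the list. Overestimating a dimension moves rows to
  later points of no larger weight, so upper bounds for the dimensions give a lower bound for the
  total.\<close>

lemma dsum_le_drops: "dims_le l K cs ds \<Longrightarrow> dsum (real (pdim (ann n l K))) cs ds \<le> drops l (ann n l K) cs"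
proof (induction l K cs ds rule: dims_le.induct)
  case (1 l K c cs d ds)
  have eq: "ann n l K \<inter> ann n l {x c} = ann n l (insert (x c) K)"
    unfolding ann_insert[of n l "x c" K] by blast
  let ?p = "real (pdim (ann n l (insert (x c) K)))"
  have ih: "dsum ?p cs ds \<le> drops l (ann n l (insert (x c) K)) cs" using 1 by simp
  have "dsum (real d) cs ds \<le> dsum ?p cs ds + (real d - ?p) * y (Suc c)"
    using 1 by (intro dsum_mono_start) auto
  thus ?case using ih by (simp add: eq algebra_simps)
qed auto

lemma dims_le_bound: "dims_le l K (q # cs) ds \<Longrightarrow> c \<in> set cs \<Longrightarrow> c \<le> q"
  by (cases ds) auto

lemma allp_eq_ann: "allp l = ann n l {}"
  by (auto simp: ann_def)

end

text \<open>The gap between \<nu> and \<mu> absorbs every additive constant from the index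
  \<open>i0\<close> on, so that the inequalities derived below are homogeneous in the
  logarithms.\<close>

locale minpts_large = minpts +
  fixes \<mu> :: real and i0 :: nat
  assumes mu: "\<nu> < \<mu>"
    and big: "\<And>q l k. i0 \<le> q \<Longrightarrow> l \<le> n \<Longrightarrow> k \<le> n + 1 \<Longrightarrow>
      \<nu> * C1 (Suc l) \<le> (\<mu> - \<nu>) * y q \<and> CD l k \<le> (\<mu> - \<nu>) * y q \<and> \<nu> * (C4 (Suc l) + K0) \<le> (\<mu> - \<nu>) * y q"
    and y_pos: "\<And>q. i0 \<le> q \<Longrightarrow> 0 < y q"
begin

lemma full_dims:
  assumes "l \<le> n" "i0 \<le> q" "dims_le l {} (q # cs) ds" "ann n l (x ` set (q # cs)) = {0}"
  shows "dsum (real l + 1) (q # cs) ds \<le> y (Suc q) + \<mu> * y q"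
proof -
  have "drops l (allp l) (q # cs) \<le> y (Suc q) + \<nu> * y q + \<nu> * C1 (Suc l)"
    by (rule chain_full[OF assms(1) dims_le_bound[OF assms(3)] assms(4)])
  moreover have "\<nu> * C1 (Suc l) \<le> (\<mu> - \<nu>) * y q" using big[OF assms(2,1), of 0] by simp
  moreover have "dsum (real (pdim (ann n l {}))) (q # cs) ds \<le> drops l (ann n l {}) (q # cs)"
    by (rule dsum_le_drops[OF assms(3)])
  moreover have "real (pdim (ann n l {})) = real l + 1" unfolding allp_eq_ann[symmetric] pdim_all by simp
  ultimately show ?thesis unfolding allp_eq_ann left_diff_distrib by simp
qed

lemma dual_dims:
  assumes "l \<le> n" "i0 \<le> q" "dims_le l {} (q # cs) ds"
    and k: "k > 0" "pdim (ann n l (x ` set (q # cs))) = k"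
    and Q: "Polynomial.content Q = 1" "degree Q + k \<le> Suc l"
    and kill: "\<And>a. a < k \<Longrightarrow> monom 1 a * Q \<in> ann n l (x ` set (q # cs))"
    and r: "r \<le> n" "Q \<in> ann n r {x (Suc h)}" "Q \<notin> ann n r {x h}"
  shows "real k * y (Suc h) + dsum (real l + 1) (q # cs) ds \<le> y (Suc q) + \<mu> * y q"
proof -
  have "real k * y (Suc h) + drops l (allp l) (q # cs) \<le> y (Suc q) + \<nu> * y q + CD l k"
    by (rule chain_dual_lower[OF assms(1) dims_le_bound[OF assms(3)] k Q kill r])
  moreover have "k \<le> n + 1" using Q(2) assms(1) by linarith
  hence "CD l k \<le> (\<mu> - \<nu>) * y q" using big[OF assms(2,1), of k] by simp
  moreover have "dsum (real (pdim (ann n l {}))) (q # cs) ds \<le> drops l (ann n l {}) (q # cs)"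
    by (rule dsum_le_drops[OF assms(3)])
  moreover have "real (pdim (ann n l {})) = real l + 1" unfolding allp_eq_ann[symmetric] pdim_all by simp
  ultimately show ?thesis unfolding allp_eq_ann left_diff_distrib by simp
qed

lemma nontrivial_primitive:
  assumes "F \<in> ann n l K" "F \<noteq> 0"
  obtains Q c where "c \<noteq> 0" "F = smult c Q" "Q \<in> ann n l K" "Q \<noteq> 0" "Polynomial.content Q = 1"
proof -
  have eq: "F = smult (Polynomial.content F) (primitive_part F)" by simp
  have c: "Polynomial.content F \<noteq> 0" using assms by simp
  hence "primitive_part F \<in> ann n l K"
    using satur_ann[of n l K] assms(1) eq unfolding satur_def by metis
  thus ?thesis using that[OF c eq] assms(2) by simp
qed

lemma smult_not_ann: "c \<noteq> 0 \<Longrightarrow> smult c Q \<notin> ann n l K \<Longrightarrow> Q \<notin> ann n l K"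
  using submod_smult[OF submod_ann] by blast

text \<open>Some polynomial kills \<open>x k\<close> but not the pair, say at shift j. At this shift
  \<open>x k\<close> depends on the pair, so the two rows of the pair replace its own row. The
  common annihilator is then contained in that of \<open>x k\<close> cut by one further
  hyperplane.\<close>

lemma pair_rows:
  assumes n: "n = 2 * m" "1 \<le> m" and k: "rix 2 i = Suc k"
    and dk: "pdim (ann n (m + 1) {x k}) \<le> 2" and di: "pdim (ann n (m + 1) {x i, x (Suc i)}) \<le> 1"
  shows "\<exists>j<m. pdim {F. degree F \<le> m + 1 \<and>
    (\<forall>u\<in>set (map (grow j j) [Suc i, i] @ map (shrow k) (filter (\<lambda>l. l \<noteq> j) [0..<m])). app F u 0 = 0)} \<le> 1"
proof -
  have n2: "2 \<le> n" and l: "m + 1 \<le> n" and nl: "n - (m + 1) = m - 1" using n by auto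
  have ik: "Suc i \<le> k" "k < rix 2 i" using rix2_gt[OF n2, of i] k by auto
  have dk2: "2 \<le> pdim (ann n (m + 1) {x k})" using pdim_ann_single_ge[OF l, of "x k"] n by simp
  have "\<not> ann n (m + 1) {x k} \<subseteq> ann n (m + 1) {x i, x (Suc i)}"
  proof
    assume "ann n (m + 1) {x k} \<subseteq> ann n (m + 1) {x i, x (Suc i)}"
    from pdim_mono[OF degb_ann this] show False using dk2 di by simp
  qed
  then obtain F0 where F0: "F0 \<in> ann n (m + 1) {x k}" "F0 \<notin> ann n (m + 1) {x i, x (Suc i)}" by blast
  then obtain c j where cj: "c = i \<or> c = Suc i" "j \<le> m - 1" "app F0 (x c) j \<noteq> 0"
    using nl by (auto simp: ann_def)
  have jm: "j < m" using cj n by linarith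
  let ?us = "map (grow j j) [Suc i, i] @ map (shrow k) (filter (\<lambda>l. l \<noteq> j) [0..<m])"
  let ?R = "{F. degree F \<le> m + 1 \<and> (\<forall>u\<in>set ?us. app F u 0 = 0)}"
  have sub: "?R \<subseteq> {F \<in> ann n (m + 1) {x k}. app F (shrow c j) 0 = 0}"
  proof
    fix F assume F: "F \<in> ?R"
    have gi: "app F (grow j j (Suc i)) 0 = 0" "app F (grow j j i) 0 = 0" using F by auto
    hence 0: "app F (x (Suc i)) j = 0" "app F (x i) j = 0" by (auto simp: app_grow)
    have 1: "app F (x k) l = 0" if "l < m" "l \<noteq> j" for l
    proof -
      have "shrow k l \<in> set ?us" using that by auto
      hence "app F (shrow k l) 0 = 0" using F by blast
      thus ?thesis by (simp add: app_shrow)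
    qed
    have dF: "degree F \<le> m + 1" using F by blast
    have "degree (monom 1 j * F) \<le> n"
      using degree_mult_le[of "monom (1::int) j" F] degree_monom_le[of "1::int" j] dF jm n by linarith
    hence "monom 1 j * F \<in> ann n n {x i, x (Suc i)}" using 0 by (auto simp: ann_top app_monom_mult)
    hence "monom 1 j * F \<in> ann n n (blk i k)"
      using blk_pair[OF n2, of i i "Suc i" k] ik by simp
    hence 2: "app F (x k) j = 0" using ik by (auto simp: ann_top app_monom_mult)
    have "F \<in> ann n (m + 1) {x k}"
    proof (rule annI)
      fix v l assume "v \<in> {x k}" "l \<le> n - (m + 1)"
      hence "v = x k" "l < m" using nl n by auto
      thus "app F v l = 0" using 1[of l] 2 by (cases "l = j") auto
    qed (rule dF)
    moreover have "app F (shrow c j) 0 = 0" using 0 cj(1) by (auto simp: app_shrow)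
    ultimately show "F \<in> {F \<in> ann n (m + 1) {x k}. app F (shrow c j) 0 = 0}" by blast
  qed
  have "pdim {F \<in> ann n (m + 1) {x k}. app F (shrow c j) 0 = 0} + 1 = pdim (ann n (m + 1) {x k})"
    by (rule pdim_cut[OF submod_ann degb_ann F0(1)]) (use cj in \<open>simp add: app_shrow\<close>)
  moreover have "degb (m + 1) {F \<in> ann n (m + 1) {x k}. app F (shrow c j) 0 = 0}"
    by (rule degb_subset[OF degb_ann]) auto
  ultimately have "pdim ?R \<le> 1" using pdim_mono[OF _ sub, of "m + 1"] dk by simp
  thus ?thesis using jm by blast
qed

lemma length_filter_neq: "j < m \<Longrightarrow> length (filter (\<lambda>l. l \<noteq> j) [0..<m]) = m - 1"
proof -
  assume j: "j < m"
  have "length (filter (\<lambda>l. l \<noteq> j) [0..<m]) = card ({0..<m} - {j})"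
    by (subst distinct_card[symmetric]) (auto intro!: arg_cong[where f = card])
  thus ?thesis using j by simp
qed

text \<open>The \<open>m + 1\<close> rows of \<open>pair_rows\<close>, for the pair following
  \<open>x i\<close>, are completed to a non-zero determinant by one row from the three points. The
  \<open>m - 1\<close> rows of the late point \<open>x k\<close> cost only its error, while the top
  row comes from \<open>x (Suc (Suc i))\<close>.\<close>

lemma E1:
  assumes n: "n = 2 * m" "1 \<le> m" and k: "rix 2 (Suc i) = Suc k" and i: "i0 \<le> i"
    and dk: "pdim (ann n (m + 1) {x k}) \<le> 2" and di: "pdim (ann n (m + 1) {x (Suc i), x (Suc (Suc i))}) \<le> 1"
    and zero: "ann n (m + 1) {x i, x (Suc i), x (Suc (Suc i))} = {0}"
  shows "(real m - 1) * y (Suc k) + y (Suc (Suc i)) + y (Suc i) \<le> \<mu> * y (Suc (Suc i))"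
proof -
  have n2: "2 \<le> n" and l: "m + 1 \<le> n" and nl: "n - (m + 1) = m - 1" using n by auto
  have ik: "Suc (Suc i) \<le> k" "k < rix 2 (Suc i)" using rix2_gt[OF n2, of "Suc i"] k by auto
  let ?js = "\<lambda>j. filter (\<lambda>l. l \<noteq> j) [0..<m]"
  let ?us = "\<lambda>j. map (grow j j) [Suc (Suc i), Suc i] @ map (shrow k) (?js j)"
  obtain j where j: "j < m" "pdim {F. degree F \<le> m + 1 \<and> (\<forall>u\<in>set (?us j). app F u 0 = 0)} \<le> 1"
    using pair_rows[OF n k dk di] by (elim exE conjE) (rule that)
  let ?R = "{F. degree F \<le> m + 1 \<and> (\<forall>u\<in>set (?us j). app F u 0 = 0)}"
  have smR: "submod ?R" "degb (m + 1) ?R"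
    using submod_kill[OF submod_all[of "m + 1"], of "set (?us j)"] by (auto simp: degb_def)
  have "\<exists>c j'. i \<le> c \<and> c \<le> Suc (Suc i) \<and> j' \<le> m - 1 \<and> {F \<in> ?R. app F (shrow c j') 0 = 0} = {0}"
  proof (cases "?R = {0}")
    case True
    thus ?thesis by (intro exI[of _ i] exI[of _ 0]) auto
  next
    case False
    then obtain F where F: "F \<in> ?R" "F \<noteq> 0" using submod_0[OF smR(1)] by blast
    hence "F \<notin> ann n (m + 1) {x i, x (Suc i), x (Suc (Suc i))}" using zero by simp
    then obtain c j' where c: "c \<in> {i, Suc i, Suc (Suc i)}" "j' \<le> m - 1" "app F (x c) j' \<noteq> 0"
      using F nl by (auto simp: ann_def)
    let ?T = "{F \<in> ?R. app F (shrow c j') 0 = 0}"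
    have "pdim ?T + 1 = pdim ?R"
      by (rule pdim_cut[OF smR F(1)]) (use c in \<open>simp add: app_shrow\<close>)
    hence p0: "pdim ?T = 0" using j(2) by linarith
    have "submod ?T" using smR(1) by (auto simp: submod_def app_add app_smult)
    moreover have "degb (m + 1) ?T" by (rule degb_subset[OF smR(2)]) auto
    ultimately have T0: "?T = {0}" using p0 by (intro pdim_eq_0D)
    have ci: "i \<le> c" "c \<le> Suc (Suc i)" using c(1) by auto
    show ?thesis by (rule exI[of _ c], rule exI[of _ j']) (intro conjI ci c(2) T0)
  qed
  then obtain c j' where c: "i \<le> c" "c \<le> Suc (Suc i)" "j' \<le> m - 1" "{F \<in> ?R. app F (shrow c j') 0 = 0} = {0}" by (elim exE conjE) (rule that)
  let ?ps = "[Suc (Suc i), Suc i]" and ?ws = "[shrow c j']"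
  let ?N = "Suc (m + 1)"
  have "1 \<le> \<bar>real_of_int (rdet ?N (map (grow j j) ?ps @ map (shrow k) (?js j) @ ?ws))\<bar>"
  proof (rule full_rows_det)
    show "length (map (grow j j) ?ps @ map (shrow k) (?js j) @ ?ws) = Suc (m + 1)"
      using length_filter_neq[OF j(1)] n by simp
    fix F assume F: "degree F \<le> m + 1" "\<And>u. u \<in> set (map (grow j j) ?ps @ map (shrow k) (?js j) @ ?ws) \<Longrightarrow> app F u 0 = 0"
    have "F \<in> {F \<in> ?R. app F (shrow c j') 0 = 0}" using F by simp
    thus "F = 0" unfolding c(4) by simp
  qed
  hence D: "(1::real) \<le> \<bar>real_of_int (rdet ?N (map (grow j j) ?ps @ map (shrow k) (?js j) @ ?ws))\<bar>" .
  have "ln 1 + ((\<Sum>p\<leftarrow>[Suc i]. y (Suc p)) + real (length (?js j)) * y (Suc k)) / \<nu>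
      \<le> y (Suc (Suc i)) + real (length ?ws) * ln (L i) + C4 ?N"
  \<comment> \<open>It is not known which of the three points supplies the completing row, so its
    error is bounded by the largest of theirs, \<open>L i\<close>.\<close>
  proof (rule reduced_rows_log[where aw = "Xv c" and lw = "L i" and D = 1])
    show "length ?ps + length (?js j) + length ?ws = ?N" using length_filter_neq[OF j(1)] n by simp
    show "?ps = Suc (Suc i) # [Suc i]" by simp
    show "j + ?N \<le> Suc n" "j + ?N \<le> Suc n" using j(1) n by auto
    show "ann n n (x ` set ?ps) \<subseteq> ann n n {x k}"
    proof -
      have "ann n n (x ` set ?ps) = ann n n (blk (Suc i) k)"
        using blk_pair[OF n2, of "Suc i" "Suc i" "Suc (Suc i)" k] ik by (simp add: insert_commute)
      also have "\<dots> \<subseteq> ann n n {x k}" using ik by (intro ann_antimono) auto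
      finally show ?thesis .
    qed
    show "\<bar>real_of_int (w 0)\<bar> \<le> M * Xv c \<and> (\<forall>t<?N. \<bar>real_of_int (w t) - \<xi> ^ t * real_of_int (w 0)\<bar> \<le> M * L i)"
      if "w \<in> set ?ws" for w
    proof -
      have w: "w = shrow c j'" using that by simp
      have "M * L c \<le> M * L i" using L_mono[OF c(1)] M_ge_2 by (intro mult_left_mono) auto
      note bnd = this
      have w2: "\<bar>real_of_int (shrow c j' t) - \<xi> ^ t * real_of_int (shrow c j' 0)\<bar> \<le> M * L i" if "t < ?N" for t
      proof -
        have "j' + t \<le> n" using that c(3) n by linarith
        from order.trans[OF shrow_err[OF this, of c] bnd] show ?thesis .
      qed
      have w1: "\<bar>real_of_int (shrow c j' 0)\<bar> \<le> M * Xv c" using c(3) n by (intro shrow_first) simp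
      show ?thesis unfolding w by (intro conjI allI impI w1 w2)
    qed
    have "Xv c * L (Suc (Suc i)) \<le> Xv (Suc (Suc i)) * L c" by (rule cost_mono[OF c(2)])
    also have "\<dots> \<le> Xv (Suc (Suc i)) * L i" using L_mono[OF c(1)] X_ge_1[of "Suc (Suc i)"] by (intro mult_left_mono) auto
    finally show "Xv c * L (Suc (Suc i)) \<le> Xv (Suc (Suc i)) * L i" .
    show "0 \<le> Xv c" using X_ge_1[of c] by linarith
    show "0 < L i" by (rule L_pos)
    show "1 \<le> \<bar>real_of_int (rdet ?N (map (grow j j) ?ps @ map (shrow k) (?js j) @ ?ws))\<bar>" by (rule D)
    show "l + ?N \<le> Suc n" if "l \<in> set (?js j)" for l using that n by auto
  qed auto
  hence "(y (Suc (Suc i)) + (real m - 1) * y (Suc k)) / \<nu> \<le> y (Suc (Suc i)) + (K0 - y (Suc i) / \<nu>) + C4 ?N"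
    using L_upper[of i] length_filter_neq[OF j(1)] n by (simp add: of_nat_diff)
  hence "\<nu> * ((y (Suc (Suc i)) + (real m - 1) * y (Suc k)) / \<nu>) \<le> \<nu> * (y (Suc (Suc i)) + (K0 - y (Suc i) / \<nu>) + C4 ?N)"
    using nu_pos by (intro mult_left_mono) auto
  hence "y (Suc (Suc i)) + (real m - 1) * y (Suc k) \<le> \<nu> * y (Suc (Suc i)) - y (Suc i) + \<nu> * (C4 ?N + K0)"
    using nu_pos by (simp add: algebra_simps)
  moreover have "\<nu> * (C4 ?N + K0) \<le> (\<mu> - \<nu>) * y (Suc (Suc i))"
    using big[of "Suc (Suc i)" "m + 1" 0] i l by simp
  ultimately show ?thesis unfolding left_diff_distrib by linarith
qed

end

section \<open>Half-degree at least three\<close>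

lemma ann_zero_superset: "ann n r K = {0} \<Longrightarrow> K \<subseteq> K' \<Longrightarrow> ann n r K' = {0}"
  using ann_antimono[of K K' n r] zero_ann[of n r K'] by (intro equalityI) simp_all

lemma minpts_large_mono:
  assumes "minpts_large n \<xi> \<nu> K0 x \<mu> i0" "i0 \<le> i1"
  shows "minpts_large n \<xi> \<nu> K0 x \<mu> i1"
proof -
  interpret minpts_large n \<xi> \<nu> K0 x \<mu> i0 by (rule assms(1))
  show ?thesis by unfold_locales (use mu big y_pos assms(2) in auto)
qed

text \<open>\<open>mu_lt\<close> is \<open>poly (Q_poly m) (1 / \<mu>) < 0\<close> multiplied by
  \<open>\<mu> ^ 3\<close>. Together with \<open>mu_gt\<close> it places the excess of \<mu> over m
  between 1 and 2.\<close>

locale minpts_even = minpts_large +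
  fixes m :: nat
  assumes n_eq: "n = 2 * m" and m3: "3 \<le> m"
    and rank0: "\<And>i. i0 \<le> i \<Longrightarrow> ann n (m - 1) {x i} = {0}"
    and mu_gt: "real m + 1 < \<mu>"
    and mu_lt: "(\<mu> - real m) * \<mu>\<^sup>2 < real m * \<mu> + real m * (real m - 1)"
begin

abbreviation s :: real where "s \<equiv> \<mu> - real m"

text \<open>Expanded around \<mu> = m + s, \<open>mu_lt\<close> becomes m times this inequality up
  to a term \<open>s ^ 3\<close> of the right sign. The weaker form suffices wherever the estimate
  is not sharp.\<close>

lemma s_bound: "2 * s\<^sup>2 - s + 1 < (2 - s) * real m"
proof -
  have "s * (real m + s)\<^sup>2 < real m * (real m + s) + real m * (real m - 1)" using mu_lt by simp
  hence "0 < real m * ((2 - s) * real m - (2 * s\<^sup>2 - s + 1)) - s ^ 3"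
    by (simp add: algebra_simps power2_eq_square power3_eq_cube)
  moreover have "0 < s ^ 3" using mu_gt by simp
  ultimately have "0 < real m * ((2 - s) * real m - (2 * s\<^sup>2 - s + 1))" by linarith
  hence "0 < (2 - s) * real m - (2 * s\<^sup>2 - s + 1)" using m3 by (simp add: zero_less_mult_iff)
  thus ?thesis by linarith
qed

lemma s_lt: "s < 2"
proof (rule ccontr)
  assume "\<not> s < 2"
  hence "(2 - s) * real m \<le> 0" by (simp add: mult_nonpos_nonneg)
  moreover have "0 < 2 * s\<^sup>2 - s + 1"
    using zero_le_power2[of "s - 1"] zero_le_power2[of s] by (simp add: power2_eq_square algebra_simps)
  ultimately show False using s_bound by linarith
qed

lemma levels: "m - 1 \<le> n" "m \<le> n" "m + 1 \<le> n" "m + 2 \<le> n" "2 \<le> n" "3 \<le> n"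
  "n - (m + 1) = m - 1" "n - (m + 2) = m - 2" "n - m = m"
  using n_eq m3 by auto

section \<open>Single points and pairs of consecutive points\<close>

lemma dim_point1: "i0 \<le> i \<Longrightarrow> pdim (ann n (m + 1) {x i}) \<le> 2"
  by (rule castel_dim[of "m + 1" n "m - 1" _ n]) (use levels n_eq m3 rank0 pdim_ann_n_point in auto)

lemma dim_point2: "i0 \<le> i \<Longrightarrow> pdim (ann n (m + 2) {x i}) \<le> 4"
  by (rule castel_dim[of "m + 2" n "m - 1" _ n]) (use levels n_eq m3 rank0 pdim_ann_n_point in auto)

lemma shifts_in_ann:
  assumes "Q \<in> ann n r K" "r + e \<le> n" "a < Suc e"
  shows "monom 1 a * Q \<in> ann n (r + e) K"
  using ann_monom[OF assms(2,1)] assms(3) by simp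

text \<open>Otherwise a primitive Q kills two consecutive points but not the one before them. The
  dual inequality with one point at level \<open>m + 1\<close> bounds the ratio of their logarithms
  from above, the one with two points at level \<open>m + 2\<close> from below, and
  \<open>s_bound\<close> separates the two bounds.\<close>

lemma pair_zero: "\<exists>i1\<ge>i0. \<forall>i\<ge>i1. ann n m {x i, x (Suc i)} = {0}"
proof -
  obtain k0 where k0: "k0 \<ge> i0" "ann n m (blk i0 k0) = {0}" using eventually_killed[OF levels(2), of i0] by blast
  have "ann n m {x i, x (Suc i)} = {0}" if i: "i \<ge> k0" for i
  proof (rule ccontr)
    assume "ann n m {x i, x (Suc i)} \<noteq> {0}"
    then obtain F where F: "F \<in> ann n m {x i, x (Suc i)}" "F \<noteq> 0" using zero_ann[of n m "{x i, x (Suc i)}"] by blast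
    have Fi: "F \<in> ann n m {x i}" "F \<in> ann n m {x (Suc i)}"
      using F(1) ann_antimono[of "{x i}" "{x i, x (Suc i)}" n m] ann_antimono[of "{x (Suc i)}" "{x i, x (Suc i)}" n m] by auto
    have "F \<notin> ann n m (blk i0 k0)" using k0(2) F(2) by simp
    from last_not_killed[OF k0(1) this Fi(2) ann_degree[OF F(1)]] i obtain h where
      h: "i0 \<le> h" "h < Suc i" "F \<notin> ann n m {x h}" "\<forall>j. h < j \<and> j \<le> Suc i \<longrightarrow> F \<in> ann n m {x j}" by auto
    have hi: "h < i" using h(2,3) Fi(1) by (cases "h = i") auto
    let ?K = "{x (Suc h), x (Suc (Suc h))}"
    have "F \<in> ann n m {x (Suc h)} \<inter> ann n m {x (Suc (Suc h))}" using h(4) hi by auto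
    hence "F \<in> ann n m ?K" unfolding ann_insert[of n m "x (Suc h)" "{x (Suc (Suc h))}"] .
    then obtain Q c where Q: "c \<noteq> 0" "F = smult c Q" "Q \<in> ann n m ?K" "Q \<noteq> 0" "Polynomial.content Q = 1"
      using nontrivial_primitive[OF _ F(2)] by metis
    have Qh: "Q \<notin> ann n m {x h}" using h(3) Q(1,2) smult_not_ann by simp
    have Q1: "Q \<in> ann n m {x (Suc h)}" using Q(3) ann_antimono[of "{x (Suc h)}" ?K n m] by auto
    have dQ: "degree Q \<le> m" by (rule ann_degree[OF Q(3)])
    have e1: "m + 1 \<le> n" and e2: "m + 2 \<le> n" using levels by auto
    have kill1: "monom 1 a * Q \<in> ann n (m + 1) (x ` set [Suc h])" if "a < 2" for a
      using shifts_in_ann[OF Q1 e1, of a] that by simp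
    have kill2: "monom 1 a * Q \<in> ann n (m + 2) (x ` set [Suc (Suc h), Suc h])" if "a < 3" for a
      using shifts_in_ann[OF Q(3) e2, of a] that by (simp add: insert_commute)
    have "pdim (ann n (m + 1) (x ` set [Suc h])) = 2"
      using dim_point1[of "Suc h"] h(1) monom_mults_pdim[where k = 2, OF Q(4) kill1 degb_ann] by simp
    hence I1: "real 2 * y (Suc h) + dsum (real (m + 1) + 1) [Suc h] [2] \<le> y (Suc (Suc h)) + \<mu> * y (Suc h)"
      by (intro dual_dims[OF e1 _ _ _ _ Q(5) _ kill1 levels(2) Q1 Qh]) (use h(1) dim_point1[of "Suc h"] dQ in auto)
    have d3: "pdim (ann n (m + 2) {x (Suc h), x (Suc (Suc h))}) \<le> 3"
      by (rule castel_dim[of "m + 2" n "m - 1" _ "n - 1"])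
        (use levels n_eq m3 h(1) ann_zero_superset[OF rank0[of "Suc h"], of ?K] pdim_ann_pair[of "Suc h" "Suc (Suc h)"] in auto)
    hence "pdim (ann n (m + 2) (x ` set [Suc (Suc h), Suc h])) = 3"
      using monom_mults_pdim[where k = 3, OF Q(4) kill2 degb_ann] by (simp add: insert_commute)
    hence I2: "real 3 * y (Suc h) + dsum (real (m + 2) + 1) [Suc (Suc h), Suc h] [4, 3] \<le> y (Suc (Suc (Suc h))) + \<mu> * y (Suc (Suc h))"
      by (intro dual_dims[OF e2 _ _ _ _ Q(5) _ kill2 levels(2) Q1 Qh]) (use h(1) dim_point2[of "Suc (Suc h)"] dQ d3 in auto)
    define a b e where "a = y (Suc h)" and "b = y (Suc (Suc h))" and "e = y (Suc (Suc (Suc h)))"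
    have a: "0 < a" using y_pos[of "Suc h"] h(1) by (simp add: a_def)
    have be: "b \<le> e" unfolding b_def e_def by (rule y_mono) simp
    have J1: "(real m - 1) * b \<le> (\<mu> - 2) * a" using I1 unfolding a_def b_def by (simp add: algebra_simps)
    have "(real m - 2) * b \<le> (real m - 2) * e" using be m3 by (intro mult_left_mono) auto
    hence J2: "3 * a \<le> (s + 1) * b" using I2 unfolding a_def[symmetric] b_def[symmetric] e_def[symmetric] by (simp add: a_def b_def e_def algebra_simps)
    have "(real m - 1) * (3 * a) \<le> (real m - 1) * ((s + 1) * b)" using J2 m3 by (intro mult_left_mono) auto
    also have "\<dots> = (s + 1) * ((real m - 1) * b)" by simp
    also have "\<dots> \<le> (s + 1) * ((\<mu> - 2) * a)" using J1 mu_gt by (intro mult_left_mono) auto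
    finally have "a * (3 * (real m - 1)) \<le> a * ((s + 1) * (\<mu> - 2))" by (simp add: mult_ac)
    hence "3 * (real m - 1) \<le> (s + 1) * (\<mu> - 2)" using a by simp
    hence "(2 - s) * real m \<le> s * s - s + 1" by (simp add: algebra_simps)
    moreover have "0 \<le> s * s" by simp
    ultimately show False using s_bound unfolding power2_eq_square by linarith
  qed
  thus ?thesis using k0(1) by blast
qed

text \<open>Eliminating c and then b leaves
  \<open>m * (\<mu> + m - 1) \<le> s * \<mu>\<^sup>2\<close>, the exact negation of
  \<open>mu_lt\<close>; this system is the source of the polynomial.\<close>

lemma three_ineq:
  assumes "0 < a" "real m * b \<le> \<mu> * a" "(real m - 1) * c + b + a \<le> \<mu> * b" "2 * a + b \<le> (s + 1) * c"
  shows False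
proof -
  have m1: "0 < real m - 1" "0 < s" "0 < \<mu>" using m3 mu_gt by auto
  have "(real m - 1) * (2 * a + b) \<le> (real m - 1) * ((s + 1) * c)" using assms(4) m1 by (intro mult_left_mono) auto
  also have "\<dots> = (s + 1) * ((real m - 1) * c)" by simp
  also have "\<dots> \<le> (s + 1) * ((\<mu> - 1) * b - a)" using assms(3) m1 by (intro mult_left_mono) (auto simp: algebra_simps)
  finally have "a * (\<mu> + real m - 1) \<le> b * (s * \<mu>)" by (simp add: algebra_simps)
  hence "real m * (a * (\<mu> + real m - 1)) \<le> real m * (b * (s * \<mu>))" using m3 by (intro mult_left_mono) auto
  also have "\<dots> = (real m * b) * (s * \<mu>)" by simp
  also have "\<dots> \<le> (\<mu> * a) * (s * \<mu>)" using assms(2) m1 by (intro mult_right_mono) auto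
  finally have "a * (real m * (\<mu> + real m - 1)) \<le> a * (s * \<mu>\<^sup>2)" by (simp add: power2_eq_square mult_ac)
  hence "real m * (\<mu> + real m - 1) \<le> s * \<mu>\<^sup>2" using assms(1) by simp
  thus False using mu_lt by (simp add: algebra_simps)
qed

text \<open>After eliminating d, c and b the outcome contradicts \<open>\<mu> - 1\<close> times
  \<open>mu_lt\<close>, with slack \<open>(m - 1) * s\<^sup>2\<close>. The sign of T must be settled
  before the bound for b can be inserted.\<close>

lemma four_ineq:
  assumes "0 < a" "0 < b" "real m * b \<le> \<mu> * a" "(real m - 1) * c + b + a \<le> \<mu> * b"
    "a + b + c \<le> (s + 1) * d" "(real m - 1) * d + c + b \<le> \<mu> * c"
  shows False
proof -
  have m1: "0 < real m - 1" "0 < s" "0 < \<mu>" "0 < \<mu> - 1" using m3 mu_gt by auto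
  define T where "T = s * \<mu> * (\<mu> - 1) - (real m - 1) * \<mu>"
  have "(real m - 1) * (a + b + c) \<le> (real m - 1) * ((s + 1) * d)" using assms(5) m1 by (intro mult_left_mono) auto
  also have "\<dots> = (s + 1) * ((real m - 1) * d)" by simp
  also have "\<dots> \<le> (s + 1) * ((\<mu> - 1) * c - b)" using assms(6) m1 by (intro mult_left_mono) (auto simp: algebra_simps)
  finally have "(real m - 1) * a + \<mu> * b \<le> c * (s * \<mu>)" by (simp add: algebra_simps)
  hence "(real m - 1) * ((real m - 1) * a + \<mu> * b) \<le> (real m - 1) * (c * (s * \<mu>))" using m1 by (intro mult_left_mono) auto
  also have "\<dots> = ((real m - 1) * c) * (s * \<mu>)" by simp
  also have "\<dots> \<le> ((\<mu> - 1) * b - a) * (s * \<mu>)" using assms(4) m1 by (intro mult_right_mono) (auto simp: algebra_simps)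
  finally have 1: "a * ((real m - 1)\<^sup>2 + s * \<mu>) \<le> b * T"
    unfolding T_def by (simp add: algebra_simps power2_eq_square)
  have "0 < a * ((real m - 1)\<^sup>2 + s * \<mu>)" using assms(1) m1 by (intro mult_pos_pos add_nonneg_pos) auto
  hence "0 < b * T" using 1 by linarith
  hence T: "0 < T" using assms(2) by (simp add: zero_less_mult_iff)
  have "real m * (a * ((real m - 1)\<^sup>2 + s * \<mu>)) \<le> real m * (b * T)" using 1 by (intro mult_left_mono) auto
  also have "\<dots> = (real m * b) * T" by simp
  also have "\<dots> \<le> (\<mu> * a) * T" using assms(3) T by (intro mult_right_mono) auto
  finally have "a * (real m * ((real m - 1)\<^sup>2 + s * \<mu>)) \<le> a * (\<mu> * T)" by (simp add: mult_ac)
  hence 2: "real m * ((real m - 1)\<^sup>2 + s * \<mu>) \<le> \<mu> * T" using assms(1) by simp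
  have "(\<mu> - 1) * (s * \<mu>\<^sup>2) < (\<mu> - 1) * (real m * \<mu> + real m * (real m - 1))"
    using mu_lt m1(4) by (rule mult_strict_left_mono)
  moreover have "\<mu> * T = (\<mu> - 1) * (s * \<mu>\<^sup>2) - (real m - 1) * \<mu>\<^sup>2"
    unfolding T_def by (simp add: algebra_simps power2_eq_square)
  moreover have "real m * ((real m - 1)\<^sup>2 + s * \<mu>) - ((\<mu> - 1) * (real m * \<mu> + real m * (real m - 1)) - (real m - 1) * \<mu>\<^sup>2)
      = (real m - 1) * s\<^sup>2"
    by (simp add: algebra_simps power2_eq_square)
  moreover have "0 \<le> (real m - 1) * s\<^sup>2" using m1 by simp
  ultimately show False using 2 by linarith
qed

end

locale minpts_even_pairs = minpts_even +
  assumes pairs: "\<And>i. i0 \<le> i \<Longrightarrow> ann n m {x i, x (Suc i)} = {0}"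
begin

section \<open>Blocks of points at the levels m + 1 and m + 2\<close>

lemma dim_pair1: "i0 \<le> i \<Longrightarrow> pdim (ann n (m + 1) {x i, x (Suc i)}) \<le> 1"
  by (rule castel_dim[of "m + 1" n m _ "n - 1"]) (use levels n_eq m3 pairs pdim_ann_pair[of i "Suc i"] in auto)

lemma dim_block2:
  assumes "i0 \<le> c" "{x c, x (Suc c)} \<subseteq> K" "pdim (ann n n K) \<le> D" "2 \<le> d" "D \<le> d + 2 * (m - 2)"
  shows "pdim (ann n (m + 2) K) \<le> d"
  by (rule castel_dim[of "m + 2" n m K D]) (use levels assms ann_zero_superset[OF pairs[OF assms(1)] assms(2)] in auto)

lemma dim_pair2:
  assumes "i0 \<le> i"
  shows "pdim (ann n (m + 2) {x i, x (Suc i)}) \<le> 3"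
  by (rule dim_block2[OF assms order.refl, of "n - 1"]) (use pdim_ann_pair[of i "Suc i"] n_eq m3 in auto)

lemma dim_triple2:
  assumes "i0 \<le> i" "rix 2 i = Suc q"
  shows "pdim (ann n (m + 2) {x i, x q, x (Suc q)}) \<le> 2"
proof (rule dim_block2[of q])
  show "i0 \<le> q" using rix2_gt[OF levels(5), of i] assms by simp
  have "{x i, x q, x (Suc q)} = {x (Suc q), x q, x i}" by auto
  thus "pdim (ann n n {x i, x q, x (Suc q)}) \<le> n - 2"
    using rix_le[of i 2] blk_triple_rix2[OF levels(5) assms(2)] assms(2) by simp
qed (use n_eq m3 in auto)

text \<open>If nothing kills \<open>x (Suc i)\<close> at level m, a full determinant gives the
  bound. Otherwise the annihilating Q misses \<open>x i\<close>, because pairs have no annihilator,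
  and the dual inequality at level \<open>m + 1\<close> is strong enough as
  \<open>\<mu> \<le> 2 * m\<close>.\<close>

lemma E0:
  assumes "i0 \<le> i"
  shows "real m * y (Suc (Suc i)) \<le> \<mu> * y (Suc i)"
proof (cases "ann n m {x (Suc i)} = {0}")
  case True
  have "dsum (real m + 1) [Suc i] [0] \<le> y (Suc (Suc i)) + \<mu> * y (Suc i)"
    by (rule full_dims[OF levels(2)]) (use assms True in auto)
  thus ?thesis by (simp add: algebra_simps)
next
  case False
  then obtain Q where Q: "Q \<in> ann n m {x (Suc i)}" "Q \<noteq> 0" "Polynomial.content Q = 1"
    using ann_primitive by blast
  have Qi: "Q \<notin> ann n m {x i}"
  proof
    assume "Q \<in> ann n m {x i}"
    hence "Q \<in> ann n m {x i, x (Suc i)}" using Q(1) unfolding ann_insert[of n m "x i" "{x (Suc i)}"] by blast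
    thus False using pairs[OF assms] Q(2) by simp
  qed
  have kill: "monom 1 a * Q \<in> ann n (m + 1) (x ` set [Suc i])" if "a < 2" for a
    using shifts_in_ann[OF Q(1) levels(3), of a] that by simp
  have "pdim (ann n (m + 1) (x ` set [Suc i])) = 2"
    using dim_point1[of "Suc i"] assms monom_mults_pdim[where k = 2, OF Q(2) kill degb_ann] by simp
  hence I: "real 2 * y (Suc i) + dsum (real (m + 1) + 1) [Suc i] [2] \<le> y (Suc (Suc i)) + \<mu> * y (Suc i)"
    by (intro dual_dims[OF levels(3) _ _ _ _ Q(3) _ kill levels(2) Q(1) Qi]) (use assms dim_point1[of "Suc i"] ann_degree[OF Q(1)] in auto)
  define a b where "a = y (Suc i)" and "b = y (Suc (Suc i))"
  have a: "0 < a" using y_pos[of "Suc i"] assms by (simp add: a_def)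
  have J: "(real m - 1) * b \<le> (\<mu> - 2) * a" using I unfolding a_def b_def by (simp add: algebra_simps)
  have "\<mu> \<le> 2 * real m" using s_lt m3 by simp
  hence c: "real m * (\<mu> - 2) \<le> (real m - 1) * \<mu>" by (simp add: algebra_simps)
  have "(real m - 1) * (real m * b) = real m * ((real m - 1) * b)" by simp
  also have "\<dots> \<le> real m * ((\<mu> - 2) * a)" using J by (intro mult_left_mono) auto
  also have "\<dots> = (real m * (\<mu> - 2)) * a" by simp
  also have "\<dots> \<le> ((real m - 1) * \<mu>) * a" using c a by (intro mult_right_mono) auto
  finally have "(real m - 1) * (real m * b) \<le> (real m - 1) * (\<mu> * a)" by (simp add: mult_ac)
  thus ?thesis using m3 unfolding a_def b_def by simp
qed

text \<open>Otherwise some Q kills the block that starts right after the last point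
  \<open>x h\<close> it misses and ends where it first spans three dimensions. \<open>E0\<close>,
  \<open>E1\<close> and the dual inequality at level \<open>m + 2\<close> for this block form the
  system of \<open>three_ineq\<close>.\<close>

lemma blocks_zero: "\<exists>i1\<ge>i0. \<forall>i\<ge>i1. ann n (m + 1) (blk i (rix 2 i)) = {0}"
proof -
  obtain k0 where k0: "k0 \<ge> i0" "ann n (m + 1) (blk i0 k0) = {0}" using eventually_killed[OF levels(3), of i0] by blast
  have "ann n (m + 1) (blk i (rix 2 i)) = {0}" if i: "i \<ge> k0" for i
  proof (rule ccontr)
    assume "ann n (m + 1) (blk i (rix 2 i)) \<noteq> {0}"
    then obtain F where F: "F \<in> ann n (m + 1) (blk i (rix 2 i))" "F \<noteq> 0" using zero_ann[of n "m + 1" "blk i (rix 2 i)"] by blast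
    have iq: "i < rix 2 i" using rix2_gt[OF levels(5), of i] by simp
    have Fi: "F \<in> ann n (m + 1) {x i}" using F(1) ann_antimono[of "{x i}" "blk i (rix 2 i)" n "m + 1"] iq by auto
    have "F \<notin> ann n (m + 1) (blk i0 k0)" using k0(2) F(2) by simp
    from last_not_killed[OF k0(1) this Fi ann_degree[OF F(1)] i] obtain h where
      h: "i0 \<le> h" "h < i" "F \<notin> ann n (m + 1) {x h}" "\<forall>j. h < j \<and> j \<le> i \<longrightarrow> F \<in> ann n (m + 1) {x j}" by blast
    define I where "I = Suc h"
    have iI: "i0 \<le> I" using h by (simp add: I_def)
    obtain k where k: "rix 2 I = Suc k" "Suc I \<le> k" using rix_pred[OF levels(5), of I] by metis
    have kq: "Suc k \<le> rix 2 i" using rix_mono[of I i 2] h k by (simp add: I_def)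
    let ?K = "blk I (Suc k)"
    \<comment> \<open>Points up to index i are killed by the choice of h, later ones because they
      lie in the block of i, \<open>rix\<close> being monotone.\<close>
    have FK: "F \<in> ann n (m + 1) ?K"
    proof (rule annI[OF ann_degree[OF F(1)]])
      fix v j assume v: "v \<in> ?K" "j \<le> n - (m + 1)"
      then obtain c where c: "v = x c" "I \<le> c" "c \<le> Suc k" by auto
      show "app F v j = 0"
      proof (cases "c \<le> i")
        case True
        hence "F \<in> ann n (m + 1) {x c}" using h(4) c by (simp add: I_def)
        thus ?thesis using v(2) c(1) annD[of F n "m + 1" "{x c}" v j] by simp
      next
        case False
        hence "v \<in> blk i (rix 2 i)" using c kq by auto
        thus ?thesis using annD[OF F(1) _ v(2)] by simp
      qed
    qed
    then obtain Q c where Q: "c \<noteq> 0" "F = smult c Q" "Q \<in> ann n (m + 1) ?K" "Q \<noteq> 0" "Polynomial.content Q = 1"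
      using nontrivial_primitive[OF _ F(2)] by metis
    have Qh: "Q \<notin> ann n (m + 1) {x h}" using h(3) Q(1,2) smult_not_ann by simp
    have Q1: "Q \<in> ann n (m + 1) {x (Suc h)}" using Q(3) ann_antimono[of "{x I}" ?K n "m + 1"] k by (auto simp: I_def)
    have dQ: "degree Q \<le> m + 1" by (rule ann_degree[OF Q(3)])
    \<comment> \<open>The annihilator of the pair is at most a line, spanned by Q; if part of it
      killed \<open>x h\<close> too, then so would Q.\<close>
    have zero: "ann n (m + 1) {x h, x (Suc h), x (Suc (Suc h))} = {0}"
    proof (rule ccontr)
      let ?K2 = "{x (Suc h), x (Suc (Suc h))}" and ?K3 = "{x h, x (Suc h), x (Suc (Suc h))}"
      assume "ann n (m + 1) ?K3 \<noteq> {0}"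
      then obtain G where G: "G \<in> ann n (m + 1) ?K3" "G \<noteq> 0" using zero_ann[of n "m + 1" ?K3] by blast
      have sub: "ann n (m + 1) ?K3 \<subseteq> ann n (m + 1) ?K2" by (rule ann_antimono) auto
      have le: "pdim (ann n (m + 1) ?K2) \<le> pdim (ann n (m + 1) ?K3)"
        using pdim_pos[OF degb_ann G] dim_pair1[of "Suc h"] h(1) by simp
      have QK2: "Q \<in> ann n (m + 1) ?K2" using Q(3) ann_antimono[of ?K2 ?K n "m + 1"] k by (auto simp: I_def)
      have "Q \<in> ann n (m + 1) ?K3"
        by (rule full_pdim_mem[OF submod_ann submod_ann sub degb_ann le QK2 satur_ann])
      thus False using Qh ann_antimono[of "{x h}" ?K3 n "m + 1"] by auto
    qed
    have E1': "(real m - 1) * y (Suc k) + y (Suc (Suc h)) + y (Suc h) \<le> \<mu> * y (Suc (Suc h))"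
      by (rule E1[OF n_eq _ _ h(1) _ _ zero]) (use m3 k iI dim_point1[of k] dim_pair1[of "Suc h"] h(1) in \<open>auto simp: I_def\<close>)
    let ?cs = "[Suc k, k, I]"
    have Kcs: "x ` set ?cs = {x I, x k, x (Suc k)}" by auto
    have "Q \<in> ann n (m + 1) (x ` set ?cs)"
      using Q(3) ann_antimono[of "x ` set ?cs" ?K n "m + 1"] k by auto
    hence kill: "monom 1 a * Q \<in> ann n (m + 2) (x ` set ?cs)" if "a < 2" for a
      using shifts_in_ann[of Q "m + 1" "x ` set ?cs" 1 a] levels(4) that by simp
    have d2: "pdim (ann n (m + 2) {x I, x k, x (Suc k)}) \<le> 2" by (rule dim_triple2[OF iI k(1)])
    hence "pdim (ann n (m + 2) (x ` set ?cs)) = 2"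
      using monom_mults_pdim[where k = 2, OF Q(4) kill degb_ann] unfolding Kcs by simp
    hence "real 2 * y (Suc h) + dsum (real (m + 2) + 1) ?cs [4, 3, 2] \<le> y (Suc (Suc k)) + \<mu> * y (Suc k)"
      by (intro dual_dims[OF levels(4) _ _ _ _ Q(5) _ kill levels(3) Q1 Qh])
        (use iI k dim_point2[of "Suc k"] dim_pair2[of k] d2 dQ in auto)
    hence "2 * y (Suc h) + (real m - 2) * y (Suc (Suc k)) + y (Suc k) + y (Suc (Suc h)) \<le> \<mu> * y (Suc k)"
      unfolding I_def by (simp add: algebra_simps)
    moreover have "(real m - 2) * y (Suc k) \<le> (real m - 2) * y (Suc (Suc k))"
      using y_mono[of "Suc k" "Suc (Suc k)"] m3 by (intro mult_left_mono) auto
    ultimately have "2 * y (Suc h) + y (Suc (Suc h)) \<le> (s + 1) * y (Suc k)" by (simp add: algebra_simps)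
    thus False using three_ineq[OF _ E0[OF h(1)] E1'] y_pos[of "Suc h"] h(1) by simp
  qed
  thus ?thesis using k0(1) by blast
qed

end

subsection \<open>Blocks spanning three dimensions\<close>

text \<open>A linear space of singular \<open>2 \<times> 2\<close> matrices has a common kernel or a common cokernel;
  the hypothesis says that all sums of two of the spanning matrices are singular.\<close>

lemma singular_pencil_aux:
  fixes a b c d :: "nat \<Rightarrow> int"
  assumes polar: "\<And>j j'. P j \<Longrightarrow> P j' \<Longrightarrow> a j * d j' + a j' * d j = b j * c j' + b j' * c j"
    and p: "P p" "a p \<noteq> 0"
  shows "(\<exists>\<alpha> \<beta>. (\<alpha> \<noteq> 0 \<or> \<beta> \<noteq> 0) \<and> (\<forall>j. P j \<longrightarrow> \<alpha> * a j + \<beta> * b j = 0 \<and> \<alpha> * c j + \<beta> * d j = 0)) \<or>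
    (\<exists>\<alpha> \<beta>. (\<alpha> \<noteq> 0 \<or> \<beta> \<noteq> 0) \<and> (\<forall>j. P j \<longrightarrow> \<alpha> * a j + \<beta> * c j = 0 \<and> \<alpha> * b j + \<beta> * d j = 0))"
proof -
  have det0: "a j * d j = b j * c j" if "P j" for j using polar[OF that that] by simp
  have dj: "a p * (a p * d j) = a p * b p * c j + c p * (a p * b j - b p * a j)" if "P j" for j
  proof -
    have "a p * (a p * d j + a j * d p) = a p * (b p * c j + b j * c p)" using polar[OF p(1) that] by simp
    hence "a p * (a p * d j) = a p * (b p * c j + b j * c p) - a j * (a p * d p)" by (simp add: algebra_simps)
    thus ?thesis unfolding det0[OF p(1)] by (simp add: algebra_simps)
  qed
  \<comment> \<open>These are the entries left after clearing with the pivot \<open>a p\<close>. The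
    relation between them shows that B or C vanishes identically, which gives the two
    alternatives.\<close>
  define B where "B j = a p * b j - b p * a j" for j
  define C where "C j = a p * c j - c p * a j" for j
  have BC: "B j * C j' + B j' * C j = 0" if "P j" "P j'" for j j'
  proof -
    have "(a p * a p) * (b j * c j' + b j' * c j) = (a p * a p) * (a j * d j' + a j' * d j)"
      using polar[OF that] by simp
    also have "\<dots> = a j * (a p * (a p * d j')) + a j' * (a p * (a p * d j))" by (simp add: algebra_simps)
    finally show ?thesis
      unfolding dj[OF that(1)] dj[OF that(2)] B_def C_def by (simp add: algebra_simps)
  qed
  show ?thesis
  proof (cases "\<forall>j. P j \<longrightarrow> B j = 0")
    case True
    have "- b p * a j + a p * b j = 0 \<and> - b p * c j + a p * d j = 0" if "P j" for j
    proof -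
      have "B j = 0" using True that by blast
      moreover have "a p * (a p * d j - b p * c j) = c p * B j"
        using dj[OF that] by (simp add: B_def algebra_simps)
      ultimately have "a p * (a p * d j - b p * c j) = 0" by simp
      hence "a p * d j - b p * c j = 0" using p(2) by simp
      thus ?thesis using \<open>B j = 0\<close> unfolding B_def by simp
    qed
    thus ?thesis using p(2) by blast
  next
    case False
    then obtain q where q: "P q" "B q \<noteq> 0" by blast
    have Cq: "C q = 0" using BC[OF q(1) q(1)] q(2) by simp
    have C0: "C j = 0" if "P j" for j using BC[OF q(1) that] Cq q(2) by simp
    have "- c p * a j + a p * c j = 0 \<and> - c p * b j + a p * d j = 0" if "P j" for j
    proof -
      have "a p * (a p * d j - c p * b j) = b p * C j" using dj[OF that] by (simp add: C_def algebra_simps)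
      hence "a p * (a p * d j - c p * b j) = 0" using C0[OF that] by simp
      hence "a p * d j - c p * b j = 0" using p(2) by simp
      thus ?thesis using C0[OF that] unfolding C_def by simp
    qed
    thus ?thesis using p(2) by blast
  qed
qed

lemma singular_pencil:
  fixes a b c d :: "nat \<Rightarrow> int"
  assumes sing: "\<And>j j'. P j \<Longrightarrow> P j' \<Longrightarrow> (a j + a j') * (d j + d j') = (b j + b j') * (c j + c j')"
  shows "(\<exists>\<alpha> \<beta>. (\<alpha> \<noteq> 0 \<or> \<beta> \<noteq> 0) \<and> (\<forall>j. P j \<longrightarrow> \<alpha> * a j + \<beta> * b j = 0 \<and> \<alpha> * c j + \<beta> * d j = 0)) \<or>
    (\<exists>\<alpha> \<beta>. (\<alpha> \<noteq> 0 \<or> \<beta> \<noteq> 0) \<and> (\<forall>j. P j \<longrightarrow> \<alpha> * a j + \<beta> * c j = 0 \<and> \<alpha> * b j + \<beta> * d j = 0))" (is ?thesis)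
proof -
  have det0: "a j * d j = b j * c j" if "P j" for j using sing[OF that that] by (simp add: algebra_simps)
  have polar: "a j * d j' + a j' * d j = b j * c j' + b j' * c j" if "P j" "P j'" for j j'
    using sing[OF that] det0[OF that(1)] det0[OF that(2)] by (simp add: algebra_simps)
  have polar': "b j * c j' + b j' * c j = a j * d j' + a j' * d j" "c j * b j' + c j' * b j = d j * a j' + d j' * a j"
    "d j * a j' + d j' * a j = c j * b j' + c j' * b j" if "P j" "P j'" for j j'
    using polar[OF that] by (simp_all add: algebra_simps)
  show ?thesis
  proof (cases "\<exists>p. P p \<and> a p \<noteq> 0")
    case True
    thus ?thesis using singular_pencil_aux[of P a d b c, OF polar] by blast
  next
    case na: False
    show ?thesis
    proof (cases "\<exists>p. P p \<and> b p \<noteq> 0")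
      case True
      then obtain p where "P p" "b p \<noteq> 0" by blast
      from singular_pencil_aux[of P b c a d, OF polar'(1) this] show ?thesis by (metis add.commute)
    next
      case nb: False
      have "1 * a j + 0 * c j = 0 \<and> 1 * b j + 0 * d j = 0" if "P j" for j using na nb that by auto
      thus ?thesis by (metis zero_neq_one)
    qed
  qed
qed

section \<open>Two-dimensional spaces of polynomials\<close>

lemma two_degrees:
  assumes "2 \<le> pdim S" "degb l S"
  shows "\<exists>F G. F \<in> S \<and> G \<in> S \<and> F \<noteq> 0 \<and> G \<noteq> 0 \<and> degree F \<noteq> degree G"
proof -
  have "\<not> card (degree ` (S - {0})) \<le> Suc 0" using assms(1) by (simp add: pdim_def)
  hence "\<not> (\<forall>a\<in>degree ` (S - {0}). \<forall>b\<in>degree ` (S - {0}). a = b)"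
    using card_le_Suc0_iff_eq[OF finite_degs[OF assms(2)]] by simp
  thus ?thesis by blast
qed

lemma pdim_ge_2:
  assumes "F \<in> S" "G \<in> S" "F \<noteq> 0" "G \<noteq> 0" "degree F \<noteq> degree G" "degb l S"
  shows "2 \<le> pdim S"
proof -
  have "{degree F, degree G} \<subseteq> degree ` (S - {0})" using assms by auto
  from card_mono[OF finite_degs[OF assms(6)] this] show ?thesis using assms(5) by (simp add: pdim_def)
qed

lemma comb_nonzero:
  fixes F G :: "int poly"
  assumes "F \<noteq> 0" "G \<noteq> 0" "degree F \<noteq> degree G" "a \<noteq> 0 \<or> b \<noteq> 0"
  shows "smult a F + smult b G \<noteq> 0"
proof
  assume "smult a F + smult b G = 0"
  hence eq: "smult a F = smult (- b) G" by (simp add: eq_neg_iff_add_eq_0)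
  show False
  proof (cases "a = 0 \<or> b = 0")
    case True
    thus ?thesis using eq assms by auto
  next
    case False
    thus ?thesis using arg_cong[OF eq, of degree] assms(3) by simp
  qed
qed

lemma span2:
  assumes S: "submod S" "degb l S" "pdim S \<le> 2"
    and FG: "F \<in> S" "G \<in> S" "F \<noteq> 0" "G \<noteq> 0" "degree F \<noteq> degree G" and H: "H \<in> S"
  shows "\<exists>c a b. c \<noteq> 0 \<and> smult c H = smult a F + smult b G"
proof -
  let ?S = "{smult a F + smult b G | a b. True}"
  have sm: "submod ?S"
    unfolding submod_def
  proof (intro conjI ballI allI)
    show "0 \<in> ?S" by (rule CollectI, rule exI[of _ 0], rule exI[of _ 0]) simp
    fix P Q c assume "P \<in> ?S"
    then obtain a b where P: "P = smult a F + smult b G" by blast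
    have "smult c P = smult (c * a) F + smult (c * b) G" by (simp add: P smult_add_right)
    thus "smult c P \<in> ?S" by blast
    assume "Q \<in> ?S"
    then obtain a' b' where Q: "Q = smult a' F + smult b' G" by blast
    have "P + Q = smult (a + a') F + smult (b + b') G" by (simp add: P Q smult_add_left)
    thus "P + Q \<in> ?S" by blast
  qed
  have sub: "?S \<subseteq> S" using S(1) FG by (auto intro: submod_add submod_smult)
  have "F = smult 1 F + smult 0 G" "G = smult 0 F + smult 1 G" by simp_all
  hence "F \<in> ?S" "G \<in> ?S" by blast+
  hence "2 \<le> pdim ?S" by (rule pdim_ge_2) (use FG degb_subset[OF S(2) sub] in auto)
  hence "pdim S \<le> pdim ?S" using S(3) by simp
  from full_pdim_scaled_mem[OF sm S(1) sub S(2) this H] show ?thesis by blast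
qed

lemma ann_mult:
  assumes "Q \<in> ann n r K" "degree B \<le> e" "r + e \<le> n"
  shows "B * Q \<in> ann n (r + e) K"
proof (rule annI)
  show "degree (B * Q) \<le> r + e" using degree_mult_le[of B Q] ann_degree[OF assms(1)] assms(2) by linarith
  fix v j assume v: "v \<in> K" "j \<le> n - (r + e)"
  have "app Q v (j + t) = 0" if "t \<le> e" for t
    by (rule annD[OF assms(1) v(1)]) (use v(2) that assms(3) in linarith)
  thus "app (B * Q) v j = 0" unfolding app_mult app_eq_sum[OF assms(2)] by simp
qed

locale minpts_even_blocks = minpts_even_pairs +
  assumes blocks: "\<And>i. i0 \<le> i \<Longrightarrow> ann n (m + 1) (blk i (rix 2 i)) = {0}"
begin

lemma basis_through:
  assumes sub: "ann n n {x p, x q, x r} \<subseteq> ann n n {x k}"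
  shows "\<exists>b1 b2. b1 \<in> {x p, x q, x r} \<and> b2 \<in> {x p, x q, x r} \<and> ann n n {x k, b1, b2} \<subseteq> ann n n {x p, x q, x r}"
proof -
  obtain g c where g: "g \<noteq> 0" "\<And>t. t \<le> n \<Longrightarrow> g * x k t = (\<Sum>i<3. c i * ([x p, x q, x r] ! i) t)"
    using double_ann[of n "[x p, x q, x r]" "x k"] sub by (auto simp: numeral_3_eq_3)
  have rel: "g * x k t = c 0 * x p t + c 1 * x q t + c 2 * x r t" if "t \<le> n" for t
    using g(2)[OF that] by (simp add: numeral_3_eq_3 numeral_2_eq_2)
  have ap: "g * app F (x k) 0 = c 0 * app F (x p) 0 + c 1 * app F (x q) 0 + c 2 * app F (x r) 0" if "degree F \<le> n" for F
  proof -
    have "g * app F (x k) 0 = (\<Sum>t\<le>n. coeff F t * (g * x k t))"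
      by (simp add: app_eq_sum[OF that] sum_distrib_left mult_ac)
    also have "\<dots> = (\<Sum>t\<le>n. coeff F t * (c 0 * x p t + c 1 * x q t + c 2 * x r t))"
      by (intro sum.cong) (auto simp: rel)
    also have "\<dots> = c 0 * app F (x p) 0 + c 1 * app F (x q) 0 + c 2 * app F (x r) 0"
      by (simp add: app_eq_sum[OF that] sum_distrib_left sum.distrib algebra_simps)
    finally show ?thesis .
  qed
  have "c 0 \<noteq> 0 \<or> c 1 \<noteq> 0 \<or> c 2 \<noteq> 0" using rel[of 0] g(1) x_pos[of k] by auto
  thus ?thesis
  proof (elim disjE)
    assume c: "c 0 \<noteq> 0"
    have "app F (x p) 0 = 0" if "degree F \<le> n" "app F (x k) 0 = 0" "app F (x q) 0 = 0" "app F (x r) 0 = 0" for F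
      using ap[OF that(1)] that c by simp
    thus ?thesis by (intro exI[of _ "x q"] exI[of _ "x r"]) (auto simp: ann_top)
  next
    assume c: "c 1 \<noteq> 0"
    have "app F (x q) 0 = 0" if "degree F \<le> n" "app F (x k) 0 = 0" "app F (x p) 0 = 0" "app F (x r) 0 = 0" for F
      using ap[OF that(1)] that c by simp
    thus ?thesis by (intro exI[of _ "x p"] exI[of _ "x r"]) (auto simp: ann_top)
  next
    assume c: "c 2 \<noteq> 0"
    have "app F (x r) 0 = 0" if "degree F \<le> n" "app F (x k) 0 = 0" "app F (x p) 0 = 0" "app F (x q) 0 = 0" for F
      using ap[OF that(1)] that c by simp
    thus ?thesis by (intro exI[of _ "x p"] exI[of _ "x q"]) (auto simp: ann_top)
  qed
qed

text \<open>If the level \<open>m + 1\<close> annihilator of \<open>x k\<close> and v had dimension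
  two, some Q would kill both already at level m, and at level \<open>m + 2\<close> their
  annihilators would be multiples of Q. Whether a multiple of Q kills w depends only on the sequence
  \<open>app Q w\<close>, with \<open>m + 1\<close> relevant entries. Two dimensions of quadratic
  annihilators of this sequence force a linear one B, and then \<open>B * Q\<close> kills K at level
  \<open>m + 1\<close>.\<close>

lemma no_common_kernel:
  assumes K3: "ann n (m + 1) K = {0}" "2 \<le> pdim (ann n (m + 2) K)"
    and v: "ann n n K \<subseteq> ann n n {x k, v}" "ann n n {x k, v, w} \<subseteq> ann n n K"
    and w: "ann n n K \<subseteq> ann n n {w}" and indep: "\<not> ann n n {x k} \<subseteq> ann n n {v}" and k: "i0 \<le> k"
  shows "pdim (ann n (m + 1) {x k, v}) < 2"
proof (rule ccontr)
  assume "\<not> pdim (ann n (m + 1) {x k, v}) < 2"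
  hence p2: "2 \<le> pdim (ann n (m + 1) {x k, v})" by simp
  obtain F0 where "F0 \<in> ann n n {x k}" "F0 \<notin> ann n n {v}" using indep by blast
  hence F0: "F0 \<in> ann n n {x k}" "app F0 v 0 \<noteq> 0" by (auto simp: ann_top)
  have "pdim {F \<in> ann n n {x k}. app F v 0 = 0} + 1 = pdim (ann n n {x k})"
    by (rule pdim_cut[OF submod_ann degb_ann F0])
  moreover have "{F \<in> ann n n {x k}. app F v 0 = 0} = ann n n {x k, v}" by (auto simp: ann_top)
  ultimately have rk: "pdim (ann n n {x k, v}) = n - 1" using pdim_ann_n_point[of k] by simp
  have "ann n m {x k, v} \<noteq> {0}"
  proof
    assume z: "ann n m {x k, v} = {0}"
    have "pdim (ann n (m + 1) {x k, v}) \<le> 1"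
      by (rule castel_dim[of "m + 1" n m _ "n - 1"]) (use levels n_eq m3 z rk in auto)
    thus False using p2 by simp
  qed
  then obtain Q where Q: "Q \<in> ann n m {x k, v}" "Q \<noteq> 0" using zero_ann[of n m "{x k, v}"] by blast
  have Kzero: "F = 0" if "F \<in> ann n (m + 1) {x k, v, w}" for F
    using ann_level_mono[OF levels(3) v(2)] that K3(1) by auto
  let ?W = "app Q w"
  have W: "\<exists>t\<le>m. ?W t \<noteq> 0"
  proof (rule ccontr)
    assume neg: "\<not> ?thesis"
    have "Q \<in> ann n m {x k, v, w}"
    proof (rule annI[OF ann_degree[OF Q(1)]])
      fix u j assume u: "u \<in> {x k, v, w}" "j \<le> n - m"
      show "app Q u j = 0"
      proof (cases "u \<in> {x k, v}")
        case True
        thus ?thesis using annD[OF Q(1)] u(2) by blast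
      next
        case False
        hence "u = w" using u(1) by blast
        thus ?thesis using neg u(2) levels(9) by auto
      qed
    qed
    hence "Q \<in> ann n (m + 1) {x k, v, w}" by (rule ann_mono_level[rotated 2]) (use levels in auto)
    thus False using Kzero Q(2) by blast
  qed
  have kv: "pdim (ann n (m + 2) {x k, v}) \<le> 3"
    by (rule castel_dim[of "m + 2" n "m - 1" _ "n - 1"])
      (use levels n_eq m3 rk ann_zero_superset[OF rank0[OF k], of "{x k, v}"] in auto)
  \<comment> \<open>These products already have dimension 3, the maximum for the annihilator of
    \<open>x k\<close> and v, so up to integer factors they exhaust it.\<close>
  let ?T = "{A * Q | A. degree A \<le> 2}"
  have Tsub: "?T \<subseteq> ann n (m + 2) {x k, v}" using ann_mult[OF Q(1) _ levels(4)] by blast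
  have smT: "submod ?T"
    unfolding submod_def
  proof (intro conjI ballI allI)
    show "0 \<in> ?T" by (rule CollectI, rule exI[of _ 0]) simp
    fix P P' c assume "P \<in> ?T"
    then obtain A where A: "P = A * Q" "degree A \<le> 2" by blast
    have "smult c P = smult c A * Q" "degree (smult c A) \<le> 2" using A degree_smult_le[of c A] by auto
    thus "smult c P \<in> ?T" by blast
    assume "P' \<in> ?T"
    then obtain A' where A': "P' = A' * Q" "degree A' \<le> 2" by blast
    have "P + P' = (A + A') * Q" "degree (A + A') \<le> 2" using A A' by (auto simp: distrib_right degree_add_le)
    thus "P + P' \<in> ?T" by blast
  qed
  have "3 \<le> pdim ?T"
  proof (rule monom_mults_pdim[OF Q(2) _ degb_subset[OF degb_ann Tsub]])
    fix a :: nat assume "a < 3"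
    hence "degree (monom (1::int) a) \<le> 2" using degree_monom_le[of "1::int" a] by linarith
    thus "monom 1 a * Q \<in> ?T" by blast
  qed
  hence le: "pdim (ann n (m + 2) {x k, v}) \<le> pdim ?T" using kv by simp
  have quot: "\<exists>A. A \<in> ann m 2 {?W} \<and> A \<noteq> 0 \<and> degree F = degree A + degree Q" if F: "F \<in> ann n (m + 2) K" "F \<noteq> 0" for F
  proof -
    have "F \<in> ann n (m + 2) {x k, v}" using ann_level_mono[OF levels(4) v(1)] F(1) by blast
    from full_pdim_scaled_mem[OF smT submod_ann Tsub degb_ann le this]
    obtain c A where A: "c \<noteq> 0" "smult c F = A * Q" "degree A \<le> 2" by blast
    have A0: "A \<noteq> 0" using A F(2) by auto
    have "degree F = degree (A * Q)" using A by (metis degree_smult_eq)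
    hence deg: "degree F = degree A + degree Q" using A0 Q(2) by (simp add: degree_mult_eq)
    have "A \<in> ann m 2 {?W}"
    proof (rule annI[OF A(3)])
      fix u j assume u: "u \<in> {?W}" "j \<le> m - 2"
      have "F \<in> ann n (m + 2) {w}"
      proof -
        show ?thesis using ann_level_mono[OF levels(4) w] F(1) by blast
      qed
      hence "app F w j = 0" using u(2) levels(8) annD[of F n "m + 2" "{w}" w j] by simp
      hence "app (A * Q) w j = 0" using arg_cong[OF A(2), of "\<lambda>P. app P w j"] by (simp add: app_smult)
      thus "app A u j = 0" using u(1) by (simp add: app_mult)
    qed
    thus ?thesis using A0 deg by blast
  qed
  obtain F G where FG: "F \<in> ann n (m + 2) K" "G \<in> ann n (m + 2) K" "F \<noteq> 0" "G \<noteq> 0" "degree F \<noteq> degree G"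
    using two_degrees[OF K3(2) degb_ann] by blast
  obtain A A' where AA: "A \<in> ann m 2 {?W}" "A \<noteq> 0" "degree F = degree A + degree Q"
    "A' \<in> ann m 2 {?W}" "A' \<noteq> 0" "degree G = degree A' + degree Q"
    using quot[OF FG(1,3)] quot[OF FG(2,4)] by blast
  have W2: "2 \<le> pdim (ann m 2 {?W})" by (rule pdim_ge_2[OF AA(1,4,2,5) _ degb_ann]) (use AA FG(5) in auto)
  obtain t where t: "t \<le> m" "?W t \<noteq> 0" using W by blast
  have Wm: "pdim (ann m m {?W}) \<le> m"
  proof -
    have ap: "app (monom 1 t * 1) ?W 0 = ?W t" unfolding app_monom_mult by (simp add: app_def)
    have "pdim {F \<in> {F. degree F \<le> m}. app F ?W 0 = 0} + 1 = pdim {F :: int poly. degree F \<le> m}"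
      by (rule pdim_cut[OF submod_all, of m m "monom 1 t * 1"])
        (use t ap in \<open>auto simp: degb_def intro: order.trans[OF degree_monom_le]\<close>)
    moreover have "{F \<in> {F. degree F \<le> m}. app F ?W 0 = 0} = ann m m {?W}" by (auto simp: ann_top)
    ultimately show ?thesis by (simp add: pdim_all)
  qed
  have "ann m 1 {?W} \<noteq> {0}"
  proof
    assume z: "ann m 1 {?W} = {0}"
    have "pdim (ann m 2 {?W}) \<le> 1" by (rule castel_dim[of 2 m 1 _ m]) (use m3 z Wm in auto)
    thus False using W2 by simp
  qed
  then obtain B where B: "B \<in> ann m 1 {?W}" "B \<noteq> 0" using zero_ann[of m 1 "{?W}"] by blast
  have BQ: "B * Q \<in> ann n (m + 1) {x k, v}"
    by (rule ann_mult[OF Q(1) ann_degree[OF B(1)] levels(3)])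
  have "B * Q \<in> ann n (m + 1) {x k, v, w}"
  proof (rule annI[OF ann_degree[OF BQ]])
    fix u j assume u: "u \<in> {x k, v, w}" "j \<le> n - (m + 1)"
    show "app (B * Q) u j = 0"
    proof (cases "u \<in> {x k, v}")
      case True
      thus ?thesis using annD[OF BQ] u(2) by blast
    next
      case False
      hence "u = w" using u(1) by blast
      thus ?thesis using annD[OF B(1), of ?W j] u(2) levels(7) by (simp add: app_mult)
    qed
  qed
  hence "B * Q = 0" by (rule Kzero)
  thus False using B(2) Q(2) by simp
qed

text \<open>Three-dimensional analogue of \<open>E1\<close>. Let F and G span the level
  \<open>m + 1\<close> annihilator of \<open>x k\<close>, and let b1, b2 complete \<open>x k\<close>
  to a basis of the span. The determinant is non-zero as soon as the \<open>2 \<times> 2\<close>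
  matrix of the values of F and G on b1 and b2, summed over two shifts, is regular. If all of these
  are singular, the pencil lemma gives either a vector of the span on which F and G both vanish,
  excluded by \<open>no_common_kernel\<close>, or a combination of F and G killing the whole span,
  excluded by \<open>blocks\<close>.\<close>

lemma B0:
  assumes i: "i0 \<le> i" and q: "rix 2 i = Suc q" and k: "rix 3 i = Suc k" and two: "2 \<le> pdim (ann n (m + 2) (blk i k))"
  shows "(real m - 1) * y (Suc k) + y (Suc q) + y (Suc i) \<le> \<mu> * y (Suc q)"
proof -
  let ?K = "{x (Suc q), x q, x i}"
  have iq: "Suc i \<le> q" using rix2_gt[OF levels(5), of i] q by simp
  have qk: "Suc q \<le> k" using rix3_gt[OF levels(6), of i] q k by simp
  have annV: "ann n n (blk i k) = ann n n ?K" by (rule blk_triple[OF levels(6) q qk]) (use k in simp)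
  have "ann n (m + 1) (blk i k) = {0}" by (rule ann_zero_superset[OF blocks[OF i]]) (use q qk in auto)
  hence zero: "ann n (m + 1) ?K = {0}" using ann_level_cong[OF levels(3) annV] by simp
  have two': "2 \<le> pdim (ann n (m + 2) ?K)" using two ann_level_cong[OF levels(4) annV] by simp
  have Kk: "ann n n ?K \<subseteq> ann n n {x k}" unfolding annV[symmetric] using qk iq by (intro ann_antimono) auto
  have rkK: "pdim (ann n n ?K) \<le> n - 2" using rix_le[of i 2] blk_triple_rix2[OF levels(5) q] q by simp
  have ik: "i0 \<le> k" using i iq qk by simp
  obtain b1 b2 where b: "b1 \<in> ?K" "b2 \<in> ?K" "ann n n {x k, b1, b2} \<subseteq> ann n n ?K"
    using basis_through[OF Kk] by blast
  have Kb: "ann n n ?K \<subseteq> ann n n {b1}" "ann n n ?K \<subseteq> ann n n {b2}" using b(1,2) by (intro ann_antimono; simp)+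
  have rk3: "pdim (ann n n {x k, b1, b2}) \<le> n - 2"
    using pdim_mono[OF degb_ann b(3)] rkK by simp
  have pair_rk: "n - 1 \<le> pdim (ann n n {x k, b})" for b
    using pdim_ann_insert[of n "{x k}" b] pdim_ann_n_point[of k] by (simp add: insert_commute)
  have dk: "pdim (ann n (m + 1) {x k}) \<le> 2" by (rule dim_point1[OF ik])
  have "2 \<le> pdim (ann n (m + 1) {x k})" using pdim_ann_single_ge[OF levels(3), of "x k"] n_eq by simp
  then obtain F G where FG: "F \<in> ann n (m + 1) {x k}" "G \<in> ann n (m + 1) {x k}" "F \<noteq> 0" "G \<noteq> 0" "degree F \<noteq> degree G"
    using two_degrees[OF _ degb_ann] by blast
  have "\<exists>j j'. j < m \<and> j' < m \<and> (app F b1 j + app F b1 j') * (app G b2 j + app G b2 j') \<noteq> (app F b2 j + app F b2 j') * (app G b1 j + app G b1 j')"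
  proof (rule ccontr)
    assume neg: "\<not> ?thesis"
    have sing: "(app F b1 j + app F b1 j') * (app G b2 j + app G b2 j') = (app F b2 j + app F b2 j') * (app G b1 j + app G b1 j')"
      if "j < m" "j' < m" for j j' using neg that by simp
    have "(\<exists>\<alpha> \<beta>. (\<alpha> \<noteq> 0 \<or> \<beta> \<noteq> 0) \<and> (\<forall>j<m. \<alpha> * app F b1 j + \<beta> * app F b2 j = 0 \<and> \<alpha> * app G b1 j + \<beta> * app G b2 j = 0)) \<or>
      (\<exists>\<alpha> \<beta>. (\<alpha> \<noteq> 0 \<or> \<beta> \<noteq> 0) \<and> (\<forall>j<m. \<alpha> * app F b1 j + \<beta> * app G b1 j = 0 \<and> \<alpha> * app F b2 j + \<beta> * app G b2 j = 0))" (is "?A \<or> ?B")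
      by (rule singular_pencil[of "\<lambda>j. j < m"]) (rule sing)
    thus False
    proof
      assume ?A
      then obtain \<alpha> \<beta> where ab: "\<alpha> \<noteq> 0 \<or> \<beta> \<noteq> 0" and
        ker: "\<forall>j<m. \<alpha> * app F b1 j + \<beta> * app F b2 j = 0 \<and> \<alpha> * app G b1 j + \<beta> * app G b2 j = 0" by blast
      show False
      proof -
        define v where "v = (\<lambda>t. \<alpha> * b1 t + \<beta> * b2 t)"
        have apv: "app P v j = \<alpha> * app P b1 j + \<beta> * app P b2 j" for P j unfolding v_def by (rule app_comb)
        define w where "w = (if \<beta> \<noteq> 0 then b1 else b2)"
        have bw: "ann n n {x k, v, w} \<subseteq> ann n n {x k, b1, b2}"
          using ab by (cases "\<beta> = 0") (auto simp: ann_top apv w_def)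
        have v1: "ann n n ?K \<subseteq> ann n n {x k, v}"
        proof
          fix P assume P: "P \<in> ann n n ?K"
          hence "app P (x k) 0 = 0" "app P b1 0 = 0" "app P b2 0 = 0" "degree P \<le> n"
            using Kk Kb by (auto simp: ann_top)
          thus "P \<in> ann n n {x k, v}" by (auto simp: ann_top apv)
        qed
        have Kw: "ann n n ?K \<subseteq> ann n n {w}" using Kb by (simp add: w_def)
        have indep: "\<not> ann n n {x k} \<subseteq> ann n n {v}"
        proof
          assume sub: "ann n n {x k} \<subseteq> ann n n {v}"
          have "ann n n {x k, w} \<subseteq> ann n n {x k, v, w}"
          proof
            fix P assume P: "P \<in> ann n n {x k, w}"
            hence "P \<in> ann n n {x k}" by (auto simp: ann_top)
            hence "P \<in> ann n n {v}" using sub by blast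
            thus "P \<in> ann n n {x k, v, w}" using P by (auto simp: ann_top)
          qed
          hence "ann n n {x k, w} \<subseteq> ann n n {x k, b1, b2}" using bw by blast
          from pdim_mono[OF degb_ann this] show False using rk3 pair_rk[of w] levels(5) by simp
        qed
        have "F \<in> ann n (m + 1) {x k, v}" "G \<in> ann n (m + 1) {x k, v}"
        proof -
          have "app F v j = 0 \<and> app G v j = 0" if "j \<le> n - (m + 1)" for j
            using ker that levels(7) m3 by (simp add: apv)
          thus "F \<in> ann n (m + 1) {x k, v}" "G \<in> ann n (m + 1) {x k, v}"
            using FG(1,2) by (auto simp: ann_def)
        qed
        hence "2 \<le> pdim (ann n (m + 1) {x k, v})" using FG by (intro pdim_ge_2[OF _ _ _ _ _ degb_ann])
        moreover have "ann n n {x k, v, w} \<subseteq> ann n n ?K" using bw b(3) by blast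
        ultimately show False using no_common_kernel[OF zero two' v1 _ Kw indep ik] by simp
      qed
    next
      assume ?B
      then obtain \<alpha> \<beta> where ab: "\<alpha> \<noteq> 0 \<or> \<beta> \<noteq> 0" and
        ker: "\<forall>j<m. \<alpha> * app F b1 j + \<beta> * app G b1 j = 0 \<and> \<alpha> * app F b2 j + \<beta> * app G b2 j = 0" by blast
      show False
      proof -
        let ?P = "smult \<alpha> F + smult \<beta> G"
        have nz: "?P \<noteq> 0" by (rule comb_nonzero[OF FG(3-5) ab])
        have P1: "?P \<in> ann n (m + 1) {x k}" by (intro submod_add submod_smult submod_ann FG)
        have "app ?P b1 j = 0 \<and> app ?P b2 j = 0" if "j \<le> n - (m + 1)" for j
          using ker that levels(7) m3 by (simp add: app_add app_smult)
        hence "?P \<in> ann n (m + 1) {x k, b1, b2}" using P1 by (auto simp: ann_def)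
        hence "?P \<in> ann n (m + 1) ?K" using ann_level_mono[OF levels(3) b(3)] by blast
        thus False using zero nz by simp
      qed
    qed
  qed
  then obtain j j' where j: "j < m" "j' < m"
    and det: "(app F b1 j + app F b1 j') * (app G b2 j + app G b2 j') \<noteq> (app F b2 j + app F b2 j') * (app G b1 j + app G b1 j')" by blast
  let ?js = "filter (\<lambda>l. l \<noteq> j) [0..<m]" and ?ps = "[Suc q, q, i]" and ?N = "Suc (m + 1)"
  let ?us = "map (grow j j') ?ps @ map (shrow k) ?js @ []"
  have D: "1 \<le> \<bar>real_of_int (rdet ?N ?us)\<bar>"
  proof (rule full_rows_det)
    show "length ?us = Suc (m + 1)" using length_filter_neq[OF j(1)] m3 by simp
    fix H assume H: "degree H \<le> m + 1" "\<And>u. u \<in> set ?us \<Longrightarrow> app H u 0 = 0"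
    have gp: "app H (x p) j + app H (x p) j' = 0" if "p \<in> {Suc q, q, i}" for p
    proof -
      have "grow j j' p \<in> set ?us" using that by auto
      from H(2)[OF this] show ?thesis by (simp only: app_grow)
    qed
    have hk: "app H (x k) l = 0" if "l < m" "l \<noteq> j" for l
    proof -
      have "shrow k l \<in> set ?us" using that by auto
      from H(2)[OF this] show ?thesis by (simp only: app_shrow)
    qed
    let ?P = "(monom 1 j + monom 1 j') * H"
    have apP: "app ?P v 0 = app H v j + app H v j'" for v
      by (simp add: distrib_right app_add app_monom_mult)
    have "degree (monom (1::int) j + monom 1 j') \<le> m - 1"
      using j by (intro degree_add_le order.trans[OF degree_monom_le]) auto
    hence "degree ?P \<le> n" using degree_mult_le[of "monom (1::int) j + monom 1 j'" H] H(1) n_eq m3 by linarith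
    hence "?P \<in> ann n n ?K" using gp by (auto simp: ann_top apP)
    hence "?P \<in> ann n n {x k}" using Kk by blast
    hence "app H (x k) j + app H (x k) j' = 0" by (simp add: ann_top apP)
    hence "app H (x k) j = 0" using hk[OF j(2)] by (cases "j' = j") auto
    hence hk': "app H (x k) l = 0" if "l < m" for l using hk that by (cases "l = j") auto
    have "H \<in> ann n (m + 1) {x k}" by (rule annI[OF H(1)]) (use hk' levels(7) m3 in auto)
    then obtain c a b where cab: "c \<noteq> 0" "smult c H = smult a F + smult b G"
      using span2[OF submod_ann degb_ann dk FG] by blast
    have gb: "app H b1 j + app H b1 j' = 0" "app H b2 j + app H b2 j' = 0" using b(1,2) gp by auto
    have lin: "c * (app H u j + app H u j') = a * (app F u j + app F u j') + b * (app G u j + app G u j')" for u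
      using arg_cong[OF cab(2), of "\<lambda>P. app P u j"] arg_cong[OF cab(2), of "\<lambda>P. app P u j'"]
      by (simp add: app_add app_smult algebra_simps)
    define A1 A2 G1 G2 where "A1 = app F b1 j + app F b1 j'" and "A2 = app F b2 j + app F b2 j'"
      and "G1 = app G b1 j + app G b1 j'" and "G2 = app G b2 j + app G b2 j'"
    have l1: "a * A1 + b * G1 = 0" and l2: "a * A2 + b * G2 = 0"
      using lin[of b1] lin[of b2] gb by (auto simp: A1_def A2_def G1_def G2_def)
    have dt: "A1 * G2 - A2 * G1 \<noteq> 0" using det by (simp add: A1_def A2_def G1_def G2_def)
    have "a * (A1 * G2 - A2 * G1) = G2 * (a * A1 + b * G1) - G1 * (a * A2 + b * G2)"
      "b * (A1 * G2 - A2 * G1) = A1 * (a * A2 + b * G2) - A2 * (a * A1 + b * G1)" by (simp_all add: algebra_simps)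
    hence "a * (A1 * G2 - A2 * G1) = 0" "b * (A1 * G2 - A2 * G1) = 0" unfolding l1 l2 by simp_all
    hence "a = 0" "b = 0" using dt by simp_all
    thus "H = 0" using cab by simp
  qed
  have "ln 1 + ((\<Sum>p\<leftarrow>[q, i]. y (Suc p)) + real (length ?js) * y (Suc k)) / \<nu> \<le> y (Suc q) + real (length ([] :: (nat \<Rightarrow> int) list)) * ln 1 + C4 ?N"
  proof (rule reduced_rows_log[where aw = 0 and lw = 1 and D = 1])
    show "length ?ps + length ?js + length ([] :: (nat \<Rightarrow> int) list) = ?N" using length_filter_neq[OF j(1)] m3 by simp
    show "?ps = Suc q # [q, i]" by simp
    show "j + ?N \<le> Suc n" "j' + ?N \<le> Suc n" using j n_eq by auto
    show "l + ?N \<le> Suc n" if "l \<in> set ?js" for l using that n_eq by auto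
    show "ann n n (x ` set ?ps) \<subseteq> ann n n {x k}" using Kk by simp
    show "1 \<le> \<bar>real_of_int (rdet ?N ?us)\<bar>" by (rule D)
    show "0 * L (Suc q) \<le> Xv (Suc q) * 1" using X_ge_1[of "Suc q"] by simp
  qed (use iq in auto)
  hence "(y (Suc q) + y (Suc i) + (real m - 1) * y (Suc k)) / \<nu> \<le> y (Suc q) + C4 ?N"
    using length_filter_neq[OF j(1)] m3 by (simp add: of_nat_diff)
  hence "\<nu> * ((y (Suc q) + y (Suc i) + (real m - 1) * y (Suc k)) / \<nu>) \<le> \<nu> * (y (Suc q) + C4 ?N)"
    using nu_pos by (intro mult_left_mono) auto
  hence "y (Suc q) + y (Suc i) + (real m - 1) * y (Suc k) \<le> \<nu> * y (Suc q) + \<nu> * C4 ?N"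
    using nu_pos by (simp add: distrib_left)
  moreover have "\<nu> * (C4 ?N + K0) \<le> (\<mu> - \<nu>) * y (Suc q)"
    using big[of "Suc q" "m + 1" 0] i iq levels(3) by simp
  moreover have "0 \<le> \<nu> * K0" using nu_pos K0_nonneg by simp
  ultimately show ?thesis unfolding left_diff_distrib distrib_left by linarith
qed

lemma blk_insert: "h < k \<Longrightarrow> blk h k = insert (x h) (blk (Suc h) k)"
proof -
  assume "h < k"
  hence "{h..k} = insert h {Suc h..k}" by auto
  thus ?thesis by simp
qed

text \<open>Put I = h + 1. If k is not I, then \<open>x k\<close> does not lie in the span of the
  preceding points from I on, so k can only be I + 1, \<open>rix 2 I\<close> or
  \<open>rix 3 I\<close>; beyond \<open>rix 3 I\<close> the level \<open>m + 2\<close> annihilator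
  would be too small. At each possible position a full determinant at level \<open>m + 2\<close>
  leads to a contradiction.\<close>

lemma block_step_absurd:
  assumes h: "i0 \<le> h" and hk: "Suc h \<le> k"
    and Z: "ann n (m + 2) (blk h k) = {0}" and NZ1: "ann n (m + 2) (blk (Suc h) k) \<noteq> {0}"
    and NZ2: "ann n (m + 2) (blk h (k - 1)) \<noteq> {0}"
  shows False
proof -
  define I where "I = Suc h"
  have iI: "i0 \<le> I" using h by (simp add: I_def)
  have a: "0 < y I" "0 < y (Suc I)" using y_pos iI by auto
  show False
  proof (cases "k = I")
    case True
    have "{h..k} = {k, h}" using True by (auto simp: I_def)
    hence "dsum (real (m + 2) + 1) [I, h] [4, 0] \<le> y (Suc I) + \<mu> * y I"
      using Z True by (intro full_dims[OF levels(4)]) (use iI dim_point2[of I] in \<open>auto simp: I_def insert_commute\<close>)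
    hence "(real m - 2) * y (Suc I) + 4 * y I \<le> \<mu> * y I" by (simp add: I_def algebra_simps)
    moreover have "(real m - 2) * y I \<le> (real m - 2) * y (Suc I)"
      using y_mono[of I "Suc I"] m3 by (intro mult_left_mono) auto
    ultimately have "(real m + 2) * y I \<le> \<mu> * y I" by (simp add: algebra_simps)
    hence "real m + 2 \<le> \<mu>" using a(1) by simp
    thus False using s_lt by simp
  next
    case False
    then obtain k' where k': "k = Suc k'" "I \<le> k'" using hk by (cases k) (auto simp: I_def)
    have hk1: "h < k" "h < k'" using k' by (auto simp: I_def)
    have ins: "ann n n (blk h c) = ann n n {x h} \<inter> ann n n (blk I c)" if "h < c" for c
      unfolding blk_insert[OF that] I_def by (rule ann_insert)
    have A: "ann n n (blk I k) \<noteq> ann n n (blk I k')"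
    proof
      assume "ann n n (blk I k) = ann n n (blk I k')"
      hence "ann n n (blk h k) = ann n n (blk h k')" using ins[OF hk1(1)] ins[OF hk1(2)] by simp
      hence "ann n (m + 2) (blk h k) = ann n (m + 2) (blk h k')" by (rule ann_level_cong[OF levels(4)])
      thus False using Z NZ2 k' by simp
    qed
    \<comment> \<open>Two polynomials are at hand that kill this block, one of them also
      \<open>x k\<close>, the other also \<open>x h\<close>. On a line they would be proportional
      and kill everything.\<close>
    have dim2: "2 \<le> pdim (ann n (m + 2) (blk I k'))"
    proof (rule ccontr)
      assume "\<not> ?thesis"
      hence p1: "pdim (ann n (m + 2) (blk I k')) \<le> 1" by simp
      obtain P where P: "P \<in> ann n (m + 2) (blk I k)" "P \<noteq> 0" using NZ1 zero_ann[of n "m + 2" "blk I k"] unfolding I_def by blast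
      obtain P' where P': "P' \<in> ann n (m + 2) (blk h k')" "P' \<noteq> 0" using NZ2 zero_ann[of n "m + 2" "blk h k'"] k' by auto
      have "blk I k' \<subseteq> blk I k" using k' by (intro image_mono) auto
      hence PI: "P \<in> ann n (m + 2) (blk I k')" using P(1) ann_antimono[of "blk I k'" "blk I k" n "m + 2"] by blast
      have sub: "ann n (m + 2) (blk h k') \<subseteq> ann n (m + 2) (blk I k')" by (rule ann_antimono) (auto simp: I_def)
      have le: "pdim (ann n (m + 2) (blk I k')) \<le> pdim (ann n (m + 2) (blk h k'))"
        using p1 pdim_pos[OF degb_ann P'] by simp
      have "P \<in> ann n (m + 2) (blk h k')"
        by (rule full_pdim_mem[OF submod_ann submod_ann sub degb_ann le PI satur_ann])
      hence "P \<in> ann n (m + 2) {x h}" using ann_antimono[of "{x h}" "blk h k'" n "m + 2"] hk1 by auto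
      hence "P \<in> ann n (m + 2) (blk h k)"
        using P(1) unfolding blk_insert[OF hk1(1)] I_def ann_insert[of n "m + 2" "x h" "blk (Suc h) k"] by blast
      thus False using Z P(2) by simp
    qed
    \<comment> \<open>If \<open>x h\<close> lay in the plane of the next two points, adding it to
      the block could not remove annihilators.\<close>
    have r2h: "rix 2 h = Suc I"
    proof (rule ccontr)
      assume "rix 2 h \<noteq> Suc I"
      hence lt: "Suc I < rix 2 h" using rix2_gt[OF levels(5), of h] by (simp add: I_def)
      have "ann n n (blk I k) \<subseteq> ann n n {x I, x (Suc I)}" using k' by (intro ann_antimono) auto
      also have "\<dots> = ann n n (blk h (Suc I))"
        using blk_pair[OF levels(5), of h I "Suc I" "Suc I"] lt by (simp add: I_def)
      also have "\<dots> \<subseteq> ann n n {x h}" by (intro ann_antimono) (auto simp: I_def)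
      finally have "ann n n (blk h k) = ann n n (blk I k)" using ins[OF hk1(1)] by blast
      hence "ann n (m + 2) (blk h k) = ann n (m + 2) (blk I k)" by (rule ann_level_cong[OF levels(4)])
      thus False using Z NZ1 by (simp add: I_def)
    qed
    have "{h..Suc I} = {h, I, Suc I}" by (auto simp: I_def)
    hence zero: "ann n (m + 1) {x h, x (Suc h), x (Suc (Suc h))} = {0}"
      using blocks[OF h] r2h by (simp add: I_def)
    obtain q where q: "rix 2 I = Suc q" "Suc I \<le> q" using rix_pred[OF levels(5), of I] by metis
    have iq: "i0 \<le> q" using q iI by simp
    have E1': "(real m - 1) * y (Suc q) + y (Suc I) + y I \<le> \<mu> * y (Suc I)"
      unfolding I_def by (rule E1[OF n_eq _ _ h _ _ zero])
        (use m3 q iI iq dim_point1[of q] dim_pair1[of I] in \<open>auto simp: I_def\<close>)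
    have E0': "real m * y (Suc I) \<le> \<mu> * y I" unfolding I_def by (rule E0[OF h])
    consider "k = Suc I" | "Suc I < k" "k < Suc q" | "k = Suc q" "Suc I < k" | "Suc q < k" "k < rix 3 I" | "k = rix 3 I" | "rix 3 I < k"
      using k' q rix3_gt[OF levels(6), of I] by linarith
    thus False
    proof cases
      case 1
      have "{h..k} = {Suc I, I, h}" using 1 by (auto simp: I_def)
      hence "dsum (real (m + 2) + 1) [Suc I, I, h] [4, 3, 0] \<le> y (Suc (Suc I)) + \<mu> * y (Suc I)"
        using Z by (intro full_dims[OF levels(4)])
          (use iI dim_point2[of "Suc I"] dim_pair2[of I] in \<open>auto simp: I_def insert_commute\<close>)
      hence "(real m - 2) * y (Suc (Suc I)) + y (Suc I) + 3 * y I \<le> \<mu> * y (Suc I)" by (simp add: I_def algebra_simps)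
      moreover have "(real m - 2) * y (Suc I) \<le> (real m - 2) * y (Suc (Suc I))"
        using y_mono[of "Suc I" "Suc (Suc I)"] m3 by (intro mult_left_mono) auto
      ultimately have "3 * y I \<le> (s + 1) * y (Suc I)" by (simp add: algebra_simps)
      hence "real m * (3 * y I) \<le> real m * ((s + 1) * y (Suc I))" by (intro mult_left_mono) auto
      also have "\<dots> = (s + 1) * (real m * y (Suc I))" by simp
      also have "\<dots> \<le> (s + 1) * (\<mu> * y I)" using E0' mu_gt by (intro mult_left_mono) auto
      finally have "y I * (3 * real m) \<le> y I * ((s + 1) * \<mu>)" by (simp add: mult_ac)
      hence "3 * real m \<le> (s + 1) * \<mu>" using a(1) by simp
      hence "(2 - s) * real m \<le> s * s + s" by (simp add: algebra_simps)
      moreover have False if "A \<le> \<sigma> * \<sigma> + \<sigma>" "2 * \<sigma>\<^sup>2 - \<sigma> + 1 < A" for A \<sigma> :: real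
      proof -
        have "0 \<le> (\<sigma> - 1) * (\<sigma> - 1)" by simp
        hence "0 \<le> \<sigma> * \<sigma> - 2 * \<sigma> + 1" by (simp add: algebra_simps)
        thus False using that unfolding power2_eq_square by linarith
      qed
      ultimately show False using s_bound by blast
    next
      case 2
      have "ann n n (blk I k) = ann n n {x I, x (Suc I)}" "ann n n (blk I k') = ann n n {x I, x (Suc I)}"
        using blk_pair[OF levels(5), of I I "Suc I" k] blk_pair[OF levels(5), of I I "Suc I" k'] 2 k' q by auto
      thus False using A by simp
    next
      case 3
      let ?cs = "[Suc q, q, I, h]"
      have "ann n n (blk h k) = ann n n {x h} \<inter> ann n n {x (Suc q), x q, x I}"
        using ins[OF hk1(1)] blk_triple_rix2[OF levels(5) q(1)] 3 by simp
      also have "\<dots> = ann n n (x ` set ?cs)" by (auto simp: ann_top)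
      finally have "ann n (m + 2) (x ` set ?cs) = {0}" using Z ann_level_cong[OF levels(4)] by metis
      hence "dsum (real (m + 2) + 1) ?cs [4, 3, 2, 0] \<le> y (Suc (Suc q)) + \<mu> * y (Suc q)"
        by (intro full_dims[OF levels(4)])
          (use iI iq q dim_point2[of "Suc q"] dim_pair2[of q] dim_triple2[OF iI q(1)] in \<open>auto simp: I_def insert_commute\<close>)
      hence "(real m - 2) * y (Suc (Suc q)) + y (Suc q) + y (Suc I) + 2 * y I \<le> \<mu> * y (Suc q)" by (simp add: I_def algebra_simps)
      moreover have "(real m - 2) * y (Suc q) \<le> (real m - 2) * y (Suc (Suc q))"
        using y_mono[of "Suc q" "Suc (Suc q)"] m3 by (intro mult_left_mono) auto
      ultimately have "2 * y I + y (Suc I) \<le> (s + 1) * y (Suc q)" by (simp add: algebra_simps)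
      thus False by (rule three_ineq[OF a(1) E0' E1'])
    next
      case 4
      have "ann n n (blk I k) = ann n n (blk I k')"
        using blk_triple[OF levels(6) q(1), of k] blk_triple[OF levels(6) q(1), of k'] 4 k' by simp
      thus False using A by simp
    next
      case 5
      have qk': "Suc q \<le> k'" using rix3_gt[OF levels(6), of I] q(1) 5 k'(1) by simp
      let ?K3 = "{x (Suc q), x q, x I}"
      have annk': "ann n n (blk I k') = ann n n ?K3" by (rule blk_triple[OF levels(6) q(1) qk']) (use 5 k' in simp)
      have annk: "ann n n (blk I k) = ann n n {x k} \<inter> ann n n ?K3"
        using blk_Suc[of I k'] k' annk' ann_insert[of n n "x k" "blk I k'"] by simp
      \<comment> \<open>The index k' is inserted because the dimension bound after two points at
        level \<open>m + 2\<close> is available for consecutive pairs; it does not change the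
        span.\<close>
      let ?cs = "[k, k', Suc q, q, I, h]"
      have K3k': "ann n n ?K3 \<subseteq> ann n n {x k'}" unfolding annk'[symmetric] using k' by (intro ann_antimono) auto
      have eqI: "ann n n {x I, x q, x (Suc q), x k', x k} = ann n n (blk I k)"
        unfolding annk using K3k' by (auto simp: ann_top)
      have "ann n n (x ` set ?cs) = ann n n {x h} \<inter> ann n n {x I, x q, x (Suc q), x k', x k}" by (auto simp: ann_top)
      hence "ann n n (x ` set ?cs) = ann n n (blk h k)" unfolding eqI using ins[OF hk1(1)] by simp
      hence fin: "ann n (m + 2) (x ` set ?cs) = {0}" using Z ann_level_cong[OF levels(4)] by metis
      have "\<not> ann n n {x q, x (Suc q)} \<subseteq> ann n n {x k}"
      proof
        assume sub: "ann n n {x q, x (Suc q)} \<subseteq> ann n n {x k}"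
        have "ann n n ?K3 \<subseteq> ann n n {x q, x (Suc q)}" by (rule ann_antimono) auto
        hence "ann n n (blk I k) = ann n n (blk I k')" using sub unfolding annk annk' by blast
        thus False using A by simp
      qed
      then obtain F0 where F0: "F0 \<in> ann n n {x q, x (Suc q)}" "F0 \<notin> ann n n {x k}" by blast
      hence nz: "app F0 (x k) 0 \<noteq> 0" by (auto simp: ann_top)
      have "pdim {F \<in> ann n n {x q, x (Suc q)}. app F (x k) 0 = 0} + 1 = pdim (ann n n {x q, x (Suc q)})"
        by (rule pdim_cut[OF submod_ann degb_ann F0(1) nz])
      moreover have "pdim (ann n n {x q, x (Suc q), x k', x k}) \<le> pdim {F \<in> ann n n {x q, x (Suc q)}. app F (x k) 0 = 0}"
      proof (rule pdim_mono)
        show "degb n {F \<in> ann n n {x q, x (Suc q)}. app F (x k) 0 = 0}"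
          by (rule degb_subset[OF degb_ann[of n n "{x q, x (Suc q)}"]]) simp
        show "ann n n {x q, x (Suc q), x k', x k} \<subseteq> {F \<in> ann n n {x q, x (Suc q)}. app F (x k) 0 = 0}"
          by (auto simp: ann_top)
      qed
      ultimately have rk4: "pdim (ann n n {x q, x (Suc q), x k', x k}) \<le> n - 2"
        using pdim_ann_pair[of q "Suc q"] by simp
      have ik': "i0 \<le> k'" using k' iI by simp
      have d2: "pdim (ann n (m + 2) {x k', x k}) \<le> 3" using dim_pair2[OF ik'] k' by simp
      have d3: "pdim (ann n (m + 2) {x (Suc q), x k', x k}) \<le> 3"
        by (rule order.trans[OF pdim_ann_antimono d2]) auto
      have d4: "pdim (ann n (m + 2) {x q, x (Suc q), x k', x k}) \<le> 2"
        by (rule dim_block2[OF iq _ rk4]) (use n_eq m3 in auto)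
      have d5: "pdim (ann n (m + 2) {x I, x q, x (Suc q), x k', x k}) \<le> 1"
      proof (rule castel_dim[of "m + 2" n "m + 1" _ "n - 3"])
        have "ann n (m + 1) (blk I k) = {0}" by (rule ann_zero_superset[OF blocks[OF iI]]) (use q qk' k' in auto)
        thus "ann n (m + 1) {x I, x q, x (Suc q), x k', x k} = {0}" using ann_level_cong[OF levels(3) eqI] by simp
        show "pdim (ann n n {x I, x q, x (Suc q), x k', x k}) \<le> n - 3" unfolding eqI using rix_le[of I 3] 5 by simp
      qed (use levels n_eq m3 in auto)
      have "dsum (real (m + 2) + 1) ?cs [4, 3, 3, 2, 1, 0] \<le> y (Suc k) + \<mu> * y k"
        by (rule full_dims[OF levels(4) _ _ fin])
          (use iI ik' k' qk' q dim_point2[of k] d2 d3 d4 d5 fin in \<open>auto simp: I_def insert_commute\<close>)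
      hence "(real m - 2) * y (Suc k) + y k + y (Suc q) + y (Suc I) + y I \<le> \<mu> * y k"
        using k'(1) by (simp add: I_def algebra_simps)
      moreover have "(real m - 2) * y k \<le> (real m - 2) * y (Suc k)"
        using y_mono[of k "Suc k"] m3 by (intro mult_left_mono) auto
      ultimately have L2: "y I + y (Suc I) + y (Suc q) \<le> (s + 1) * y k" by (simp add: algebra_simps)
      have r3: "rix 3 I = Suc k'" using 5 k' by simp
      have "(real m - 1) * y k + y (Suc q) + y (Suc I) \<le> \<mu> * y (Suc q)"
        using B0[OF iI q(1) r3 dim2] k' by simp
      thus False by (rule four_ineq[OF a E0' E1' L2])
    next
      case 6
      have sub: "blk I (rix 3 I) \<subseteq> blk I k'" using 6 k' by auto
      have "pdim (ann n (m + 2) (blk I (rix 3 I))) \<le> 1"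
      proof (rule castel_dim[of "m + 2" n "m + 1" _ "n - 3"])
        show "ann n (m + 1) (blk I (rix 3 I)) = {0}"
          by (rule ann_zero_superset[OF blocks[OF iI]]) (use rix3_gt[OF levels(6), of I] in auto)
      qed (use levels n_eq m3 rix_le in auto)
      thus False using dim2 pdim_ann_antimono[OF sub, of n "m + 2"] by simp
    qed
  qed
qed

text \<open>\<open>kap i\<close> is the end of the shortest block from i without annihilator at
  level \<open>m + 2\<close>. It exceeds i, since one point leaves at least four dimensions, so it
  must increase somewhere. At such an index h the block loses its property when shortened at either
  end.\<close>

lemma contradiction: False
proof -
  define kap where "kap i = (LEAST k. ann n (m + 2) (blk i k) = {0})" for i
  have zero: "ann n (m + 2) (blk i (kap i)) = {0}" for i
  proof -
    obtain k where "ann n (m + 2) (blk i k) = {0}" using eventually_killed[OF levels(4), of i] by blast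
    thus ?thesis unfolding kap_def by (rule LeastI)
  qed
  have before: "ann n (m + 2) (blk i k) \<noteq> {0}" if "k < kap i" for i k
    using not_less_Least[OF that[unfolded kap_def]] .
  have gt: "i < kap i" for i
  proof (rule ccontr)
    assume "\<not> i < kap i"
    hence "{i..kap i} \<subseteq> {i}" by auto
    hence "blk i (kap i) \<subseteq> {x i}" by auto
    from ann_zero_superset[OF zero this] have "pdim (ann n (m + 2) {x i}) = 0" by simp
    thus False using pdim_ann_single_ge[OF levels(4), of "x i"] n_eq by simp
  qed
  have "\<exists>h\<ge>i0. kap h < kap (Suc h)"
  proof (rule ccontr)
    assume "\<not> ?thesis"
    hence dec: "kap (Suc h) \<le> kap h" if "i0 \<le> h" for h using that by (meson not_less)
    have "kap (i0 + d) \<le> kap i0" for d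
    proof (induction d)
      case (Suc d)
      thus ?case using dec[of "i0 + d"] by simp
    qed simp
    from this[of "kap i0"] gt[of "i0 + kap i0"] show False by simp
  qed
  then obtain h where h: "i0 \<le> h" "kap h < kap (Suc h)" by blast
  show False
  proof (rule block_step_absurd[OF h(1), of "kap h"])
    show "Suc h \<le> kap h" using gt[of h] by simp
    show "ann n (m + 2) (blk h (kap h)) = {0}" by (rule zero)
    show "ann n (m + 2) (blk (Suc h) (kap h)) \<noteq> {0}" by (rule before[OF h(2)])
    show "ann n (m + 2) (blk h (kap h - 1)) \<noteq> {0}" by (rule before) (use gt[of h] in simp)
  qed
qed

end

text \<open>Each property holds only from some index on, so the threshold is raised before the next
  locale is entered.\<close>

lemma minpts_even_False:
  assumes "minpts_even n \<xi> \<nu> K0 x \<mu> i0 m"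
  shows False
proof -
  interpret A: minpts_even n \<xi> \<nu> K0 x \<mu> i0 m by (rule assms)
  obtain i1 where i1: "i0 \<le> i1" "\<And>i. i1 \<le> i \<Longrightarrow> ann n m {x i, x (Suc i)} = {0}" using A.pair_zero by blast
  have mono: "minpts_even n \<xi> \<nu> K0 x \<mu> i2 m" if "i0 \<le> i2" for i2
    unfolding minpts_even_def minpts_even_axioms_def
    using minpts_large_mono[OF A.minpts_large_axioms that] A.n_eq A.m3 A.rank0 A.mu_gt A.mu_lt that by auto
  have pairs: "minpts_even_pairs n \<xi> \<nu> K0 x \<mu> i2 m" if "i1 \<le> i2" for i2
    unfolding minpts_even_pairs_def minpts_even_pairs_axioms_def
    using mono[of i2] i1 that by auto
  interpret B: minpts_even_pairs n \<xi> \<nu> K0 x \<mu> i1 m by (rule pairs) simp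
  obtain i2 where i2: "i1 \<le> i2" "\<And>i. i2 \<le> i \<Longrightarrow> ann n (m + 1) (x ` {i..A.rix 2 i}) = {0}" using B.blocks_zero by blast
  interpret C: minpts_even_pairs n \<xi> \<nu> K0 x \<mu> i2 m by (rule pairs[OF i2(1)])
  interpret D: minpts_even_blocks n \<xi> \<nu> K0 x \<mu> i2 m
    by unfold_locales (use i2 in auto)
  show False by (rule D.contradiction)
qed

section \<open>Dimension four\<close>

lemma rdet_entry_bound:
  fixes us :: "(nat \<Rightarrow> int) list"
  assumes "length us = N" "N > 0" "\<And>r t. r < N \<Longrightarrow> t < N \<Longrightarrow> \<bar>real_of_int ((us ! r) t)\<bar> \<le> h r" "\<And>r. r < N \<Longrightarrow> 0 < h r"
  shows "\<bar>real_of_int (rdet N us)\<bar> \<le> fact N * (h 0 * (\<Prod>r = 1..<N. h r))"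
proof -
  have "\<bar>rdet N (map (\<lambda>u t. real_of_int (u t)) us)\<bar> \<le> fact N * (h 0 * (\<Prod>r = 1..<N. h r))"
    by (rule rdet_abs_le[where ?l0.0 = "h 0"]) (use assms in \<open>auto intro: less_imp_le\<close>)
  thus ?thesis unfolding rdet_of_int[OF assms(1)] .
qed

lemma rdet_abs_mset:
  fixes us vs :: "(nat \<Rightarrow> int) list"
  assumes "mset us = mset vs" "length vs = N"
  shows "\<bar>rdet N us\<bar> = \<bar>rdet N vs\<bar>"
proof -
  obtain p where p: "p permutes {..<length vs}" "permute_list p vs = us"
    using mset_eq_permutation[OF assms(1)] by blast
  have pN: "p permutes {0..<N}" using p(1) assms(2) by (simp add: atLeast0LessThan)
  have inN: "p r < N" if "r < N" for r using permutes_in_image[OF pN, of r] that by simp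
  have nth: "us ! r = vs ! p r" if "r < N" for r
    using permute_list_nth[OF p(1), of r] that unfolding p(2) assms(2) by simp
  have "rowmat N us = Matrix.mat N N (\<lambda>(i, j). rowmat N vs $$ (p i, j))"
    by (rule eq_matI) (simp_all add: rowmat_def nth inN)
  hence "rdet N us = signof p * rdet N vs" using det_permute_rows[OF rowmat_carrier pN, of vs] by simp
  thus ?thesis using signof_pm_one[of p, where 'a = int] by (auto simp: abs_mult)
qed

text \<open>The cofactors are written as determinants with a unit row, so that the bounds for rows
  of points and units apply to them.\<close>

lemma rdet4_expand:
  fixes w :: "nat \<Rightarrow> int"
  shows "rdet 4 [w, u, v, e] = (\<Sum>t<4. w t * rdet 4 [unitrow t, u, v, e])"
proof -
  have ex: "(\<Prod>r = 0..<4. ([w, u, v, e] ! r) (p r)) = w (p 0) * (u (p 1) * v (p 2) * e (p 3))" for w u v e :: "nat \<Rightarrow> int" and p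
    by (simp add: eval_nat_numeral mult_ac)
  have un: "w (p 0) = (\<Sum>t<4. w t * unitrow t (p 0))" if "p permutes {0..<4}" for p :: "nat \<Rightarrow> nat"
  proof -
    have "p 0 < 4" using permutes_in_image[OF that, of 0] by simp
    thus ?thesis by (simp add: unitrow_def if_distrib cong: if_cong)
  qed
  have "rdet 4 [w, u, v, e] = (\<Sum>p | p permutes {0..<4}. signof p * ((\<Sum>t<4. w t * unitrow t (p 0)) * (u (p 1) * v (p 2) * e (p 3))))"
    unfolding rdet_leibniz ex by (intro sum.cong refl) (simp add: un[symmetric])
  also have "\<dots> = (\<Sum>p | p permutes {0..<4}. \<Sum>t<4. w t * (signof p * (unitrow t (p 0) * (u (p 1) * v (p 2) * e (p 3)))))"
    by (simp add: sum_distrib_left sum_distrib_right mult_ac)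
  also have "\<dots> = (\<Sum>t<4. w t * rdet 4 [unitrow t, u, v, e])"
    unfolding rdet_leibniz ex sum_distrib_left by (rule sum.swap)
  finally show ?thesis .
qed

lemma rdet_equal_rows:
  fixes us :: "(nat \<Rightarrow> int) list"
  assumes "i < N" "j < N" "i \<noteq> j" "us ! i = us ! j"
  shows "rdet N us = 0"
  by (rule det_identical_rows[OF rowmat_carrier assms(3,1,2)]) (use assms in \<open>auto simp: rowmat_def intro!: eq_vecI\<close>)

lemma rdet_1: "rdet 1 [w] = w 0"
  by (simp add: rdet_leibniz)

lemma app_sym:
  assumes "degree F \<le> N" "degree G \<le> N"
  shows "app F (coeff G) 0 = app G (coeff F) 0"
  by (simp add: app_eq_sum[OF assms(1)] app_eq_sum[OF assms(2)] mult.commute)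

text \<open>Besides the bound for heights, \<open>C5\<close> covers the factor 5! = 120 in the wedge
  estimate; \<open>KC\<close> collects the constants in the size of the linear forms. The conditions
  on \<mu> reflect that the positive root lies between 1/3 and 1/2.\<close>

locale minpts_four = minpts_large +
  fixes C5 KC :: real
  assumes n_eq: "n = 4" and mu2: "2 < \<mu>" and mu3: "\<mu> < 3"
    and rank0: "\<And>i. i0 \<le> i \<Longrightarrow> ann n 2 {x i} = {0}"
    and C5: "C3 \<le> C5" "ln 120 \<le> 4 * C5" "0 \<le> C5"
    and KC: "KC = \<mu> * (ln (4 * M * (fact 4 * M ^ 4)) + 2 * K0 + C5)"
    and big2: "\<And>q. i0 \<le> q \<Longrightarrow> \<nu> * \<mu> * (C4 4 + C5) \<le> (\<mu> - \<nu>) * y q \<and> \<nu> * \<mu> * (C2 4 2 + 2 * C5) \<le> (\<mu> - \<nu>) * y q"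
    and big3: "\<And>q. i0 \<le> q \<Longrightarrow> 2 * KC + \<mu> < (3 - \<mu>) * y q"
begin

lemma levels: "2 \<le> n" "3 \<le> n" "n - 3 = 1" "n = 2 * 2" using n_eq by auto

lemma dim_point: "i0 \<le> i \<Longrightarrow> pdim (ann n 3 {x i}) \<le> 2"
  by (rule castel_dim[of 3 n 2 _ n]) (use n_eq rank0 pdim_ann_n_point in auto)

lemma dim_pair: "i0 \<le> i \<Longrightarrow> pdim (ann n 3 {x i, x (Suc i)}) \<le> 1"
  by (rule castel_dim[of 3 n 2 _ "n - 1"])
    (use n_eq ann_zero_superset[OF rank0[of i], of "{x i, x (Suc i)}"] pdim_ann_pair[of i "Suc i"] in auto)

lemma E0:
  assumes "i0 \<le> i"
  shows "2 * y (Suc i) \<le> \<mu> * y i"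
proof -
  have "dsum (real 2 + 1) [i] [0] \<le> y (Suc i) + \<mu> * y i"
    by (rule full_dims[OF levels(1)]) (use assms rank0 in auto)
  thus ?thesis by simp
qed

text \<open>A zero annihilator would permit a full determinant, whose inequality requires
  \<open>3 \<le> \<mu>\<close>.\<close>

lemma pair_nonzero:
  assumes "i0 \<le> i"
  shows "ann n 3 {x i, x (Suc i)} \<noteq> {0}"
proof
  assume z: "ann n 3 {x i, x (Suc i)} = {0}"
  have "dsum (real 3 + 1) [Suc i, i] [2, 0] \<le> y (Suc (Suc i)) + \<mu> * y (Suc i)"
    by (rule full_dims[OF levels(2)]) (use assms dim_point[of "Suc i"] z in \<open>auto simp: insert_commute\<close>)
  hence "y (Suc (Suc i)) + 2 * y (Suc i) \<le> \<mu> * y (Suc i)" by simp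
  moreover have "y (Suc i) \<le> y (Suc (Suc i))" by (rule y_mono) simp
  ultimately have "3 * y (Suc i) \<le> \<mu> * y (Suc i)" by linarith
  thus False using mu3 y_pos[of "Suc i"] assms by simp
qed

definition P :: "nat \<Rightarrow> int poly" where
  "P i = (SOME Q. Q \<in> ann n 3 {x i, x (Suc i)} \<and> Polynomial.content Q = 1)"

lemma P_in: "i0 \<le> i \<Longrightarrow> P i \<in> ann n 3 {x i, x (Suc i)}" and P_content: "i0 \<le> i \<Longrightarrow> Polynomial.content (P i) = 1"
proof -
  assume i: "i0 \<le> i"
  have "\<exists>Q. Q \<in> ann n 3 {x i, x (Suc i)} \<and> Polynomial.content Q = 1"
    using ann_primitive[OF pair_nonzero[OF i]] by blast
  from someI_ex[OF this] show "P i \<in> ann n 3 {x i, x (Suc i)}" "Polynomial.content (P i) = 1"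
    unfolding P_def by blast+
qed

lemma P_nz: "i0 \<le> i \<Longrightarrow> P i \<noteq> 0" using P_content[of i] by auto

lemma P_deg: "i0 \<le> i \<Longrightarrow> degree (P i) \<le> 3" using ann_degree[OF P_in] .

lemma P_point: "i0 \<le> i \<Longrightarrow> P i \<in> ann n 3 {x i}" "i0 \<le> i \<Longrightarrow> P i \<in> ann n 3 {x (Suc i)}"
  using P_in[of i] ann_antimono[of "{x i}" "{x i, x (Suc i)}" n 3] ann_antimono[of "{x (Suc i)}" "{x i, x (Suc i)}" n 3] by auto

lemma line_sub:
  assumes "pdim (ann n 3 K) \<le> 1" "Q \<noteq> 0" "Q \<in> ann n 3 K" "Q \<in> ann n 3 K'"
  shows "ann n 3 K \<subseteq> ann n 3 K'"
proof -
  have Q: "Q \<in> ann n 3 (K \<union> K')" using assms unfolding ann_Un by blast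
  have sub: "ann n 3 (K \<union> K') \<subseteq> ann n 3 K" by (rule ann_antimono) auto
  have le: "pdim (ann n 3 K) \<le> pdim (ann n 3 (K \<union> K'))" using assms(1) pdim_pos[OF degb_ann Q assms(2)] by simp
  have "ann n 3 K \<subseteq> ann n 3 (K \<union> K')"
    using full_pdim_mem[OF submod_ann submod_ann sub degb_ann le _ satur_ann] by blast
  thus ?thesis using ann_antimono[of K' "K \<union> K'" n 3] by blast
qed

text \<open>The logarithmic height of \<open>P i\<close> on the scale of the \<open>y i\<close>: in
  this normalisation \<open>height_lower\<close> reads \<open>y i \<le> eta i\<close>.\<close>

definition eta :: "nat \<Rightarrow> real" where "eta i = \<mu> * (ln (ht (P i)) + C5)"

lemma ln_ht_nonneg: "i0 \<le> i \<Longrightarrow> 0 \<le> ln (ht (P i))"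
  using ht_ge_1[OF P_nz] by simp

text \<open>Consecutive pairs often share the same line of annihilators; such an i is the first
  index after a change of the line, which is where a lower bound for the height is
  available.\<close>

definition start :: "nat \<Rightarrow> bool" where
  "start i \<longleftrightarrow> (\<exists>h\<ge>i0. i = Suc h \<and> P i \<notin> ann n 3 {x h})"

lemma start_ge: "start i \<Longrightarrow> i0 \<le> i" by (auto simp: start_def)

lemma a_le_eta:
  assumes "start i"
  shows "y i \<le> eta i"
proof -
  obtain h where h: "i0 \<le> h" "i = Suc h" "P i \<notin> ann n 3 {x h}" using assms by (auto simp: start_def)
  have "y i / \<nu> \<le> ln (ht (P i)) + C3"
    using height_lower[OF levels(2) _ h(3)] P_point(1)[OF start_ge[OF assms]] h(2) by simp
  hence "y i / \<nu> \<le> ln (ht (P i)) + C5" using C5 by linarith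
  hence "y i \<le> \<nu> * (ln (ht (P i)) + C5)" using nu_pos by (simp add: pos_divide_le_eq mult.commute)
  also have "\<dots> \<le> eta i" unfolding eta_def
    using mu ln_ht_nonneg[OF start_ge[OF assms]] C5 by (intro mult_right_mono) auto
  finally show ?thesis .
qed

lemma scale_up:
  assumes "t \<le> B - w / \<nu> + C" "0 \<le> w" "\<nu> * \<mu> * (C + D) \<le> (\<mu> - \<nu>) * w"
  shows "\<mu> * (t + D) + w \<le> \<mu> * B"
proof -
  have "\<mu> * (t + D) \<le> \<mu> * (B - w / \<nu> + C + D)" using assms(1) mu nu_pos by (intro mult_left_mono) auto
  also have "\<dots> = \<mu> * B - w + ((\<nu> * \<mu> * (C + D) - (\<mu> - \<nu>) * w) / \<nu>)" using nu_pos by (simp add: field_simps)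
  also have "\<dots> \<le> \<mu> * B - w + 0" using assms(3) nu_pos by (intro add_left_mono) (simp add: divide_le_0_iff)
  finally show ?thesis by simp
qed

text \<open>As in \<open>E1\<close>, except that the rows of \<open>pair_rows\<close> are completed
  by the unit row at a largest coefficient of \<open>P i\<close>. The determinant is a non-zero
  multiple of this coefficient, which brings the height into the inequality.\<close>

lemma E1_eta:
  assumes i: "i0 \<le> i" and k: "rix 2 i = Suc k"
  shows "eta i + y (Suc i) + y (Suc k) \<le> \<mu> * y (Suc i)"
proof -
  have ik: "Suc i \<le> k" "k < rix 2 i" using rix2_gt[OF levels(1), of i] k by auto
  let ?js = "\<lambda>j. filter (\<lambda>l. l \<noteq> j) [0..<2]"
  let ?us = "\<lambda>j. map (grow j j) [Suc i, i] @ map (shrow k) (?js j)"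
  have dk: "pdim (ann n (2 + 1) {x k}) \<le> 2" using dim_point[of k] ik i by simp
  have di: "pdim (ann n (2 + 1) {x i, x (Suc i)}) \<le> 1" using dim_pair[OF i] by simp
  obtain j where j: "j < 2" "pdim {F. degree F \<le> 2 + 1 \<and> (\<forall>u\<in>set (?us j). app F u 0 = 0)} \<le> 1"
    using pair_rows[OF levels(4) one_le_numeral k dk di] by (elim exE conjE) (rule that)
  let ?R = "{F. degree F \<le> 2 + 1 \<and> (\<forall>u\<in>set (?us j). app F u 0 = 0)}"
  have smR: "submod ?R" "degb 3 ?R"
    using submod_kill[OF submod_all[of 3], of "set (?us j)"] by (auto simp: degb_def)
  have Pk: "P i \<in> ann n 3 {x k}"
  proof -
    have "ann n n {x i, x (Suc i)} = ann n n (blk i k)" using blk_pair[OF levels(1), of i i "Suc i" k] ik by simp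
    hence "P i \<in> ann n 3 (blk i k)" using P_in[OF i] ann_level_cong[OF levels(2)] by metis
    thus ?thesis using ann_antimono[of "{x k}" "blk i k" n 3] ik by auto
  qed
  have jl: "l \<le> n - 3" if "l < 2" for l using that n_eq by simp
  have ax: "app (P i) (x i) l = 0" "app (P i) (x (Suc i)) l = 0" "app (P i) (x k) l = 0" if "l < 2" for l
    using annD[OF P_point(1)[OF i] _ jl[OF that]] annD[OF P_point(2)[OF i] _ jl[OF that]] annD[OF Pk _ jl[OF that]] by auto
  have kills: "app (P i) u 0 = 0" if "u \<in> set (?us j)" for u
    using that ax j(1) by (auto simp: app_grow app_shrow)
  have PR: "P i \<in> ?R" using kills P_deg[OF i] by simp
  obtain t where t: "t \<le> degree (P i)" "ht (P i) = \<bar>real_of_int (coeff (P i) t)\<bar>" using ht_attained by blast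
  have t4: "t < 4" using t(1) P_deg[OF i] by simp
  have ct: "coeff (P i) t \<noteq> 0" using t(2) ht_ge_1[OF P_nz[OF i]] by auto
  have len3: "length (?us j) = 3" using length_filter_neq[OF j(1)] by simp
  have nz: "1 \<le> \<bar>real_of_int (rdet (Suc 3) (?us j @ [unitrow t]))\<bar>"
  proof (rule full_rows_det)
    show "length (?us j @ [unitrow t]) = Suc 3" using len3 by simp
    fix F assume F: "degree F \<le> 3" "\<And>u. u \<in> set (?us j @ [unitrow t]) \<Longrightarrow> app F u 0 = 0"
    let ?T = "{F \<in> ?R. app F (unitrow t) 0 = 0}"
    have "pdim ?T + 1 = pdim ?R" by (rule pdim_cut[OF smR PR]) (use ct in \<open>simp add: app_unitrow\<close>)
    hence p0: "pdim ?T = 0" using j(2) by linarith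
    have "submod ?T" using smR(1) by (auto simp: submod_def app_add app_smult)
    moreover have "degb 3 ?T" by (rule degb_subset[OF smR(2)]) auto
    ultimately have "?T = {0}" using p0 by (intro pdim_eq_0D)
    moreover have "F \<in> ?T" using F by simp
    ultimately show "F = 0" by simp
  qed
  obtain z where z: "\<forall>ws. length ws = 1 \<longrightarrow> rdet 4 (?us j @ ws) = z * rdet 1 (map (app (P i)) ws)"
    using dual_minors[of 4 3 1 "?us j" "P i"] len3 P_content[OF i] P_deg[OF i] kills by auto
  have zt: "rdet 4 (?us j @ [unitrow t]) = z * coeff (P i) t"
    using z[rule_format, of "[unitrow t]"] by (simp add: rdet_1 app_unitrow del: One_nat_def)
  have "z \<noteq> 0" using nz zt by auto
  hence "1 \<le> \<bar>real_of_int z\<bar>" by linarith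
  hence "1 * ht (P i) \<le> \<bar>real_of_int z\<bar> * ht (P i)" using ht_nonneg by (intro mult_right_mono) auto
  hence low: "ht (P i) \<le> \<bar>real_of_int (rdet 4 (map (grow j j) [Suc i, i] @ map (shrow k) (?js j) @ [unitrow t]))\<bar>"
    using zt t(2) by (simp add: abs_mult)
  have "ln (ht (P i)) + ((\<Sum>p\<leftarrow>[i]. y (Suc p)) + real (length (?js j)) * y (Suc k)) / \<nu>
      \<le> y (Suc i) + real (length [unitrow t]) * ln 1 + C4 4"
  proof (rule reduced_rows_log[where aw = 1 and lw = 1, OF _ _ _ _ _ _ _ _ _ _ _ _ low])
    show "length [Suc i, i] + length (?js j) + length [unitrow t] = 4" using length_filter_neq[OF j(1)] by simp
    show "j + 4 \<le> Suc n" "j + 4 \<le> Suc n" using j(1) n_eq by auto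
    show "l + 4 \<le> Suc n" if "l \<in> set (?js j)" for l using that n_eq by auto
    show "ann n n (x ` set [Suc i, i]) \<subseteq> ann n n {x k}"
    proof -
      have "ann n n (x ` set [Suc i, i]) = ann n n (blk i k)"
        using blk_pair[OF levels(1), of i i "Suc i" k] ik by (simp add: insert_commute)
      also have "\<dots> \<subseteq> ann n n {x k}" using ik by (intro ann_antimono) auto
      finally show ?thesis .
    qed
    show "1 * L (Suc i) \<le> Xv (Suc i) * 1" using L_le_1[of "Suc i"] X_ge_1[of "Suc i"] by linarith
    show "0 < ht (P i)" using ht_ge_1[OF P_nz[OF i]] by linarith
    show "\<bar>real_of_int (w 0)\<bar> \<le> M * 1 \<and> (\<forall>t<4. \<bar>real_of_int (w t) - \<xi> ^ t * real_of_int (w 0)\<bar> \<le> M * 1)"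
      if "w \<in> set [unitrow t]" for w
    proof -
      have w: "w = unitrow t" using that by simp
      have "\<bar>real_of_int (unitrow t t') - \<xi> ^ t' * real_of_int (unitrow t 0)\<bar> \<le> M * 1" if "t' < 4" for t'
      proof -
        have "\<bar>real_of_int (unitrow t t') - \<xi> ^ t' * real_of_int (unitrow t 0)\<bar> \<le> 1 + \<bar>\<xi>\<bar> ^ t'"
          by (auto simp: unitrow_def power_abs[symmetric])
        also have "\<dots> \<le> M" using M_ge[of t'] that n_eq by simp
        finally show ?thesis by simp
      qed
      moreover have "\<bar>real_of_int (unitrow t 0)\<bar> \<le> M * 1" using M_ge_2 by (simp add: unitrow_def)
      ultimately show ?thesis unfolding w by blast
    qed
  qed auto
  hence "ln (ht (P i)) \<le> y (Suc i) - (y (Suc i) + y (Suc k)) / \<nu> + C4 4"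
    using length_filter_neq[OF j(1)] by simp
  moreover have "\<nu> * \<mu> * (C4 4 + C5) \<le> (\<mu> - \<nu>) * (y (Suc i) + y (Suc k))"
  proof -
    have "\<nu> * \<mu> * (C4 4 + C5) \<le> (\<mu> - \<nu>) * y (Suc i)" using big2[of "Suc i"] i by simp
    moreover have "0 \<le> (\<mu> - \<nu>) * y (Suc k)" using mu y_nonneg by simp
    ultimately show ?thesis unfolding distrib_left by linarith
  qed
  moreover have "0 \<le> y (Suc i) + y (Suc k)" using y_nonneg[of "Suc i"] y_nonneg[of "Suc k"] by linarith
  ultimately have "eta i + (y (Suc i) + y (Suc k)) \<le> \<mu> * y (Suc i)" unfolding eta_def by (intro scale_up)
  thus ?thesis by simp
qed

text \<open>The three points leave exactly two dimensions at level 4, filled by \<open>P i\<close>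
  and its shift; hence the height counts twice.\<close>

lemma dual_eta:
  assumes i: "i0 \<le> i" and k: "rix 2 i = Suc k" and kill: "P i \<in> ann n 3 {x (Suc k)}"
  shows "2 * eta i + y (Suc i) + y (Suc k) \<le> \<mu> * y (Suc k)"
proof -
  have ik: "Suc i \<le> k" "k < rix 2 i" using rix2_gt[OF levels(1), of i] k by auto
  let ?cs = "[Suc k, k, i]"
  have Pb: "P i \<in> ann n 3 (blk i k)"
    using P_in[OF i] ann_level_cong[OF levels(2) blk_pair[OF levels(1), of i i "Suc i" k]] ik by auto
  have "P i \<in> ann n 3 (x ` set ?cs)"
  proof -
    have "P i \<in> ann n 3 {x (Suc k)} \<inter> ann n 3 (blk i k)" using Pb kill by blast
    hence "P i \<in> ann n 3 (insert (x (Suc k)) (blk i k))" unfolding ann_insert[of n 3 "x (Suc k)" "blk i k"] .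
    thus ?thesis using ann_antimono[of "x ` set ?cs" "insert (x (Suc k)) (blk i k)" n 3] ik by auto
  qed
  hence kl: "monom 1 a * P i \<in> ann n 4 (x ` set ?cs)" if "a < 2" for a
    using ann_monom[of 3 1 n "P i" "x ` set ?cs" a] that n_eq by simp
  have eq: "x ` set ?cs = {x (Suc k), x k, x i}" by auto
  have pd: "pdim (ann n 4 (x ` set ?cs)) = 2"
    using rix_eq[of 2 i] blk_triple_rix2[OF levels(1) k] k n_eq unfolding eq by simp
  have d: "real 2 * ln (ht (P i)) + (drops 4 (allp 4) ?cs - y (Suc (Suc k))) / \<nu> \<le> y (Suc k) + C2 4 2"
    by (rule chain_dual[OF _ _ _ pd P_content[OF i] _ kl]) (use n_eq ik P_deg[OF i] in auto)
  have "pdim (ann n 4 {x (Suc k)}) \<le> 4" "pdim (ann n 4 {x k, x (Suc k)}) \<le> 3"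
    using pdim_ann_n_point[of "Suc k"] pdim_ann_pair[of k "Suc k"] n_eq by simp_all
  hence "dims_le 4 {} ?cs [4, 3, 2]" using pd ik by (simp add: insert_commute)
  from dsum_le_drops[OF this] have "dsum 5 ?cs [4, 3, 2] \<le> drops 4 (allp 4) ?cs"
    unfolding allp_eq_ann[symmetric] pdim_all by simp
  hence "y (Suc k) + y (Suc i) \<le> drops 4 (allp 4) ?cs - y (Suc (Suc k))" by simp
  hence "(y (Suc k) + y (Suc i)) / \<nu> \<le> (drops 4 (allp 4) ?cs - y (Suc (Suc k))) / \<nu>"
    using nu_pos by (intro divide_right_mono) auto
  hence "2 * ln (ht (P i)) \<le> y (Suc k) - (y (Suc k) + y (Suc i)) / \<nu> + C2 4 2" using d by simp
  moreover have "\<nu> * \<mu> * (C2 4 2 + 2 * C5) \<le> (\<mu> - \<nu>) * (y (Suc k) + y (Suc i))"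
  proof -
    have "\<nu> * \<mu> * (C2 4 2 + 2 * C5) \<le> (\<mu> - \<nu>) * y (Suc i)" using big2[of "Suc i"] i by simp
    moreover have "0 \<le> (\<mu> - \<nu>) * y (Suc k)" using mu y_nonneg by simp
    ultimately show ?thesis unfolding distrib_left by linarith
  qed
  moreover have "0 \<le> y (Suc k) + y (Suc i)" using y_nonneg[of "Suc i"] y_nonneg[of "Suc k"] by linarith
  ultimately have "\<mu> * (2 * ln (ht (P i)) + 2 * C5) + (y (Suc k) + y (Suc i)) \<le> \<mu> * y (Suc k)" by (intro scale_up)
  thus ?thesis unfolding eta_def by (simp add: algebra_simps)
qed

lemma eta_pos: "start i \<Longrightarrow> 0 < eta i"
  using a_le_eta[of i] y_pos[OF start_ge, of i] by linarith

text \<open>The first inequality below eliminates \<open>c\<close> between \<open>E1_eta\<close> and \<open>dual_eta\<close>.\<close>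

lemma bc_lower:
  assumes "start i" "rix 2 i = Suc k" "P i \<in> ann n 3 {x (Suc k)}"
  shows "(\<mu> + 1) * eta i \<le> \<mu> * (\<mu> - 2) * y (Suc i)" and "4 * eta i \<le> 3 * y (Suc i)" and "5 * eta i \<le> 3 * y (Suc k)"
proof -
  let ?b = "y (Suc i)" and ?c = "y (Suc k)" and ?e = "eta i"
  note i = start_ge[OF assms(1)]
  have e: "0 < ?e" by (rule eta_pos[OF assms(1)])
  have 1: "?e + ?b + ?c \<le> \<mu> * ?b" by (rule E1_eta[OF i assms(2)])
  have 2: "2 * ?e + ?b + ?c \<le> \<mu> * ?c" by (rule dual_eta[OF i assms(2,3)])
  have "(\<mu> - 1) * ?c \<le> (\<mu> - 1) * ((\<mu> - 1) * ?b - ?e)" using 1 mu2 by (intro mult_left_mono) (auto simp: algebra_simps)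
  hence "2 * ?e + ?b \<le> (\<mu> - 1) * ((\<mu> - 1) * ?b - ?e)" using 2 by (simp add: algebra_simps)
  thus A: "(\<mu> + 1) * ?e \<le> \<mu> * (\<mu> - 2) * ?b" by (simp add: algebra_simps)
  have b0: "0 \<le> ?b" by (rule y_nonneg)
  have "\<mu> * (\<mu> - 2) * 4 \<le> 3 * (\<mu> + 1)"
  proof -
    have "0 \<le> (3 - \<mu>) * (4 * \<mu> + 1)" using mu2 mu3 by (intro mult_nonneg_nonneg) auto
    thus ?thesis by (simp add: algebra_simps)
  qed
  hence "\<mu> * (\<mu> - 2) * 4 * ?b \<le> 3 * (\<mu> + 1) * ?b" using b0 by (rule mult_right_mono)
  hence "(\<mu> + 1) * (4 * ?e) \<le> (\<mu> + 1) * (3 * ?b)" using A by (simp add: algebra_simps)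
  thus B: "4 * ?e \<le> 3 * ?b" using mu2 by simp
  have "(\<mu> - 1) * ?c \<le> 2 * ?c" using mu3 y_nonneg[of "Suc k"] by (intro mult_right_mono) auto
  hence "2 * ?e + ?b \<le> 2 * ?c" using 2 by (simp add: algebra_simps)
  thus "5 * ?e \<le> 3 * ?c" using B by linarith
qed

text \<open>The hypotheses make the increments of b decrease by at least
  \<open>(3 - \<mu>) * b 0\<close> at each step, so eventually they are negative.\<close>

lemma shrinking_absurd:
  fixes b :: "nat \<Rightarrow> real"
  assumes "\<And>t. 0 < b t" "\<And>t. b t \<le> b (Suc t)" "\<And>t. b t + b (Suc (Suc t)) \<le> (\<mu> - 1) * b (Suc t)"
  shows False
proof -
  have mono: "b 0 \<le> b t" for t by (induction t) (use assms(2) order.trans in blast)+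
  have "b (Suc t) - b t \<le> b 1 - b 0 - real t * ((3 - \<mu>) * b 0)" for t
  proof (induction t)
    case (Suc t)
    have "b (Suc (Suc t)) - b (Suc t) \<le> (b (Suc t) - b t) - (3 - \<mu>) * b (Suc t)"
      using assms(3)[of t] by (simp add: algebra_simps)
    moreover have "(3 - \<mu>) * b 0 \<le> (3 - \<mu>) * b (Suc t)" using mono[of "Suc t"] mu3 by (intro mult_left_mono) auto
    ultimately have "b (Suc (Suc t)) - b (Suc t) \<le> (b (Suc t) - b t) - (3 - \<mu>) * b 0" by linarith
    thus ?case using Suc by (simp add: algebra_simps)
  qed simp
  moreover obtain t :: nat where "(b 1 - b 0) / ((3 - \<mu>) * b 0) < real t" using reals_Archimedean2 by blast
  hence "b 1 - b 0 < real t * ((3 - \<mu>) * b 0)" using mu3 assms(1)[of 0] by (simp add: pos_divide_less_eq)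
  ultimately have "b (Suc t) - b t < 0" by (metis diff_less_0_iff_less order_le_less_trans)
  thus False using assms(2)[of t] by simp
qed

text \<open>If \<open>P i\<close> misses the first point outside the plane of the pair, then k is
  again a start with the same defect. The resulting infinite chain turns \<open>E1_eta\<close> into
  the hypothesis of \<open>shrinking_absurd\<close>.\<close>

lemma start_kills:
  assumes "start i" "rix 2 i = Suc k"
  shows "P i \<in> ann n 3 {x (Suc k)}"
proof (rule ccontr)
  assume bad: "P i \<notin> ann n 3 {x (Suc k)}"
  define D2 where "D2 i \<longleftrightarrow> start i \<and> P i \<notin> ann n 3 {x (rix 2 i)}" for i
  have step: "D2 (rix 2 i - 1)" "Suc i \<le> rix 2 i - 1" "Suc (rix 2 i - 1) = rix 2 i" if D: "D2 i" for i
  proof -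
    have i: "i0 \<le> i" using D start_ge by (simp add: D2_def)
    obtain k where k: "rix 2 i = Suc k" "Suc i \<le> k" using rix_pred[OF levels(1), of i] by metis
    then obtain l where l: "k = Suc l" "i \<le> l" by (cases k) auto
    show "Suc i \<le> rix 2 i - 1" "Suc (rix 2 i - 1) = rix 2 i" using k by auto
    have bad: "P i \<notin> ann n 3 {x (Suc k)}" using D k by (simp add: D2_def)
    have ik: "i0 \<le> k" using i k by simp
    have eq: "ann n n {x i, x (Suc i)} = ann n n {x l, x k}"
      using blk_pair[OF levels(1), of i i "Suc i" k] blk_pair[OF levels(1), of i l k k] k l by simp
    have st: "start k"
    proof -
      have "P k \<notin> ann n 3 {x l}"
      proof
        assume "P k \<in> ann n 3 {x l}"
        hence "P k \<in> ann n 3 {x l, x k}" using P_point(1)[OF ik] unfolding ann_insert[of n 3 "x l" "{x k}"] by blast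
        hence "P k \<in> ann n 3 {x i, x (Suc i)}" using ann_level_cong[OF levels(2) eq] by simp
        from line_sub[OF dim_pair[OF i] P_nz[OF ik] this P_point(2)[OF ik]]
        have "P i \<in> ann n 3 {x (Suc k)}" using P_in[OF i] by blast
        thus False using bad by simp
      qed
      thus ?thesis unfolding start_def using l i by (intro exI[of _ l]) auto
    qed
    \<comment> \<open>If the defect ended at k, \<open>bc_lower\<close> at k combined with
      \<open>E1_eta\<close> and \<open>E0\<close> at i would give
      \<open>1 \<le> (\<mu> - 2) * (\<mu> - 2)\<close>, impossible for \<mu> between 2 and
      3.\<close>
    have "P k \<notin> ann n 3 {x (rix 2 k)}"
    proof
      obtain k2 where k2: "rix 2 k = Suc k2" using rix_pred[OF levels(1), of k] by metis
      assume "P k \<in> ann n 3 {x (rix 2 k)}"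
      hence "P k \<in> ann n 3 {x (Suc k2)}" using k2 by simp
      from bc_lower(1)[OF st k2 this] have 1: "(\<mu> + 1) * eta k \<le> \<mu> * (\<mu> - 2) * y (Suc k)" .
      have sti: "start i" using D by (simp add: D2_def)
      have "eta i + y (Suc i) + y (Suc k) \<le> \<mu> * y (Suc i)" by (rule E1_eta[OF i k(1)])
      hence 2: "y (Suc k) \<le> (\<mu> - 1) * y (Suc i) - y i" using a_le_eta[OF sti] by (simp add: algebra_simps)
      have 3: "2 * y (Suc i) \<le> \<mu> * y i" by (rule E0[OF i])
      have "\<mu> * y (Suc k) \<le> \<mu> * ((\<mu> - 1) * y (Suc i) - y i)" using 2 mu2 by (intro mult_left_mono) auto
      also have "\<dots> \<le> (\<mu> - 2) * (\<mu> + 1) * y (Suc i)" using 3 by (simp add: algebra_simps)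
      also have "\<dots> \<le> (\<mu> - 2) * (\<mu> + 1) * eta k"
        using y_mono[OF k(2)] a_le_eta[OF st] mu2 by (intro mult_left_mono) auto
      finally have "(\<mu> - 2) * (\<mu> * y (Suc k)) \<le> (\<mu> - 2) * ((\<mu> - 2) * (\<mu> + 1) * eta k)"
        using mu2 by (intro mult_left_mono) auto
      hence "((\<mu> + 1) * eta k) * 1 \<le> ((\<mu> + 1) * eta k) * ((\<mu> - 2) * (\<mu> - 2))" using 1 by (simp add: mult_ac)
      moreover have "0 < (\<mu> + 1) * eta k" using eta_pos[OF st] mu2 by simp
      ultimately have "1 \<le> (\<mu> - 2) * (\<mu> - 2)" by (simp only: mult_le_cancel_left_pos)
      moreover have "(\<mu> - 2) * (\<mu> - 2) < 1 * 1" using mu2 mu3 by (intro mult_strict_mono) auto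
      ultimately show False by simp
    qed
    thus "D2 (rix 2 i - 1)" using st k by (simp add: D2_def)
  qed
  define u where "u t = ((\<lambda>i. rix 2 i - 1) ^^ t) i" for t
  have D: "D2 (u t)" for t
  proof (induction t)
    case 0
    show ?case using bad assms by (simp add: u_def D2_def)
  next
    case (Suc t)
    thus ?case using step(1)[of "u t"] by (simp add: u_def)
  qed
  have uS: "u (Suc t) = rix 2 (u t) - 1" for t by (simp add: u_def)
  have ge: "i0 \<le> u t" for t using D[of t] start_ge by (simp add: D2_def)
  have up: "Suc (u t) \<le> u (Suc t)" for t using step(2)[OF D[of t]] by (simp add: uS)
  show False
  proof (rule shrinking_absurd[of "\<lambda>t. y (Suc (u t))"])
    show "0 < y (Suc (u t))" for t using y_pos[of "Suc (u t)"] ge[of t] by simp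
    show "y (Suc (u t)) \<le> y (Suc (u (Suc t)))" for t using up[of t] by (intro y_mono) simp
    fix t
    have r: "rix 2 (u (Suc t)) = Suc (u (Suc (Suc t)))" using step(3)[OF D[of "Suc t"]] by (simp add: uS)
    have "eta (u (Suc t)) + y (Suc (u (Suc t))) + y (Suc (u (Suc (Suc t)))) \<le> \<mu> * y (Suc (u (Suc t)))"
      by (rule E1_eta[OF ge r])
    moreover have "y (Suc (u t)) \<le> eta (u (Suc t))"
      using a_le_eta[of "u (Suc t)"] D[of "Suc t"] y_mono[OF up[of t]] by (simp add: D2_def)
    ultimately show "y (Suc (u t)) + y (Suc (u (Suc (Suc t)))) \<le> (\<mu> - 1) * y (Suc (u (Suc t)))"
      by (simp add: algebra_simps)
  qed
qed

end

subsection \<open>Linear forms attached to the minimal points\<close>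

lemma app_cong:
  assumes "degree F \<le> N" "\<And>t. t \<le> N \<Longrightarrow> v t = w t"
  shows "app F v 0 = app F w 0"
  using assms(2) by (simp add: app_eq_sum[OF assms(1)])

lemma coeff_shift_le_ht: "\<bar>real_of_int (coeff (monom 1 1 * F) t)\<bar> \<le> ht F"
  using coeff_le_ht[of F "t - 1"] ht_nonneg[of F] by (simp add: coeff_monom_mult)

context minpts_four
begin

text \<open>A point read as a polynomial, so that \<open>dual_minors\<close> can be used with points
  and polynomials exchanged.\<close>

definition pt :: "nat \<Rightarrow> int poly" where "pt c = (\<Sum>t\<le>n. monom (x c t) t)"

lemma coeff_pt: "coeff (pt c) t = (if t \<le> n then x c t else 0)"
  by (simp add: pt_def coeff_sum)

lemma coeff_pt4: "t \<le> 4 \<Longrightarrow> coeff (pt c) t = x c t"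
proof -
  assume "t \<le> 4"
  hence "t \<le> n" using n_eq by linarith
  thus ?thesis by (simp add: coeff_pt)
qed

lemma degree_pt: "degree (pt c) \<le> n"
  by (rule degree_le) (simp add: coeff_pt)

text \<open>Dividing by the content would give a smaller point with no larger error. The index is a
  successor because the comparison is with the preceding minimal point.\<close>

lemma point_primitive: "Polynomial.content (pt (Suc l)) = 1"
proof (rule ccontr)
  let ?g = "Polynomial.content (pt (Suc l))"
  assume ne: "?g \<noteq> 1"
  have pt0: "pt (Suc l) \<noteq> 0" using coeff_pt[of "Suc l" 0] x_pos[of "Suc l"] by force
  hence g0: "?g \<noteq> 0" by simp
  have "0 \<le> ?g" by (metis normalize_content abs_ge_zero normalize_int_def)
  hence g2: "2 \<le> ?g" using ne g0 by linarith
  define u where "u t = coeff (primitive_part (pt (Suc l))) t" for t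
  have xu: "x (Suc l) t = ?g * u t" if "t \<le> n" for t
  proof -
    have "coeff (smult ?g (primitive_part (pt (Suc l)))) t = coeff (pt (Suc l)) t" by simp
    thus ?thesis using that by (simp only: coeff_smult coeff_pt u_def if_True)
  qed
  have x0: "x (Suc l) 0 = ?g * u 0" using xu[of 0] by simp
  have u0: "0 < u 0" using x0 x_pos[of "Suc l"] g2 by (simp add: zero_less_mult_iff)
  have "1 * u 0 < ?g * u 0" using g2 u0 by (intro mult_strict_right_mono) auto
  hence "\<bar>u 0\<bar> < x (Suc l) 0" using x0 u0 by simp
  hence "L l \<le> err n \<xi> u" using u0 by (intro minimal) (auto intro: exI[of _ 0])
  also have "\<dots> \<le> L (Suc l)"
  proof (rule err_le)
    fix t assume t: "t \<le> n"
    have "real_of_int (x (Suc l) t) - \<xi> ^ t * Xv (Suc l) = real_of_int ?g * (real_of_int (u t) - \<xi> ^ t * real_of_int (u 0))"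
      by (simp add: xu[OF t] x0 algebra_simps)
    hence "\<bar>real_of_int (x (Suc l) t) - \<xi> ^ t * Xv (Suc l)\<bar> = real_of_int ?g * \<bar>real_of_int (u t) - \<xi> ^ t * real_of_int (u 0)\<bar>"
      using g2 by (simp add: abs_mult)
    moreover have "1 * \<bar>real_of_int (u t) - \<xi> ^ t * real_of_int (u 0)\<bar> \<le> real_of_int ?g * \<bar>real_of_int (u t) - \<xi> ^ t * real_of_int (u 0)\<bar>"
      using g2 by (intro mult_right_mono) auto
    ultimately have "1 * \<bar>real_of_int (u t) - \<xi> ^ t * real_of_int (u 0)\<bar> \<le> \<bar>real_of_int (x (Suc l) t) - \<xi> ^ t * Xv (Suc l)\<bar>" by (simp only:)
    from order.trans[OF this err_ge[OF t, of "x (Suc l)" \<xi>]]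
    show "\<bar>real_of_int (u t) - \<xi> ^ t * real_of_int (u 0)\<bar> \<le> L (Suc l)" by simp
  qed
  finally show False using L_Suc[of l] by linarith
qed

text \<open>The coefficient vectors of the two polynomials and of their shifts are four independent
  rows orthogonal to the primitive point \<open>x (Suc l)\<close>. Their exterior product is
  therefore a non-zero integer multiple of this point, and its entries are at most 5! times the
  squares of both heights.\<close>

lemma wedge:
  assumes i: "i0 \<le> i" and l: "i0 \<le> l" and PP: "P i \<in> ann n 3 {x l}" "P i \<in> ann n 3 {x (Suc l)}" "P (Suc l) \<notin> ann n 3 {x l}"
  shows "\<mu> * y (Suc l) \<le> 2 * eta i + 2 * eta (Suc l)"
proof -
  let ?P = "P i" and ?R = "P (Suc l)" and ?c = "Suc l"
  have il: "i0 \<le> Suc l" using l by simp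
  have R: "?R \<in> ann n 3 {x ?c}" by (rule P_point(1)[OF il])
  let ?Fs = "[?P, monom 1 1 * ?P, ?R, monom 1 1 * ?R]"
  let ?us = "map coeff ?Fs"
  have mdeg: "degree (monom 1 1 * F) \<le> 4" if "degree F \<le> 3" for F :: "int poly"
    using degree_mult_le[of "monom (1::int) 1" F] degree_monom_le[of "1::int" 1] that by linarith
  have dP: "degree ?P \<le> 3" "degree ?R \<le> 3" using P_deg i il by auto
  have dF: "degree F \<le> 4" if "F \<in> set ?Fs" for F using that dP mdeg by auto
  have apx: "app F (x ?c) 0 = 0" if "F \<in> set ?Fs" for F
  proof -
    have "app G (x ?c) j = 0" if "G = ?P \<or> G = ?R" "j \<le> 1" for G j
      using annD[OF PP(2), of "x ?c" j] annD[OF R, of "x ?c" j] that n_eq by auto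
    thus ?thesis using that by (auto simp: app_monom_mult)
  qed
  have kill: "app (pt ?c) u 0 = 0" if u: "u \<in> set ?us" for u
  proof -
    obtain F where F: "F \<in> set ?Fs" "u = coeff F" using u by auto
    have "app (pt ?c) (coeff F) 0 = app F (coeff (pt ?c)) 0"
      by (rule app_sym[of _ 4]) (use degree_pt[of ?c] n_eq dF[OF F(1)] in auto)
    also have "\<dots> = app F (x ?c) 0" by (rule app_cong[OF dF[OF F(1)]]) (rule coeff_pt4)
    finally show ?thesis using apx[OF F(1)] F(2) by simp
  qed
  have nz: "1 \<le> \<bar>real_of_int (rdet (Suc 4) (?us @ [unitrow 0]))\<bar>"
  proof (rule full_rows_det)
    show "length (?us @ [unitrow 0]) = Suc 4" by simp
    fix F assume F: "degree F \<le> 4" "\<And>u. u \<in> set (?us @ [unitrow 0]) \<Longrightarrow> app F u 0 = 0"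
    show "F = 0"
    proof (rule ccontr)
      assume "F \<noteq> 0"
      let ?f = "coeff F"
      have f0: "?f 0 = 0" using F(2)[of "unitrow 0"] by (simp add: app_unitrow)
      have sw: "app G ?f 0 = 0" if "G \<in> set ?Fs" for G
        using app_sym[OF F(1) dF[OF that]] F(2)[of "coeff G"] that by auto
      have sw2: "app G ?f j = 0" if G: "G = ?P \<or> G = ?R" and j: "j \<le> 1" for G j
      proof (cases "j = 0")
        case True
        thus ?thesis using sw[of G] G by auto
      next
        case False
        hence "j = 1" using j by simp
        moreover have "app (monom 1 1 * G) ?f 0 = 0" using sw[of "monom 1 1 * G"] G by auto
        ultimately show ?thesis by (simp add: app_monom_mult)
      qed
      \<comment> \<open>A common zero f with first entry 0 is independent of the point, so the two
        leave at most a line at level 3. Both polynomials would lie on it, although only one of them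
        kills \<open>x l\<close>.\<close>
      let ?K = "{x ?c, ?f}"
      have Pf: "?P \<in> ann n 3 ?K"
        by (rule annI[OF dP(1)]) (use sw2[of ?P] annD[OF PP(2), of "x ?c"] n_eq in auto)
      have Rf: "?R \<in> ann n 3 ?K"
        by (rule annI[OF dP(2)]) (use sw2[of ?R] annD[OF R, of "x ?c"] n_eq in auto)
      obtain t where t: "?f t \<noteq> 0" using \<open>F \<noteq> 0\<close> by (auto simp: poly_eq_iff)
      have t4: "t \<le> n" using t F(1) n_eq le_degree[of F t] by simp
      let ?G = "smult (x ?c 0) (monom 1 t * 1) - smult (x ?c t) (monom 1 0 * 1)"
      have ap: "app ?G v 0 = x ?c 0 * v t - x ?c t * v 0" for v
        unfolding app_diff app_smult app_monom_mult by (simp add: app_def)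
      have "degree ?G \<le> n"
        using t4 by (intro degree_diff_le order.trans[OF degree_smult_le]) (auto intro: order.trans[OF degree_monom_le])
      hence G: "?G \<in> ann n n {x ?c}" using ap by (auto simp: ann_top)
      have "pdim {F \<in> ann n n {x ?c}. app F ?f 0 = 0} + 1 = pdim (ann n n {x ?c})"
        by (rule pdim_cut[OF submod_ann degb_ann G]) (use ap f0 t x_pos[of ?c] in auto)
      moreover have "{F \<in> ann n n {x ?c}. app F ?f 0 = 0} = ann n n ?K" by (auto simp: ann_top)
      ultimately have rk: "pdim (ann n n ?K) = n - 1" using pdim_ann_n_point[of ?c] by simp
      have "pdim (ann n 3 ?K) \<le> 1"
        by (rule castel_dim[of 3 n 2 _ "n - 1"]) (use n_eq rk ann_zero_superset[OF rank0[OF il], of ?K] in auto)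
      from line_sub[OF this P_nz[OF i] Pf PP(1)] Rf PP(3) show False by blast
    qed
  qed
  obtain z where z: "\<forall>ws. length ws = 1 \<longrightarrow> rdet 5 (?us @ ws) = z * rdet 1 (map (app (pt ?c)) ws)"
    using dual_minors[of 5 4 1 ?us "pt ?c"] point_primitive[of l] degree_pt[of ?c] n_eq kill by auto
  have zt: "rdet 5 (?us @ [unitrow 0]) = z * x ?c 0"
    using z[rule_format, of "[unitrow 0]"] by (simp add: rdet_1 app_unitrow coeff_pt del: One_nat_def)
  have "z \<noteq> 0" using nz zt by auto
  hence "1 \<le> \<bar>real_of_int z\<bar>" by linarith
  hence "1 * Xv ?c \<le> \<bar>real_of_int z\<bar> * Xv ?c" using X_ge_1[of ?c] by (intro mult_right_mono) auto
  hence low: "Xv ?c \<le> \<bar>real_of_int (rdet 5 (?us @ [unitrow 0]))\<bar>"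
    using X_ge_1[of ?c] unfolding zt by (simp add: abs_mult)
  define h where "h r = (if r < 2 then ht ?P else if r < 4 then ht ?R else 1)" for r :: nat
  have h1: "1 \<le> ht ?P" "1 \<le> ht ?R" using ht_ge_1[OF P_nz[OF i]] ht_ge_1[OF P_nz[OF il]] by auto
  have "\<bar>real_of_int (rdet 5 (?us @ [unitrow 0]))\<bar> \<le> fact 5 * (h 0 * (\<Prod>r = 1..<5. h r))"
  proof (rule rdet_entry_bound)
    fix r t :: nat assume "r < 5" "t < 5"
    hence "r = 0 \<or> r = 1 \<or> r = 2 \<or> r = 3 \<or> r = 4" by auto
    thus "\<bar>real_of_int (((?us @ [unitrow 0]) ! r) t)\<bar> \<le> h r"
    proof (elim disjE)
      assume "r = 0" thus ?thesis using coeff_le_ht[of ?P t] by (simp add: h_def)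
    next
      assume "r = 1" thus ?thesis using coeff_shift_le_ht[of ?P t] by (simp add: h_def)
    next
      assume "r = 2" thus ?thesis using coeff_le_ht[of ?R t] by (simp add: h_def)
    next
      assume "r = 3" thus ?thesis using coeff_shift_le_ht[of ?R t] by (simp add: h_def)
    next
      assume "r = 4" thus ?thesis by (simp add: h_def unitrow_def)
    qed
  qed (use h1 in \<open>auto simp: h_def\<close>)
  also have "h 0 * (\<Prod>r = 1..<5. h r) = ht ?P ^ 2 * ht ?R ^ 2"
    by (simp add: h_def eval_nat_numeral)
  finally have "Xv ?c \<le> 120 * (ht ?P ^ 2 * ht ?R ^ 2)" using low by (simp add: fact_numeral)
  hence "y ?c \<le> ln (120 * (ht ?P ^ 2 * ht ?R ^ 2))" using X_ge_1[of ?c] by simp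
  also have "\<dots> = ln 120 + (ln (ht ?P ^ 2) + ln (ht ?R ^ 2))"
  proof -
    have "0 < ht ?P ^ 2" "0 < ht ?R ^ 2" using h1 by simp_all
    thus ?thesis by (simp only: ln_mult_pos mult_pos_pos zero_less_numeral)
  qed
  also have "\<dots> = ln 120 + 2 * ln (ht ?P) + 2 * ln (ht ?R)" using h1 by (simp add: ln_realpow)
  also have "\<dots> \<le> 2 * (ln (ht ?P) + C5) + 2 * (ln (ht ?R) + C5)" using C5(2) by simp
  finally have "\<mu> * y ?c \<le> \<mu> * (2 * (ln (ht ?P) + C5) + 2 * (ln (ht ?R) + C5))" using mu2 by (intro mult_left_mono) auto
  thus ?thesis by (simp add: eta_def algebra_simps)
qed

text \<open>The polynomial \<open>P i\<close> keeps killing consecutive pairs until the line of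
  annihilators changes, and a change must come since \<open>P i\<close> cannot kill all later
  points.\<close>

lemma next_start:
  assumes i: "i0 \<le> i"
  shows "\<exists>l\<ge>i. start (Suc l) \<and> P i \<in> ann n 3 {x l} \<and> P i \<in> ann n 3 {x (Suc l)} \<and> P (Suc l) \<notin> ann n 3 {x l}"
proof -
  have claim: "P i \<in> ann n 3 {x (i + d), x (Suc (i + d))}" if "\<And>l. i \<le> l \<Longrightarrow> l < i + d \<Longrightarrow> P (Suc l) \<in> ann n 3 {x l}" for d
    using that
  proof (induction d)
    case 0
    show ?case using P_in[OF i] by simp
  next
    case (Suc d)
    let ?j = "i + d" and ?K = "{x (i + d), x (Suc (i + d))}"
    have ih: "P i \<in> ann n 3 ?K" using Suc by simp
    have ij: "i0 \<le> Suc ?j" "i0 \<le> ?j" using i by auto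
    have "P (Suc ?j) \<in> ann n 3 {x ?j}" using Suc(2)[of ?j] by simp
    hence "P (Suc ?j) \<in> ann n 3 ?K"
      using P_point(1)[OF ij(1)] unfolding ann_insert[of n 3 "x ?j" "{x (Suc ?j)}"] by blast
    from line_sub[OF dim_pair[OF ij(2)] P_nz[OF ij(1)] this P_in[OF ij(1)]] ih
    show ?case by auto
  qed
  have "\<exists>l\<ge>i. P (Suc l) \<notin> ann n 3 {x l}"
  proof (rule ccontr)
    assume neg: "\<not> ?thesis"
    obtain k where k: "k \<ge> i" "ann n 3 (blk i k) = {0}" using eventually_killed[OF levels(2), of i] by blast
    have "P i \<in> ann n 3 (blk i k)"
    proof (rule annI[OF P_deg[OF i]])
      fix v j assume v: "v \<in> blk i k" "j \<le> n - 3"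
      then obtain c where c: "v = x c" "i \<le> c" by auto
      have "P i \<in> ann n 3 {x (i + (c - i)), x (Suc (i + (c - i)))}" by (rule claim) (use neg in auto)
      hence "P i \<in> ann n 3 {x c, x (Suc c)}" using c(2) by simp
      from annD[OF this, of v j] show "app (P i) v j = 0" using v(2) c(1) by simp
    qed
    thus False using k(2) P_nz[OF i] by simp
  qed
  then obtain l0 where l0: "i \<le> l0 \<and> P (Suc l0) \<notin> ann n 3 {x l0}" by blast
  define l where "l = (LEAST l. i \<le> l \<and> P (Suc l) \<notin> ann n 3 {x l})"
  have l: "i \<le> l \<and> P (Suc l) \<notin> ann n 3 {x l}" unfolding l_def by (rule LeastI[of _ l0]) (rule l0)
  have lmin: "P (Suc l') \<in> ann n 3 {x l'}" if "i \<le> l'" "l' < l" for l'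
    using not_less_Least[of l' "\<lambda>l. i \<le> l \<and> P (Suc l) \<notin> ann n 3 {x l}"] that unfolding l_def by blast
  have "P i \<in> ann n 3 {x (i + (l - i)), x (Suc (i + (l - i)))}" by (rule claim) (use lmin in auto)
  hence "P i \<in> ann n 3 {x l, x (Suc l)}" using l by simp
  hence "P i \<in> ann n 3 {x l}" "P i \<in> ann n 3 {x (Suc l)}"
    using ann_antimono[of "{x l}" "{x l, x (Suc l)}" n 3] ann_antimono[of "{x (Suc l)}" "{x l, x (Suc l)}" n 3] by auto
  moreover have "start (Suc l)" unfolding start_def using l i by (intro exI[of _ l]) auto
  ultimately show ?thesis using l by blast
qed

text \<open>Consecutive minimal points form a lattice basis of the integer points of their plane:
  rounding the real coefficients leaves an integer point below \<open>x (Suc i)\<close> with error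
  below \<open>L i\<close>, hence zero. Non-proportionality gives
  \<open>\<beta> \<noteq> 0\<close>.\<close>

lemma integer_relation:
  assumes k: "Suc i \<le> k" "k < rix 2 i"
  shows "\<exists>\<alpha> \<beta> :: int. \<beta> \<noteq> 0 \<and> (\<forall>t\<le>n. x k t = \<alpha> * x i t + \<beta> * x (Suc i) t)"
proof -
  have "ann n n (x ` set [i, Suc i]) = ann n n (blk i k)" using blk_pair[OF levels(1), of i i "Suc i" k] k by simp
  also have "\<dots> \<subseteq> ann n n {x k}" using k by (intro ann_antimono) auto
  finally obtain a where a: "\<And>t. t \<le> n \<Longrightarrow> real_of_int (x k t) = (\<Sum>r<2. a r * real_of_int (x ([i, Suc i] ! r) t))"
    using real_relation[of "[i, Suc i]" k] by (auto simp: numeral_2_eq_2)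
  have rel: "real_of_int (x k t) = a 0 * real_of_int (x i t) + a 1 * real_of_int (x (Suc i) t)" if "t \<le> n" for t
    using a[OF that] by (simp add: numeral_2_eq_2)
  define \<alpha> \<beta> where "\<alpha> = round (a 0)" and "\<beta> = round (a 1)"
  define d where "d = a 0 - real_of_int \<alpha>"
  define e where "e = a 1 - real_of_int \<beta>"
  have d: "\<bar>d\<bar> \<le> 1 / 2" unfolding d_def \<alpha>_def using of_int_round_abs_le[of "a 0"] by linarith
  have e: "\<bar>e\<bar> \<le> 1 / 2" unfolding e_def \<beta>_def using of_int_round_abs_le[of "a 1"] by linarith
  define u where "u t = x k t - \<alpha> * x i t - \<beta> * x (Suc i) t" for t
  have ur: "real_of_int (u t) = d * real_of_int (x i t) + e * real_of_int (x (Suc i) t)" if "t \<le> n" for t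
    using rel[OF that] by (simp add: u_def d_def e_def algebra_simps)
  have comb: "\<bar>d * p + e * q\<bar> \<le> (\<bar>p\<bar> + \<bar>q\<bar>) / 2" for p q
  proof -
    have "\<bar>d * p\<bar> \<le> 1 / 2 * \<bar>p\<bar>" "\<bar>e * q\<bar> \<le> 1 / 2 * \<bar>q\<bar>"
      unfolding abs_mult using d e by (intro mult_right_mono; simp)+
    from order.trans[OF abs_triangle_ineq add_mono[OF this]] show ?thesis by simp
  qed
  have zero: "u t = 0" if "t \<le> n" for t
  proof (rule ccontr)
    assume "u t \<noteq> 0"
    have "\<bar>real_of_int (u 0)\<bar> \<le> (\<bar>Xv i\<bar> + \<bar>Xv (Suc i)\<bar>) / 2" unfolding ur[OF le0] by (rule comb)
    also have "\<dots> < Xv (Suc i)" using X_strict[of i "Suc i"] X_ge_1[of i] by simp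
    finally have "\<bar>u 0\<bar> < x (Suc i) 0" by linarith
    hence "L i \<le> err n \<xi> u" using \<open>u t \<noteq> 0\<close> that by (intro minimal) auto
    also have "\<dots> \<le> (L i + L (Suc i)) / 2"
    proof (rule err_le)
      fix t assume t: "t \<le> n"
      have "real_of_int (u t) - \<xi> ^ t * real_of_int (u 0) =
        d * (real_of_int (x i t) - \<xi> ^ t * Xv i) + e * (real_of_int (x (Suc i) t) - \<xi> ^ t * Xv (Suc i))"
        unfolding ur[OF t] ur[OF le0] by (simp add: algebra_simps)
      thus "\<bar>real_of_int (u t) - \<xi> ^ t * real_of_int (u 0)\<bar> \<le> (L i + L (Suc i)) / 2"
        using comb[of "real_of_int (x i t) - \<xi> ^ t * Xv i" "real_of_int (x (Suc i) t) - \<xi> ^ t * Xv (Suc i)"]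
          err_ge[OF t, of "x i" \<xi>] err_ge[OF t, of "x (Suc i)" \<xi>] by simp
    qed
    finally show False using L_Suc[of i] by simp
  qed
  hence r: "x k t = \<alpha> * x i t + \<beta> * x (Suc i) t" if "t \<le> n" for t using zero[OF that] by (simp add: u_def)
  have "\<beta> \<noteq> 0"
  proof
    assume "\<beta> = 0"
    hence "x i 0 * x k t = x i t * x k 0" if "t \<le> n" for t using r[OF that] r[OF le0] by simp
    thus False using points_not_proportional[of i k] k by auto
  qed
  thus ?thesis using r by blast
qed

lemma form_size:
  assumes i: "i0 \<le> i" and Z: "0 \<le> Z" "Z * ht (P i) \<le> 4 * M * (fact 4 * M ^ 4) * Xv q * (L p * L r)"
  shows "Z \<le> exp ((\<mu> * y q - y (Suc p) - y (Suc r) - eta i + KC) / \<mu>)"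
proof (cases "Z = 0")
  case False
  hence Z0: "0 < Z" using Z by simp
  let ?KB = "4 * M * (fact 4 * M ^ 4)"
  have KB: "0 < ?KB" using M_ge_2 by simp
  have h: "0 < ht (P i)" using ht_ge_1[OF P_nz[OF i]] by linarith
  have pos: "0 < Xv q" "0 < L p" "0 < L r" using X_ge_1[of q] L_pos by auto
  have zh: "0 < Z * ht (P i)" using Z0 h by (rule mult_pos_pos)
  hence "0 < ?KB * Xv q * (L p * L r)" using Z(2) by (rule less_le_trans)
  hence "ln (Z * ht (P i)) \<le> ln (?KB * Xv q * (L p * L r))" using Z(2) zh by (simp only: ln_le_cancel_iff)
  hence "ln Z + ln (ht (P i)) \<le> ln ?KB + y q + (ln (L p) + ln (L r))"
    using Z0 h pos KB by (simp only: ln_mult_pos mult_pos_pos)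
  hence "ln Z \<le> ln ?KB + y q + 2 * K0 - (y (Suc p) + y (Suc r)) / \<nu> - ln (ht (P i))"
    using L_upper[of p] L_upper[of r] by (simp add: add_divide_distrib)
  hence "\<mu> * ln Z \<le> \<mu> * (ln ?KB + y q + 2 * K0 - (y (Suc p) + y (Suc r)) / \<nu> - ln (ht (P i)))"
    using mu2 by (intro mult_left_mono) auto
  also have "\<dots> = \<mu> * y q - \<mu> / \<nu> * (y (Suc p) + y (Suc r)) - eta i + KC"
    unfolding KC eta_def by (simp add: algebra_simps add_divide_distrib)
  also have "\<dots> \<le> \<mu> * y q - (y (Suc p) + y (Suc r)) - eta i + KC"
  proof -
    have "1 * (y (Suc p) + y (Suc r)) \<le> \<mu> / \<nu> * (y (Suc p) + y (Suc r))"
      using mu nu_pos y_nonneg[of "Suc p"] y_nonneg[of "Suc r"] by (intro mult_right_mono) auto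
    thus ?thesis by simp
  qed
  finally have "ln Z \<le> (\<mu> * y q - y (Suc p) - y (Suc r) - eta i + KC) / \<mu>"
    using mu2 by (simp add: pos_le_divide_eq mult.commute)
  hence "exp (ln Z) \<le> exp ((\<mu> * y q - y (Suc p) - y (Suc r) - eta i + KC) / \<mu>)" by (simp only: exp_le_cancel_iff)
  thus ?thesis using Z0 by (simp only: exp_ln)
qed simp

text \<open>\<open>P i\<close> kills both shifts of \<open>x i\<close> and any shift of
  \<open>x (Suc i)\<close>, so the exterior product of three such rows is an integer multiple of
  \<open>P i\<close>. The coefficients z0 and z1 are these multiples for the two shifts of
  \<open>x (Suc i)\<close>; dividing by the height makes them small.\<close>

lemma form_exists:
  assumes i: "i0 \<le> i" and k: "rix 2 i = Suc k"
  shows "\<exists>z0 z1 :: int. (z0 \<noteq> 0 \<or> z1 \<noteq> 0) \<and>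
    \<bar>real_of_int z0\<bar> \<le> exp (((\<mu> - 2) * y (Suc i) - eta i + KC) / \<mu>) \<and>
    \<bar>real_of_int z0 * \<xi> - real_of_int z1\<bar> \<le> exp ((\<mu> * y i - y (Suc i) - y (Suc k) - eta i + KC) / \<mu>)"
proof -
  have ik: "Suc i \<le> k" "k < rix 2 i" using rix2_gt[OF levels(1), of i] k by auto
  let ?F = "fact 4 * M ^ 4" and ?P = "P i"
  have Fp: "0 < ?F" using M_ge_2 by simp
  have "1 * ?F \<le> 4 * M * ?F" using M_ge_2 Fp by (intro mult_right_mono) auto
  hence F0: "?F \<le> 4 * M * ?F" by simp
  let ?u = "shrow i 0" and ?v = "shrow i 1"
  obtain t0 where t0: "t0 \<le> degree ?P" "ht ?P = \<bar>real_of_int (coeff ?P t0)\<bar>" using ht_attained by blast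
  have t4: "t0 < 4" using t0(1) P_deg[OF i] by simp
  have h: "0 < ht ?P" using ht_ge_1[OF P_nz[OF i]] by linarith
  have ct: "coeff ?P t0 \<noteq> 0" using t0(2) h by auto
  let ?e = "unitrow t0"
  define T where "T w = rdet 4 [w, ?u, ?v, ?e]" for w
  have jl: "j \<le> n - 3" if "j < 2" for j using that n_eq by simp
  have kl: "app ?P (shrow c j) 0 = 0" if "c = i \<or> c = Suc i" "j < 2" for c j
    using annD[OF P_point(1)[OF i] _ jl[OF that(2)]] annD[OF P_point(2)[OF i] _ jl[OF that(2)]] that(1) by (auto simp: app_shrow)
  have ex: "\<exists>z. T (shrow (Suc i) j) = z * coeff ?P t0" if j: "j < 2" for j
  proof -
    have "\<exists>z. \<forall>ws. length ws = 1 \<longrightarrow> rdet 4 ([shrow (Suc i) j, ?u, ?v] @ ws) = z * rdet 1 (map (app ?P) ws)"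
      by (rule dual_minors[of 4 3 1]) (use P_content[OF i] P_deg[OF i] kl j in auto)
    then obtain z where z: "\<forall>ws. length ws = 1 \<longrightarrow> rdet 4 ([shrow (Suc i) j, ?u, ?v] @ ws) = z * rdet 1 (map (app ?P) ws)" by blast
    have "T (shrow (Suc i) j) = z * coeff ?P t0"
      using z[rule_format, of "[?e]"] by (simp add: T_def rdet_1 app_unitrow del: One_nat_def)
    thus ?thesis by blast
  qed
  obtain z0 where z0: "T (shrow (Suc i) 0) = z0 * coeff ?P t0" using ex[of 0] by auto
  obtain z1 where z1: "T (shrow (Suc i) 1) = z1 * coeff ?P t0" using ex[of 1] by auto
  \<comment> \<open>The pair has a smaller annihilator than \<open>x i\<close> alone, so one of the
    two shifts of \<open>x (Suc i)\<close> is independent of the rows of \<open>x i\<close>.\<close>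
  have nonzero: "z0 \<noteq> 0 \<or> z1 \<noteq> 0"
  proof -
    have "2 \<le> pdim (ann n 3 {x i})" using pdim_ann_single_ge[OF levels(2), of "x i"] n_eq by simp
    hence "\<not> ann n 3 {x i} \<subseteq> ann n 3 {x i, x (Suc i)}"
      using pdim_mono[OF degb_ann[of 3 n "{x i, x (Suc i)}"], of "ann n 3 {x i}"] dim_pair[OF i] by linarith
    then obtain G where G: "G \<in> ann n 3 {x i}" "G \<notin> ann n 3 {x i, x (Suc i)}" by blast
    then obtain j where j: "j \<le> 1" "app G (x (Suc i)) j \<noteq> 0" using n_eq by (auto simp: ann_def)
    have j2: "j < 2" using j by simp
    let ?w = "shrow (Suc i) j"
    let ?A = "{F \<in> ann n 3 {x i}. app F ?w 0 = 0}"
    have smA: "submod ?A" "degb 3 ?A"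
      using submod_kill[OF submod_ann[of n 3 "{x i}"], of "{?w}"] degb_subset[OF degb_ann[of 3 n "{x i}"]] by auto
    have "pdim ?A + 1 = pdim (ann n 3 {x i})"
      by (rule pdim_cut[OF submod_ann degb_ann G(1)]) (use j in \<open>simp add: app_shrow\<close>)
    hence pA: "pdim ?A \<le> 1" using dim_point[OF i] by linarith
    have PA: "?P \<in> ?A" using P_point(1)[OF i] kl[of "Suc i" j] j2 by simp
    let ?B = "{F \<in> ?A. app F ?e 0 = 0}"
    have "pdim ?B + 1 = pdim ?A" by (rule pdim_cut[OF smA PA]) (use ct in \<open>simp add: app_unitrow\<close>)
    hence pB: "pdim ?B = 0" using pA by linarith
    have "submod ?B" using smA(1) by (auto simp: submod_def app_add app_smult)
    moreover have "degb 3 ?B" by (rule degb_subset[OF smA(2)]) auto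
    ultimately have B0: "?B = {0}" using pB by (intro pdim_eq_0D)
    have "1 \<le> \<bar>real_of_int (rdet (Suc 3) [?w, ?u, ?v, ?e])\<bar>"
    proof (rule full_rows_det)
      fix F assume F: "degree F \<le> 3" "\<And>u. u \<in> set [?w, ?u, ?v, ?e] \<Longrightarrow> app F u 0 = 0"
      have "app F (x i) l = 0" if "l \<le> 1" for l
        using F(2)[of ?u] F(2)[of ?v] that by (cases "l = 0") (auto simp: app_shrow le_Suc_eq)
      hence "F \<in> ann n 3 {x i}" using F(1) n_eq by (auto simp: ann_def)
      hence "F \<in> ?B" using F(2)[of ?w] F(2)[of ?e] by simp
      thus "F = 0" unfolding B0 by simp
    qed simp
    hence "T ?w \<noteq> 0" unfolding T_def by auto
    moreover have "j = 0 \<or> j = 1" using j by auto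
    ultimately show ?thesis using z0 z1 by auto
  qed
  have size0: "\<bar>real_of_int z0\<bar> * ht ?P \<le> 4 * M * ?F * Xv (Suc i) * (L i * L i)"
  proof -
    have "\<bar>real_of_int (rdet 4 (map (\<lambda>(c, j). shrow c j) [(Suc i, 0), (i, 0), (i, 1)] @ map unitrow [t0]))\<bar> \<le>
        fact 4 * M ^ 4 * Xv (Suc i) * (\<Prod>r<length [(i, 0::nat), (i, 1)]. L (fst ([(i, 0::nat), (i, 1)] ! r)))"
      by (rule rows_with_units) (use n_eq t4 in auto)
    also have "rdet 4 (map (\<lambda>(c, j). shrow c j) [(Suc i, 0), (i, 0), (i, 1)] @ map unitrow [t0]) = z0 * coeff ?P t0"
      using z0 by (simp add: T_def)
    also have "(\<Prod>r<length [(i, 0::nat), (i, 1)]. L (fst ([(i, 0::nat), (i, 1)] ! r))) = L i * L i" by (simp add: numeral_2_eq_2)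
    finally have "\<bar>real_of_int z0\<bar> * ht ?P \<le> ?F * Xv (Suc i) * (L i * L i)" using t0(2) by (simp add: abs_mult)
    also have "\<dots> \<le> 4 * M * ?F * Xv (Suc i) * (L i * L i)"
      using F0 X_ge_1[of "Suc i"] L_pos[of i] by (intro mult_right_mono) auto
    finally show ?thesis .
  qed
  obtain \<alpha> \<beta> where ab: "\<beta> \<noteq> 0" "\<And>t. t \<le> n \<Longrightarrow> x k t = \<alpha> * x i t + \<beta> * x (Suc i) t"
    using integer_relation[OF ik] by blast
  define c where "c t = rdet 4 [unitrow t, ?u, ?v, ?e]" for t
  have Tc: "T w = (\<Sum>t<4. w t * c t)" for w unfolding T_def c_def by (rule rdet4_expand)
  have cb: "\<bar>real_of_int (c t)\<bar> \<le> ?F * Xv i * L i" if t: "t < 4" for t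
  proof -
    have "\<bar>c t\<bar> = \<bar>rdet 4 [?u, ?v, unitrow t, ?e]\<bar>" unfolding c_def by (rule rdet_abs_mset) auto
    hence "\<bar>real_of_int (c t)\<bar> = \<bar>real_of_int (rdet 4 [?u, ?v, unitrow t, ?e])\<bar>" by (simp flip: of_int_abs)
    also have "\<dots> = \<bar>real_of_int (rdet 4 (map (\<lambda>(c, j). shrow c j) [(i, 0), (i, 1)] @ map unitrow [t, t0]))\<bar>" by simp
    also have "\<dots> \<le> fact 4 * M ^ 4 * Xv i * (\<Prod>r<length [(i, 1::nat)]. L (fst ([(i, 1::nat)] ! r)))"
      by (rule rows_with_units) (use n_eq t4 t in auto)
    finally show ?thesis by simp
  qed
  have Ti: "T (shrow i j) = 0" if "j < 2" for j
  proof -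
    have "j = 0 \<or> j = 1" using that by auto
    thus ?thesis unfolding T_def
      using rdet_equal_rows[of 0 4 1 "[shrow i 0, ?u, ?v, ?e]"] rdet_equal_rows[of 0 4 2 "[shrow i 1, ?u, ?v, ?e]"] by auto
  qed
  have Tk: "T (shrow k j) = \<beta> * T (shrow (Suc i) j)" if j: "j < 2" for j
  proof -
    have "T (shrow k j) = (\<Sum>t<4. \<alpha> * (shrow i j t * c t) + \<beta> * (shrow (Suc i) j t * c t))"
      unfolding Tc using j n_eq by (intro sum.cong) (auto simp: shrow_def ab(2) algebra_simps)
    also have "\<dots> = \<alpha> * T (shrow i j) + \<beta> * T (shrow (Suc i) j)"
      unfolding Tc by (simp add: sum.distrib sum_distrib_left)
    finally show ?thesis using Ti[OF j] by simp
  qed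
  \<comment> \<open>T is linear in its first row and vanishes on the shifts of \<open>x i\<close>,
    so replacing \<open>x (Suc i)\<close> by \<open>x k\<close> only multiplies the form by a
    non-zero integer. For \<open>x k\<close> the entries \<xi> times one coordinate minus the next
    are bounded by a constant times \<open>L k\<close>.\<close>
  have size1: "\<bar>real_of_int z0 * \<xi> - real_of_int z1\<bar> * ht ?P \<le> 4 * M * ?F * Xv i * (L i * L k)"
  proof -
    have "real_of_int \<beta> * ((real_of_int z0 * \<xi> - real_of_int z1) * real_of_int (coeff ?P t0))
        = \<xi> * real_of_int (T (shrow k 0)) - real_of_int (T (shrow k 1))"
      using Tk[of 0] Tk[of 1] z0 z1 by (simp add: algebra_simps)
    also have "\<dots> = (\<Sum>t<4. (\<xi> * real_of_int (x k t) - real_of_int (x k (Suc t))) * real_of_int (c t))"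
      unfolding Tc by (simp add: shrow_def sum_distrib_left sum_subtractf algebra_simps)
    also have "\<bar>\<dots>\<bar> \<le> (\<Sum>t<4. \<bar>(\<xi> * real_of_int (x k t) - real_of_int (x k (Suc t))) * real_of_int (c t)\<bar>)" by (rule sum_abs)
    also have "\<dots> \<le> (\<Sum>t<(4::nat). (M * L k) * (?F * Xv i * L i))"
    proof (rule sum_mono)
      fix t :: nat assume "t \<in> {..<4}"
      hence t: "t < 4" "t \<le> n" "Suc t \<le> n" using n_eq by auto
      have "\<xi> * real_of_int (x k t) - real_of_int (x k (Suc t)) =
        \<xi> * (real_of_int (x k t) - \<xi> ^ t * Xv k) - (real_of_int (x k (Suc t)) - \<xi> ^ Suc t * Xv k)" by (simp add: algebra_simps)
      also have "\<bar>\<dots>\<bar> \<le> \<bar>\<xi>\<bar> * \<bar>real_of_int (x k t) - \<xi> ^ t * Xv k\<bar> + \<bar>real_of_int (x k (Suc t)) - \<xi> ^ Suc t * Xv k\<bar>"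
        unfolding abs_mult[symmetric] by (rule abs_triangle_ineq4)
      also have "\<dots> \<le> (M - 1) * L k + L k"
        using err_ge[OF t(2), of "x k" \<xi>] err_ge[OF t(3), of "x k" \<xi>] M_ge[of 1] n_eq M_ge_2
        by (intro add_mono mult_mono) auto
      finally have "\<bar>\<xi> * real_of_int (x k t) - real_of_int (x k (Suc t))\<bar> \<le> M * L k" by (simp add: algebra_simps)
      thus "\<bar>(\<xi> * real_of_int (x k t) - real_of_int (x k (Suc t))) * real_of_int (c t)\<bar> \<le> (M * L k) * (?F * Xv i * L i)"
        unfolding abs_mult using cb[OF t(1)] M_ge_2 L_pos[of k] by (intro mult_mono) auto
    qed
    also have "\<dots> = 4 * M * ?F * Xv i * (L i * L k)" by simp
    finally have up: "\<bar>real_of_int \<beta>\<bar> * (\<bar>real_of_int z0 * \<xi> - real_of_int z1\<bar> * ht ?P) \<le> 4 * M * ?F * Xv i * (L i * L k)"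
      unfolding abs_mult t0(2) .
    have "1 \<le> \<bar>real_of_int \<beta>\<bar>" using ab(1) by linarith
    hence "1 * (\<bar>real_of_int z0 * \<xi> - real_of_int z1\<bar> * ht ?P) \<le> \<bar>real_of_int \<beta>\<bar> * (\<bar>real_of_int z0 * \<xi> - real_of_int z1\<bar> * ht ?P)"
      using h by (intro mult_right_mono) auto
    thus ?thesis using up by linarith
  qed
  have "\<bar>real_of_int z0\<bar> \<le> exp ((\<mu> * y (Suc i) - y (Suc i) - y (Suc i) - eta i + KC) / \<mu>)"
    by (rule form_size[OF i _ size0]) simp
  moreover have "\<mu> * y (Suc i) - y (Suc i) - y (Suc i) = (\<mu> - 2) * y (Suc i)" by (simp add: algebra_simps)
  moreover have "\<bar>real_of_int z0 * \<xi> - real_of_int z1\<bar> \<le> exp ((\<mu> * y i - y (Suc i) - y (Suc k) - eta i + KC) / \<mu>)"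
    by (rule form_size[OF i _ size1]) simp
  ultimately show ?thesis using nonzero by (intro exI[of _ z0] exI[of _ z1]) simp
qed

definition form :: "nat \<Rightarrow> int \<Rightarrow> int \<Rightarrow> bool" where
  "form i z0 z1 \<longleftrightarrow> (z0 \<noteq> 0 \<or> z1 \<noteq> 0) \<and>
    \<bar>real_of_int z0\<bar> \<le> exp (((\<mu> - 2) * y (Suc i) - eta i + KC) / \<mu>) \<and>
    \<bar>real_of_int z0 * \<xi> - real_of_int z1\<bar> \<le> exp ((\<mu> * y i - y (Suc i) - y (rix 2 i) - eta i + KC) / \<mu>)"

text \<open>The resultant equals w0 times the first form minus z0 times the second, both evaluated
  at \<xi>. T1 and T2 make each product smaller than 1/2, so the integer is zero.\<close>

lemma forms_parallel:
  assumes i: "start i" "start i'" "i < i'" and w: "\<mu> * y i' \<le> 2 * eta i + 2 * eta i'"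
    and f: "form i z0 z1" "form i' w0 w1"
  shows "z0 * w1 = z1 * w0"
proof (rule ccontr)
  assume ne: "z0 * w1 \<noteq> z1 * w0"
  obtain k where k: "rix 2 i = Suc k" using rix_pred[OF levels(1), of i] by metis
  obtain k' where k': "rix 2 i' = Suc k'" using rix_pred[OF levels(1), of i'] by metis
  define a b c e where "a = y i" and "b = y (Suc i)" and "c = y (Suc k)" and "e = eta i"
  define a' b' c' e' where "a' = y i'" and "b' = y (Suc i')" and "c' = y (Suc k')" and "e' = eta i'"
  have e: "0 < e" "0 < e'" "a \<le> e" "a' \<le> e'" using eta_pos a_le_eta i by (auto simp: e_def e'_def a_def a'_def)
  have bc: "4 * e \<le> 3 * b" "5 * e \<le> 3 * c" "4 * e' \<le> 3 * b'" "5 * e' \<le> 3 * c'"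
    using bc_lower(2,3)[OF i(1) k start_kills[OF i(1) k]] bc_lower(2,3)[OF i(2) k' start_kills[OF i(2) k']]
    by (auto simp: e_def b_def c_def e'_def b'_def c'_def)
  have ba: "b \<le> a'" unfolding b_def a'_def using i(3) by (intro y_mono) simp
  have b0: "0 \<le> b" by (simp add: b_def y_nonneg)
  have b'a': "2 * b' \<le> \<mu> * a'" using E0[OF start_ge[OF i(2)]] by (simp add: a'_def b'_def)
  hence b'e: "b' \<le> e + e'" using w by (simp add: a'_def e_def e'_def)
  have large: "2 * KC + \<mu> < (3 - \<mu>) * e"
  proof -
    have "(3 - \<mu>) * a \<le> (3 - \<mu>) * e" using e mu3 by (intro mult_left_mono) auto
    thus ?thesis using big3[OF start_ge[OF i(1)]] by (simp add: a_def)
  qed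
  have T1: "(\<mu> - 2) * b' - e' + (\<mu> * a - b - c - e) + 2 * KC < - \<mu>"
  proof -
    have "(\<mu> - 2) * b' \<le> (\<mu> - 2) * (e + e')" using b'e mu2 by (intro mult_left_mono) auto
    also have "\<dots> \<le> 1 * (e + e')" using mu3 e by (intro mult_right_mono) auto
    finally have "(\<mu> - 2) * b' \<le> e + e'" by simp
    moreover have "\<mu> * a \<le> \<mu> * e" using e mu2 by (intro mult_left_mono) auto
    ultimately show ?thesis using large bc unfolding left_diff_distrib by linarith
  qed
  have T2: "(\<mu> - 2) * b - e + (\<mu> * a' - b' - c' - e') + 2 * KC < - \<mu>"
  proof -
    have "(\<mu> - 2) * b \<le> 1 * b" using mu3 b0 by (intro mult_right_mono) auto
    moreover have "\<mu> * a' \<le> 3 * e'"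
    proof -
      have "\<mu> * a' \<le> \<mu> * e'" using e mu2 by (intro mult_left_mono) auto
      also have "\<dots> \<le> 3 * e'" using e mu3 by (intro mult_right_mono) auto
      finally show ?thesis .
    qed
    moreover have "(3 - \<mu>) * e \<le> 1 * e" using e mu2 by (intro mult_right_mono) auto
    ultimately show ?thesis using large bc ba e by linarith
  qed
  have half: "exp r * exp r' < 1 / 2" if "r * \<mu> + r' * \<mu> < - \<mu>" for r r' :: real
  proof -
    have "(r + r') * \<mu> < (-1) * \<mu>" using that by (simp add: algebra_simps)
    hence "r + r' < -1" by (rule mult_right_less_imp_less) (use mu2 in simp)
    hence "exp (r + r') < exp (-1)" by simp
    also have "exp (-1) \<le> (1 / 2 :: real)" using exp_ge_add_one_self[of "1::real"] by (simp add: exp_minus field_simps)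
    finally show ?thesis by (simp add: exp_add)
  qed
  let ?B = "real_of_int z0 * \<xi> - real_of_int z1" and ?B' = "real_of_int w0 * \<xi> - real_of_int w1"
  have m0: "\<mu> \<noteq> 0" using mu2 by simp
  have p1: "\<bar>real_of_int w0\<bar> * \<bar>?B\<bar> < 1 / 2"
  proof -
    have "\<bar>real_of_int w0\<bar> * \<bar>?B\<bar> \<le> exp (((\<mu> - 2) * b' - e' + KC) / \<mu>) * exp ((\<mu> * a - b - c - e + KC) / \<mu>)"
      using f k unfolding form_def a_def b_def c_def e_def b'_def e'_def by (intro mult_mono) auto
    also have "\<dots> < 1 / 2" by (rule half) (use T1 m0 in simp)
    finally show ?thesis .
  qed
  have p2: "\<bar>real_of_int z0\<bar> * \<bar>?B'\<bar> < 1 / 2"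
  proof -
    have "\<bar>real_of_int z0\<bar> * \<bar>?B'\<bar> \<le> exp (((\<mu> - 2) * b - e + KC) / \<mu>) * exp ((\<mu> * a' - b' - c' - e' + KC) / \<mu>)"
      using f k' unfolding form_def a'_def b'_def c'_def e'_def b_def e_def by (intro mult_mono) auto
    also have "\<dots> < 1 / 2" by (rule half) (use T2 m0 in simp)
    finally show ?thesis .
  qed
  have "real_of_int (z0 * w1 - z1 * w0) = real_of_int w0 * ?B - real_of_int z0 * ?B'" by (simp add: algebra_simps)
  also have "\<bar>\<dots>\<bar> \<le> \<bar>real_of_int w0\<bar> * \<bar>?B\<bar> + \<bar>real_of_int z0\<bar> * \<bar>?B'\<bar>"
    unfolding abs_mult[symmetric] by (rule abs_triangle_ineq4)
  finally have "\<bar>real_of_int (z0 * w1 - z1 * w0)\<bar> < 1" using p1 p2 by linarith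
  hence "z0 * w1 - z1 * w0 = 0" by linarith
  thus False using ne by simp
qed

text \<open>All forms along the chain of starts are proportional to the first one, whose value at
  \<xi> is non-zero by \<open>nonalg\<close>. Having integer coefficients, they stay above
  \<open>\<bar>B 0\<bar> / S\<close> at \<xi>, while the bound in \<open>form\<close> tends to
  zero.\<close>

lemma contradiction: False
proof -
  have exf: "\<exists>p. i0 \<le> i \<longrightarrow> form i (fst p) (snd p)" for i
  proof (cases "i0 \<le> i")
    case True
    obtain k where k: "rix 2 i = Suc k" using rix_pred[OF levels(1), of i] by metis
    from form_exists[OF True k] obtain z0 z1 where "form i z0 z1" unfolding form_def k by blast
    thus ?thesis by (intro exI[of _ "(z0, z1)"]) simp
  qed simp
  obtain Z where Z: "\<And>i. i0 \<le> i \<Longrightarrow> form i (fst (Z i)) (snd (Z i))" using choice[OF allI[of "\<lambda>i. \<exists>p. i0 \<le> i \<longrightarrow> form i (fst p) (snd p)", OF exf]] by blast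
  have exn: "\<exists>i'. i0 \<le> i \<longrightarrow> start i' \<and> i < i' \<and> \<mu> * y i' \<le> 2 * eta i + 2 * eta i'" for i
  proof (cases "i0 \<le> i")
    case True
    obtain l where l: "i \<le> l" "start (Suc l)" "P i \<in> ann n 3 {x l}" "P i \<in> ann n 3 {x (Suc l)}" "P (Suc l) \<notin> ann n 3 {x l}"
      using next_start[OF True] by blast
    have "\<mu> * y (Suc l) \<le> 2 * eta i + 2 * eta (Suc l)" by (rule wedge[OF True _ l(3-5)]) (use l True in simp)
    thus ?thesis using l by (intro exI[of _ "Suc l"]) simp
  qed simp
  obtain nx where nx: "\<And>i. i0 \<le> i \<Longrightarrow> start (nx i) \<and> i < nx i \<and> \<mu> * y (nx i) \<le> 2 * eta i + 2 * eta (nx i)"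
    using choice[OF allI[of "\<lambda>i. \<exists>i'. i0 \<le> i \<longrightarrow> start i' \<and> i < i' \<and> \<mu> * y i' \<le> 2 * eta i + 2 * eta i'", OF exn]] by blast
  define u where "u t = (nx ^^ Suc t) i0" for t
  have uS: "u (Suc t) = nx (u t)" for t by (simp add: u_def)
  have st: "start (u t)" for t
  proof (induction t)
    case 0
    show ?case using nx[of i0] by (simp add: u_def)
  next
    case (Suc t)
    show ?case unfolding uS using nx[OF start_ge[OF Suc]] by blast
  qed
  note ge = start_ge[OF st]
  have ut: "t \<le> u t" for t
  proof (induction t)
    case (Suc t)
    thus ?case using nx[OF ge[of t]] unfolding uS by linarith
  qed simp
  define z0 z1 where "z0 t = fst (Z (u t))" and "z1 t = snd (Z (u t))" for t
  have fm: "form (u t) (z0 t) (z1 t)" for t unfolding z0_def z1_def by (rule Z[OF ge])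
  have nz: "z0 t \<noteq> 0 \<or> z1 t \<noteq> 0" for t using fm[of t] by (simp add: form_def)
  have cons: "z0 t * z1 (Suc t) = z1 t * z0 (Suc t)" for t
    by (rule forms_parallel[OF st st _ _ fm fm]) (use nx[OF ge[of t]] in \<open>auto simp: uS\<close>)
  have par: "z0 t * z1 0 = z1 t * z0 0" for t
  proof (induction t)
    case (Suc t)
    have "z0 t * (z0 (Suc t) * z1 0 - z1 (Suc t) * z0 0) = z0 (Suc t) * (z0 t * z1 0) - z0 0 * (z0 t * z1 (Suc t))"
      by (simp add: algebra_simps)
    also have "\<dots> = 0" unfolding Suc cons by (simp add: algebra_simps)
    finally have 1: "z0 t * (z0 (Suc t) * z1 0 - z1 (Suc t) * z0 0) = 0" .
    have "z1 t * (z0 (Suc t) * z1 0 - z1 (Suc t) * z0 0) = z1 0 * (z1 t * z0 (Suc t)) - z1 (Suc t) * (z1 t * z0 0)"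
      by (simp add: algebra_simps)
    also have "\<dots> = 0" unfolding Suc[symmetric] cons[symmetric] by (simp add: algebra_simps)
    finally show ?case using 1 nz[of t] by auto
  qed simp
  define B where "B t = real_of_int (z0 t) * \<xi> - real_of_int (z1 t)" for t
  have B0: "B 0 \<noteq> 0"
  proof -
    let ?p = "[:- z1 0, z0 0:]"
    have p: "?p \<noteq> 0" "degree ?p \<le> n" using nz[of 0] n_pos by auto
    have "ev \<xi> ?p = (\<Sum>t\<le>1. real_of_int (coeff ?p t) * \<xi> ^ t)" by (rule ev_eq_sum) simp
    also have "\<dots> = B 0" by (simp add: B_def)
    finally show ?thesis using nonalg[OF p] by simp
  qed
  define S where "S = \<bar>real_of_int (z0 0)\<bar> + \<bar>real_of_int (z1 0)\<bar>"
  have S: "0 < S" using nz[of 0] by (auto simp: S_def)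
  have low: "\<bar>B 0\<bar> / S \<le> \<bar>B t\<bar>" for t
  proof -
    have pr: "real_of_int (z0 t) * real_of_int (z1 0) = real_of_int (z1 t) * real_of_int (z0 0)"
      using par[of t] by (simp flip: of_int_mult)
    have "real_of_int (z0 0) * B t = real_of_int (z0 t) * B 0" "real_of_int (z1 0) * B t = real_of_int (z1 t) * B 0"
      using pr unfolding B_def by (simp_all add: algebra_simps)
    hence "\<bar>real_of_int (z0 0)\<bar> * \<bar>B t\<bar> = \<bar>real_of_int (z0 t)\<bar> * \<bar>B 0\<bar>" "\<bar>real_of_int (z1 0)\<bar> * \<bar>B t\<bar> = \<bar>real_of_int (z1 t)\<bar> * \<bar>B 0\<bar>"
      by (simp_all flip: abs_mult)
    hence "S * \<bar>B t\<bar> = (\<bar>real_of_int (z0 t)\<bar> + \<bar>real_of_int (z1 t)\<bar>) * \<bar>B 0\<bar>" by (simp add: S_def distrib_right)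
    moreover have "1 \<le> \<bar>real_of_int (z0 t)\<bar> + \<bar>real_of_int (z1 t)\<bar>" using nz[of t] by linarith
    hence "1 * \<bar>B 0\<bar> \<le> (\<bar>real_of_int (z0 t)\<bar> + \<bar>real_of_int (z1 t)\<bar>) * \<bar>B 0\<bar>" by (intro mult_right_mono) auto
    ultimately show ?thesis using S by (simp add: pos_divide_le_eq mult.commute)
  qed
  obtain j0 where j0: "\<And>j. j \<ge> j0 \<Longrightarrow> KC - \<mu> * ln (\<bar>B 0\<bar> / S) + 1 \<le> y j" using y_large by blast
  let ?i = "u j0"
  obtain k where k: "rix 2 ?i = Suc k" using rix_pred[OF levels(1), of ?i] by metis
  have bc: "4 * eta ?i \<le> 3 * y (Suc ?i)" "5 * eta ?i \<le> 3 * y (Suc k)"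
    using bc_lower(2,3)[OF st k start_kills[OF st k]] by auto
  have "\<mu> * y ?i \<le> 3 * eta ?i"
  proof -
    have "\<mu> * y ?i \<le> \<mu> * eta ?i" using a_le_eta[OF st] mu2 by (intro mult_left_mono) auto
    also have "\<dots> \<le> 3 * eta ?i" using mu3 eta_pos[OF st] by (intro mult_right_mono) (auto intro: less_imp_le)
    finally show ?thesis .
  qed
  hence "\<mu> * y ?i - y (Suc ?i) - y (Suc k) - eta ?i + KC \<le> KC - y ?i" using bc a_le_eta[OF st, of j0] by linarith
  also have "\<dots> < \<mu> * ln (\<bar>B 0\<bar> / S)" using j0[OF ut] by linarith
  finally have "(\<mu> * y ?i - y (Suc ?i) - y (Suc k) - eta ?i + KC) / \<mu> < ln (\<bar>B 0\<bar> / S)"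
    using mu2 by (simp add: pos_divide_less_eq mult.commute)
  hence "exp ((\<mu> * y ?i - y (Suc ?i) - y (Suc k) - eta ?i + KC) / \<mu>) < exp (ln (\<bar>B 0\<bar> / S))" by (simp only: exp_less_cancel_iff)
  also have "\<dots> = \<bar>B 0\<bar> / S" using B0 S by simp
  finally have "\<bar>B j0\<bar> < \<bar>B 0\<bar> / S" using fm[of j0] k unfolding form_def B_def by simp
  thus False using low[of j0] by simp
qed

end

section \<open>Construction of minimal points and conclusion\<close>

context minpts
begin

lemma exists_large:
  assumes "\<nu> < \<mu>"
  shows "\<exists>i0. minpts_large n \<xi> \<nu> K0 x \<mu> i0"
proof -
  define A where "A = (\<lambda>l. \<nu> * C1 (Suc l)) ` {..n} \<union> (\<lambda>(l, k). CD l k) ` ({..n} \<times> {..n + 1}) \<union> (\<lambda>l. \<nu> * (C4 (Suc l) + K0)) ` {..n}"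
  have fin: "finite A" by (simp add: A_def)
  obtain i0 where i0: "\<And>i. i \<ge> i0 \<Longrightarrow> max 1 (Max A / (\<mu> - \<nu>)) \<le> y i" using y_large by blast
  have A: "a \<le> (\<mu> - \<nu>) * y q" if "a \<in> A" "i0 \<le> q" for a q
  proof -
    have "a \<le> Max A" using that fin by simp
    moreover have "Max A / (\<mu> - \<nu>) \<le> y q" using i0[OF that(2)] by simp
    hence "Max A \<le> (\<mu> - \<nu>) * y q" using assms by (simp add: pos_divide_le_eq mult.commute)
    ultimately show ?thesis by linarith
  qed
  have "minpts_large n \<xi> \<nu> K0 x \<mu> i0"
  proof
    show "\<nu> < \<mu>" by (rule assms)
    fix q l k assume "i0 \<le> q" "l \<le> n" "k \<le> n + 1"
    thus "\<nu> * C1 (Suc l) \<le> (\<mu> - \<nu>) * y q \<and> CD l k \<le> (\<mu> - \<nu>) * y q \<and> \<nu> * (C4 (Suc l) + K0) \<le> (\<mu> - \<nu>) * y q"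
      by (intro conjI A) (auto simp: A_def)
  next
    fix q assume "i0 \<le> q"
    thus "0 < y q" using i0[of q] by simp
  qed
  thus ?thesis by blast
qed

lemma even_absurd:
  assumes "n = 2 * m" "3 \<le> m" "\<nu> < \<mu>" "real m + 1 < \<mu>" "\<mu> < real m + 2"
    "(\<mu> - real m) * \<mu>\<^sup>2 < real m * \<mu> + real m * (real m - 1)"
  shows False
proof -
  obtain i0 where i0: "minpts_large n \<xi> \<nu> K0 x \<mu> i0" using exists_large[OF assms(3)] by blast
  \<comment> \<open>Level \<open>m - 1\<close> corresponds to l = m + 2 in
    \<open>rank_lower\<close>, whose hypothesis holds since
    \<open>\<nu> < \<mu> < m + 2\<close>.\<close>
  have "\<exists>i1. \<forall>i\<ge>i1. ann n (n + 1 - (m + 2)) {x i} = {0}" by (rule rank_lower) (use assms in auto)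
  moreover have "n + 1 - (m + 2) = m - 1" using assms by simp
  ultimately obtain i1 where i1: "\<And>i. i \<ge> i1 \<Longrightarrow> ann n (m - 1) {x i} = {0}" by auto
  have "minpts_large n \<xi> \<nu> K0 x \<mu> (max i0 i1)" by (rule minpts_large_mono[OF i0]) simp
  hence "minpts_even n \<xi> \<nu> K0 x \<mu> (max i0 i1) m"
    unfolding minpts_even_def minpts_even_axioms_def using assms i1 by auto
  thus False by (rule minpts_even_False)
qed

lemma four_absurd:
  assumes "n = 4" "\<nu> < \<mu>" "2 < \<mu>" "\<mu> < 3"
  shows False
proof -
  obtain i0 where i0: "minpts_large n \<xi> \<nu> K0 x \<mu> i0" using exists_large[OF assms(2)] by blast
  have "\<exists>i1. \<forall>i\<ge>i1. ann n (n + 1 - 3) {x i} = {0}" by (rule rank_lower) (use assms in auto)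
  moreover have "n + 1 - 3 = 2" using assms by simp
  ultimately obtain i1 where i1: "\<And>i. i \<ge> i1 \<Longrightarrow> ann n 2 {x i} = {0}" by auto
  define C5 where "C5 = max C3 (ln 120)"
  define KC where "KC = \<mu> * (ln (4 * M * (fact 4 * M ^ 4)) + 2 * K0 + C5)"
  define B where "B = max (\<nu> * \<mu> * (C4 4 + C5)) (\<nu> * \<mu> * (C2 4 2 + 2 * C5)) / (\<mu> - \<nu>)"
  define B' where "B' = (2 * KC + \<mu>) / (3 - \<mu>) + 1"
  obtain i2 where i2: "\<And>i. i \<ge> i2 \<Longrightarrow> max B B' \<le> y i" using y_large by blast
  let ?i = "max i0 (max i1 i2)"
  interpret A: minpts_large n \<xi> \<nu> K0 x \<mu> ?i by (rule minpts_large_mono[OF i0]) simp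
  have "minpts_four n \<xi> \<nu> K0 x \<mu> ?i C5 KC"
  proof
    show "n = 4" "2 < \<mu>" "\<mu> < 3" by (rule assms)+
    show "ann n 2 {x i} = {0}" if "?i \<le> i" for i using i1 that by simp
    have "0 \<le> ln (120 :: real)" "C3 \<le> C5" "ln 120 \<le> C5" by (simp_all add: C5_def)
    thus "C3 \<le> C5" "ln 120 \<le> 4 * C5" "0 \<le> C5" by linarith+
    show "KC = \<mu> * (ln (4 * M * (fact 4 * M ^ 4)) + 2 * K0 + C5)" by (rule KC_def)
    fix q assume q: "?i \<le> q"
    have "B \<le> y q" "B' \<le> y q" using i2[of q] q by auto
    hence "max (\<nu> * \<mu> * (C4 4 + C5)) (\<nu> * \<mu> * (C2 4 2 + 2 * C5)) \<le> (\<mu> - \<nu>) * y q"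
      unfolding B_def using assms by (simp add: pos_divide_le_eq mult.commute)
    thus "\<nu> * \<mu> * (C4 4 + C5) \<le> (\<mu> - \<nu>) * y q \<and> \<nu> * \<mu> * (C2 4 2 + 2 * C5) \<le> (\<mu> - \<nu>) * y q" by simp
    have "(2 * KC + \<mu>) / (3 - \<mu>) < y q" using \<open>B' \<le> y q\<close> by (simp add: B'_def)
    thus "2 * KC + \<mu> < (3 - \<mu>) * y q" using assms by (simp add: pos_divide_less_eq mult.commute)
  qed
  thus False by (rule minpts_four.contradiction)
qed

end

subsection \<open>Existence of minimal points\<close>

text \<open>For each N, rounding gives a best integer point with first coordinate N; the minimal
  points are the successive records of its error, starting at N = 1.\<close>

lemma minimal_points_exist:
  fixes \<xi> l :: real
  assumes n: "1 \<le> n" and nonalg: "\<And>P. P \<noteq> 0 \<Longrightarrow> degree P \<le> n \<Longrightarrow> ev \<xi> P \<noteq> 0" and l: "0 < l"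
    and sol: "\<forall>\<^sub>F B in at_top. \<exists>x :: nat \<Rightarrow> int. (\<exists>k\<le>n. x k \<noteq> 0) \<and> \<bar>real_of_int (x 0)\<bar> \<le> B \<and>
      (\<forall>k\<in>{1..n}. \<bar>real_of_int (x 0) * \<xi> ^ k - real_of_int (x k)\<bar> \<le> B powr (- l))"
  shows "\<exists>K0 x. minpts n \<xi> (1 / l) K0 x"
proof -
  define p where "p N t = round (real N * \<xi> ^ t)" for N t :: nat
  define Lf where "Lf N = err n \<xi> (p N)" for N
  have p0: "p N 0 = int N" for N by (simp add: p_def)
  have pos: "0 < Lf N" if "1 \<le> N" for N
  proof (rule ccontr)
    assume "\<not> 0 < Lf N"
    hence "real_of_int (p N 1) = \<xi> * real N" using err_ge[of 1 n "p N" \<xi>] n p0[of N] by (simp add: Lf_def)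
    moreover have "ev \<xi> [:- p N 1, int N:] = (\<Sum>t\<le>1. real_of_int (coeff [:- p N 1, int N:] t) * \<xi> ^ t)"
      by (rule ev_eq_sum) simp
    ultimately have "ev \<xi> [:- p N 1, int N:] = 0" by simp
    moreover have "degree [:- p N 1, int N:] \<le> n" using n by simp
    ultimately show False using nonalg[of "[:- p N 1, int N:]"] that by simp
  qed
  have half: "Lf N \<le> 1 / 2" for N
    unfolding Lf_def
  proof (rule err_le)
    fix t
    show "\<bar>real_of_int (p N t) - \<xi> ^ t * real_of_int (p N 0)\<bar> \<le> 1 / 2"
      using of_int_round_abs_le[of "real N * \<xi> ^ t"] by (simp add: p0) (simp add: p_def mult.commute)
  qed
  have best: "Lf (nat \<bar>u 0\<bar>) \<le> err n \<xi> u" for u :: "nat \<Rightarrow> int"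
    unfolding Lf_def
  proof (rule err_le)
    fix t assume t: "t \<le> n"
    define s :: int where "s = (if 0 \<le> u 0 then 1 else -1)"
    have N: "real (nat \<bar>u 0\<bar>) = real_of_int s * real_of_int (u 0)" by (auto simp: s_def)
    have "\<bar>real (nat \<bar>u 0\<bar>) * \<xi> ^ t - real_of_int (p (nat \<bar>u 0\<bar>) t)\<bar> \<le> \<bar>real (nat \<bar>u 0\<bar>) * \<xi> ^ t - real_of_int (s * u t)\<bar>"
      unfolding p_def by (rule round_diff_minimal)
    also have "\<dots> = \<bar>real_of_int (u t) - \<xi> ^ t * real_of_int (u 0)\<bar>"
      unfolding N by (auto simp: s_def abs_minus_commute mult.commute)
    also have "\<dots> \<le> err n \<xi> u" by (rule err_ge[OF t])
    finally show "\<bar>real_of_int (p (nat \<bar>u 0\<bar>) t) - \<xi> ^ t * real_of_int (p (nat \<bar>u 0\<bar>) 0)\<bar> \<le> err n \<xi> u"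
      by (simp add: p0 abs_minus_commute mult.commute)
  qed
  obtain B1 where B1: "\<And>B. B1 \<le> B \<Longrightarrow> \<exists>x :: nat \<Rightarrow> int. (\<exists>k\<le>n. x k \<noteq> 0) \<and> \<bar>real_of_int (x 0)\<bar> \<le> B \<and>
      (\<forall>k\<in>{1..n}. \<bar>real_of_int (x 0) * \<xi> ^ k - real_of_int (x k)\<bar> \<le> B powr (- l))"
    using sol unfolding eventually_at_top_linorder by blast
  define B0 where "B0 = max B1 2"
  have small: "\<exists>N\<ge>1. real N \<le> B \<and> Lf N \<le> B powr (- l)" if B: "B0 \<le> B" for B
  proof -
    obtain u :: "nat \<Rightarrow> int" where u: "\<exists>k\<le>n. u k \<noteq> 0" "\<bar>real_of_int (u 0)\<bar> \<le> B"
      "\<forall>k\<in>{1..n}. \<bar>real_of_int (u 0) * \<xi> ^ k - real_of_int (u k)\<bar> \<le> B powr (- l)"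
      using B1[of B] B by (auto simp: B0_def)
    have B2: "2 \<le> B" using B by (simp add: B0_def)
    have lt1: "B powr (- l) < 1" using B2 l by (intro powr_less_one) auto
    have u0: "u 0 \<noteq> 0"
    proof
      assume u0: "u 0 = 0"
      obtain k where k: "k \<le> n" "u k \<noteq> 0" using u(1) by blast
      hence "k \<in> {1..n}" using u0 by (cases k) auto
      hence "\<bar>real_of_int (u k)\<bar> < 1" using u(3) u0 lt1 by fastforce
      thus False using k by linarith
    qed
    have "err n \<xi> u \<le> B powr (- l)"
    proof (rule err_le)
      fix t assume t: "t \<le> n"
      show "\<bar>real_of_int (u t) - \<xi> ^ t * real_of_int (u 0)\<bar> \<le> B powr (- l)"
      proof (cases "t = 0")
        case False
        hence "\<bar>real_of_int (u 0) * \<xi> ^ t - real_of_int (u t)\<bar> \<le> B powr (- l)" using u(3) t by simp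
        thus ?thesis by (simp add: abs_minus_commute mult.commute)
      qed simp
    qed
    hence "Lf (nat \<bar>u 0\<bar>) \<le> B powr (- l)" using best[of u] by linarith
    thus ?thesis using u0 u(2) by (intro exI[of _ "nat \<bar>u 0\<bar>"]) auto
  qed
  have arb: "\<exists>N\<ge>1. Lf N < e" if e: "0 < e" for e
  proof -
    have "((\<lambda>B. B powr (- l)) \<longlongrightarrow> 0) at_top" by (rule tendsto_neg_powr) (use l in \<open>auto intro: filterlim_ident\<close>)
    hence "\<forall>\<^sub>F B in at_top. B powr (- l) < e" using e by (simp add: order_tendstoD)
    then obtain B2 where B2: "\<And>B. B2 \<le> B \<Longrightarrow> B powr (- l) < e" unfolding eventually_at_top_linorder by blast
    obtain N where "1 \<le> N" "Lf N \<le> max B0 B2 powr (- l)" using small[of "max B0 B2"] by auto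
    thus ?thesis using B2[of "max B0 B2"] by (intro exI[of _ N]) auto
  qed
  have nxt: "\<exists>N'. N < N' \<and> Lf N' < Lf N" if N: "1 \<le> N" for N
  proof -
    let ?e = "Min (Lf ` {1..N})"
    have fin: "finite (Lf ` {1..N})" "Lf ` {1..N} \<noteq> {}" using N by auto
    have "0 < ?e" using pos by (subst Min_gr_iff[OF fin]) auto
    then obtain N' where N': "1 \<le> N'" "Lf N' < ?e" using arb by blast
    have "N < N'"
    proof (rule ccontr)
      assume "\<not> N < N'"
      hence "?e \<le> Lf N'" using N' by (intro Min_le[OF fin(1)]) auto
      thus False using N' by simp
    qed
    moreover have "?e \<le> Lf N" using N by (intro Min_le[OF fin(1)]) auto
    ultimately show ?thesis using N' by (intro exI[of _ N']) auto
  qed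
  define S where "S = rec_nat (1::nat) (\<lambda>_ N. LEAST N'. N < N' \<and> Lf N' < Lf N)"
  have S0: "S 0 = 1" and SS: "S (Suc i) = (LEAST N'. S i < N' \<and> Lf N' < Lf (S i))" for i by (simp_all add: S_def)
  have step: "S i < S (Suc i) \<and> Lf (S (Suc i)) < Lf (S i)" if "1 \<le> S i" for i
    unfolding SS by (rule LeastI_ex[OF nxt[OF that]])
  have S1: "1 \<le> S i" for i
  proof (induction i)
    case (Suc i)
    thus ?case using step[of i] by simp
  qed (simp add: S0)
  have least: "Lf (S i) \<le> Lf N" if "S i < N" "N < S (Suc i)" for i N
    using not_less_Least[of N "\<lambda>N'. S i < N' \<and> Lf N' < Lf (S i)"] that unfolding SS by auto
  have rec_low: "Lf (S i) \<le> Lf N" if "1 \<le> N" "N < S (Suc i)" for i N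
    using that
  proof (induction i arbitrary: N)
    case 0
    thus ?case using least[of 0 N] by (cases "N = 1") (auto simp: S0)
  next
    case (Suc i)
    consider "N < S (Suc i)" | "N = S (Suc i)" | "S (Suc i) < N" by linarith
    thus ?case
    proof cases
      case 1
      thus ?thesis using Suc.IH[of N] Suc.prems step[OF S1[of i]] by simp
    next
      case 3
      thus ?thesis using least Suc.prems by simp
    qed simp
  qed
  \<comment> \<open>To stay strictly below the next record m, solutions are taken with first
    coordinate at most m/2, which costs \<open>l * ln 2\<close>. The second term covers the range
    below \<open>2 * B0\<close>, where no solution is guaranteed.\<close>
  define K0 where "K0 = l * ln 2 + l * ln (2 * B0)"
  have B0: "2 \<le> B0" by (simp add: B0_def)
  have "minpts n \<xi> (1 / l) K0 (\<lambda>i. p (S i))"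
  proof
    show "1 \<le> n" by (rule n)
    show "0 < 1 / l" using l by simp
    show "0 \<le> K0" using l B0 by (simp add: K0_def)
    show "ev \<xi> P \<noteq> 0" if "P \<noteq> 0" "degree P \<le> n" for P by (rule nonalg[OF that])
    fix i
    show "0 < p (S i) 0" using S1[of i] by (simp add: p0)
    show "p (S i) 0 < p (S (Suc i)) 0" using step[OF S1[of i]] by (simp add: p0)
    show "err n \<xi> (p (S (Suc i))) < err n \<xi> (p (S i))" using step[OF S1[of i]] by (simp add: Lf_def)
    show "0 < err n \<xi> (p (S i))" using pos[OF S1[of i]] by (simp add: Lf_def)
    show "err n \<xi> (p (S i)) \<le> 1" using half[of "S i"] by (simp add: Lf_def)
    show "err n \<xi> (p (S i)) \<le> err n \<xi> u" if u: "\<exists>t\<le>n. u t \<noteq> 0" "\<bar>u 0\<bar> < p (S (Suc i)) 0" for u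
    proof (cases "u 0 = 0")
      case True
      obtain t where t: "t \<le> n" "u t \<noteq> 0" using u(1) by blast
      hence "1 \<le> \<bar>real_of_int (u t)\<bar>" by linarith
      also have "\<dots> \<le> err n \<xi> u" using err_ge[OF t(1), of u \<xi>] True by simp
      finally show ?thesis using half[of "S i"] by (simp add: Lf_def)
    next
      case False
      have "Lf (S i) \<le> Lf (nat \<bar>u 0\<bar>)" using u(2) False by (intro rec_low) (auto simp: p0)
      thus ?thesis using best[of u] by (simp add: Lf_def)
    qed
    define m where "m = real (S (Suc i))"
    have m1: "1 \<le> m" using S1[of "Suc i"] by (simp add: m_def)
    have "ln (Lf (S i)) \<le> K0 - l * ln m"
    proof (cases "B0 \<le> m / 2")
      case True
      obtain N where N: "1 \<le> N" "real N \<le> m / 2" "Lf N \<le> (m / 2) powr (- l)" using small[OF True] by blast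
      have "real N < m" using N(2) m1 by linarith
      hence "Lf (S i) \<le> Lf N" using N(1) by (intro rec_low) (auto simp: m_def)
      hence "Lf (S i) \<le> (m / 2) powr (- l)" using N(3) by linarith
      moreover have "0 < (m / 2) powr (- l)" using m1 by simp
      ultimately have "ln (Lf (S i)) \<le> ln ((m / 2) powr (- l))" using pos[OF S1[of i]] by (simp only: ln_le_cancel_iff)
      also have "\<dots> = l * ln 2 - l * ln m" using m1 by (simp add: ln_powr ln_div algebra_simps)
      also have "\<dots> \<le> K0 - l * ln m" using l B0 by (simp add: K0_def)
      finally show ?thesis .
    next
      case False
      hence "ln m \<le> ln (2 * B0)" using m1 by simp
      hence "l * ln m \<le> l * ln (2 * B0)" using l by (intro mult_left_mono) auto
      moreover have "ln (Lf (S i)) \<le> 0" using half[of "S i"] pos[OF S1[of i]] by simp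
      moreover have "0 \<le> l * ln 2" using l by simp
      ultimately show ?thesis by (simp add: K0_def)
    qed
    thus "ln (err n \<xi> (p (S i))) \<le> K0 - ln (real_of_int (p (S (Suc i)) 0)) / (1 / l)"
      by (simp add: Lf_def m_def p0 mult.commute)
  qed
  thus ?thesis by blast
qed

subsection \<open>Degree of the extension\<close>

text \<open>The minimal polynomial of \<xi> divides P, and its degree is the dimension of the simple
  extension. The contrapositive provides \<open>nonalg\<close>.\<close>

lemma extension_degree_le:
  fixes \<xi> :: real
  assumes P: "P \<noteq> 0" "degree P \<le> n" "ev \<xi> P = 0"
  shows "extension_degree \<rat> (rat_adjoin \<xi>) \<le> enat n"
proof -
  define R where "R = (ring_of_type_algebra :: real ring)"
  have ops: "carrier R = UNIV" "monoid.mult R = times" "one R = 1" "ring.zero R = 0" "add R = (+)"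
    by (auto simp: R_def ring_of_type_algebra_def)
  interpret R: field R unfolding R_def by (rule field_from_type_algebra)
  have neg: "a_inv R a = - a" for a by (rule R.minus_equality) (auto simp: ops)
  have inv: "m_inv R a = inverse a" if "a \<noteq> 0" for a by (rule R.comm_inv_char) (use that in \<open>auto simp: ops\<close>)
  have sub: "subring \<rat> R" by (rule R.subringI) (auto simp: ops neg)
  have sf: "subfield \<rat> R" by (rule R.subfieldI'[OF sub]) (auto simp: ops inv)
  have pw: "a [^]\<^bsub>R\<^esub> (k :: nat) = a ^ k" for a k by (induction k) (auto simp: ops)
  have ev_list: "R.eval xs a = poly (Poly (rev xs)) a" for xs a
    by (induction xs) (auto simp: ops pw Poly_append poly_monom)
  \<comment> \<open>Polynomials in \<open>HOL-Algebra\<close> are coefficient lists with the leading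
    coefficient first, hence the reversal.\<close>
  define q where "q = rev (map real_of_int (coeffs P))"
  have q0: "q \<noteq> []" using P(1) by (simp add: q_def)
  have "R.eval q \<xi> = poly (map_poly real_of_int P) \<xi>" by (simp add: ev_list q_def map_poly_def)
  also have "\<dots> = ev \<xi> P" by (simp add: poly_altdef ev_def degree_map_poly coeff_map_poly)
  finally have root: "R.eval q \<xi> = ring.zero R" using P(3) by (simp add: ops)
  have qc: "q \<in> carrier (univ_poly R \<rat>)"
    unfolding univ_poly_carrier[symmetric] polynomial_def
    using P(1) by (auto simp: q_def ops hd_rev last_map last_coeffs_eq_coeff_degree)
  have alg: "(R.algebraic over \<rat>) \<xi>" by (rule R.algebraicI[OF qc q0 root])
  have xi: "\<xi> \<in> carrier R" by (simp add: ops)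
  have Irr: "R.Irr \<rat> \<xi> \<in> carrier (univ_poly R \<rat>)" by (rule R.IrrE(1)[OF sf xi alg])
  have "length (R.Irr \<rat> \<xi>) - 1 \<le> length q - 1"
    by (rule R.pdivides_imp_degree_le[OF sub Irr qc q0 R.Irr_minimal[OF sf xi alg qc root]])
  also have "\<dots> \<le> n" using P(1,2) by (simp add: q_def length_coeffs_degree)
  finally have le: "length (R.Irr \<rat> \<xi>) - 1 \<le> n" .
  have "R.simple_extension \<rat> \<xi> = generate_field R (insert \<xi> \<rat>)"
  proof (rule R.generate_fieldI)
    show "insert \<xi> \<rat> \<subseteq> carrier R" by (simp add: ops)
    show "subfield (R.simple_extension \<rat> \<xi>) R" using R.simple_extension_is_subfield[OF sf xi] alg by blast
    show "insert \<xi> \<rat> \<subseteq> R.simple_extension \<rat> \<xi>"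
      using R.simple_extension_incl[of \<rat> \<xi>] R.simple_extension_mem[OF sub xi] by (simp add: ops)
    show "R.simple_extension \<rat> \<xi> \<subseteq> K" if "subfield K R" "insert \<xi> \<rat> \<subseteq> K" for K
      by (rule R.simple_extension_subring_incl[OF subfieldE(1)[OF that(1)]]) (use that in auto)
  qed
  hence adj: "rat_adjoin \<xi> = R.simple_extension \<rat> \<xi>" by (simp add: rat_adjoin_def R_def)
  have "R.finite_dimension \<rat> (R.simple_extension \<rat> \<xi>)" using R.finite_dimension_simple_extension[OF sf xi] alg by blast
  moreover have "R.dim \<rat> (R.simple_extension \<rat> \<xi>) = length (R.Irr \<rat> \<xi>) - 1"
    using R.simple_extension_dim[OF sf xi alg] by (simp add: over_def)
  ultimately show ?thesis
    using le unfolding extension_degree_def adj R_def[symmetric] by simp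
qed

subsection \<open>Location of the positive root\<close>

lemma beta_root:
  assumes "m \<ge> 2"
  shows "0 < beta m" "poly (Q_poly m) (beta m) = 0"
  using theI'[OF ex1_positive_root_Q[OF assms]] unfolding beta_def by auto

lemma beta_gtI: "m \<ge> 2 \<Longrightarrow> 0 < a \<Longrightarrow> 0 < poly (Q_poly m) a \<Longrightarrow> a < beta m"
  using beta_root[of m] poly_Q_strict_antimono[of "beta m" a m] by (cases a "beta m" rule: linorder_cases) auto

lemma beta_ltI: "m \<ge> 2 \<Longrightarrow> 0 < a \<Longrightarrow> poly (Q_poly m) a < 0 \<Longrightarrow> beta m < a"
  using beta_root[of m] poly_Q_strict_antimono[of a "beta m" m] by (cases a "beta m" rule: linorder_cases) auto

lemma Q_poly_reciprocal:
  assumes "m \<ge> 3" "0 < \<mu>"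
  shows "\<mu> ^ 3 * poly (Q_poly m) (1 / \<mu>) = (\<mu> - real m) * \<mu>\<^sup>2 - (real m * \<mu> + real m * (real m - 1))"
  using assms by (simp add: Q_poly_def field_simps eval_nat_numeral)

theorem theorem1p3:
  fixes m n :: nat and \<xi> :: real
  assumes "n = 2 * m" and "n \<ge> 4"
    and "extension_degree \<rat> (rat_adjoin \<xi>) > enat n"
  shows "lambda_hat n \<xi> \<le> ereal (beta m)"
proof (rule ccontr)
  assume neg: "\<not> lambda_hat n \<xi> \<le> ereal (beta m)"
  have m2: "2 \<le> m" using assms by simp
  note b = beta_root[OF m2]
  have nonalg: "ev \<xi> P \<noteq> 0" if "P \<noteq> 0" "degree P \<le> n" for P
  proof
    assume "ev \<xi> P = 0"
    from extension_degree_le[OF that this] assms(3) show False by simp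
  qed
  \<comment> \<open>An exponent below U keeps \<mu> above m + 1, respectively above 2, as the two
    impossibility lemmas demand.\<close>
  define U where "U = (if m \<ge> 3 then 1 / (real m + 1) else 1 / 2)"
  have U: "beta m < U"
  proof (cases "m \<ge> 3")
    case True
    have "(real m + 1) ^ 3 * poly (Q_poly m) (1 / (real m + 1)) = - (real m * (real m - 2)) + 1"
      by (subst Q_poly_reciprocal[OF True]) (simp_all add: algebra_simps power2_eq_square)
    moreover have "3 * 1 \<le> real m * (real m - 2)" using True by (intro mult_mono) auto
    ultimately have "(real m + 1) ^ 3 * poly (Q_poly m) (1 / (real m + 1)) < 0" by linarith
    hence "poly (Q_poly m) (1 / (real m + 1)) < 0" by (simp add: mult_less_0_iff)
    thus ?thesis using True m2 by (simp add: U_def beta_ltI)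
  next
    case False
    have "beta m < 1 / 2" by (rule beta_ltI[OF m2]) (use False in \<open>simp_all add: Q_poly_def\<close>)
    thus ?thesis using False by (simp add: U_def)
  qed
  obtain l where l: "beta m < l" "\<forall>\<^sub>F B in at_top. \<exists>x :: nat \<Rightarrow> int. (\<exists>k\<le>n. x k \<noteq> 0) \<and> \<bar>real_of_int (x 0)\<bar> \<le> B \<and>
        (\<forall>k\<in>{1..n}. \<bar>real_of_int (x 0) * \<xi> ^ k - real_of_int (x k)\<bar> \<le> B powr (- l))"
    using neg unfolding lambda_hat_def not_le less_Sup_iff by auto
  \<comment> \<open>Lowering the exponent to at most U preserves solvability. The midpoint
    \<open>l2\<close> leaves room on both sides: \<nu> = 1/l1 is below \<mu> = 1/l2, and the
    polynomial is still negative at \<open>l2\<close>.\<close>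
  define l1 where "l1 = min l U"
  define l2 where "l2 = (beta m + l1) / 2"
  have ord: "beta m < l2" "l2 < l1" "l1 \<le> l" "l1 \<le> U" "0 < l2" "0 < l1"
    using l(1) U b(1) by (auto simp: l1_def l2_def)
  have "\<forall>\<^sub>F B in at_top. \<exists>x :: nat \<Rightarrow> int. (\<exists>k\<le>n. x k \<noteq> 0) \<and> \<bar>real_of_int (x 0)\<bar> \<le> B \<and>
        (\<forall>k\<in>{1..n}. \<bar>real_of_int (x 0) * \<xi> ^ k - real_of_int (x k)\<bar> \<le> B powr (- l1))"
    using l(2) eventually_ge_at_top[of "1::real"]
  proof eventually_elim
    case (elim B)
    have "B powr (- l) \<le> B powr (- l1)" using elim ord by (intro powr_mono) auto
    thus ?case using elim(1) by (meson order.trans)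
  qed
  note sol = this
  have n1: "1 \<le> n" using assms(2) by simp
  from minimal_points_exist[OF n1 nonalg ord(6) sol] obtain K0 x where mp: "minpts n \<xi> (1 / l1) K0 x" by blast
  interpret minpts n \<xi> "1 / l1" K0 x by (rule mp)
  define \<mu> where "\<mu> = 1 / l2"
  have mu: "1 / l1 < \<mu>" "0 < \<mu>" "1 / \<mu> = l2" using ord by (auto simp: \<mu>_def frac_less2)
  have Q: "poly (Q_poly m) (1 / \<mu>) < 0"
    unfolding mu(3) using poly_Q_strict_antimono[OF b(1) ord(1), of m] b(2) by simp
  show False
  proof (cases "m \<ge> 3")
    case True
    have "1 / (1 / (real m + 1)) < \<mu>" unfolding \<mu>_def using ord True by (intro frac_less2) (auto simp: U_def)
    hence mu1: "real m + 1 < \<mu>" by simp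
    have "\<mu> ^ 3 * poly (Q_poly m) (1 / \<mu>) < 0" using Q mu(2) by (intro mult_pos_neg) auto
    hence lt: "(\<mu> - real m) * \<mu>\<^sup>2 < real m * \<mu> + real m * (real m - 1)"
      unfolding Q_poly_reciprocal[OF True mu(2)] by simp
    have "1 / (real m + 2) < beta m"
    proof (rule beta_gtI[OF m2])
      have "(real m + 2) ^ 3 * poly (Q_poly m) (1 / (real m + 2)) = 7 * real m + 8"
        by (subst Q_poly_reciprocal[OF True]) (simp_all add: algebra_simps power2_eq_square)
      hence "0 < (real m + 2) ^ 3 * poly (Q_poly m) (1 / (real m + 2))" by simp
      thus "0 < poly (Q_poly m) (1 / (real m + 2))" by (simp add: zero_less_mult_iff)
    qed simp
    hence "1 / l2 < 1 / (1 / (real m + 2))" using ord by (intro frac_less2) auto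
    hence "\<mu> < real m + 2" by (simp add: \<mu>_def)
    thus False using even_absurd[OF assms(1) True mu(1) mu1 _ lt] by simp
  next
    case False
    hence m: "m = 2" using m2 by simp
    have "1 / (1 / 2) < \<mu>" unfolding \<mu>_def using ord False by (intro frac_less2) (auto simp: U_def)
    moreover have "1 / 3 < beta m" by (rule beta_gtI[OF m2]) (simp_all add: Q_poly_def m)
    hence "1 / l2 < 1 / (1 / 3)" using ord by (intro frac_less2) auto
    hence "\<mu> < 3" by (simp add: \<mu>_def)
    ultimately show False using four_absurd[OF _ mu(1)] assms(1) m by simp
  qed
qed

end
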